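(* Let $K\colon \mathbb{R}^d\setminus\{0\}\to[0,+\infty)$ be a kernel satisfying all the standing assumptions listed in the context. Let $E\subset\mathbb{R}^d$ be a set whose boundary $\Sigma:=\partial E$ is compact and of class $C^2$. Then $$\lim_{\varepsilon\to0^+} H_\varepsilon(E,x)=H_0(\Sigma,x)\quad\text{uniformly in } x\in\Sigma .$$
   Context: Notation: $d\ge 2$; $B(x,r)$ is the open ball of center $x$ and radius $r$ in $\mathbb{R}^d$; $A^c=\mathbb{R}^d\setminus A$; $\mathbb{S}^{d-1}=\partial B(0,1)$; for $e\in\mathbb{S}^{d-1}$, $e^\perp$ is the hyperplane of vectors orthogonal to $e$ and $\pi_{e^\perp}$ the orthogonal projection onto it; $\mathcal{H}^{d-1}$ is the $(d-1)$-dimensional Hausdorff measure; $\mathrm{Sym}(d)$ is the space of real symmetric $d\times d$ matrices. For $\lambda>0$, $e\in\mathbb{S}^{d-1}$, set $Q_\lambda(e):=\{y\in\mathbb{R}^d: |y\cdot e|\le\frac{\lambda}{2}|\pi_{e^\perp}(y)|^2\}$. Standing assumptions on $K$: $K\colon\mathbb{R}^d\setminus\{0\}\to[0,+\infty)$ is measurable and - $K(y)=K(-y)$ for all $y\ne0$; - $K\in W^{1,1}(B(0,r)^c)$ for all $r>0$; - $\lim_{r\to0^+} r\int_{B(0,r)^c}K(y)\,dy=0$; - $y\mapsto K(y)$ and $y\mapsto |y||\nabla K(y)|$ belong to $L^1(Q_\lambda(e))$ for all $e\in\mathbb{S}^{d-1}$, $\lambda>0$; - for all $\lambda>0$ there is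 $a_\lambda>0$ with $\int_{Q_\lambda(e)}K(y)\,dy\le a_\lambda$ for all $e\in\mathbb{S}^{d-1}$; - there are $a_0,b_0>0$ such that for all $e\in\mathbb{S}^{d-1}$, $\limsup_{\lambda\to0^+}\frac1\lambda\int_{Q_\lambda(e)}K(y)\,dy\le a_0$ and $\limsup_{\lambda\to0^+}\frac1\lambda\int_{Q_\lambda(e)}|\nabla K(y)||y|\,dy\le b_0$; - for all $e\in\mathbb{S}^{d-1}$, $\lim_{\lambda\to+\infty}\frac1\lambda\int_{Q_\lambda(e)}K(y)\,dy=0$; - there are $m>0$ and $s\in(0,1)$ with $K(y)\le \frac{m}{|y|^{d+1+s}}$ for $y\in B(0,1)^c$. $K$ is identified with its representative that is absolutely continuous on lines: for every $e\in\mathbb{S}^{d-1}$ and $\mathcal{H}^{d-1}$-a.e. $z\in e^\perp$, $t\mapsto K(z+te)$ is absolutely continuous on compact intervals (so that integrals of $K$ over hyperplanes $e^\perp$ make sense). Nonlocal curvature: for a kernel $K$, a measurable $E\subseteq\mathbb{R}^d$ and $x\in\partial E$, $$H_K(E,x):=-\lim_{r\to0^+}\int_{B(x,r)^c}K(y-x)\tilde\chi_E(y)\,dy,$$ where $\tilde\chi_E=1$ on $E$ and $\tilde\chi_E=-1$ on $E^c$. For $\varepsilon>0$, $K_\varepsilon(x):=\varepsilon^{-d}K(x/\varepsilon)$ and $H_\varepsilon(E,x):=\frac1\varepsilon H_{K_\varepsilon}(E,x)$. Anisotropic mean curvature: $M_K\colon\mathbb{S}^{d-1}\to\mathrm{Sym}(d)$,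 $M_K(e):=\int_{e^\perp}K(z)\,z\otimes z\,d\mathcal{H}^{d-1}(z)$. For $E$ with $C^2$ boundary $\Sigma$ and $x\in\Sigma$, with $\hat n$ the outer unit normal to $E$ at $x$, $$H_0(\Sigma,x):=-\frac{1}{|\nabla\phi(x)|}\mathrm{tr}\big(M_K(\hat n)\,\pi_{\hat n^\perp}\nabla^2\phi(x)\,\pi_{\hat n^\perp}\big),$$ where $\phi$ is any $C^2$ function such that, in some open neighbourhood $U$ of $x$, $\Sigma\cap U=\{y\in U:\phi(y)=0\}$, $E\cap U=\{y\in U:\phi(y)>0\}$ up to points of $\Sigma$, and $\nabla\phi(x)\ne0$. *)

theory Defs
  imports "HOL-Analysis.Analysis"
begin

text \<open>The usual normalisation: a set of diameter \<open>2 r\<close> is weighted by the volume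
  of the \<open>k\<close>-dimensional ball of radius \<open>r\<close>. The case distinction only matters for
  \<open>k = 0\<close>, where nonempty sets have weight 1.\<close>

definition hausdorff_weight :: "nat \<Rightarrow> 'a::metric_space set \<Rightarrow> ennreal" where
  "hausdorff_weight k U =
     (if U = {} then 0 else ennreal (unit_ball_vol (real k) * (diameter U / 2) ^ k))"

text \<open>Boundedness is required of the covering sets because \<^const>\<open>diameter\<close> is real-valued
  and says nothing about unbounded sets.\<close>

definition hausdorff_covers :: "real \<Rightarrow> 'a::metric_space set \<Rightarrow> (nat \<Rightarrow> 'a set) set" where
  "hausdorff_covers \<delta> A =
     {U. A \<subseteq> (\<Union>i. U i) \<and> (\<forall>i. bounded (U i) \<and> diameter (U i) \<le> \<delta>)}"

definition hausdorff_pre :: "nat \<Rightarrow> real \<Rightarrow> 'a::metric_space set \<Rightarrow> ennreal" where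
  "hausdorff_pre k \<delta> A = (INF U\<in>hausdorff_covers \<delta> A. \<Sum>i. hausdorff_weight k (U i))"

definition hausdorff_outer :: "nat \<Rightarrow> 'a::metric_space set \<Rightarrow> ennreal" where
  "hausdorff_outer k A = (SUP \<delta>\<in>{0<..}. hausdorff_pre k \<delta> A)"

text \<open>The measure lives on all Caratheodory-measurable sets, not only on the Borel sets: the
  restrictions of a kernel to hyperplanes need not be Borel.\<close>

definition hausdorff_measure :: "nat \<Rightarrow> 'a::metric_space measure" where
  "hausdorff_measure k =
     measure_of UNIV (lambda_system UNIV UNIV (hausdorff_outer k)) (hausdorff_outer k)"

lemma hausdorff_pre_empty:
  assumes "0 < \<delta>" shows "hausdorff_pre k \<delta> ({} :: 'a::metric_space set) = 0"
proof -
  have "(\<lambda>_. {}) \<in> hausdorff_covers \<delta> ({} :: 'a set)"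
    using assms by (simp add: hausdorff_covers_def diameter_def)
  then have "hausdorff_pre k \<delta> ({} :: 'a set) \<le> (\<Sum>i::nat. hausdorff_weight k ({} :: 'a set))"
    unfolding hausdorff_pre_def by (rule INF_lower)
  then show ?thesis by (simp add: hausdorff_weight_def)
qed

lemma hausdorff_pre_mono: "A \<subseteq> B \<Longrightarrow> hausdorff_pre k \<delta> A \<le> hausdorff_pre k \<delta> B"
  unfolding hausdorff_pre_def
  by (rule INF_superset_mono) (auto simp: hausdorff_covers_def)

lemma hausdorff_pre_countably_subadditive:
  fixes A :: "nat \<Rightarrow> 'a::metric_space set"
  shows "hausdorff_pre k \<delta> (\<Union>n. A n) \<le> (\<Sum>n. hausdorff_pre k \<delta> (A n))"
proof (rule ennreal_le_epsilon)
  fix e :: real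
  assume fin: "(\<Sum>n. hausdorff_pre k \<delta> (A n)) < top" and e: "0 < e"
  have "\<exists>U\<in>hausdorff_covers \<delta> (A n). (\<Sum>i. hausdorff_weight k (U i))
          < hausdorff_pre k \<delta> (A n) + ennreal (e * (1/2) ^ Suc n)" for n
  proof -
    have "hausdorff_pre k \<delta> (A n) \<noteq> top"
      using fin by (metis ennreal_suminf_lessD less_irrefl)
    then have "hausdorff_pre k \<delta> (A n)
        < hausdorff_pre k \<delta> (A n) + ennreal (e * (1/2) ^ Suc n)"
      using e by simp
    then show ?thesis unfolding hausdorff_pre_def INF_less_iff .
  qed
  then obtain U where U: "\<And>n. U n \<in> hausdorff_covers \<delta> (A n)"
    and lt: "\<And>n. (\<Sum>i. hausdorff_weight k (U n i))
          < hausdorff_pre k \<delta> (A n) + ennreal (e * (1/2) ^ Suc n)"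
    by metis
  define V where "V = (\<lambda>m. case prod_decode m of (n, i) \<Rightarrow> U n i)"
  have "V \<in> hausdorff_covers \<delta> (\<Union>n. A n)"
  proof -
    have "x \<in> (\<Union>m. V m)" if "x \<in> A n" for x n
    proof -
      have "A n \<subseteq> (\<Union>i. U n i)" using U[of n] by (simp add: hausdorff_covers_def)
      with that obtain i where "x \<in> U n i" by auto
      then have "x \<in> V (prod_encode (n, i))" by (simp add: V_def)
      then show ?thesis by blast
    qed
    moreover have "bounded (V m) \<and> diameter (V m) \<le> \<delta>" for m
      using U by (auto simp: V_def hausdorff_covers_def split: prod.split)
    ultimately show ?thesis by (auto simp: hausdorff_covers_def)
  qed
  then have "hausdorff_pre k \<delta> (\<Union>n. A n) \<le> (\<Sum>m. hausdorff_weight k (V m))"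
    unfolding hausdorff_pre_def by (rule INF_lower)
  also have "\<dots> = (\<Sum>n. \<Sum>i. hausdorff_weight k (U n i))"
    using suminf_ennreal_2dimen[of "\<lambda>n. \<Sum>i. hausdorff_weight k (U n i)"
        "\<lambda>(n, i). hausdorff_weight k (U n i)"]
    by (simp add: V_def o_def split_beta')
  also have "\<dots> \<le> (\<Sum>n. hausdorff_pre k \<delta> (A n) + ennreal (e * (1/2) ^ Suc n))"
    using lt by (intro suminf_le) (auto intro: less_imp_le)
  also have "\<dots> = (\<Sum>n. hausdorff_pre k \<delta> (A n)) + (\<Sum>n. ennreal (e * (1/2) ^ Suc n))"
    by (rule suminf_add[symmetric]) auto
  also have "(\<Sum>n. ennreal (e * (1/2) ^ Suc n)) = ennreal e"
    using e sums_mult[OF power_half_series, of e]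
    by (subst suminf_ennreal_eq[of _ e]) auto
  finally show "hausdorff_pre k \<delta> (\<Union>n. A n)
      \<le> (\<Sum>n. hausdorff_pre k \<delta> (A n)) + ennreal e" .
qed

lemma outer_measure_hausdorff:
  "outer_measure_space UNIV (hausdorff_outer k :: 'a::metric_space set \<Rightarrow> ennreal)"
  unfolding outer_measure_space_def
proof (intro conjI)
  show "positive UNIV (hausdorff_outer k :: 'a set \<Rightarrow> ennreal)"
    by (simp add: positive_def hausdorff_outer_def hausdorff_pre_empty)
  show "increasing UNIV (hausdorff_outer k :: 'a set \<Rightarrow> ennreal)"
    unfolding increasing_def hausdorff_outer_def
    by (auto intro!: SUP_mono' hausdorff_pre_mono)
  show "countably_subadditive UNIV (hausdorff_outer k :: 'a set \<Rightarrow> ennreal)"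
    unfolding countably_subadditive_def
  proof (intro allI impI)
    fix A :: "nat \<Rightarrow> 'a set"
    have "hausdorff_pre k \<delta> (\<Union>n. A n) \<le> (\<Sum>n. hausdorff_outer k (A n))" if "0 < \<delta>" for \<delta>
    proof -
      have "hausdorff_pre k \<delta> (\<Union>n. A n) \<le> (\<Sum>n. hausdorff_pre k \<delta> (A n))"
        by (rule hausdorff_pre_countably_subadditive)
      also have "\<dots> \<le> (\<Sum>n. hausdorff_outer k (A n))"
        using that unfolding hausdorff_outer_def by (intro suminf_le SUP_upper) auto
      finally show ?thesis .
    qed
    then show "hausdorff_outer k (\<Union>n. A n) \<le> (\<Sum>n. hausdorff_outer k (A n))"
      unfolding hausdorff_outer_def[of k "\<Union>n. A n"] by (intro SUP_least) auto
  qed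
qed

lemma space_hausdorff [simp]: "space (hausdorff_measure k) = UNIV"
  by (simp add: hausdorff_measure_def space_measure_of_conv)

lemma measure_space_hausdorff:
  "measure_space UNIV (lambda_system UNIV UNIV (hausdorff_outer k)) (hausdorff_outer k)"
  using sigma_algebra.caratheodory_lemma[OF sigma_algebra_Pow[of UNIV],
      unfolded Pow_UNIV, OF outer_measure_hausdorff] .

lemma sets_hausdorff:
  "sets (hausdorff_measure k) = lambda_system UNIV UNIV (hausdorff_outer k)"
  using measure_space_hausdorff[of k]
  unfolding measure_space_def hausdorff_measure_def
  by (metis sigma_algebra.sets_measure_of_eq)

lemma emeasure_hausdorff:
  "A \<in> sets (hausdorff_measure k) \<Longrightarrow> emeasure (hausdorff_measure k) A = hausdorff_outer k A"
  using measure_space_hausdorff[of k]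
  by (intro emeasure_measure_of[OF hausdorff_measure_def])
     (auto simp: measure_space_def sets_hausdorff)

definition partial :: "'n::finite \<Rightarrow> (real^'n \<Rightarrow> real) \<Rightarrow> real^'n \<Rightarrow> real" where
  "partial i f x = frechet_derivative f (at x) (axis i 1)"

definition grad :: "(real^'n::finite \<Rightarrow> real) \<Rightarrow> real^'n \<Rightarrow> real^'n" where
  "grad f x = (\<chi> i. partial i f x)"

definition hessian :: "(real^'n::finite \<Rightarrow> real) \<Rightarrow> real^'n \<Rightarrow> real^'n^'n" where
  "hessian f x = (\<chi> i j. partial i (partial j f) x)"

text \<open>\<open>C_k k U f\<close>: \<open>f\<close> is of class \<open>C\<^sup>k\<close> on the open set \<open>U\<close>.\<close>

primrec C_k :: "nat \<Rightarrow> (real^'n::finite) set \<Rightarrow> (real^'n \<Rightarrow> real) \<Rightarrow> bool" where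
  "C_k 0 U f \<longleftrightarrow> continuous_on U f"
| "C_k (Suc k) U f \<longleftrightarrow> (\<forall>x\<in>U. f differentiable (at x)) \<and> (\<forall>i. C_k k U (partial i f))"

definition test_function :: "(real^'n::finite) set \<Rightarrow> (real^'n \<Rightarrow> real) \<Rightarrow> bool" where
  "test_function U \<phi> \<longleftrightarrow> (\<forall>k. C_k k UNIV \<phi>) \<and>
     compact (closure {x. \<phi> x \<noteq> 0}) \<and> closure {x. \<phi> x \<noteq> 0} \<subseteq> U"

text \<open>\<open>f \<in> W\<^sup>1\<^sup>,\<^sup>1(U)\<close> for open \<open>U\<close>, with weak gradient \<open>g\<close>.\<close>

definition sobolev_W11 ::
    "(real^'n::finite) set \<Rightarrow> (real^'n \<Rightarrow> real) \<Rightarrow> (real^'n \<Rightarrow> real^'n) \<Rightarrow> bool" where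
  "sobolev_W11 U f g \<longleftrightarrow>
     set_integrable lebesgue U f \<and> set_integrable lebesgue U g \<and>
     (\<forall>\<phi> i. test_function U \<phi> \<longrightarrow>
        (LINT x:U|lebesgue. f x * partial i \<phi> x) = - (LINT x:U|lebesgue. g x $ i * \<phi> x))"

definition abs_continuous_on_Icc :: "real \<Rightarrow> real \<Rightarrow> (real \<Rightarrow> real) \<Rightarrow> bool" where
  "abs_continuous_on_Icc a b f \<longleftrightarrow>
     (\<forall>\<epsilon>>0. \<exists>\<delta>>0. \<forall>\<D> S. \<D> division_of S \<and> S \<subseteq> {a..b} \<and> (\<Sum>I\<in>\<D>. Sup I - Inf I) < \<delta> \<longrightarrow>
        (\<Sum>I\<in>\<D>. \<bar>f (Sup I) - f (Inf I)\<bar>) < \<epsilon>)"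

definition hyperplane :: "real^'n::finite \<Rightarrow> (real^'n) set" where
  "hyperplane e = {z. z \<bullet> e = 0}"

definition tensor :: "real^'n::finite \<Rightarrow> real^'n \<Rightarrow> real^'n^'n" where
  "tensor u v = (\<chi> i j. u $ i * v $ j)"

text \<open>This is the orthogonal projection onto \<open>hyperplane e\<close> only for unit vectors \<open>e\<close>.\<close>

definition proj_perp :: "real^'n::finite \<Rightarrow> real^'n^'n" where
  "proj_perp e = mat 1 - tensor e e"

definition Q :: "real \<Rightarrow> real^'n::finite \<Rightarrow> (real^'n) set" where
  "Q l e = {y. \<bar>y \<bullet> e\<bar> \<le> l / 2 * (norm (proj_perp e *v y))\<^sup>2}"

text \<open>Kernels live on the complement of the origin; the value of the HOL function \<open>K\<close> at 0 is
  irrelevant. \<open>DK\<close> is the weak gradient of \<open>K\<close> on the complement of the origin, which is unique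
  up to null sets, so that one \<open>DK\<close> serves for all radii \<open>r\<close>. The interior of the complement of
  the open ball is taken because Sobolev spaces are over open sets.\<close>

locale curvature_kernel =
  fixes K :: "real^'n::finite \<Rightarrow> real" and DK :: "real^'n \<Rightarrow> real^'n"
  assumes measurable: "K \<in> borel_measurable (lebesgue_on (- {0}))"
    and nonneg: "\<And>y. y \<noteq> 0 \<Longrightarrow> 0 \<le> K y"
    and even: "\<And>y. y \<noteq> 0 \<Longrightarrow> K (- y) = K y"
    and sobolev: "\<And>r. 0 < r \<Longrightarrow> sobolev_W11 (interior (- ball 0 r)) K DK"
    and tail: "((\<lambda>r. r * (LINT y:- ball 0 r|lebesgue. K y)) \<longlongrightarrow> 0) (at_right 0)"
    and integrable_Q: "\<And>e l. e \<in> sphere 0 1 \<Longrightarrow> 0 < l \<Longrightarrow>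
          set_integrable lebesgue (Q l e) K \<and>
          set_integrable lebesgue (Q l e) (\<lambda>y. norm y * norm (DK y))"
    and bounded_Q: "\<And>l. 0 < l \<Longrightarrow>
          \<exists>a>0. \<forall>e\<in>sphere 0 1. (LINT y:Q l e|lebesgue. K y) \<le> a"
    and small_Q: "\<exists>a>0. \<forall>e\<in>sphere 0 1.
          Limsup (at_right 0) (\<lambda>l. ereal (1 / l * (LINT y:Q l e|lebesgue. K y))) \<le> ereal a"
    and small_Q_gradient: "\<exists>b>0. \<forall>e\<in>sphere 0 1.
          Limsup (at_right 0)
            (\<lambda>l. ereal (1 / l * (LINT y:Q l e|lebesgue. norm (DK y) * norm y))) \<le> ereal b"
    and large_Q: "\<And>e. e \<in> sphere 0 1 \<Longrightarrow>
          ((\<lambda>l. 1 / l * (LINT y:Q l e|lebesgue. K y)) \<longlongrightarrow> 0) at_top"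
    and decay: "\<exists>m>0. \<exists>s\<in>{0<..<1}. \<forall>y\<in>- ball 0 1.
          K y \<le> m / norm y powr (real CARD('n) + 1 + s)"
    and abs_continuous_on_lines: "\<And>e. e \<in> sphere 0 1 \<Longrightarrow>
          AE z in hausdorff_measure (CARD('n) - 1). z \<in> hyperplane e \<longrightarrow>
            (\<forall>a b. abs_continuous_on_Icc a b (\<lambda>t. K (z + t *\<^sub>R e)))"

definition signed_chi :: "'a set \<Rightarrow> 'a \<Rightarrow> real" where
  "signed_chi E y = (if y \<in> E then 1 else - 1)"

definition truncated_curvature ::
    "(real^'n::finite \<Rightarrow> real) \<Rightarrow> (real^'n) set \<Rightarrow> real^'n \<Rightarrow> real \<Rightarrow> real" where
  "truncated_curvature K E x r = - (LINT y:- ball x r|lebesgue. K (y - x) * signed_chi E y)"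

definition nonlocal_curvature ::
    "(real^'n::finite \<Rightarrow> real) \<Rightarrow> (real^'n) set \<Rightarrow> real^'n \<Rightarrow> real" where
  "nonlocal_curvature K E x = Lim (at_right 0) (truncated_curvature K E x)"

definition rescaled_kernel :: "real \<Rightarrow> (real^'n::finite \<Rightarrow> real) \<Rightarrow> real^'n \<Rightarrow> real" where
  "rescaled_kernel \<epsilon> K x = K (x /\<^sub>R \<epsilon>) / \<epsilon> ^ CARD('n)"

definition rescaled_curvature ::
    "(real^'n::finite \<Rightarrow> real) \<Rightarrow> real \<Rightarrow> (real^'n) set \<Rightarrow> real^'n \<Rightarrow> real" where
  "rescaled_curvature K \<epsilon> E x = 1 / \<epsilon> * nonlocal_curvature (rescaled_kernel \<epsilon> K) E x"

definition curvature_matrix :: "(real^'n::finite \<Rightarrow> real) \<Rightarrow> real^'n \<Rightarrow> real^'n^'n" where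
  "curvature_matrix K e =
     (LINT z:hyperplane e|hausdorff_measure (CARD('n) - 1). K z *\<^sub>R tensor z z)"

definition C2_defining_function ::
    "(real^'n::finite) set \<Rightarrow> real^'n \<Rightarrow> (real^'n \<Rightarrow> real) \<Rightarrow> bool" where
  "C2_defining_function E x \<phi> \<longleftrightarrow>
     (\<exists>U. open U \<and> x \<in> U \<and> C_k 2 U \<phi> \<and>
        frontier E \<inter> U = {y\<in>U. \<phi> y = 0} \<and>
        (E - frontier E) \<inter> U = {y\<in>U. \<phi> y > 0} \<and>
        grad \<phi> x \<noteq> 0)"

definition has_C2_boundary :: "(real^'n::finite) set \<Rightarrow> bool" where
  "has_C2_boundary E \<longleftrightarrow> (\<forall>x\<in>frontier E. \<exists>\<phi>. C2_defining_function E x \<phi>)"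

text \<open>Since \<open>\<phi>\<close> is positive inside \<open>E\<close>, the outer normal points against its gradient.\<close>

definition outer_normal_of :: "(real^'n::finite \<Rightarrow> real) \<Rightarrow> real^'n \<Rightarrow> real^'n" where
  "outer_normal_of \<phi> x = - (grad \<phi> x /\<^sub>R norm (grad \<phi> x))"

text \<open>The value does not depend on which defining function the choice operator picks.\<close>

definition anisotropic_curvature ::
    "(real^'n::finite \<Rightarrow> real) \<Rightarrow> (real^'n) set \<Rightarrow> real^'n \<Rightarrow> real" where
  "anisotropic_curvature K E x =
     (let \<phi> = (SOME \<phi>. C2_defining_function E x \<phi>);
          n = outer_normal_of \<phi> x
      in - (1 / norm (grad \<phi> x)) *
           trace (curvature_matrix K n ** proj_perp n ** hessian \<phi> x ** proj_perp n))"

end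

theory Submission
  imports Defs
begin

text \<open>
  Fix a boundary point \<open>x\<close> with outer unit normal \<open>n\<close> and blow up around \<open>x\<close> by the factor
  \<open>1 / \<epsilon>\<close>. As \<open>K\<close> is even, the half space \<open>z \<bullet> n < 0\<close> has no nonlocal curvature at the origin;
  subtracting it gives \<open>H\<^sub>\<epsilon>(E, x) = - (2 / \<epsilon>) \<integral> K \<sigma>\<close>, where \<open>\<sigma>\<close> (\<open>halfspace_defect\<close>) is the
  indicator of the blown-up interior of \<open>E\<close> minus that of the half space
  (\<open>truncated_curvature_tendsto\<close>). Write \<open>z = w + t n\<close> with \<open>w\<close> orthogonal to \<open>n\<close>. By Taylor's
  formula the blown-up boundary is close to the graph \<open>t = \<epsilon> / 2 b(w)\<close> of the quadratic form \<open>b\<close>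
  of the boundary (\<open>second_order_geometry\<close>), so \<open>\<sigma>\<close> lives in a region of thickness of order
  \<open>\<epsilon> |w|\<^sup>2\<close>. If \<open>K(w + t n)\<close> may be replaced by \<open>K(w)\<close> there, integration in \<open>t\<close> leaves
  \<open>\<epsilon> / 2 \<integral> K(w) b(w) dw\<close>, and by the definition of \<open>M\<^sub>K\<close> this is \<open>- \<epsilon> / 2\<close> times the anisotropic
  mean curvature (\<open>anisotropic_curvature_slice\<close>).

  Three regions contribute errors. Where \<open>|z| \<ge> \<delta> / \<epsilon>\<close> or \<open>|w| \<ge> R\<close>, the decay of \<open>K\<close> suffices
  (\<open>far_region_small\<close>, \<open>slice_outside_small\<close>). Where \<open>|w| < R\<close>, replacing \<open>K(w + t n)\<close> by \<open>K(w)\<close>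
  costs at most a multiple of \<open>\<epsilon>\<close> times the integral of \<open>|z|\<^sup>2 |DK|\<close> over a bounded piece of
  \<open>Q\<^sub>\<lambda>(n)\<close> with \<open>\<lambda>\<close> of order \<open>\<epsilon>\<close> (\<open>slice_replacement\<close>). This has to be small uniformly in \<open>n\<close>,
  whereas the hypotheses on \<open>DK\<close> are asymptotic in \<open>\<lambda>\<close> for each direction separately. The way
  out is that \<open>|z|\<^sup>2 |DK|\<close> is locally integrable (\<open>gradient_second_moment\<close>): integrate
  \<open>(1 / \<lambda>) \<integral>\<^sub>Q\<^sub>\<lambda>\<^sub>(\<^sub>e\<^sub>) |z| |DK|\<close> over all directions \<open>e\<close>; a point \<open>z\<close> belongs to \<open>Q\<^sub>\<lambda>(e)\<close> for a set of
  directions whose measure is of order \<open>\<lambda> |z|\<close>, so that Fubini produces the extra factor \<open>|z|\<close>,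
  while the pointwise asymptotic bounds pass to the average. The volume of a bounded piece of
  \<open>Q\<^sub>\<lambda>(e)\<close> tends to 0 uniformly in \<open>e\<close>, and absolute continuity of the integral does the rest
  (\<open>gradient_thin\<close>).

  Two measure-theoretic facts support the argument. The Hausdorff measure on a hyperplane is the
  Lebesgue measure transported by a linear isometry; the inequality that is not elementary is the
  isodiametric inequality, obtained here from a Brunn-Minkowski inequality for finite unions of boxes.
  And on almost every line in direction \<open>e\<close> the increments of \<open>K\<close> are bounded by integrals of
  \<open>|DK|\<close> (\<open>AE_line_regular\<close>), because the continuous restriction of \<open>K\<close> to the line has the
  restriction of \<open>DK \<bullet> e\<close> as its weak derivative.

  All constants depend only on a compact piece of the boundary on which a single defining
  function is used, so that the convergence is uniform on each piece, and finitely many pieces cover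
  the boundary. That the limits from different defining functions agree is the uniqueness of limits.
\<close>

section \<open>The isodiametric inequality\<close>

text \<open>The last condition says that two distinct boxes are separated by a hyperplane orthogonal to a
  basis vector. This form of disjointness is what the inductive proof of the Brunn-Minkowski
  inequality below consumes.\<close>

definition box_family :: "'i set \<Rightarrow> ('i \<Rightarrow> 'a::euclidean_space) \<Rightarrow> ('i \<Rightarrow> 'a) \<Rightarrow> bool" where
  "box_family I l u \<longleftrightarrow> finite I \<and> (\<forall>i\<in>I. \<forall>b\<in>Basis. l i \<bullet> b < u i \<bullet> b) \<and>
     (\<forall>i\<in>I. \<forall>j\<in>I. i \<noteq> j \<longrightarrow> (\<exists>b\<in>Basis. u i \<bullet> b \<le> l j \<bullet> b \<or> u j \<bullet> b \<le> l i \<bullet> b))"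

definition family_volume :: "'i set \<Rightarrow> ('i \<Rightarrow> 'a::euclidean_space) \<Rightarrow> ('i \<Rightarrow> 'a) \<Rightarrow> real" where
  "family_volume I l u = (\<Sum>i\<in>I. \<Prod>b\<in>Basis. (u i - l i) \<bullet> b)"

definition sum_of_families ::
    "'i set \<Rightarrow> ('i \<Rightarrow> 'a::euclidean_space) \<Rightarrow> ('i \<Rightarrow> 'a) \<Rightarrow> 'j set \<Rightarrow> ('j \<Rightarrow> 'a) \<Rightarrow> ('j \<Rightarrow> 'a) \<Rightarrow> 'a set" where
  "sum_of_families I l u J l' u' = (\<Union>i\<in>I. \<Union>j\<in>J. box (l i + l' j) (u i + u' j))"

text \<open>Applied to an upper corner (\<open>cut_above\<close>: to a lower corner), this trims a box to one side of the
  hyperplane at height \<open>c\<close> in direction \<open>b\<close>.\<close>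

definition cut_below :: "'a::euclidean_space \<Rightarrow> real \<Rightarrow> 'a \<Rightarrow> 'a" where
  "cut_below b c v = v + (min (v \<bullet> b) c - v \<bullet> b) *\<^sub>R b"

definition cut_above :: "'a::euclidean_space \<Rightarrow> real \<Rightarrow> 'a \<Rightarrow> 'a" where
  "cut_above b c v = v + (max (v \<bullet> b) c - v \<bullet> b) *\<^sub>R b"

lemma cut_inner:
  assumes "b \<in> Basis" "b' \<in> Basis"
  shows "cut_below b c v \<bullet> b' = (if b' = b then min (v \<bullet> b) c else v \<bullet> b')"
    and "cut_above b c v \<bullet> b' = (if b' = b then max (v \<bullet> b) c else v \<bullet> b')"
  using assms by (auto simp: cut_below_def cut_above_def inner_add_left inner_Basis)

lemma box_family_cut:
  fixes l u :: "'i \<Rightarrow> 'a::euclidean_space"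
  assumes "box_family I l u" and b: "b \<in> Basis"
  shows "box_family {i\<in>I. l i \<bullet> b < c} l (\<lambda>i. cut_below b c (u i))"
    and "box_family {i\<in>I. c < u i \<bullet> b} (\<lambda>i. cut_above b c (l i)) u"
proof -
  have sep: "\<exists>b\<in>Basis. u i \<bullet> b \<le> l j \<bullet> b \<or> u j \<bullet> b \<le> l i \<bullet> b" if "i \<in> I" "j \<in> I" "i \<noteq> j" for i j
    using assms that unfolding box_family_def by blast
  have lt: "l i \<bullet> b < u i \<bullet> b" if "i \<in> I" "b \<in> Basis" for i b
    using assms that unfolding box_family_def by blast
  have fin: "finite I" using assms by (simp add: box_family_def)
  have *: "cut_below b c v \<bullet> b' \<le> v \<bullet> b'" "v \<bullet> b' \<le> cut_above b c v \<bullet> b'" if "b' \<in> Basis" for v b'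
    using cut_inner[OF b that, of c v] by auto
  show "box_family {i\<in>I. l i \<bullet> b < c} l (\<lambda>i. cut_below b c (u i))"
    unfolding box_family_def
  proof (intro conjI ballI impI)
    fix i b' assume "i \<in> {i\<in>I. l i \<bullet> b < c}" and "b' \<in> (Basis :: 'a set)"
    then show "l i \<bullet> b' < cut_below b c (u i) \<bullet> b'" using cut_inner[OF b, of b' c "u i"] lt[of i b'] by auto
  next
    fix i j assume "i \<in> {i\<in>I. l i \<bullet> b < c}" "j \<in> {i\<in>I. l i \<bullet> b < c}" "i \<noteq> j"
    then obtain b' where "b' \<in> Basis" "u i \<bullet> b' \<le> l j \<bullet> b' \<or> u j \<bullet> b' \<le> l i \<bullet> b'" using sep[of i j] by auto
    then show "\<exists>b'\<in>Basis. cut_below b c (u i) \<bullet> b' \<le> l j \<bullet> b' \<or> cut_below b c (u j) \<bullet> b' \<le> l i \<bullet> b'"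
      using *(1)[of b' "u i"] *(1)[of b' "u j"] by (intro bexI[of _ b']) auto
  qed (use fin in auto)
  show "box_family {i\<in>I. c < u i \<bullet> b} (\<lambda>i. cut_above b c (l i)) u"
    unfolding box_family_def
  proof (intro conjI ballI impI)
    fix i b' assume "i \<in> {i\<in>I. c < u i \<bullet> b}" "b' \<in> (Basis :: 'a set)"
    then show "cut_above b c (l i) \<bullet> b' < u i \<bullet> b'" using cut_inner[OF b, of b' c "l i"] lt[of i b'] by auto
  next
    fix i j assume "i \<in> {i\<in>I. c < u i \<bullet> b}" "j \<in> {i\<in>I. c < u i \<bullet> b}" "i \<noteq> j"
    then obtain b' where "b' \<in> Basis" "u i \<bullet> b' \<le> l j \<bullet> b' \<or> u j \<bullet> b' \<le> l i \<bullet> b'" using sep[of i j] by auto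
    then show "\<exists>b'\<in>Basis. u i \<bullet> b' \<le> cut_above b c (l j) \<bullet> b' \<or> u j \<bullet> b' \<le> cut_above b c (l i) \<bullet> b'"
      using *(2)[of b' "l i"] *(2)[of b' "l j"] by (intro bexI[of _ b']) auto
  qed (use fin in auto)
qed

lemma family_volume_below:
  assumes "box_family I l u" and b: "b \<in> Basis"
  shows "family_volume {i\<in>I. l i \<bullet> b < c} l (\<lambda>i. cut_below b c (u i)) =
    (\<Sum>i\<in>I. max 0 (min (u i \<bullet> b) c - l i \<bullet> b) * (\<Prod>b'\<in>Basis - {b}. (u i - l i) \<bullet> b'))"
proof -
  have fin: "finite I" using assms by (simp add: box_family_def)
  have lt: "l i \<bullet> b < u i \<bullet> b" if "i \<in> I" "b \<in> Basis" for i b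
    using assms that unfolding box_family_def by blast
  have "family_volume {i\<in>I. l i \<bullet> b < c} l (\<lambda>i. cut_below b c (u i)) =
     (\<Sum>i\<in>I. if l i \<bullet> b < c then \<Prod>b'\<in>Basis. (cut_below b c (u i) - l i) \<bullet> b' else 0)"
    unfolding family_volume_def using fin by (simp add: sum.inter_filter)
  also have "\<dots> = (\<Sum>i\<in>I. max 0 (min (u i \<bullet> b) c - l i \<bullet> b) * (\<Prod>b'\<in>Basis - {b}. (u i - l i) \<bullet> b'))"
  proof (rule sum.cong[OF refl])
    fix i assume i: "i \<in> I"
    have "(\<Prod>b'\<in>Basis - {b}. (cut_below b c (u i) - l i) \<bullet> b') = (\<Prod>b'\<in>Basis - {b}. (u i - l i) \<bullet> b')"
      by (rule prod.cong) (auto simp: inner_diff_left cut_inner[OF b])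
    then show "(if l i \<bullet> b < c then \<Prod>b'\<in>Basis. (cut_below b c (u i) - l i) \<bullet> b' else 0) =
       max 0 (min (u i \<bullet> b) c - l i \<bullet> b) * (\<Prod>b'\<in>Basis - {b}. (u i - l i) \<bullet> b')"
      using lt[OF i b] by (auto simp: prod.remove[OF finite_Basis b] inner_diff_left cut_inner[OF b b])
  qed
  finally show ?thesis .
qed

lemma family_volume_above:
  assumes "box_family I l u" and b: "b \<in> Basis"
  shows "family_volume {i\<in>I. c < u i \<bullet> b} (\<lambda>i. cut_above b c (l i)) u =
    (\<Sum>i\<in>I. max 0 (u i \<bullet> b - max (l i \<bullet> b) c) * (\<Prod>b'\<in>Basis - {b}. (u i - l i) \<bullet> b'))"
proof -
  have fin: "finite I" using assms by (simp add: box_family_def)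
  have lt: "l i \<bullet> b < u i \<bullet> b" if "i \<in> I" "b \<in> Basis" for i b
    using assms that unfolding box_family_def by blast
  have "family_volume {i\<in>I. c < u i \<bullet> b} (\<lambda>i. cut_above b c (l i)) u =
     (\<Sum>i\<in>I. if c < u i \<bullet> b then \<Prod>b'\<in>Basis. (u i - cut_above b c (l i)) \<bullet> b' else 0)"
    unfolding family_volume_def using fin by (simp add: sum.inter_filter)
  also have "\<dots> = (\<Sum>i\<in>I. max 0 (u i \<bullet> b - max (l i \<bullet> b) c) * (\<Prod>b'\<in>Basis - {b}. (u i - l i) \<bullet> b'))"
  proof (rule sum.cong[OF refl])
    fix i assume i: "i \<in> I"
    have "(\<Prod>b'\<in>Basis - {b}. (u i - cut_above b c (l i)) \<bullet> b') = (\<Prod>b'\<in>Basis - {b}. (u i - l i) \<bullet> b')"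
      by (rule prod.cong) (auto simp: inner_diff_left cut_inner[OF b])
    then show "(if c < u i \<bullet> b then \<Prod>b'\<in>Basis. (u i - cut_above b c (l i)) \<bullet> b' else 0) =
       max 0 (u i \<bullet> b - max (l i \<bullet> b) c) * (\<Prod>b'\<in>Basis - {b}. (u i - l i) \<bullet> b')"
      using lt[OF i b] by (auto simp: prod.remove[OF finite_Basis b] inner_diff_left cut_inner[OF b b])
  qed
  finally show ?thesis .
qed

lemma family_volume_split:
  assumes "box_family I l u" and b: "b \<in> Basis"
  shows "family_volume {i\<in>I. l i \<bullet> b < c} l (\<lambda>i. cut_below b c (u i)) +
    family_volume {i\<in>I. c < u i \<bullet> b} (\<lambda>i. cut_above b c (l i)) u = family_volume I l u"
  unfolding family_volume_below[OF assms] family_volume_above[OF assms]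
  unfolding sum.distrib[symmetric] distrib_right[symmetric] family_volume_def
proof (rule sum.cong[OF refl])
  fix i assume i: "i \<in> I"
  have "l i \<bullet> b < u i \<bullet> b" using assms i unfolding box_family_def by blast
  then have "max 0 (min (u i \<bullet> b) c - l i \<bullet> b) + max 0 (u i \<bullet> b - max (l i \<bullet> b) c) = (u i - l i) \<bullet> b"
    by (auto simp: inner_diff_left)
  then show "(max 0 (min (u i \<bullet> b) c - l i \<bullet> b) + max 0 (u i \<bullet> b - max (l i \<bullet> b) c)) *
      (\<Prod>b'\<in>Basis - {b}. (u i - l i) \<bullet> b') = (\<Prod>b\<in>Basis. (u i - l i) \<bullet> b)"
    by (simp add: prod.remove[OF finite_Basis b])
qed

lemma family_volume_pos:
  assumes "box_family I l u" "I \<noteq> {}" shows "0 < family_volume I l u"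
  using assms unfolding family_volume_def box_family_def
  by (intro sum_pos prod_pos) (auto simp: inner_diff_left)

text \<open>The volume below the height \<open>c\<close> is continuous in \<open>c\<close> and runs from 0 to the whole volume.\<close>

lemma exists_cut_with_ratio:
  assumes fam: "box_family J l u" and b: "b \<in> Basis" and \<rho>: "0 \<le> \<rho>" "\<rho> \<le> 1"
  obtains c where "family_volume {i\<in>J. l i \<bullet> b < c} l (\<lambda>i. cut_below b c (u i)) = \<rho> * family_volume J l u"
proof -
  define f where "f c = (\<Sum>i\<in>J. max 0 (min (u i \<bullet> b) c - l i \<bullet> b) * (\<Prod>b'\<in>Basis - {b}. (u i - l i) \<bullet> b'))" for c
  have fin: "finite J" using assms by (simp add: box_family_def)
  have lt: "l i \<bullet> b < u i \<bullet> b" if "i \<in> J" for i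
    using assms that unfolding box_family_def by blast
  define B where "B = Max (insert 1 ((\<lambda>i. \<bar>l i \<bullet> b\<bar> + \<bar>u i \<bullet> b\<bar>) ` J))"
  have B: "\<bar>l i \<bullet> b\<bar> + \<bar>u i \<bullet> b\<bar> \<le> B" if "i \<in> J" for i
    unfolding B_def using fin that by (intro Max_ge) auto
  have B1: "1 \<le> B" unfolding B_def using fin by (intro Max_ge) auto
  have "f (- B) = 0" unfolding f_def
    by (rule sum.neutral) (use B in \<open>force simp: max_def min_def\<close>)
  moreover have "f B = family_volume J l u"
    unfolding f_def family_volume_def
  proof (rule sum.cong[OF refl])
    fix i assume i: "i \<in> J"
    have "max 0 (min (u i \<bullet> b) B - l i \<bullet> b) = (u i - l i) \<bullet> b"
      using B[OF i] lt[OF i] by (auto simp: inner_diff_left)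
    then show "max 0 (min (u i \<bullet> b) B - l i \<bullet> b) * (\<Prod>b'\<in>Basis - {b}. (u i - l i) \<bullet> b') = (\<Prod>b\<in>Basis. (u i - l i) \<bullet> b)"
      by (simp add: prod.remove[OF finite_Basis b])
  qed
  moreover have "0 \<le> family_volume J l u"
    using family_volume_pos[OF fam] by (cases "J = {}") (auto simp: family_volume_def)
  moreover have "continuous_on {-B..B} f" unfolding f_def by (intro continuous_intros)
  ultimately obtain c where "f c = \<rho> * family_volume J l u"
    using IVT'[of f "-B" "\<rho> * family_volume J l u" B] B1 \<rho> by (auto simp: mult_left_le_one_le)
  then show ?thesis using that[of c] unfolding family_volume_below[OF fam b] f_def by simp
qed

lemma sum_of_families_commute:
  "sum_of_families I l u J l' u' = sum_of_families J l' u' I l u"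
  unfolding sum_of_families_def by (auto simp: add.commute)

lemma sum_of_families_lmeasurable:
  assumes "finite I" "finite J" shows "sum_of_families I l u J l' u' \<in> lmeasurable"
  unfolding sum_of_families_def using assms by (intro fmeasurable.finite_UN) auto

text \<open>The step of Hadwiger and Ohmann. Cut the first family along a hyperplane separating two of its
  boxes, which leaves fewer boxes on either side, and cut the second family in the same volume ratio
  \<open>\<rho>\<close>. The two pairs of halves have sums on different sides of a hyperplane, and as the ratios agree
  the square roots of the products of volumes add up to the square root for the whole families.\<close>

lemma brunn_minkowski_boxes_step:
  fixes l u :: "'i \<Rightarrow> 'a::euclidean_space" and l' u' :: "'j \<Rightarrow> 'a"
  assumes I: "box_family I l u" and J: "box_family J l' u'"
    and ij: "i \<in> I" "j \<in> I" and b: "b \<in> Basis" and sep: "u i \<bullet> b \<le> l j \<bullet> b"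
    and J0: "J \<noteq> {}"
    and IH: "\<And>I1 J1 l u l' u'. I1 \<subset> I \<Longrightarrow> J1 \<subseteq> J \<Longrightarrow> box_family I1 l u \<Longrightarrow> box_family J1 l' u' \<Longrightarrow>
       2 ^ DIM('a) * sqrt (family_volume I1 l u * family_volume J1 l' u')
         \<le> measure lebesgue (sum_of_families I1 l u J1 l' u' :: 'a set)"
  shows "2 ^ DIM('a) * sqrt (family_volume I l u * family_volume J l' u')
         \<le> measure lebesgue (sum_of_families I l u J l' u')"
proof -
  have fin: "finite I" "finite J" using I J by (auto simp: box_family_def)
  define c where "c = l j \<bullet> b"
  define I1 where "I1 = {i\<in>I. l i \<bullet> b < c}"
  define I2 where "I2 = {i\<in>I. c < u i \<bullet> b}"
  define u1 where "u1 = (\<lambda>i. cut_below b c (u i))"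
  define l2 where "l2 = (\<lambda>i. cut_above b c (l i))"
  have I12: "I1 \<subset> I" "I2 \<subset> I"
  proof -
    have "j \<notin> I1" "i \<notin> I2" using sep by (auto simp: c_def I1_def I2_def)
    then show "I1 \<subset> I" "I2 \<subset> I" using ij by (auto simp: I1_def I2_def)
  qed
  define \<rho> where "\<rho> = family_volume I1 l u1 / family_volume I l u"
  have V: "family_volume I1 l u1 + family_volume I2 l2 u = family_volume I l u"
    unfolding I1_def I2_def u1_def l2_def by (rule family_volume_split[OF I b])
  have fam1: "box_family I1 l u1" "box_family I2 l2 u"
    unfolding I1_def I2_def u1_def l2_def by (rule box_family_cut[OF I b])+
  have nn: "0 \<le> family_volume I1 l u1" "0 \<le> family_volume I2 l2 u"
    using family_volume_pos[OF fam1(1)] family_volume_pos[OF fam1(2)]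
    by (cases "I1 = {}"; cases "I2 = {}"; auto simp: family_volume_def)+
  have Vpos: "0 < family_volume I l u" using family_volume_pos[OF I] ij by auto
  have \<rho>: "0 \<le> \<rho>" "\<rho> \<le> 1" unfolding \<rho>_def using nn V Vpos by auto
  obtain c' where c': "family_volume {i\<in>J. l' i \<bullet> b < c'} l' (\<lambda>i. cut_below b c' (u' i)) = \<rho> * family_volume J l' u'"
    using exists_cut_with_ratio[OF J b \<rho>] by blast
  define J1 where "J1 = {i\<in>J. l' i \<bullet> b < c'}"
  define J2 where "J2 = {i\<in>J. c' < u' i \<bullet> b}"
  define u1' where "u1' = (\<lambda>i. cut_below b c' (u' i))"
  define l2' where "l2' = (\<lambda>i. cut_above b c' (l' i))"
  have W: "family_volume J1 l' u1' + family_volume J2 l2' u' = family_volume J l' u'"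
    unfolding J1_def J2_def u1'_def l2'_def by (rule family_volume_split[OF J b])
  have W1: "family_volume J1 l' u1' = \<rho> * family_volume J l' u'"
    using c' by (simp add: J1_def u1'_def)
  have W2: "family_volume J2 l2' u' = (1 - \<rho>) * family_volume J l' u'"
    using W W1 by (simp add: algebra_simps)
  have V1: "family_volume I1 l u1 = \<rho> * family_volume I l u"
    using Vpos by (simp add: \<rho>_def)
  have V2: "family_volume I2 l2 u = (1 - \<rho>) * family_volume I l u"
    using V V1 by (simp add: algebra_simps)
  have fam2: "box_family J1 l' u1'" "box_family J2 l2' u'"
    unfolding J1_def J2_def u1'_def l2'_def by (rule box_family_cut[OF J b])+
  have sub: "J1 \<subseteq> J" "J2 \<subseteq> J" by (auto simp: J1_def J2_def)
  let ?S = "sum_of_families I l u J l' u'"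
  let ?S1 = "sum_of_families I1 l u1 J1 l' u1'"
  let ?S2 = "sum_of_families I2 l2 u J2 l2' u'"
  let ?n = "2 ^ DIM('a) :: real"
  have le: "cut_below b k v \<bullet> b' \<le> v \<bullet> b'" "v \<bullet> b' \<le> cut_above b k v \<bullet> b'" if "b' \<in> Basis" for k v b'
    using cut_inner[OF b that, of k v] by auto
  have "x \<in> ?S \<and> x \<bullet> b < c + c'" if x: "x \<in> ?S1" for x
  proof -
    obtain i j where ij: "i \<in> I1" "j \<in> J1" "x \<in> box (l i + l' j) (u1 i + u1' j)"
      using x unfolding sum_of_families_def by blast
    have "x \<in> box (l i + l' j) (u i + u' j)"
      using ij(3) unfolding mem_box u1_def u1'_def inner_add_left
      using le(1)[of _ c "u i"] le(1)[of _ c' "u' j"] by fastforce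
    moreover have "x \<bullet> b < u1 i \<bullet> b + u1' j \<bullet> b"
      using ij(3) b unfolding mem_box by (auto simp: inner_add_left)
    moreover have "i \<in> I" "j \<in> J" using ij I12 sub by blast+
    ultimately show ?thesis using cut_inner(1)[OF b b, of c "u i"] cut_inner(1)[OF b b, of c' "u' j"]
      unfolding sum_of_families_def u1_def u1'_def by (intro conjI, blast) auto
  qed
  moreover have "x \<in> ?S \<and> x \<bullet> b > c + c'" if x: "x \<in> ?S2" for x
  proof -
    obtain i j where ij: "i \<in> I2" "j \<in> J2" "x \<in> box (l2 i + l2' j) (u i + u' j)"
      using x unfolding sum_of_families_def by blast
    have "x \<in> box (l i + l' j) (u i + u' j)"
      using ij(3) unfolding mem_box l2_def l2'_def inner_add_left
      using le(2)[of _ "l i" c] le(2)[of _ "l' j" c'] by fastforce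
    moreover have "x \<bullet> b > l2 i \<bullet> b + l2' j \<bullet> b"
      using ij(3) b unfolding mem_box by (auto simp: inner_add_left)
    moreover have "i \<in> I" "j \<in> J" using ij I12 sub by blast+
    ultimately show ?thesis using cut_inner(2)[OF b b, of c "l i"] cut_inner(2)[OF b b, of c' "l' j"]
      unfolding sum_of_families_def l2_def l2'_def by (intro conjI, blast) auto
  qed
  ultimately have S12: "?S1 \<union> ?S2 \<subseteq> ?S" "?S1 \<inter> ?S2 = {}" by force+
  have fins: "finite I1" "finite I2" "finite J1" "finite J2"
    using fin I12 sub by (meson finite_subset psubset_imp_subset)+
  have "?n * sqrt (family_volume I l u * family_volume J l' u') =
     \<rho> * (?n * sqrt (family_volume I l u * family_volume J l' u')) +
     (1 - \<rho>) * (?n * sqrt (family_volume I l u * family_volume J l' u'))" by (simp add: algebra_simps)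
  also have "\<dots> = ?n * sqrt (family_volume I1 l u1 * family_volume J1 l' u1') +
     ?n * sqrt (family_volume I2 l2 u * family_volume J2 l2' u')"
  proof -
    have "sqrt ((r * x) * (r * y)) = r * sqrt (x * y)" if "0 \<le> r" for r x y :: real
      using that real_sqrt_mult[of "r\<^sup>2" "x * y"] by (simp add: power2_eq_square mult_ac)
    then show ?thesis unfolding V1 V2 W1 W2 using \<rho> by (simp add: mult_ac)
  qed
  also have "\<dots> \<le> measure lebesgue ?S1 + measure lebesgue ?S2"
    using IH[OF I12(1) sub(1) fam1(1) fam2(1)] IH[OF I12(2) sub(2) fam1(2) fam2(2)] by simp
  also have "\<dots> = measure lebesgue (?S1 \<union> ?S2)"
    using measure_Un3[OF sum_of_families_lmeasurable[OF fins(1,3)] sum_of_families_lmeasurable[OF fins(2,4)],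
        of l u1 l' u1' l2 u l2' u'] S12(2) by simp
  also have "\<dots> \<le> measure lebesgue ?S"
    by (intro measure_mono_fmeasurable) (use S12 fins fin in \<open>auto intro!: sum_of_families_lmeasurable sets.Un fmeasurableD\<close>)
  finally show ?thesis .
qed

lemma sqrt_prod: "finite A \<Longrightarrow> sqrt (prod f A) = (\<Prod>x\<in>A. sqrt (f x))"
  by (induction A rule: finite_induct) (auto simp: real_sqrt_mult)

text \<open>Brunn-Minkowski in the multiplicative form \<open>|A + B| \<ge> 2\<^sup>n sqrt (|A| |B|)\<close>. It is weaker than the
  usual form but already sharp for balls, which is what the isodiametric inequality needs. For two
  single boxes it is the inequality of arithmetic and geometric means in each coordinate.\<close>

lemma brunn_minkowski_boxes:
  fixes l u :: "'i \<Rightarrow> 'a::euclidean_space" and l' u' :: "'i \<Rightarrow> 'a"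
  assumes "box_family I l u" and "box_family J l' u'"
  shows "2 ^ DIM('a) * sqrt (family_volume I l u * family_volume J l' u')
         \<le> measure lebesgue (sum_of_families I l u J l' u')"
  using assms
proof (induction "card I + card J" arbitrary: I J l u l' u' rule: less_induct)
  case less
  note I = less.prems(1) and J = less.prems(2)
  have fin: "finite I" "finite J" using I J by (auto simp: box_family_def)
  show ?case
  proof (cases "I = {} \<or> J = {}")
    case True
    then show ?thesis by (auto simp: family_volume_def)
  next
    case nonempty: False
    consider i j where "i \<in> I" "j \<in> I" "i \<noteq> j" | i j where "i \<in> J" "j \<in> J" "i \<noteq> j"
      | i j where "I = {i}" "J = {j}"
    proof (cases "(\<exists>i\<in>I. \<exists>j\<in>I. i \<noteq> j) \<or> (\<exists>i\<in>J. \<exists>j\<in>J. i \<noteq> j)")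
      case True
      then show thesis using that(1,2) by (elim disjE bexE)
    next
      case False
      then have "is_singleton I" "is_singleton J"
        using nonempty by (auto intro!: is_singletonI')
      then show thesis using that(3) by (auto simp: is_singleton_def)
    qed
    then show ?thesis
    proof cases
      case 1
      then obtain b where b: "b \<in> Basis" "u i \<bullet> b \<le> l j \<bullet> b \<or> u j \<bullet> b \<le> l i \<bullet> b"
        using I unfolding box_family_def by blast
      have IH: "2 ^ DIM('a) * sqrt (family_volume I1 l u * family_volume J1 l' u')
         \<le> measure lebesgue (sum_of_families I1 l u J1 l' u')"
        if "I1 \<subset> I" "J1 \<subseteq> J" "box_family I1 l u" "box_family J1 l' u'" for I1 J1 and l u l' u' :: "'i \<Rightarrow> 'a"
      proof (rule less.hyps)
        show "card I1 + card J1 < card I + card J"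
          using psubset_card_mono[OF fin(1) that(1)] card_mono[OF fin(2) that(2)] by linarith
      qed (use that in auto)
      show ?thesis
      proof (cases "u i \<bullet> b \<le> l j \<bullet> b")
        case True
        show ?thesis
          by (rule brunn_minkowski_boxes_step[OF I J 1(1,2) b(1) True _ IH]) (use nonempty in auto)
      next
        case False
        then have "u j \<bullet> b \<le> l i \<bullet> b" using b by auto
        then show ?thesis
          using brunn_minkowski_boxes_step[OF I J 1(2,1) b(1) _ _ IH] nonempty by blast
      qed
    next
      case 2
      then obtain b where b: "b \<in> Basis" "u' i \<bullet> b \<le> l' j \<bullet> b \<or> u' j \<bullet> b \<le> l' i \<bullet> b"
        using J unfolding box_family_def by blast
      have IH: "2 ^ DIM('a) * sqrt (family_volume J1 l' u' * family_volume I1 l u)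
         \<le> measure lebesgue (sum_of_families J1 l' u' I1 l u)"
        if "J1 \<subset> J" "I1 \<subseteq> I" "box_family J1 l' u'" "box_family I1 l u" for I1 J1 and l u l' u' :: "'i \<Rightarrow> 'a"
      proof (rule less.hyps)
        show "card J1 + card I1 < card I + card J"
          using psubset_card_mono[OF fin(2) that(1)] card_mono[OF fin(1) that(2)] by linarith
      qed (use that in auto)
      have "2 ^ DIM('a) * sqrt (family_volume J l' u' * family_volume I l u)
         \<le> measure lebesgue (sum_of_families J l' u' I l u)"
      proof (cases "u' i \<bullet> b \<le> l' j \<bullet> b")
        case True
        show ?thesis
          by (rule brunn_minkowski_boxes_step[OF J I 2(1,2) b(1) True _ IH]) (use nonempty in auto)
      next
        case False
        then have "u' j \<bullet> b \<le> l' i \<bullet> b" using b by auto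
        then show ?thesis
          using brunn_minkowski_boxes_step[OF J I 2(2,1) b(1) _ _ IH] nonempty by blast
      qed
      then show ?thesis
        unfolding sum_of_families_commute[of I l u J] mult.commute[of "family_volume I l u"] .
    next
      case 3
      have pos: "0 < (u i - l i) \<bullet> b" "0 < (u' j - l' j) \<bullet> b" if "b \<in> Basis" for b
        using I J 3 that by (auto simp: box_family_def inner_diff_left)
      have AG: "2 * sqrt (x * y) \<le> x + y" if "0 \<le> x" "0 \<le> y" for x y :: real
        using arith_geo_mean_sqrt[OF that] by simp
      have "2 ^ DIM('a) * sqrt (family_volume I l u * family_volume J l' u')
        = (\<Prod>b\<in>Basis. 2 * sqrt (((u i - l i) \<bullet> b) * ((u' j - l' j) \<bullet> b)))"
        unfolding 3 family_volume_def
        by (simp add: prod.distrib real_sqrt_mult sqrt_prod)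
      also have "\<dots> \<le> (\<Prod>b\<in>Basis. ((u i + u' j) - (l i + l' j)) \<bullet> b)"
      proof (rule prod_mono, intro conjI)
        fix b :: 'a assume "b \<in> Basis"
        then show "2 * sqrt (((u i - l i) \<bullet> b) * ((u' j - l' j) \<bullet> b)) \<le> ((u i + u' j) - (l i + l' j)) \<bullet> b"
          using AG[of "(u i - l i) \<bullet> b" "(u' j - l' j) \<bullet> b"] pos[of b]
          by (simp add: algebra_simps inner_diff_left inner_add_left)
        show "0 \<le> 2 * sqrt (((u i - l i) \<bullet> b) * ((u' j - l' j) \<bullet> b))"
          using pos[OF \<open>b \<in> Basis\<close>] by simp
      qed
      also have "\<dots> = measure lborel (box (l i + l' j) (u i + u' j))"
      proof -
        have "\<forall>b\<in>Basis. (l i + l' j) \<bullet> b \<le> (u i + u' j) \<bullet> b"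
        proof
          fix b :: 'a assume "b \<in> Basis"
          then show "(l i + l' j) \<bullet> b \<le> (u i + u' j) \<bullet> b"
            using pos[of b] by (simp add: inner_diff_left inner_add_left)
        qed
        then show ?thesis by (subst measure_lborel_box_eq) (rule if_P[symmetric])
      qed
      also have "\<dots> = measure lebesgue (sum_of_families I l u J l' u')"
        by (simp add: 3 sum_of_families_def)
      finally show ?thesis .
    qed
  qed
qed

lemma box_add_decompose:
  fixes a b c d :: "'a::euclidean_space"
  assumes ab: "\<And>i. i \<in> Basis \<Longrightarrow> a \<bullet> i < b \<bullet> i" and cd: "\<And>i. i \<in> Basis \<Longrightarrow> c \<bullet> i < d \<bullet> i"
    and z: "z \<in> box (a + c) (b + d)"
  obtains x y where "x \<in> box a b" "y \<in> box c d" "z = x + y"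
proof -
  define \<theta> where "\<theta> i = ((z - (a + c)) \<bullet> i) / ((b + d - (a + c)) \<bullet> i)" for i
  define x where "x = a + (\<Sum>i\<in>Basis. (\<theta> i * ((b - a) \<bullet> i)) *\<^sub>R i)"
  define y where "y = c + (\<Sum>i\<in>Basis. (\<theta> i * ((d - c) \<bullet> i)) *\<^sub>R i)"
  have \<theta>: "0 < \<theta> i" "\<theta> i < 1" "\<theta> i * ((b + d - (a + c)) \<bullet> i) = (z - (a + c)) \<bullet> i" if "i \<in> Basis" for i
  proof -
    have "0 < (z - (a + c)) \<bullet> i" "(z - (a + c)) \<bullet> i < (b + d - (a + c)) \<bullet> i"
      using z that by (auto simp: mem_box inner_diff_left)
    then show "0 < \<theta> i" "\<theta> i < 1" "\<theta> i * ((b + d - (a + c)) \<bullet> i) = (z - (a + c)) \<bullet> i"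
      unfolding \<theta>_def by (auto simp: divide_simps)
  qed
  have co: "x \<bullet> i = a \<bullet> i + \<theta> i * ((b - a) \<bullet> i)" "y \<bullet> i = c \<bullet> i + \<theta> i * ((d - c) \<bullet> i)" if "i \<in> Basis" for i
    using that by (simp_all add: x_def y_def inner_add_left)
  have conv: "p < p + t * (q - p)" "p + t * (q - p) < q" if "0 < t" "t < 1" "p < q" for p q t :: real
  proof -
    have "t * (q - p) < q - p" "0 < t * (q - p)"
      using that mult_strict_right_mono[of t 1 "q - p"] by auto
    then show "p < p + t * (q - p)" "p + t * (q - p) < q" by (auto simp only: less_diff_eq add.commute)
  qed
  show ?thesis
  proof
    show "x \<in> box a b" "y \<in> box c d"
      unfolding mem_box using co \<theta> ab cd conv by (auto simp: inner_diff_left)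
    show "z = x + y"
    proof (rule euclidean_eqI)
      fix i :: 'a assume i: "i \<in> Basis"
      show "z \<bullet> i = (x + y) \<bullet> i"
        using \<theta>(3)[OF i] co[OF i] by (simp add: inner_add_left inner_diff_left algebra_simps)
    qed
  qed
qed

text \<open>Approximate \<open>A\<close> from outside by a finite family of small boxes meeting it. The sum of the family and
  its reflection consists of differences of points that are \<open>2 \<delta>\<close>-close to \<open>A\<close>, hence lies in a ball of
  radius \<open>D + 4 \<delta>\<close>; and the volume of the sum is at least \<open>2\<^sup>n |A|\<close>.\<close>

lemma isodiametric_approx:
  fixes A :: "'a::euclidean_space set"
  assumes A: "A \<in> lmeasurable" and bdd: "bounded A" and \<delta>: "0 < \<delta>"
    and D: "\<And>x y. x \<in> A \<Longrightarrow> y \<in> A \<Longrightarrow> dist x y \<le> D"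
  shows "2 ^ DIM('a) * measure lebesgue A \<le> measure lebesgue (ball (0::'a) (D + 4 * \<delta>))"
proof -
  obtain a b where ab: "A \<subseteq> cbox a b" using bdd bounded_subset_cbox_symmetric by blast
  obtain p where p: "p tagged_division_of (cbox a b)" "(\<lambda>x. ball x \<delta>) fine p"
    using fine_division_exists[of "\<lambda>x. ball x \<delta>" a b] \<delta> by (auto simp: gauge_def)
  define P where "P = snd ` p"
  have P: "P division_of (cbox a b)" using division_of_tagged_division[OF p(1)] by (simp add: P_def)
  define I where "I = {k \<in> P. k \<inter> A \<noteq> {} \<and> interior k \<noteq> {}}"
  define l u where "l k = (SOME l. \<exists>u. k = cbox l u)" "u k = (SOME u. k = cbox (l k) u)" for k :: "'a set"
  have k: "k = cbox (l k) (u k)" if "k \<in> P" for k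
  proof -
    have "\<exists>l u. k = cbox l u" using division_ofD(4)[OF P that] by blast
    then have "\<exists>u. k = cbox (l k) u" unfolding l_u_def(1) by (rule someI_ex)
    then show ?thesis unfolding l_u_def(2) by (rule someI_ex)
  qed
  have int: "interior k = box (l k) (u k)" if "k \<in> P" for k
    using k[OF that] interior_cbox by metis
  have finP: "finite P" using P by blast
  have small: "dist x y < 2 * \<delta>" if k: "k \<in> P" "x \<in> k" "y \<in> k" for k x y
  proof -
    obtain t where "(t, k) \<in> p" using k(1) by (auto simp: P_def)
    then have "k \<subseteq> ball t \<delta>" using p(2) by (auto simp: fine_def)
    then have "dist t x < \<delta>" "dist t y < \<delta>" using k(2,3) by (auto simp: subset_iff)
    then show ?thesis using dist_triangle[of x y t] dist_commute[of x t] by linarith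
  qed
  have lt: "l k \<bullet> i < u k \<bullet> i" if "k \<in> I" "i \<in> Basis" for k i
    using that int[of k] box_ne_empty(2)[of "l k" "u k"] by (auto simp: I_def)
  have fam: "box_family I l u"
    unfolding box_family_def
  proof (intro conjI ballI impI)
    show "finite I" using finP by (simp add: I_def)
    fix k k' assume kk: "k \<in> I" "k' \<in> I" "k \<noteq> k'"
    then have "interior k \<inter> interior k' = {}" using division_ofD(5)[OF P] by (auto simp: I_def)
    then have "box (l k) (u k) \<inter> box (l k') (u k') = {}" using int kk by (auto simp: I_def)
    then obtain i where "i \<in> Basis" "u k \<bullet> i \<le> l k \<bullet> i \<or> u k' \<bullet> i \<le> l k' \<bullet> i \<or> u k \<bullet> i \<le> l k' \<bullet> i \<or> u k' \<bullet> i \<le> l k \<bullet> i"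
      unfolding disjoint_interval(4) by auto
    then show "\<exists>b\<in>Basis. u k \<bullet> b \<le> l k' \<bullet> b \<or> u k' \<bullet> b \<le> l k \<bullet> b"
      using lt[OF kk(1)] lt[OF kk(2)] by (meson not_le)
  qed (use lt in auto)
  have fam': "box_family I (\<lambda>k. - u k) (\<lambda>k. - l k)"
    using fam unfolding box_family_def by (auto; blast)
  have vol': "family_volume I (\<lambda>k. - u k) (\<lambda>k. - l k) = family_volume I l u"
    by (simp add: family_volume_def)
  have nn: "0 \<le> family_volume I l u"
    using family_volume_pos[OF fam] by (cases "I = {}") (auto simp: family_volume_def)
  have "measure lebesgue A \<le> measure lebesgue ((\<Union>k\<in>I. k) \<union> (\<Union>k\<in>{k\<in>P. interior k = {}}. k))"
  proof (rule measure_mono_fmeasurable)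
    show "A \<subseteq> (\<Union>k\<in>I. k) \<union> (\<Union>k\<in>{k\<in>P. interior k = {}}. k)"
    proof
      fix x assume x: "x \<in> A"
      then obtain k where "k \<in> P" "x \<in> k" using ab division_ofD(6)[OF P] by blast
      with x show "x \<in> (\<Union>k\<in>I. k) \<union> (\<Union>k\<in>{k\<in>P. interior k = {}}. k)"
        unfolding I_def by (cases "interior k = {}") blast+
    qed
    show "A \<in> sets lebesgue" using A by auto
    have "k \<in> lmeasurable" if "k \<in> P" for k using k[OF that] lmeasurable_cbox by metis
    then show "(\<Union>k\<in>I. k) \<union> (\<Union>k\<in>{k\<in>P. interior k = {}}. k) \<in> lmeasurable"
      using finP by (intro fmeasurable.Un fmeasurable.finite_UN) (auto simp: I_def)
  qed
  also have "\<dots> \<le> measure lebesgue (\<Union>k\<in>I. k) + measure lebesgue (\<Union>k\<in>{k\<in>P. interior k = {}}. k)"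
  proof (rule measure_Un_le)
    have "k \<in> sets lebesgue" if "k \<in> P" for k using k[OF that] lmeasurable_cbox by (metis fmeasurableD)
    then show "(\<Union>k\<in>I. k) \<in> sets lebesgue" "(\<Union>k\<in>{k\<in>P. interior k = {}}. k) \<in> sets lebesgue"
      using finP by (auto intro!: sets.finite_UN simp: I_def)
  qed
  also have "measure lebesgue (\<Union>k\<in>{k\<in>P. interior k = {}}. k) = 0"
  proof (rule negligible_imp_measure0, rule negligible_Union)
    fix t assume "t \<in> (\<lambda>k. k) ` {k\<in>P. interior k = {}}"
    then have "t = cbox (l t) (u t)" "box (l t) (u t) = {}" using k int by auto
    then show "negligible t" by (metis negligible_interval(1))
  qed (use finP in auto)
  also have "measure lebesgue (\<Union>k\<in>I. k) \<le> (\<Sum>k\<in>I. measure lebesgue k)"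
  proof (rule measure_UNION_le)
    fix k assume "k \<in> I"
    then show "k \<in> sets lebesgue" using k[of k] lmeasurable_cbox by (metis (lifting) I_def fmeasurableD mem_Collect_eq)
  qed (use finP in \<open>simp add: I_def\<close>)
  also have "(\<Sum>k\<in>I. measure lebesgue k) = family_volume I l u"
    unfolding family_volume_def
  proof (rule sum.cong[OF refl])
    fix k' assume k': "k' \<in> I"
    then have "k' = cbox (l k') (u k')" using k by (simp add: I_def)
    then have "measure lebesgue k' = measure lebesgue (cbox (l k') (u k'))" by simp
    also have "\<dots> = (\<Prod>b\<in>Basis. (u k' - l k') \<bullet> b)"
      using lt[OF k'] by (simp add: content_cbox_cases less_imp_le inner_diff_left)
    finally show "measure lebesgue k' = (\<Prod>b\<in>Basis. (u k' - l k') \<bullet> b)" .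
  qed
  finally have "2 ^ DIM('a) * measure lebesgue A \<le> 2 ^ DIM('a) * sqrt (family_volume I l u * family_volume I (\<lambda>k. - u k) (\<lambda>k. - l k))"
    using nn by (simp add: vol')
  also have "\<dots> \<le> measure lebesgue (sum_of_families I l u I (\<lambda>k. - u k) (\<lambda>k. - l k))"
    by (rule brunn_minkowski_boxes[OF fam fam'])
  also have "\<dots> \<le> measure lebesgue (ball (0::'a) (D + 4 * \<delta>))"
  proof (rule measure_mono_fmeasurable)
    have finI: "finite I" using finP by (simp add: I_def)
    show "sum_of_families I l u I (\<lambda>k. - u k) (\<lambda>k. - l k) \<in> sets lebesgue"
      using sum_of_families_lmeasurable[OF finI finI] by blast
    show "sum_of_families I l u I (\<lambda>k. - u k) (\<lambda>k. - l k) \<subseteq> ball 0 (D + 4 * \<delta>)"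
    proof
      fix z assume "z \<in> sum_of_families I l u I (\<lambda>k. - u k) (\<lambda>k. - l k)"
      then obtain k1 k2 where kk: "k1 \<in> I" "k2 \<in> I" "z \<in> box (l k1 + - u k2) (u k1 + - l k2)"
        unfolding sum_of_families_def by blast
      obtain x y where xy: "x \<in> box (l k1) (u k1)" "y \<in> box (- u k2) (- l k2)" "z = x + y"
        by (rule box_add_decompose[OF _ _ kk(3)]) (use lt kk in auto)
      have "x \<in> k1" using xy(1) int[of k1] interior_subset[of k1] kk by (auto simp: I_def)
      moreover have "- y \<in> box (l k2) (u k2)" using xy(2) by (auto simp: mem_box)
      then have "- y \<in> k2" using int[of k2] interior_subset[of k2] kk by (auto simp: I_def)
      moreover obtain x' y' where "x' \<in> k1" "x' \<in> A" "y' \<in> k2" "y' \<in> A" using kk by (auto simp: I_def)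
      ultimately have "dist x x' < 2 * \<delta>" "dist (- y) y' < 2 * \<delta>" "dist x' y' \<le> D"
        using small D kk by (auto simp: I_def)
      then have "dist x (- y) < D + 4 * \<delta>"
        using dist_triangle[of x "- y" x'] dist_triangle[of x' "- y" y'] dist_commute[of y' "- y"] by linarith
      then show "z \<in> ball 0 (D + 4 * \<delta>)" unfolding mem_ball_0 xy(3) by (simp add: dist_norm)
    qed
  qed simp
  finally show ?thesis .
qed

lemma isodiametric:
  fixes A :: "'a::euclidean_space set"
  assumes A: "A \<in> sets lebesgue" and bdd: "bounded A"
  shows "measure lebesgue A \<le> unit_ball_vol (real DIM('a)) * (diameter A / 2) ^ DIM('a)"
proof -
  define D where "D = diameter A"
  have D0: "0 \<le> D" unfolding D_def using bdd by (rule diameter_ge_0)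
  have Am: "A \<in> lmeasurable" using A bdd by (rule bounded_set_imp_lmeasurable[rotated])
  have "2 ^ DIM('a) * measure lebesgue A \<le> unit_ball_vol (real DIM('a)) * (D + 4 * \<delta>) ^ DIM('a)" if "0 < \<delta>" for \<delta>
    using isodiametric_approx[OF Am bdd that, of D] diameter_bounded_bound[OF bdd] content_ball[of "D + 4 * \<delta>" "0::'a"] that D0
    by (simp add: D_def)
  then have "eventually (\<lambda>\<delta>. 2 ^ DIM('a) * measure lebesgue A \<le> unit_ball_vol (real DIM('a)) * (D + 4 * \<delta>) ^ DIM('a)) (at_right 0)"
    by (auto simp: eventually_at_right_less intro: eventually_mono[OF eventually_at_right_less])
  moreover have "((\<lambda>\<delta>. unit_ball_vol (real DIM('a)) * (D + 4 * \<delta>) ^ DIM('a)) \<longlongrightarrow>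
      unit_ball_vol (real DIM('a)) * (D + 4 * 0) ^ DIM('a)) (at_right 0)"
    by (intro tendsto_intros)
  ultimately have "2 ^ DIM('a) * measure lebesgue A \<le> unit_ball_vol (real DIM('a)) * (D + 4 * 0) ^ DIM('a)"
    by (intro tendsto_lowerbound[where F = "at_right (0::real)"]) auto
  then show ?thesis by (simp add: D_def power_divide field_simps)
qed

section \<open>Hausdorff measure of isometric images of Euclidean sets\<close>

lemma hausdorff_pre_antimono: "\<delta> \<le> \<delta>' \<Longrightarrow> hausdorff_pre k \<delta>' A \<le> hausdorff_pre k \<delta> A"
  unfolding hausdorff_pre_def by (rule INF_superset_mono) (auto simp: hausdorff_covers_def intro: order_trans)

lemma hausdorff_outer_empty: "hausdorff_outer k ({} :: 'a::metric_space set) = 0"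
  using outer_measure_hausdorff[of k, where 'a = 'a] by (simp add: outer_measure_space_def positive_def)

lemma hausdorff_outer_mono: "A \<subseteq> B \<Longrightarrow> hausdorff_outer k A \<le> hausdorff_outer k (B :: 'a::metric_space set)"
  using outer_measure_hausdorff[of k, where 'a = 'a] by (simp add: outer_measure_space_def increasing_def)

lemma hausdorff_outer_UN: "hausdorff_outer k (\<Union>n. A n) \<le> (\<Sum>n. hausdorff_outer k (A n :: 'a::metric_space set))"
  unfolding hausdorff_outer_def[of k "\<Union>n. A n"]
proof (rule SUP_least)
  fix \<delta> :: real assume "\<delta> \<in> {0<..}"
  then show "hausdorff_pre k \<delta> (\<Union>n. A n) \<le> (\<Sum>n. hausdorff_outer k (A n))"
    unfolding hausdorff_outer_def
    by (intro order.trans[OF hausdorff_pre_countably_subadditive] suminf_le SUP_upper) auto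
qed

lemma hausdorff_outer_Un: "hausdorff_outer k (A \<union> B) \<le> hausdorff_outer k A + hausdorff_outer k (B :: 'a::metric_space set)"
proof -
  have "hausdorff_outer k (A \<union> B) \<le> (\<Sum>n. hausdorff_outer k (if n = 0 then A else if n = 1 then B else {}))"
  proof (rule order.trans[OF hausdorff_outer_mono hausdorff_outer_UN])
    show "A \<union> B \<subseteq> (\<Union>n::nat. if n = 0 then A else if n = 1 then B else {})"
      using UN_upper[of 0 UNIV "\<lambda>n::nat. if n = 0 then A else if n = 1 then B else {}"]
        UN_upper[of 1 UNIV "\<lambda>n::nat. if n = 0 then A else if n = 1 then B else {}"] by simp
  qed
  also have "\<dots> = (\<Sum>n\<in>{0, 1}. hausdorff_outer k (if n = 0 then A else if n = (1::nat) then B else {}))"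
    by (rule suminf_finite) (auto simp: hausdorff_outer_empty)
  finally show ?thesis by simp
qed

text \<open>No set of diameter at most \<open>\<delta>\<close> meets both \<open>A\<close> and \<open>B\<close>, so a cover of the union splits.\<close>

lemma hausdorff_pre_separated:
  fixes A B :: "'a::metric_space set"
  assumes sep: "\<And>x y. x \<in> A \<Longrightarrow> y \<in> B \<Longrightarrow> \<delta> < dist x y" and \<delta>: "0 < \<delta>"
  shows "hausdorff_pre k \<delta> A + hausdorff_pre k \<delta> B \<le> hausdorff_pre k \<delta> (A \<union> B)"
  unfolding hausdorff_pre_def[of k \<delta> "A \<union> B"]
proof (rule INF_greatest)
  fix U assume U: "U \<in> hausdorff_covers \<delta> (A \<union> B)"
  then have bd: "bounded (U i)" "diameter (U i) \<le> \<delta>" and cov: "A \<union> B \<subseteq> (\<Union>i. U i)" for i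
    by (auto simp: hausdorff_covers_def)
  define V where "V i = (if U i \<inter> A \<noteq> {} then U i else {})" for i
  define W where "W i = (if U i \<inter> A = {} then U i else {})" for i
  have "V \<in> hausdorff_covers \<delta> A"
  proof -
    have "A \<subseteq> (\<Union>i. V i)"
    proof
      fix x assume "x \<in> A"
      moreover then obtain i where "x \<in> U i" using cov by blast
      ultimately have "x \<in> V i" by (auto simp: V_def)
      then show "x \<in> (\<Union>i. V i)" by blast
    qed
    moreover have "bounded (V i) \<and> diameter (V i) \<le> \<delta>" for i using bd[of i] \<delta> by (simp add: V_def)
    ultimately show ?thesis by (simp add: hausdorff_covers_def)
  qed
  moreover have "W \<in> hausdorff_covers \<delta> B"
  proof -
    have "y \<in> (\<Union>i. W i)" if y: "y \<in> B" for y
    proof -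
      obtain i where i: "y \<in> U i" using cov y by auto
      have "U i \<inter> A = {}"
      proof (rule ccontr)
        assume "U i \<inter> A \<noteq> {}"
        then obtain x where "x \<in> U i" "x \<in> A" by auto
        then show False using sep[of x y] y i diameter_bounded_bound[OF bd(1)[of i], of x y] bd(2)[of i] by auto
      qed
      then show ?thesis using i by (auto simp: W_def)
    qed
    moreover have "bounded (W i) \<and> diameter (W i) \<le> \<delta>" for i using bd[of i] \<delta> by (simp add: W_def)
    ultimately show ?thesis by (auto simp: hausdorff_covers_def)
  qed
  ultimately have "hausdorff_pre k \<delta> A + hausdorff_pre k \<delta> B \<le> (\<Sum>i. hausdorff_weight k (V i)) + (\<Sum>i. hausdorff_weight k (W i))"
    unfolding hausdorff_pre_def by (intro add_mono INF_lower)
  also have "\<dots> = (\<Sum>i. hausdorff_weight k (V i) + hausdorff_weight k (W i))"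
    by (rule suminf_add) auto
  also have "\<dots> = (\<Sum>i. hausdorff_weight k (U i))"
    by (intro suminf_cong) (auto simp: V_def W_def hausdorff_weight_def)
  finally show "hausdorff_pre k \<delta> A + hausdorff_pre k \<delta> B \<le> (\<Sum>i. hausdorff_weight k (U i))" .
qed

lemma hausdorff_outer_separated:
  fixes A B :: "'a::metric_space set"
  assumes sep: "\<And>x y. x \<in> A \<Longrightarrow> y \<in> B \<Longrightarrow> r \<le> dist x y" and r: "0 < r"
  shows "hausdorff_outer k A + hausdorff_outer k B \<le> hausdorff_outer k (A \<union> B)"
proof -
  have "hausdorff_outer k A + hausdorff_outer k B = (SUP \<delta>\<in>{0<..}. hausdorff_pre k \<delta> A + hausdorff_pre k \<delta> B)"
    unfolding hausdorff_outer_def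
  proof (rule SUP_add_directed_ennreal[symmetric])
    fix i j :: real assume "i \<in> {0<..}" "j \<in> {0<..}"
    then show "\<exists>k'\<in>{0<..}. hausdorff_pre k i A + hausdorff_pre k j B \<le> hausdorff_pre k k' A + hausdorff_pre k k' B"
      by (intro bexI[of _ "min i j"] add_mono hausdorff_pre_antimono) auto
  qed
  also have "\<dots> \<le> hausdorff_outer k (A \<union> B)"
  proof (rule SUP_least)
    fix \<delta> :: real assume \<delta>: "\<delta> \<in> {0<..}"
    define \<eta> where "\<eta> = min \<delta> (r / 2)"
    have "hausdorff_pre k \<delta> A + hausdorff_pre k \<delta> B \<le> hausdorff_pre k \<eta> A + hausdorff_pre k \<eta> B"
      by (intro add_mono hausdorff_pre_antimono) (auto simp: \<eta>_def)
    also have "\<dots> \<le> hausdorff_pre k \<eta> (A \<union> B)"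
    proof (rule hausdorff_pre_separated)
      fix x y assume "x \<in> A" "y \<in> B"
      then show "\<eta> < dist x y" using sep[of x y] r by (simp add: \<eta>_def)
    qed (use r \<delta> in \<open>simp add: \<eta>_def\<close>)
    also have "\<dots> \<le> hausdorff_outer k (A \<union> B)"
      unfolding hausdorff_outer_def using r \<delta> by (intro SUP_upper) (auto simp: \<eta>_def)
    finally show "hausdorff_pre k \<delta> A + hausdorff_pre k \<delta> B \<le> hausdorff_outer k (A \<union> B)" .
  qed
  finally show ?thesis .
qed

text \<open>Caratheodory's criterion for metric outer measures. The points of \<open>T\<close> at distance at least
  \<open>1 / (n + 1)\<close> from \<open>C\<close> exhaust \<open>T - C\<close>; to see that their measures converge to that of \<open>T - C\<close>, split
  the rest into shells \<open>R n\<close>. Shells whose indices have the same parity are at positive distance from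
  each other, so that the sum of all their measures is at most twice the supremum over the
  exhaustion.\<close>

lemma closed_in_sets_hausdorff:
  fixes C :: "'a::metric_space set"
  assumes C: "closed C" shows "C \<in> sets (hausdorff_measure k)"
proof (cases "C = {}")
  case False
  let ?h = "hausdorff_outer k :: 'a set \<Rightarrow> ennreal"
  have "?h (C \<inter> T) + ?h (- C \<inter> T) \<le> ?h T" for T
  proof -
    define D where "D n = {x\<in>T. 1 / real (Suc n) \<le> infdist x C}" for n
    define R where "R n = {x\<in>T. 1 / real (Suc (Suc n)) \<le> infdist x C \<and> infdist x C < 1 / real (Suc n)}" for n
    define S where "S = (SUP n. ?h (D n))"
    have far: "r \<le> dist x y" if "infdist x C + r \<le> infdist y C" for x y r
      using that infdist_triangle[of y C x] by (simp add: dist_commute)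
    have CD: "?h (C \<inter> T) + ?h (D n) \<le> ?h T" for n
    proof -
      have "?h (C \<inter> T) + ?h (D n) \<le> ?h ((C \<inter> T) \<union> D n)"
      proof (rule hausdorff_outer_separated)
        fix x y assume "x \<in> C \<inter> T" "y \<in> D n"
        then show "1 / real (Suc n) \<le> dist x y" by (intro far) (auto simp: D_def)
      qed simp
      also have "\<dots> \<le> ?h T" by (rule hausdorff_outer_mono) (auto simp: D_def)
      finally show ?thesis .
    qed
    have RS: "(\<Sum>j<N. ?h (R (2 * j + p))) \<le> S" for N p
    proof -
      have mono: "1 / real (Suc b) \<le> 1 / real (Suc a)" if "a \<le> b" for a b
        using that by (intro divide_left_mono) auto
      have "(\<Sum>j<N. ?h (R (2 * j + p))) \<le> ?h (\<Union>j<N. R (2 * j + p))"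
      proof (induction N)
        case (Suc N)
        have "(\<Sum>j<Suc N. ?h (R (2 * j + p))) \<le> ?h (\<Union>j<N. R (2 * j + p)) + ?h (R (2 * N + p))"
          using Suc by (simp add: add_right_mono)
        also have "\<dots> \<le> ?h ((\<Union>j<N. R (2 * j + p)) \<union> R (2 * N + p))"
        proof (rule hausdorff_outer_separated)
          define r where "r = 1 / real (2 * N + p) - 1 / real (Suc (2 * N + p))"
          fix x y assume x: "x \<in> (\<Union>j<N. R (2 * j + p))" and y: "y \<in> R (2 * N + p)"
          then obtain j where j: "j < N" "1 / real (Suc (Suc (2 * j + p))) \<le> infdist x C" by (auto simp: R_def)
          have "1 / real (Suc (2 * N + p - 1)) \<le> 1 / real (Suc (Suc (2 * j + p)))"
            using j(1) by (intro mono) auto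
          then have "1 / real (2 * N + p) \<le> infdist x C" using j by simp
          moreover have "infdist y C < 1 / real (Suc (2 * N + p))" using y by (auto simp: R_def)
          ultimately have "infdist y C + r \<le> infdist x C" by (simp add: r_def)
          from far[OF this] show "(if N = 0 then 1 else 1 / real (2 * N + p) - 1 / real (Suc (2 * N + p))) \<le> dist x y"
            using j by (simp add: r_def dist_commute)
        next
          show "0 < (if N = 0 then 1 else 1 / real (2 * N + p) - 1 / real (Suc (2 * N + p)))"
            by (simp add: frac_less2)
        qed
        also have "(\<Union>j<N. R (2 * j + p)) \<union> R (2 * N + p) = (\<Union>j<Suc N. R (2 * j + p))"
          by (auto simp: less_Suc_eq)
        finally show ?case .
      qed (simp add: hausdorff_outer_empty)
      also have "\<dots> \<le> ?h (D (2 * N + p))"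
      proof (rule hausdorff_outer_mono, safe)
        fix j x assume "j < N" "x \<in> R (2 * j + p)"
        then show "x \<in> D (2 * N + p)"
          using mono[of "Suc (2 * j + p)" "2 * N + p"] by (auto simp: R_def D_def)
      qed
      also have "\<dots> \<le> S" unfolding S_def by (rule SUP_upper) simp
      finally show ?thesis .
    qed
    have key: "?h (- C \<inter> T) \<le> S"
    proof (cases "S = top")
      case False
      have sum2: "(\<Sum>j<2 * N. f j) = (\<Sum>j<N. f (2 * j + 0)) + (\<Sum>j<N. f (2 * j + 1))" for N and f :: "nat \<Rightarrow> ennreal"
        by (induction N) (auto simp: add_ac)
      have "(\<Sum>j<N. ?h (R j)) \<le> S + S" for N
      proof -
        have "(\<Sum>j<N. ?h (R j)) \<le> (\<Sum>j<2 * N. ?h (R j))" by (rule sum_mono2) auto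
        also have "\<dots> \<le> S + S" unfolding sum2 by (intro add_mono RS)
        finally show ?thesis .
      qed
      then have tot: "(\<Sum>j. ?h (R j)) \<le> S + S" by (intro suminf_le_const) auto
      then have fin: "(\<Sum>j. ?h (R j)) \<noteq> top" using False by (auto simp: top_unique)
      then have "?h (R j) \<noteq> top" for j using ennreal_suminf_lessD[of "\<lambda>j. ?h (R j)" top j] by (simp add: less_top)
      define r where "r j = enn2real (?h (R j))" for j
      have r: "?h (R j) = ennreal (r j)" for j
        using \<open>\<And>j. ?h (R j) \<noteq> top\<close> by (simp add: r_def less_top)
      have sr: "summable r"
      proof (rule summable_suminf_not_top)
        show "(\<Sum>j. ennreal (r j)) \<noteq> top" using fin unfolding r .
      qed (simp add: r_def)
      show ?thesis
      proof (rule ennreal_le_epsilon)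
        fix e :: real assume e: "0 < e"
        obtain N where N: "norm (\<Sum>i. r (i + N)) < e" using suminf_exist_split[OF e sr] by auto
        have "- C \<inter> T \<subseteq> D N \<union> (\<Union>j. R (j + N))"
        proof
          fix x assume x: "x \<in> - C \<inter> T"
          then have pos: "0 < infdist x C"
            using C \<open>C \<noteq> {}\<close> in_closed_iff_infdist_zero[OF C \<open>C \<noteq> {}\<close>, of x] infdist_nonneg[of x C] by auto
          then obtain n0 where n0: "1 / real (Suc n0) < infdist x C" using nat_approx_posE by metis
          define n where "n = (LEAST n. 1 / real (Suc n) \<le> infdist x C)"
          have n: "1 / real (Suc n) \<le> infdist x C" unfolding n_def by (rule LeastI[of _ n0]) (use n0 in simp)
          show "x \<in> D N \<union> (\<Union>j. R (j + N))"
          proof (cases "n \<le> N")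
            case True
            have "1 / real (Suc N) \<le> 1 / real (Suc n)" using True by (intro divide_left_mono) auto
            then show ?thesis using n x by (auto simp: D_def)
          next
            case False
            then obtain m where m: "n = Suc m" "N \<le> m" by (cases n) auto
            have "\<not> 1 / real (Suc m) \<le> infdist x C" using not_less_Least[of m "\<lambda>n. 1 / real (Suc n) \<le> infdist x C"] m by (simp add: n_def)
            then have "x \<in> R ((m - N) + N)" using n m x by (auto simp: R_def)
            then show ?thesis by blast
          qed
        qed
        then have "?h (- C \<inter> T) \<le> ?h (D N) + ?h (\<Union>j. R (j + N))"
          by (intro order.trans[OF hausdorff_outer_mono hausdorff_outer_Un])
        also have "\<dots> \<le> S + (\<Sum>j. ?h (R (j + N)))"
          unfolding S_def by (intro add_mono SUP_upper hausdorff_outer_UN) auto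
        also have "(\<Sum>j. ?h (R (j + N))) = ennreal (\<Sum>j. r (j + N))"
          unfolding r
        proof (rule suminf_ennreal2)
          show "summable (\<lambda>j. r (j + N))" using sr by (rule summable_ignore_initial_segment)
        qed (simp add: r_def)
        also have "\<dots> \<le> ennreal e" using N by (intro ennreal_leI) auto
        finally show "?h (- C \<inter> T) \<le> S + ennreal e" by (simp add: add_mono)
      qed
    qed simp
    have "?h (C \<inter> T) + S = (SUP n. ?h (C \<inter> T) + ?h (D n))"
      unfolding S_def by (rule ennreal_SUP_add_right) auto
    also have "\<dots> \<le> ?h T" by (rule SUP_least) (rule CD)
    finally show ?thesis using key by (meson add_left_mono order.trans)
  qed
  moreover have "?h T \<le> ?h (C \<inter> T) + ?h (- C \<inter> T)" for T
    by (rule order.trans[OF hausdorff_outer_mono hausdorff_outer_Un]) auto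
  ultimately show ?thesis
    unfolding sets_hausdorff lambda_system_def by (auto simp: Compl_eq_Diff_UNIV[symmetric] intro: antisym)
qed simp

lemma null_in_sets_hausdorff:
  fixes A :: "'a::metric_space set"
  assumes "hausdorff_outer k A = 0" shows "A \<in> sets (hausdorff_measure k)"
proof -
  have "hausdorff_outer k (A \<inter> T) + hausdorff_outer k ((UNIV - A) \<inter> T) = hausdorff_outer k T" for T
  proof (rule antisym)
    have "hausdorff_outer k (A \<inter> T) \<le> 0" using hausdorff_outer_mono[of "A \<inter> T" A k] assms by simp
    then show "hausdorff_outer k (A \<inter> T) + hausdorff_outer k ((UNIV - A) \<inter> T) \<le> hausdorff_outer k T"
      by (simp add: hausdorff_outer_mono)
    show "hausdorff_outer k T \<le> hausdorff_outer k (A \<inter> T) + hausdorff_outer k ((UNIV - A) \<inter> T)"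
      by (rule order.trans[OF hausdorff_outer_mono hausdorff_outer_Un]) auto
  qed
  then show ?thesis unfolding sets_hausdorff lambda_system_def by auto
qed

text \<open>Here the isodiametric inequality enters: each covering set pulls back to a set whose volume is at
  most its Hausdorff weight.\<close>

lemma outer_lebesgue_le_hausdorff:
  fixes \<iota> :: "'b::euclidean_space \<Rightarrow> 'a::metric_space"
  assumes iso: "\<And>x y. dist (\<iota> x) (\<iota> y) = dist x y"
  shows "outer_measure_of lebesgue B \<le> hausdorff_outer DIM('b) (\<iota> ` B)"
proof -
  have "outer_measure_of lebesgue B \<le> hausdorff_pre DIM('b) 1 (\<iota> ` B)"
    unfolding hausdorff_pre_def
  proof (rule INF_greatest)
    fix U assume U: "U \<in> hausdorff_covers 1 (\<iota> ` B)"
    then have bd: "bounded (U i)" and cov: "\<iota> ` B \<subseteq> (\<Union>i. U i)" for i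
      by (auto simp: hausdorff_covers_def)
    define W where "W i = closure (\<iota> -` U i)" for i
    have dU: "dist x y \<le> diameter (U i)" if "x \<in> \<iota> -` U i" "y \<in> \<iota> -` U i" for i x y
      using diameter_bounded_bound[OF bd[of i], of "\<iota> x" "\<iota> y"] that by (simp add: iso)
    have bV: "bounded (\<iota> -` U i)" for i
      unfolding bounded_two_points using dU by blast
    then have bW: "bounded (W i)" for i unfolding W_def by (rule bounded_closure)
    have dW: "diameter (W i) \<le> diameter (U i)" for i
      unfolding W_def diameter_closure[OF bV]
      by (rule diameter_le) (use dU[of _ i] diameter_ge_0[OF bd[of i]] in \<open>auto simp: dist_norm\<close>)
    have Wi: "emeasure lebesgue (W i) \<le> hausdorff_weight DIM('b) (U i)" for i
    proof (cases "U i = {}")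
      case True
      then show ?thesis by (simp add: W_def)
    next
      case False
      have Wl: "W i \<in> lmeasurable"
        using bW[of i] by (intro bounded_set_imp_lmeasurable) (auto simp: W_def)
      have "measure lebesgue (W i) \<le> unit_ball_vol (real DIM('b)) * (diameter (W i) / 2) ^ DIM('b)"
        using Wl bW by (intro isodiametric) auto
      also have "\<dots> \<le> unit_ball_vol (real DIM('b)) * (diameter (U i) / 2) ^ DIM('b)"
        using dW[of i] diameter_ge_0[OF bW[of i]] by (intro mult_left_mono power_mono) auto
      finally show ?thesis
        using False Wl by (simp add: hausdorff_weight_def emeasure_eq_measure2 ennreal_leI)
    qed
    have "outer_measure_of lebesgue B \<le> outer_measure_of lebesgue (\<Union>i. W i)"
    proof (rule outer_measure_of_mono, rule subsetI)
      fix x assume "x \<in> B"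
      then obtain i where "\<iota> x \<in> U i" using cov by auto
      then have "x \<in> W i" unfolding W_def using closure_subset by (metis in_mono vimageI)
      then show "x \<in> (\<Union>i. W i)" by blast
    qed
    also have "\<dots> = emeasure lebesgue (\<Union>i. W i)"
      by (rule outer_measure_of_eq) (auto simp: W_def)
    also have "\<dots> \<le> (\<Sum>i. emeasure lebesgue (W i))"
      by (rule emeasure_subadditive_countably) (auto simp: W_def)
    also have "\<dots> \<le> (\<Sum>i. hausdorff_weight DIM('b) (U i))"
      using Wi by (intro suminf_le) auto
    finally show "outer_measure_of lebesgue B \<le> (\<Sum>i. hausdorff_weight DIM('b) (U i))" .
  qed
  also have "\<dots> \<le> hausdorff_outer DIM('b) (\<iota> ` B)"
    unfolding hausdorff_outer_def by (rule SUP_upper) simp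
  finally show ?thesis .
qed

text \<open>Images of balls are covering sets whose weight is at most their volume, so that a disjoint family of
  balls inside \<open>V\<close>, enlarged by the factor \<open>c\<close>, costs at most \<open>c\<^sup>n |V|\<close>. Used with \<open>c = 5\<close> for the Vitali
  covering lemma and with \<open>c = 1\<close> for the Vitali covering theorem.\<close>

lemma hausdorff_pre_disjoint_cballs:
  fixes \<iota> :: "'b::euclidean_space \<Rightarrow> 'a::metric_space" and C :: "('b \<times> real) set"
  assumes iso: "\<And>x y. dist (\<iota> x) (\<iota> y) = dist x y"
    and C: "countable C" "pairwise (\<lambda>i j. disjnt (cball (fst i) (snd i)) (cball (fst j) (snd j))) C"
    and c: "0 < c" and r: "\<And>x r. (x, r) \<in> C \<Longrightarrow> 0 < r \<and> cball x r \<subseteq> V \<and> 2 * (c * r) \<le> \<delta>"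
    and \<delta>: "0 < \<delta>" and V: "V \<in> sets lebesgue"
  shows "hausdorff_pre DIM('b) \<delta> (\<Union>(x, r)\<in>C. \<iota> ` cball x (c * r)) \<le> ennreal (c ^ DIM('b)) * emeasure lebesgue V"
proof -
  define on where "on n \<longleftrightarrow> n \<in> to_nat_on C ` C" for n
  define X where "X n = fst (from_nat_into C n)" for n
  define \<rho> where "\<rho> n = snd (from_nat_into C n)" for n
  have onC: "(X n, \<rho> n) \<in> C" if "on n" for n
    using that C(1) unfolding on_def X_def \<rho>_def by auto
  define U where "U n = (if on n then \<iota> ` cball (X n) (c * \<rho> n) else {})" for n
  define G where "G n = (if on n then cball (X n) (\<rho> n) else {})" for n
  have dU: "dist y z \<le> 2 * (c * \<rho> n)" if "y \<in> U n" "z \<in> U n" for y z n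
  proof -
    obtain p q where "y = \<iota> p" "z = \<iota> q" "p \<in> cball (X n) (c * \<rho> n)" "q \<in> cball (X n) (c * \<rho> n)"
      using \<open>y \<in> U n\<close> \<open>z \<in> U n\<close> by (auto simp: U_def split: if_splits)
    then show ?thesis using dist_triangle3[of p q "X n"] by (simp add: iso)
  qed
  have bU: "bounded (U n)" for n unfolding bounded_two_points using dU by blast
  have diam: "diameter (U n) \<le> 2 * (c * \<rho> n)" if "on n" for n
  proof -
    have "0 < c * \<rho> n" using r[OF onC[OF that]] c by simp
    then have "U n \<noteq> {}" using that by (simp add: U_def)
    then show ?thesis unfolding diameter_def using dU by (auto intro!: cSUP_least)
  qed
  have "U \<in> hausdorff_covers \<delta> (\<Union>(x, r)\<in>C. \<iota> ` cball x (c * r))"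
  proof -
    have "diameter (U n) \<le> \<delta>" for n
    proof (cases "on n")
      case True then show ?thesis using diam[OF True] r[OF onC[OF True]] by linarith
    qed (use \<delta> in \<open>simp add: U_def\<close>)
    moreover have "(\<Union>(x, r)\<in>C. \<iota> ` cball x (c * r)) \<subseteq> (\<Union>n. U n)"
    proof -
      have "\<iota> ` cball (fst p) (c * snd p) \<subseteq> (\<Union>n. U n)" if p: "p \<in> C" for p
      proof -
        have "U (to_nat_on C p) = \<iota> ` cball (fst p) (c * snd p)"
          using p C(1) by (simp add: U_def on_def X_def \<rho>_def)
        then show ?thesis by blast
      qed
      then show ?thesis unfolding split_beta by blast
    qed
    ultimately show ?thesis using bU by (simp add: hausdorff_covers_def)
  qed
  then have "hausdorff_pre DIM('b) \<delta> (\<Union>(x, r)\<in>C. \<iota> ` cball x (c * r)) \<le> (\<Sum>n. hausdorff_weight DIM('b) (U n))"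
    unfolding hausdorff_pre_def by (rule INF_lower)
  also have "\<dots> \<le> (\<Sum>n. ennreal (c ^ DIM('b)) * emeasure lebesgue (G n))"
  proof (rule suminf_le)
    fix n
    show "hausdorff_weight DIM('b) (U n) \<le> ennreal (c ^ DIM('b)) * emeasure lebesgue (G n)"
    proof (cases "on n")
      case True
      have r0: "0 < \<rho> n" using r[OF onC[OF True]] by simp
      have "hausdorff_weight DIM('b) (U n) \<le> ennreal (unit_ball_vol (real DIM('b)) * (c * \<rho> n) ^ DIM('b))"
        unfolding hausdorff_weight_def
        using diam[OF True] diameter_ge_0[OF bU[of n]] by (auto intro!: ennreal_leI mult_left_mono power_mono)
      also have "\<dots> = ennreal (c ^ DIM('b)) * emeasure lebesgue (G n)"
        using r0 c True by (simp add: G_def emeasure_cball ennreal_mult[symmetric] power_mult_distrib mult_ac)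
      finally show ?thesis .
    qed (simp add: U_def hausdorff_weight_def)
  qed auto
  also have "\<dots> = ennreal (c ^ DIM('b)) * emeasure lebesgue (\<Union>n. G n)"
  proof -
    have "disjoint_family G"
      unfolding disjoint_family_on_def
    proof (intro ballI impI)
      fix m n :: nat assume "m \<noteq> n"
      show "G m \<inter> G n = {}"
      proof (cases "on m \<and> on n")
        case True
        then have "from_nat_into C m \<noteq> from_nat_into C n" "from_nat_into C m \<in> C" "from_nat_into C n \<in> C"
          using \<open>m \<noteq> n\<close> C(1) by (auto simp: on_def)
        then show ?thesis
          using C(2) True unfolding pairwise_def disjnt_def G_def X_def \<rho>_def by simp
      qed (auto simp: G_def)
    qed
    then have "(\<Sum>n. emeasure lebesgue (G n)) = emeasure lebesgue (\<Union>n. G n)"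
    proof (rule suminf_emeasure[rotated])
      show "range G \<subseteq> sets lebesgue" by (auto simp: G_def)
    qed
    then show ?thesis by simp
  qed
  also have "\<dots> \<le> ennreal (c ^ DIM('b)) * emeasure lebesgue V"
  proof (intro mult_left_mono emeasure_mono V)
    show "(\<Union>n. G n) \<subseteq> V" using r[OF onC] by (force simp: G_def split: if_splits)
  qed simp
  finally show ?thesis .
qed

lemma hausdorff_isometric_image_null:
  fixes \<iota> :: "'b::euclidean_space \<Rightarrow> 'a::metric_space"
  assumes iso: "\<And>x y. dist (\<iota> x) (\<iota> y) = dist x y" and N: "N \<in> null_sets lebesgue"
  shows "hausdorff_outer DIM('b) (\<iota> ` N) = 0"
proof -
  have "hausdorff_pre DIM('b) \<delta> (\<iota> ` N) \<le> 0 + ennreal e" if \<delta>: "0 < \<delta>" and e: "0 < e" for \<delta> e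
  proof -
    define e' where "e' = e / 5 ^ DIM('b)"
    have e': "0 < e'" using e by (simp add: e'_def)
    obtain V where V: "open V" "N \<subseteq> V" "emeasure lebesgue (V - N) < ennreal e'"
      by (rule sets_lebesgue_outer_open[OF null_setsD2[OF N] e'])
    have Vm: "V \<in> sets lebesgue" using V(1) by auto
    have "emeasure lebesgue V \<le> emeasure lebesgue (V - N) + emeasure lebesgue N"
      using emeasure_subadditive[of "V - N" lebesgue N] V(2) N Vm
      by (metis Diff_partition Un_commute null_setsD2 sets.Diff)
    then have eV: "emeasure lebesgue V \<le> ennreal e'" using V(3) N by (simp add: null_setsD1 less_imp_le)
    \<comment> \<open>radius \<open>\<delta> / 10\<close>: the balls enlarged by the factor 5 must have diameter at most \<open>\<delta>\<close>\<close>
    define K where "K = {(x, r). 0 < r \<and> r \<le> \<delta> / 10 \<and> cball x r \<subseteq> V}"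
    have r0: "0 < snd i \<and> snd i \<le> \<delta> / 10" if "i \<in> K" for i using that by (auto simp: K_def)
    have cov: "N \<subseteq> (\<Union>i\<in>K. cball (fst i) (snd i))"
    proof
      fix x assume "x \<in> N"
      then obtain r where "0 < r" "cball x r \<subseteq> V" using V open_contains_cball by blast
      then have "(x, min r (\<delta> / 10)) \<in> K" using \<delta> by (auto simp: K_def)
      then show "x \<in> (\<Union>i\<in>K. cball (fst i) (snd i))"
        by (rule UN_I) (use \<open>0 < r\<close> \<delta> in simp)
    qed
    obtain C where C: "countable C" "C \<subseteq> K"
      "pairwise (\<lambda>i j. disjnt (cball (fst i) (snd i)) (cball (fst j) (snd j))) C"
      "N \<subseteq> (\<Union>i\<in>C. cball (fst i) (5 * snd i))"
      by (rule Vitali_covering_lemma_cballs[OF cov r0]) (assumption | (erule (3) that))+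
    have "hausdorff_pre DIM('b) \<delta> (\<iota> ` N) \<le> hausdorff_pre DIM('b) \<delta> (\<Union>(x, r)\<in>C. \<iota> ` cball x (5 * r))"
      using C(4) by (intro hausdorff_pre_mono) fastforce
    also have "\<dots> \<le> ennreal (5 ^ DIM('b)) * emeasure lebesgue V"
      by (rule hausdorff_pre_disjoint_cballs[OF iso C(1,3) _ _ \<delta> Vm]) (use C(2) in \<open>auto simp: K_def\<close>)
    also have "\<dots> \<le> ennreal (5 ^ DIM('b)) * ennreal e'" using eV by (intro mult_left_mono) auto
    also have "\<dots> = 0 + ennreal e" using e by (simp add: e'_def ennreal_mult[symmetric])
    finally show ?thesis .
  qed
  then have "hausdorff_pre DIM('b) \<delta> (\<iota> ` N) \<le> 0" if "0 < \<delta>" for \<delta>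
    using that by (blast intro: ennreal_le_epsilon)
  then show ?thesis unfolding hausdorff_outer_def by (intro antisym SUP_least) auto
qed

text \<open>Fill an open neighbourhood of \<open>B\<close> of nearly the same volume with disjoint small balls up to a
  null set, which \<open>hausdorff_isometric_image_null\<close> takes care of.\<close>

lemma hausdorff_isometric_image_le:
  fixes \<iota> :: "'b::euclidean_space \<Rightarrow> 'a::metric_space"
  assumes iso: "\<And>x y. dist (\<iota> x) (\<iota> y) = dist x y" and B: "B \<in> sets lebesgue"
  shows "hausdorff_outer DIM('b) (\<iota> ` B) \<le> emeasure lebesgue B"
  unfolding hausdorff_outer_def
proof (rule SUP_least)
  fix \<delta> :: real assume \<delta>: "\<delta> \<in> {0<..}"
  show "hausdorff_pre DIM('b) \<delta> (\<iota> ` B) \<le> emeasure lebesgue B"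
  proof (rule ennreal_le_epsilon)
    fix e :: real assume e: "0 < e"
    obtain V where V: "open V" "B \<subseteq> V" "emeasure lebesgue (V - B) < ennreal e"
      by (rule sets_lebesgue_outer_open[OF B e])
    have Vm: "V \<in> sets lebesgue" using V(1) by auto
    have eV: "emeasure lebesgue V \<le> emeasure lebesgue B + ennreal e"
    proof -
      have "emeasure lebesgue V = emeasure lebesgue B + emeasure lebesgue (V - B)"
        using plus_emeasure[OF B sets.Diff[OF Vm B]] V(2) by (simp add: Un_absorb1)
      also have "\<dots> \<le> emeasure lebesgue B + ennreal e" by (rule add_left_mono[OF less_imp_le[OF V(3)]])
      finally show ?thesis .
    qed
    define K where "K = {(x, r). 0 < r \<and> r \<le> \<delta> / 2 \<and> cball x r \<subseteq> V}"
    have r0: "0 < snd i" if "i \<in> K" for i using that by (auto simp: K_def)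
    have cov: "\<exists>i. i \<in> K \<and> x \<in> cball (fst i) (snd i) \<and> snd i < d" if x: "x \<in> V" and d: "0 < d" for x d
    proof -
      obtain r where "0 < r" "cball x r \<subseteq> V" using V(1) x open_contains_cball by blast
      then have "(x, min r (min (\<delta> / 2) (d / 2))) \<in> K" "min r (min (\<delta> / 2) (d / 2)) < d"
        using \<delta> d by (auto simp: K_def)
      then show ?thesis by (intro exI[of _ "(x, min r (min (\<delta> / 2) (d / 2)))"]) (auto simp: K_def)
    qed
    obtain C where C: "countable C" "C \<subseteq> K"
      "pairwise (\<lambda>i j. disjnt (cball (fst i) (snd i)) (cball (fst j) (snd j))) C"
      "negligible (V - (\<Union>i\<in>C. cball (fst i) (snd i)))"
      by (rule Vitali_covering_theorem_cballs[of K snd V fst]) (erule r0 | (erule (1) cov) | (erule (3) that))+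
    let ?N = "V - (\<Union>i\<in>C. cball (fst i) (snd i))"
    have "hausdorff_pre DIM('b) \<delta> (\<iota> ` B) \<le> hausdorff_pre DIM('b) \<delta> ((\<Union>(x, r)\<in>C. \<iota> ` cball x (1 * r)) \<union> \<iota> ` ?N)"
      using V(2) by (intro hausdorff_pre_mono) fastforce
    also have "\<dots> \<le> hausdorff_pre DIM('b) \<delta> (\<Union>(x, r)\<in>C. \<iota> ` cball x (1 * r)) + hausdorff_pre DIM('b) \<delta> (\<iota> ` ?N)"
      (is "?p (?A \<union> ?B) \<le> _")
    proof -
      have "?p (?A \<union> ?B) \<le> ?p (\<Union>n::nat. if n = 0 then ?A else if n = 1 then ?B else {})"
        using UN_upper[of 0 UNIV "\<lambda>n::nat. if n = 0 then ?A else if n = 1 then ?B else {}"]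
          UN_upper[of 1 UNIV "\<lambda>n::nat. if n = 0 then ?A else if n = 1 then ?B else {}"]
        by (intro hausdorff_pre_mono) simp
      also have "\<dots> \<le> (\<Sum>n::nat. ?p (if n = 0 then ?A else if n = 1 then ?B else {}))"
        by (rule hausdorff_pre_countably_subadditive)
      also have "\<dots> = (\<Sum>n\<in>{0, 1::nat}. ?p (if n = 0 then ?A else if n = 1 then ?B else {}))"
        using \<delta> by (intro suminf_finite) (auto simp: hausdorff_pre_empty)
      finally show ?thesis by simp
    qed
    also have "hausdorff_pre DIM('b) \<delta> (\<iota> ` ?N) \<le> 0"
    proof -
      have "hausdorff_pre DIM('b) \<delta> (\<iota> ` ?N) \<le> hausdorff_outer DIM('b) (\<iota> ` ?N)"
        unfolding hausdorff_outer_def using \<delta> by (rule SUP_upper)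
      then show ?thesis
        using hausdorff_isometric_image_null[OF iso, of ?N] C(4) by (simp add: negligible_iff_null_sets)
    qed
    also have "hausdorff_pre DIM('b) \<delta> (\<Union>(x, r)\<in>C. \<iota> ` cball x (1 * r)) \<le> ennreal (1 ^ DIM('b)) * emeasure lebesgue V"
      using \<delta> by (intro hausdorff_pre_disjoint_cballs[OF iso C(1,3) _ _ _ Vm]) (use C(2) in \<open>auto simp: K_def\<close>)
    finally show "hausdorff_pre DIM('b) \<delta> (\<iota> ` B) \<le> emeasure lebesgue B + ennreal e"
      using eV by (simp add: add_mono)
  qed
qed

lemma hausdorff_isometric_image:
  fixes \<iota> :: "'b::euclidean_space \<Rightarrow> 'a::metric_space"
  assumes iso: "\<And>x y. dist (\<iota> x) (\<iota> y) = dist x y" and B: "B \<in> sets lebesgue"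
  shows "\<iota> ` B \<in> sets (hausdorff_measure DIM('b))"
    and "emeasure (hausdorff_measure DIM('b)) (\<iota> ` B) = emeasure lebesgue B"
proof -
  obtain C T where CT: "fsigma C" "T \<in> null_sets lebesgue" "C \<union> T = B"
    using lebesgue_set_almost_fsigma[OF B] by metis
  obtain F :: "nat \<Rightarrow> 'b set" where F: "range F \<subseteq> Collect compact" "C = \<Union>(F ` UNIV)"
    using CT(1) fsigma_Union_compact by metis
  have cont: "continuous_on S \<iota>" for S
    unfolding continuous_on_iff by (auto simp: iso)
  have "\<iota> ` F n \<in> sets (hausdorff_measure DIM('b))" for n
    using F(1) by (intro closed_in_sets_hausdorff compact_imp_closed compact_continuous_image[OF cont]) auto
  then have "(\<Union>n. \<iota> ` F n) \<in> sets (hausdorff_measure DIM('b))" by blast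
  moreover have "\<iota> ` T \<in> sets (hausdorff_measure DIM('b))"
    by (rule null_in_sets_hausdorff[OF hausdorff_isometric_image_null[OF iso CT(2)]])
  moreover have "\<iota> ` B = (\<Union>n. \<iota> ` F n) \<union> \<iota> ` T" using CT(3) F(2) by blast
  ultimately show m: "\<iota> ` B \<in> sets (hausdorff_measure DIM('b))" by (metis sets.Un)
  show "emeasure (hausdorff_measure DIM('b)) (\<iota> ` B) = emeasure lebesgue B"
    unfolding emeasure_hausdorff[OF m]
    using hausdorff_isometric_image_le[OF iso B] outer_lebesgue_le_hausdorff[OF iso, of B] B
    by (simp add: antisym)
qed

lemma AE_hausdorff_isometry:
  fixes \<iota> :: "'b::euclidean_space \<Rightarrow> 'a::metric_space"
  assumes iso: "\<And>x y. dist (\<iota> x) (\<iota> y) = dist x y"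
    and ae: "AE z in hausdorff_measure DIM('b). z \<in> range \<iota> \<longrightarrow> P z"
  shows "AE w in lebesgue. P (\<iota> w)"
proof -
  obtain N where N: "{z. \<not> (z \<in> range \<iota> \<longrightarrow> P z)} \<subseteq> N" "N \<in> null_sets (hausdorff_measure DIM('b))"
    using ae by (auto elim!: AE_E simp: null_sets_def)
  have "hausdorff_outer DIM('b) N = 0" using N(2) emeasure_hausdorff[of N "DIM('b)"] by (simp add: null_sets_def)
  then have "hausdorff_outer DIM('b) (\<iota> ` (\<iota> -` N)) = 0"
    using hausdorff_outer_mono[of "\<iota> ` (\<iota> -` N)" N "DIM('b)"] by (auto simp: image_vimage_subset)
  then have "outer_measure_of lebesgue (\<iota> -` N) = 0"
    using outer_lebesgue_le_hausdorff[OF iso, of "\<iota> -` N"] by simp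
  moreover obtain E where E: "E \<in> sets lebesgue" "\<iota> -` N \<subseteq> E" "outer_measure_of lebesgue (\<iota> -` N) = emeasure lebesgue E"
    using outer_measure_of_attain[of "\<iota> -` N" lebesgue] by auto
  ultimately have "E \<in> null_sets lebesgue" by (simp add: null_sets_def)
  then show ?thesis by (rule AE_I') (use N(1) E(2) in auto)
qed

text \<open>The map \<open>\<iota>\<close> need not be onto, and \<open>f\<close> may fail to be measurable for the Hausdorff measure outside
  the range. The integral is therefore compared with that of the image measure of \<open>lebesgue\<close>, which is
  a restriction of the Hausdorff measure to a smaller sigma-algebra on the range.\<close>

lemma set_integral_hausdorff_isometry:
  fixes \<iota> :: "'b::euclidean_space \<Rightarrow> 'a::metric_space" and f :: "'a \<Rightarrow> 'c::{banach, second_countable_topology}"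
  assumes iso: "\<And>x y. dist (\<iota> x) (\<iota> y) = dist x y"
    and f: "(\<lambda>w. f (\<iota> w)) \<in> borel_measurable lebesgue"
  shows "(LINT z:range \<iota>|hausdorff_measure DIM('b). f z) = (LINT w|lebesgue. f (\<iota> w))"
proof -
  let ?H = "hausdorff_measure DIM('b) :: 'a measure"
  let ?E = "embed_measure lebesgue \<iota>"
  have inj: "inj \<iota>" by (rule injI) (metis iso dist_eq_0_iff)
  have rng: "range \<iota> \<in> sets ?H" using hausdorff_isometric_image(1)[OF iso, of UNIV] by simp
  have fE: "f \<in> borel_measurable ?E"
  proof (rule measurableI)
    fix A :: "'c set" assume "A \<in> sets borel"
    then have "(\<lambda>w. f (\<iota> w)) -` A \<inter> space lebesgue \<in> sets lebesgue" using f by (rule measurable_sets[rotated])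
    moreover have "f -` A \<inter> space ?E = \<iota> ` ((\<lambda>w. f (\<iota> w)) -` A \<inter> space lebesgue)"
      by (auto simp: space_embed_measure)
    ultimately show "f -` A \<inter> space ?E \<in> sets ?E" by (simp add: in_sets_embed_measure)
  qed simp
  have "(LINT z:range \<iota>|?H. f z) = (LINT z|restrict_space ?H (range \<iota>). f z)"
    unfolding set_lebesgue_integral_def by (rule integral_restrict_space[symmetric]) (simp add: rng)
  also have "\<dots> = (LINT z|?E. f z)"
  proof (rule integral_subalgebra[symmetric, OF fE])
    show "space ?E = space (restrict_space ?H (range \<iota>))" by (simp add: space_restrict_space space_embed_measure)
    have *: "A \<in> sets ?H \<and> A \<subseteq> range \<iota> \<and> emeasure ?E A = emeasure ?H A" if A: "A \<in> sets ?E" for A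
    proof -
      obtain B where B: "B \<in> sets lebesgue" "A = \<iota> ` B" using A by (auto simp: sets_embed_measure[OF inj])
      then show ?thesis
        using hausdorff_isometric_image[OF iso B(1)] emeasure_embed_measure_image[OF inj B(1)] by auto
    qed
    then show "sets ?E \<subseteq> sets (restrict_space ?H (range \<iota>))"
      by (auto simp: sets_restrict_space_iff rng)
    show "emeasure ?E A = emeasure (restrict_space ?H (range \<iota>)) A" if "A \<in> sets ?E" for A
      using *[OF that] by (subst emeasure_restrict_space) (auto simp: rng)
  qed
  also have "\<dots> = (LINT z|distr lebesgue ?E \<iota>. f z)"
    by (rule arg_cong[where f = "\<lambda>M. integral\<^sup>L M f"], rule embed_measure_eq_distr[OF inj])
  also have "\<dots> = (LINT w|lebesgue. f (\<iota> w))"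
    using measurable_embed_measure2[OF inj, of lebesgue] fE by (rule integral_distr)
  finally show ?thesis .
qed

section \<open>Orthonormal frames of a hyperplane and its normal\<close>

text \<open>An index type with one element less than \<open>'n\<close>, so that \<open>real^'n punctured\<close> can parametrise the
  hyperplanes of \<open>real^'n\<close>. Types are nonempty, hence the exception for one-element types.\<close>

typedef ('n::finite) punctured = "{i::'n. i \<noteq> undefined \<or> CARD('n) = 1}"
proof (cases "CARD('n) = 1")
  case False
  have "\<exists>i::'n. i \<noteq> undefined"
  proof (rule ccontr)
    assume "\<not> (\<exists>i::'n. i \<noteq> undefined)"
    then have "UNIV = {undefined :: 'n}" by auto
    then have "CARD('n) = card {undefined :: 'n}" by (rule arg_cong)
    with False show False by simp
  qed
  then show ?thesis by auto
qed auto

instance punctured :: (finite) finite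
proof
  have "UNIV = range (Abs_punctured :: 'a \<Rightarrow> 'a punctured)"
    by (metis Rep_punctured_inverse surj_def)
  then show "finite (UNIV :: 'a punctured set)"
    by (rule finite_subset[OF equalityD1 finite_imageI[OF finite]])
qed

lemma range_Rep_punctured:
  assumes "CARD('n::finite) \<ge> 2"
  shows "range (Rep_punctured :: 'n punctured \<Rightarrow> 'n) = UNIV - {undefined}"
proof -
  have "CARD('n) \<noteq> 1" using assms by linarith
  then have "{i::'n. i \<noteq> undefined \<or> CARD('n) = 1} = UNIV - {undefined}" by blast
  then show ?thesis using type_definition.Rep_range[OF type_definition_punctured] by (rule trans[rotated])
qed

lemma inj_Rep_punctured: "inj Rep_punctured"
  by (rule injI) (simp add: Rep_punctured_inject)

lemma card_punctured:
  assumes "CARD('n::finite) \<ge> 2" shows "CARD('n punctured) = CARD('n) - 1"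
proof -
  have "card (range (Rep_punctured :: 'n punctured \<Rightarrow> 'n)) = CARD('n punctured)"
    by (rule card_image[OF inj_Rep_punctured])
  then show ?thesis by (simp only: range_Rep_punctured[OF assms] card_Diff_singleton UNIV_I)
qed

text \<open>Both measures can be read as the Hausdorff measure of top dimension, which an isometry preserves.\<close>

lemma distr_isometry:
  fixes f :: "'a::euclidean_space \<Rightarrow> 'b::euclidean_space"
  assumes iso: "\<And>x y. dist (f x) (f y) = dist x y" and surj: "surj f" and dim: "DIM('a) = DIM('b)"
  shows "distr lborel borel f = lborel"
proof (rule lborel_eqI[symmetric])
  have "continuous_on UNIV f" unfolding continuous_on_iff by (auto simp: iso)
  then have [measurable]: "f \<in> borel_measurable borel" by (rule borel_measurable_continuous_onI)
  fix l u :: 'b assume le: "\<And>b. b \<in> Basis \<Longrightarrow> l \<bullet> b \<le> u \<bullet> b"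
  have B: "f -` box l u \<in> sets borel" using measurable_sets[of f borel borel "box l u"] by simp
  have "emeasure lborel (f -` box l u) = emeasure lebesgue (f -` box l u)" using B by simp
  also have "\<dots> = emeasure (hausdorff_measure DIM('a)) (f ` (f -` box l u))"
    using B by (intro hausdorff_isometric_image(2)[OF iso, symmetric]) simp
  also have "f ` (f -` box l u) = (\<lambda>x. x) ` box l u" using surj by (simp add: surj_image_vimage_eq)
  also have "emeasure (hausdorff_measure DIM('a)) \<dots> = emeasure lebesgue (box l u)"
    unfolding dim by (rule hausdorff_isometric_image(2)) auto
  finally show "emeasure (distr lborel borel f) (box l u) = ennreal (\<Prod>b\<in>Basis. (u - l) \<bullet> b)"
    using le by (simp add: emeasure_distr)
qed simp

text \<open>The last conjunct records that \<open>(w, t) \<mapsto> \<iota> w + t e\<close> preserves Lebesgue measure, the form in which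
  Fubini's theorem is applied below.\<close>

definition is_frame :: "real^'n::finite \<Rightarrow> (real^'n punctured \<Rightarrow> real^'n) \<Rightarrow> bool" where
  "is_frame e \<iota> \<longleftrightarrow> norm e = 1 \<and> linear \<iota> \<and> (\<forall>w. norm (\<iota> w) = norm w) \<and> (\<forall>w. \<iota> w \<bullet> e = 0) \<and>
     range \<iota> = hyperplane e \<and> distr lborel borel (\<lambda>(w, t). \<iota> w + t *\<^sub>R e) = lborel"

lemma exists_frame:
  fixes e :: "real^'n::finite"
  assumes c: "CARD('n) \<ge> 2" and e: "norm e = 1"
  shows "\<exists>\<iota>. is_frame e \<iota>"
proof -
  have e0: "e \<noteq> 0" using e by auto
  have H: "hyperplane e = {x. e \<bullet> x = 0}" by (auto simp: hyperplane_def inner_commute)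
  have "dim (UNIV :: (real^'n punctured) set) = dim (hyperplane e)"
    unfolding H dim_hyperplane[OF e0] using card_punctured[OF c] by (simp add: dim_UNIV)
  then obtain \<iota> :: "real^'n punctured \<Rightarrow> real^'n" where \<iota>: "linear \<iota>" "\<iota> ` UNIV = hyperplane e" "\<And>x. norm (\<iota> x) = norm x"
    using isometry_subspaces[of "UNIV :: (real^'n punctured) set" "hyperplane e"] subspace_hyperplane[of e]
    unfolding H by auto
  let ?T = "\<lambda>(w, t). \<iota> w + t *\<^sub>R e"
  have ie: "\<iota> w \<bullet> e = 0" for w using \<iota>(2) by (auto simp: hyperplane_def)
  have "distr lborel borel ?T = lborel"
  proof (rule distr_isometry)
    fix x y :: "(real^'n punctured) \<times> real"
    have "?T x - ?T y = \<iota> (fst x - fst y) + (snd x - snd y) *\<^sub>R e"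
      using \<iota>(1) by (simp add: split_beta linear_diff scaleR_diff_left)
    then have "(norm (?T x - ?T y))\<^sup>2 = (norm (fst x - fst y))\<^sup>2 + (snd x - snd y)\<^sup>2"
      using norm_add_Pythagorean[of "\<iota> (fst x - fst y)" "(snd x - snd y) *\<^sub>R e"] ie \<iota>(3) e
      by (simp add: orthogonal_def)
    then have "sqrt ((norm (fst x - fst y))\<^sup>2 + (snd x - snd y)\<^sup>2) = norm (?T x - ?T y)"
      by (intro real_sqrt_unique) auto
    then show "dist (?T x) (?T y) = dist x y"
      by (simp only: dist_norm norm_prod_def fst_diff snd_diff real_norm_def power2_abs)
  next
    show "surj ?T"
    proof (rule surjI)
      fix z :: "real^'n"
      have "z - (z \<bullet> e) *\<^sub>R e \<in> range \<iota>"
        unfolding \<iota>(2) using e by (simp add: hyperplane_def inner_diff_left norm_eq_1)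
      then have "\<iota> (inv \<iota> (z - (z \<bullet> e) *\<^sub>R e)) = z - (z \<bullet> e) *\<^sub>R e" by (rule f_inv_into_f)
      then show "?T (inv \<iota> (z - (z \<bullet> e) *\<^sub>R e), z \<bullet> e) = z" by simp
    qed
    show "DIM((real^'n punctured) \<times> real) = DIM(real^'n)" using card_punctured[OF c] c by simp
  qed
  then show ?thesis using e \<iota> ie unfolding is_frame_def by blast
qed

text \<open>Dyadic shells: on the shell of radius \<open>2\<^sup>k\<close> the integrand is at most \<open>2\<^sup>-\<^sup>k\<^sup>p\<close> and the volume of order \<open>2\<^sup>k\<^sup>D\<close>.\<close>

lemma nn_integral_powr_tail_finite:
  assumes p: "real DIM('a::euclidean_space) < p"
  shows "(\<integral>\<^sup>+(x::'a). ennreal (norm x powr - p) * indicator {x. 1 \<le> norm x} x \<partial>lborel) < \<infinity>"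
proof -
  define D where "D = DIM('a)"
  define q where "q = 2 powr (real D - p)"
  have q: "0 < q" "q < 1" using p by (auto simp: q_def D_def powr_less_one)
  define F where "F k x = ennreal ((2 ^ k) powr - p) * indicator (ball (0::'a) (2 ^ Suc k)) x" for k x
  have F [measurable]: "F k \<in> borel_measurable borel" for k
    unfolding F_def by (intro borel_measurable_times_ennreal borel_measurable_indicator borel_measurable_const) simp
  have "(\<integral>\<^sup>+(x::'a). ennreal (norm x powr - p) * indicator {x. 1 \<le> norm x} x \<partial>lborel) \<le>
    (\<integral>\<^sup>+(x::'a). (\<Sum>k. F k x) \<partial>lborel)"
  proof (rule nn_integral_mono)
    fix x :: 'a
    show "ennreal (norm x powr - p) * indicator {x. 1 \<le> norm x} x \<le> (\<Sum>k. F k x)"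
    proof (cases "1 \<le> norm x")
      case True
      define k where "k = (LEAST k. norm x < 2 ^ Suc k)"
      obtain k0 where "norm x < 2 ^ k0" using real_arch_pow[of 2 "norm x"] by auto
      then have "norm x < 2 ^ Suc k0" using zero_less_power[of "2::real" k0] unfolding power_Suc by linarith
      then have k1: "norm x < 2 ^ Suc k" unfolding k_def by (rule LeastI)
      have k2: "2 ^ k \<le> norm x"
      proof (cases k)
        case (Suc j)
        then have "\<not> norm x < 2 ^ Suc j" using not_less_Least[of j "\<lambda>k. norm x < 2 ^ Suc k"] by (simp add: k_def)
        then show ?thesis using Suc by simp
      qed (use True in simp)
      have "ennreal (norm x powr - p) * indicator {x. 1 \<le> norm x} x \<le> F k x"
        using k1 k2 p True by (auto intro!: ennreal_leI powr_mono2' simp: F_def)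
      also have "\<dots> = (\<Sum>k\<in>{k}. F k x)" by simp
      also have "\<dots> \<le> (\<Sum>k. F k x)" by (rule sum_le_suminf) auto
      finally show ?thesis .
    qed simp
  qed
  also have "\<dots> = (\<Sum>k. \<integral>\<^sup>+x. F k x \<partial>lborel)" by (rule nn_integral_suminf) simp
  also have "\<dots> = (\<Sum>k. ennreal ((2 ^ k) powr - p) * emeasure lborel (ball (0::'a) (2 ^ Suc k)))"
    unfolding F_def by (intro suminf_cong nn_integral_cmult_indicator) simp
  also have "\<dots> = (\<Sum>k. ennreal ((unit_ball_vol (real D) * 2 ^ D) * q ^ k))"
  proof (rule suminf_cong)
    fix k
    have eq: "(2 ^ k) powr - p * (unit_ball_vol (real D) * (2 ^ Suc k) ^ D) = (unit_ball_vol (real D) * 2 ^ D) * q ^ k"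
    proof -
      have 1: "(2 ^ k) powr - p = 2 powr (- (p * real k))"
        by (simp only: powr_realpow[OF zero_less_numeral, symmetric] powr_powr) (simp add: mult.commute)
      have 2: "q ^ k = 2 powr ((real D - p) * real k)"
        by (simp only: powr_realpow[OF q(1), symmetric]) (simp only: q_def powr_powr)
      have "((2::real) ^ k) ^ D = 2 powr (real D * real k)"
        using powr_realpow[of "2::real" "k * D"] by (simp add: power_mult[symmetric] mult.commute)
      then have 3: "((2::real) ^ Suc k) ^ D = 2 ^ D * 2 powr (real D * real k)"
        by (simp only: power_Suc power_mult_distrib)
      have 4: "2 powr (- (p * real k)) * 2 powr (real D * real k) = 2 powr ((real D - p) * real k)"
        unfolding powr_add[symmetric] by (simp add: algebra_simps)
      show ?thesis unfolding 1 2 3 4[symmetric] by (simp only: mult_ac)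
    qed
    then show "ennreal ((2 ^ k) powr - p) * emeasure lborel (ball (0::'a) (2 ^ Suc k)) = ennreal ((unit_ball_vol (real D) * 2 ^ D) * q ^ k)"
      unfolding D_def[symmetric] eq[symmetric]
      by (subst emeasure_ball) (simp_all add: ennreal_mult[symmetric] D_def del: power_Suc)
  qed
  also have "\<dots> < \<infinity>"
  proof -
    have "summable (\<lambda>k. (unit_ball_vol (real D) * 2 ^ D) * q ^ k)"
      using q by (intro summable_mult summable_geometric) auto
    then have "(\<Sum>k. ennreal ((unit_ball_vol (real D) * 2 ^ D) * q ^ k)) \<noteq> top"
      by (rule ennreal_suminf_neq_top) (use q in simp)
    then show ?thesis unfolding infinity_ennreal_def by (rule less_top[THEN iffD1])
  qed
  finally show ?thesis .
qed

lemma frame_inner: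
  assumes "is_frame e \<iota>" shows "\<iota> v \<bullet> \<iota> w = v \<bullet> w"
proof -
  have n: "norm (\<iota> x) = norm x" for x using assms by (simp add: is_frame_def)
  have "\<iota> (v + w) = \<iota> v + \<iota> w" using assms by (simp add: is_frame_def linear_add)
  then have "(\<iota> v + \<iota> w) \<bullet> (\<iota> v + \<iota> w) = (v + w) \<bullet> (v + w)" using n[of "v + w"] by (simp add: dot_square_norm)
  moreover have "\<iota> v \<bullet> \<iota> v = v \<bullet> v" "\<iota> w \<bullet> \<iota> w = w \<bullet> w" using n by (simp_all add: dot_square_norm)
  ultimately show ?thesis by (simp add: inner_add_left inner_add_right inner_commute)
qed

lemma frame_norm:
  assumes "is_frame e \<iota>" shows "(norm (\<iota> w + t *\<^sub>R e))\<^sup>2 = (norm w)\<^sup>2 + t\<^sup>2"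
  using norm_add_Pythagorean[of "\<iota> w" "t *\<^sub>R e"] assms by (simp add: is_frame_def orthogonal_def)

lemma frame_height:
  assumes "is_frame e \<iota>" shows "(\<iota> w + t *\<^sub>R e) \<bullet> e = t"
  using assms by (simp add: is_frame_def inner_add_left norm_eq_1)

lemma frame_measurable:
  assumes "is_frame e \<iota>"
  shows "\<iota> \<in> borel_measurable borel" "(\<lambda>(w, t). \<iota> w + t *\<^sub>R e) \<in> borel_measurable (borel \<Otimes>\<^sub>M borel)"
proof -
  have "linear \<iota>" using assms by (simp add: is_frame_def)
  then show [measurable]: "\<iota> \<in> borel_measurable borel"
    by (intro borel_measurable_continuous_onI linear_continuous_on) (simp add: linear_conv_bounded_linear)
  show "(\<lambda>(w, t). \<iota> w + t *\<^sub>R e) \<in> borel_measurable (borel \<Otimes>\<^sub>M borel)" by measurable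
qed

lemma nn_integral_frame:
  fixes f :: "real^'n::finite \<Rightarrow> ennreal"
  assumes fr: "is_frame e \<iota>" and f [measurable]: "f \<in> borel_measurable borel"
  shows "(\<integral>\<^sup>+z. f z \<partial>lborel) = (\<integral>\<^sup>+w. (\<integral>\<^sup>+t. f (\<iota> w + t *\<^sub>R e) \<partial>lborel) \<partial>lborel)"
proof -
  have [measurable]: "(\<lambda>(w, t). \<iota> w + t *\<^sub>R e) \<in> borel_measurable (borel \<Otimes>\<^sub>M borel)"
    by (rule frame_measurable(2)[OF fr])
  have "(\<integral>\<^sup>+z. f z \<partial>lborel) = (\<integral>\<^sup>+z. f z \<partial>distr lborel borel (\<lambda>(w, t). \<iota> w + t *\<^sub>R e))"
    using fr by (simp add: is_frame_def)
  also have "\<dots> = (\<integral>\<^sup>+p. f (case p of (w, t) \<Rightarrow> \<iota> w + t *\<^sub>R e) \<partial>(lborel \<Otimes>\<^sub>M lborel))"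
    unfolding lborel_prod by (rule nn_integral_distr) (simp_all flip: borel_prod)
  also have "\<dots> = (\<integral>\<^sup>+w. (\<integral>\<^sup>+t. f (\<iota> w + t *\<^sub>R e) \<partial>lborel) \<partial>lborel)"
    by (subst lborel.nn_integral_fst[symmetric]) simp_all
  finally show ?thesis .
qed

lemma integrable_frame_iff:
  fixes f :: "real^'n::finite \<Rightarrow> real"
  assumes fr: "is_frame e \<iota>" and f [measurable]: "f \<in> borel_measurable borel"
  shows "integrable lborel f \<longleftrightarrow> integrable (lborel \<Otimes>\<^sub>M lborel) (\<lambda>(w, t). f (\<iota> w + t *\<^sub>R e))"
proof -
  have [measurable]: "(\<lambda>(w, t). \<iota> w + t *\<^sub>R e) \<in> borel_measurable (borel \<Otimes>\<^sub>M borel)"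
    by (rule frame_measurable(2)[OF fr])
  have "integrable lborel f \<longleftrightarrow> integrable (distr lborel borel (\<lambda>(w, t). \<iota> w + t *\<^sub>R e)) f"
    using fr by (simp add: is_frame_def)
  also have "\<dots> \<longleftrightarrow> integrable (lborel \<Otimes>\<^sub>M lborel) (\<lambda>p. f (case p of (w, t) \<Rightarrow> \<iota> w + t *\<^sub>R e))"
    unfolding lborel_prod by (rule integrable_distr_eq) (simp_all flip: borel_prod)
  also have "(\<lambda>p. f (case p of (w, t) \<Rightarrow> \<iota> w + t *\<^sub>R e)) = (\<lambda>(w, t). f (\<iota> w + t *\<^sub>R e))" by auto
  finally show ?thesis .
qed

lemma integral_frame:
  fixes f :: "real^'n::finite \<Rightarrow> real"
  assumes fr: "is_frame e \<iota>" and f: "integrable lborel f"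
  shows "AE w in lborel. integrable lborel (\<lambda>t. f (\<iota> w + t *\<^sub>R e))"
    and "integrable lborel (\<lambda>w. LINT t|lborel. f (\<iota> w + t *\<^sub>R e))"
    and "(LINT z|lborel. f z) = (LINT w|lborel. LINT t|lborel. f (\<iota> w + t *\<^sub>R e))"
proof -
  have [measurable]: "(\<lambda>(w, t). \<iota> w + t *\<^sub>R e) \<in> borel_measurable (borel \<Otimes>\<^sub>M borel)"
    by (rule frame_measurable(2)[OF fr])
  have fb [measurable]: "f \<in> borel_measurable borel" using f by simp
  have int: "integrable (lborel \<Otimes>\<^sub>M lborel) (\<lambda>(w, t). f (\<iota> w + t *\<^sub>R e))"
    using f integrable_frame_iff[OF fr fb] by simp
  show "AE w in lborel. integrable lborel (\<lambda>t. f (\<iota> w + t *\<^sub>R e))"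
    by (rule lborel_pair.AE_integrable_fst'[OF int, unfolded prod.case])
  show "integrable lborel (\<lambda>w. LINT t|lborel. f (\<iota> w + t *\<^sub>R e))"
    using lborel_pair.integrable_fst'[OF int] by simp
  have "(LINT z|lborel. f z) = (LINT z|distr lborel borel (\<lambda>(w, t). \<iota> w + t *\<^sub>R e). f z)"
    using fr by (simp add: is_frame_def)
  also have "\<dots> = (LINT p|(lborel \<Otimes>\<^sub>M lborel). f (case p of (w, t) \<Rightarrow> \<iota> w + t *\<^sub>R e))"
    unfolding lborel_prod by (rule integral_distr) (simp_all flip: borel_prod)
  also have "\<dots> = (LINT p|(lborel \<Otimes>\<^sub>M lborel). (case p of (w, t) \<Rightarrow> f (\<iota> w + t *\<^sub>R e)))"
    by (rule Bochner_Integration.integral_cong) auto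
  also have "\<dots> = (LINT w|lborel. LINT t|lborel. f (\<iota> w + t *\<^sub>R e))"
    using lborel_pair.integral_fst'[OF int] by simp
  finally show "(LINT z|lborel. f z) = (LINT w|lborel. LINT t|lborel. f (\<iota> w + t *\<^sub>R e))" .
qed

lemma AE_frame:
  fixes P :: "real^'n::finite \<Rightarrow> bool"
  assumes fr: "is_frame e \<iota>" and P: "AE z in lborel. P z"
  shows "AE w in lborel. AE t in lborel. P (\<iota> w + t *\<^sub>R e)"
proof -
  obtain N where N: "{z. \<not> P z} \<subseteq> N" "emeasure lborel N = 0" "N \<in> sets borel"
    using P by (auto elim!: AE_E)
  have [measurable]: "(\<lambda>(w, t). \<iota> w + t *\<^sub>R e) \<in> borel_measurable (borel \<Otimes>\<^sub>M borel)" "\<iota> \<in> borel_measurable borel" "N \<in> sets borel"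
    using frame_measurable[OF fr] N(3) by auto
  have "(\<integral>\<^sup>+w. (\<integral>\<^sup>+t. indicator N (\<iota> w + t *\<^sub>R e) \<partial>lborel) \<partial>lborel) = 0"
    using N(2) by (subst nn_integral_frame[OF fr, symmetric]) simp_all
  then have "AE w in lborel. (\<integral>\<^sup>+t. indicator N (\<iota> w + t *\<^sub>R e) \<partial>lborel) = 0"
    by (subst (asm) nn_integral_0_iff_AE) auto
  then show ?thesis
  proof eventually_elim
    case (elim w)
    then have "AE t in lborel. (indicator N (\<iota> w + t *\<^sub>R e) :: ennreal) = 0"
      by (subst (asm) nn_integral_0_iff_AE) auto
    then show ?case
      by eventually_elim (use N(1) in \<open>auto simp: indicator_def split: if_splits\<close>)
  qed
qed

text \<open>The slab is contained in a box of side \<open>2 r\<close> times an interval of length \<open>2 a\<close>.\<close>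

lemma slab_volume:
  fixes e :: "real^'n::finite"
  assumes c: "CARD('n) \<ge> 2" and e: "norm e = 1" and a: "0 \<le> a" and r: "0 \<le> r"
  shows "emeasure lborel {z. \<bar>z \<bullet> e\<bar> \<le> a \<and> norm z \<le> r} \<le> ennreal (2 * a * (2 * r) ^ (CARD('n) - 1))"
proof -
  obtain \<iota> where fr: "is_frame e \<iota>" using exists_frame[OF c e] by blast
  have "emeasure lborel {z. \<bar>z \<bullet> e\<bar> \<le> a \<and> norm z \<le> r} = (\<integral>\<^sup>+z. indicator {z. \<bar>z \<bullet> e\<bar> \<le> a \<and> norm z \<le> r} z \<partial>lborel)"
    by (rule nn_integral_indicator[symmetric]) simp
  also have "\<dots> = (\<integral>\<^sup>+w. (\<integral>\<^sup>+t. indicator {z. \<bar>z \<bullet> e\<bar> \<le> a \<and> norm z \<le> r} (\<iota> w + t *\<^sub>R e) \<partial>lborel) \<partial>lborel)"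
    by (rule nn_integral_frame[OF fr]) simp
  also have "\<dots> \<le> (\<integral>\<^sup>+(w::real^'n punctured). (\<integral>\<^sup>+t. indicator (cbox (- r *\<^sub>R One) (r *\<^sub>R One)) w * indicator {-a..a} t \<partial>lborel) \<partial>lborel)"
  proof (intro nn_integral_mono)
    fix w :: "real^'n punctured" and t :: real
    have "w \<in> cbox (- r *\<^sub>R One) (r *\<^sub>R One)" if n: "norm (\<iota> w + t *\<^sub>R e) \<le> r"
    proof -
      have "(norm w)\<^sup>2 \<le> (norm (\<iota> w + t *\<^sub>R e))\<^sup>2" unfolding frame_norm[OF fr] by simp
      then have "norm w \<le> r" using n by (meson abs_le_square_iff norm_ge_zero order.trans power2_le_imp_le)
      then have "\<bar>w \<bullet> b\<bar> \<le> r" if "b \<in> Basis" for b using Basis_le_norm[OF that, of w] by linarith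
      then show ?thesis by (force simp: mem_box abs_le_iff)
    qed
    then show "indicator {z. \<bar>z \<bullet> e\<bar> \<le> a \<and> norm z \<le> r} (\<iota> w + t *\<^sub>R e)
       \<le> (indicator (cbox (- r *\<^sub>R One) (r *\<^sub>R One)) w * indicator {-a..a} t :: ennreal)"
      using frame_height[OF fr, of w t] by (auto simp: indicator_def abs_le_iff)
  qed
  also have "\<dots> = emeasure lborel (cbox (- r *\<^sub>R One) (r *\<^sub>R One :: real^'n punctured)) * ennreal (2 * a)"
    using a by (simp add: nn_integral_cmult nn_integral_multc)
  also have "emeasure lborel (cbox (- r *\<^sub>R One) (r *\<^sub>R One :: real^'n punctured)) = ennreal ((2 * r) ^ (CARD('n) - 1))"
  proof -
    have side: "(r *\<^sub>R One - - r *\<^sub>R One) \<bullet> b = 2 * r" if "b \<in> Basis" for b :: "real^'n punctured"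
    proof -
      have "(One :: real^'n punctured) \<bullet> b = 1" using that by simp
      then show ?thesis by (simp only: inner_diff_left inner_scaleR_left)
    qed
    have "(\<Prod>b\<in>(Basis :: (real^'n punctured) set). (r *\<^sub>R One - - r *\<^sub>R One) \<bullet> b) = (\<Prod>b\<in>(Basis :: (real^'n punctured) set). 2 * r)"
    proof (rule prod.cong[OF refl])
      fix b :: "real^'n punctured" assume "b \<in> Basis"
      then show "(r *\<^sub>R One - - r *\<^sub>R One) \<bullet> b = 2 * r" by (rule side)
    qed
    also have "\<dots> = (2 * r) ^ (CARD('n) - 1)" by (simp add: card_punctured[OF c])
    finally have "ennreal (\<Prod>b\<in>Basis. (r *\<^sub>R One - - r *\<^sub>R One) \<bullet> (b :: real^'n punctured)) = ennreal ((2 * r) ^ (CARD('n) - 1))"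
      by (rule arg_cong)
    moreover have "emeasure lborel (cbox (- r *\<^sub>R One) (r *\<^sub>R One :: real^'n punctured)) = ennreal (\<Prod>b\<in>Basis. (r *\<^sub>R One - - r *\<^sub>R One) \<bullet> (b :: real^'n punctured))"
      by (rule emeasure_lborel_cbox) (use r in simp)
    ultimately show ?thesis by simp
  qed
  finally show ?thesis using a r by (simp add: ennreal_mult[symmetric] mult.commute)
qed

section \<open>Smooth step functions\<close>

text \<open>The one-dimensional counterpart of \<open>C_k\<close>.\<close>

primrec C_real :: "nat \<Rightarrow> (real \<Rightarrow> real) \<Rightarrow> bool" where
  "C_real 0 f \<longleftrightarrow> continuous_on UNIV f"
| "C_real (Suc k) f \<longleftrightarrow> (\<exists>f'. (\<forall>x. (f has_real_derivative f' x) (at x)) \<and> C_real k f')"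

lemma C_real_SucI:
  "(\<And>x. (f has_real_derivative f' x) (at x)) \<Longrightarrow> C_real k f' \<Longrightarrow> C_real (Suc k) f"
  by auto

lemma C_real_Suc_imp: "C_real (Suc k) f \<Longrightarrow> C_real k f"
proof (induction k arbitrary: f)
  case 0
  then obtain f' where "\<And>x. (f has_real_derivative f' x) (at x)" by auto
  then have "isCont f x" for x by (rule DERIV_isCont)
  then show ?case by (simp add: continuous_at_imp_continuous_on)
next
  case (Suc k)
  then obtain f' where f': "\<And>x. (f has_real_derivative f' x) (at x)" "C_real (Suc k) f'"
    unfolding C_real.simps(2)[of "Suc k"] by blast
  show ?case by (rule C_real_SucI[OF f'(1) Suc.IH[OF f'(2)]])
qed

lemma C_real_const: "C_real k (\<lambda>x. c)"
proof (induction k arbitrary: c)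
  case (Suc k)
  have "((\<lambda>x. c) has_real_derivative 0) (at x)" for x by simp
  then show ?case using Suc[of 0] by (rule C_real_SucI)
qed simp

lemma C_real_add: "C_real k f \<Longrightarrow> C_real k g \<Longrightarrow> C_real k (\<lambda>x. f x + g x)"
proof (induction k arbitrary: f g)
  case (Suc k)
  then obtain f' g' where "\<forall>x. (f has_real_derivative f' x) (at x)" "C_real k f'"
    "\<forall>x. (g has_real_derivative g' x) (at x)" "C_real k g'" by auto
  then show ?case by (intro C_real_SucI[of _ "\<lambda>x. f' x + g' x"] DERIV_add Suc.IH) auto
qed (auto intro: continuous_intros)

lemma C_real_mult: "C_real k f \<Longrightarrow> C_real k g \<Longrightarrow> C_real k (\<lambda>x. f x * g x)"
proof (induction k arbitrary: f g)
  case (Suc k)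
  then obtain f' g' where *: "\<forall>x. (f has_real_derivative f' x) (at x)" "C_real k f'"
    "\<forall>x. (g has_real_derivative g' x) (at x)" "C_real k g'" by auto
  have "C_real k (\<lambda>x. f' x * g x + g' x * f x)"
    using * Suc.prems[THEN C_real_Suc_imp] by (intro C_real_add Suc.IH)
  then show ?case using * by (intro C_real_SucI[of _ "\<lambda>x. f' x * g x + g' x * f x"] DERIV_mult) auto
qed (auto intro: continuous_intros)

lemma C_real_compose_affine: "C_real k f \<Longrightarrow> C_real k (\<lambda>x. f (a * x + b))"
proof (induction k arbitrary: f)
  case (Suc k)
  then obtain f' where *: "\<forall>x. (f has_real_derivative f' x) (at x)" "C_real k f'" by auto
  have "((\<lambda>x. f (a * x + b)) has_real_derivative f' (a * x + b) * a) (at x)" for x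
    using *(1) by (intro DERIV_chain2[where f = f]) (auto intro!: derivative_eq_intros)
  moreover have "C_real k (\<lambda>x. f' (a * x + b) * a)" using * by (intro C_real_mult C_real_const Suc.IH)
  ultimately show ?case by (rule C_real_SucI)
next
  case 0
  then show ?case by (auto intro!: continuous_intros intro: continuous_on_compose2[of UNIV f])
qed

lemma C_real_inverse: "C_real k f \<Longrightarrow> (\<And>x. f x \<noteq> 0) \<Longrightarrow> C_real k (\<lambda>x. inverse (f x))"
proof (induction k arbitrary: f)
  case (Suc k)
  then obtain f' where *: "\<forall>x. (f has_real_derivative f' x) (at x)" "C_real k f'" by auto
  have "((\<lambda>x. inverse (f x)) has_real_derivative (- 1) * (f' x * (inverse (f x) * inverse (f x)))) (at x)" for x
    using DERIV_inverse_fun[of f "f' x" x] * Suc.prems by (simp add: power2_eq_square mult_ac)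
  moreover have "C_real k (\<lambda>x. (- 1) * (f' x * (inverse (f x) * inverse (f x))))"
    using * Suc.prems(2) C_real_Suc_imp[OF Suc.prems(1)] by (intro C_real_mult C_real_const Suc.IH)
  ultimately show ?case by (rule C_real_SucI)
qed (auto intro!: continuous_intros)

text \<open>With \<open>p = 1\<close> the classical function \<open>exp (- 1 / x)\<close> that vanishes to infinite order at 0. The
  polynomial factor makes the class closed under differentiation.\<close>

definition flat :: "real poly \<Rightarrow> real \<Rightarrow> real" where
  "flat p x = (if 0 < x then poly p (1 / x) * exp (- (1 / x)) else 0)"

lemma poly_times_exp_tendsto_0: "((\<lambda>u::real. poly p u * exp (- u)) \<longlongrightarrow> 0) at_top"
proof -
  have "((\<lambda>u::real. \<Sum>i\<le>degree p. coeff p i * (u ^ i / exp u)) \<longlongrightarrow> (\<Sum>i\<le>degree p. coeff p i * 0)) at_top"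
    by (intro tendsto_sum tendsto_mult tendsto_const tendsto_power_div_exp_0)
  moreover have "(\<lambda>u. poly p u * exp (- u)) = (\<lambda>u. \<Sum>i\<le>degree p. coeff p i * (u ^ i / exp u))"
    by (simp add: poly_altdef sum_distrib_left exp_minus divide_inverse mult_ac)
  ultimately show ?thesis by simp
qed

lemma flat_has_derivative:
  "(flat p has_real_derivative flat ([:0, 0, 1:] * (p - pderiv p)) x) (at x)"
proof -
  consider "0 < x" | "x < 0" | "x = 0" by linarith
  then show ?thesis
  proof cases
    case 1
    have "((\<lambda>x. poly p (1 / x) * exp (- (1 / x))) has_real_derivative flat ([:0, 0, 1:] * (p - pderiv p)) x) (at x)"
      using 1 by (auto intro!: derivative_eq_intros DERIV_chain2[OF poly_DERIV] simp: flat_def field_simps power2_eq_square)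
    moreover have "eventually (\<lambda>y. flat p y = poly p (1 / y) * exp (- (1 / y))) (nhds x)"
      using eventually_nhds_in_open[of "{0<..}" x] 1 by (auto elim!: eventually_mono simp: flat_def)
    ultimately show ?thesis by (subst DERIV_cong_ev[OF refl _ refl])
  next
    case 2
    have "eventually (\<lambda>y. flat p y = 0) (nhds x)"
      using eventually_nhds_in_open[of "{..<0}" x] 2 by (auto elim!: eventually_mono simp: flat_def)
    then show ?thesis using 2 by (subst DERIV_cong_ev[OF refl _ refl, of _ "\<lambda>_. 0"]) (auto simp: flat_def)
  next
    case 3
    have "((\<lambda>h. flat p h / h) \<longlongrightarrow> 0) (at_right 0)"
    proof -
      have "((\<lambda>h::real. poly ([:0, 1:] * p) (inverse h) * exp (- (inverse h))) \<longlongrightarrow> 0) (at_right 0)"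
        by (rule filterlim_compose[OF poly_times_exp_tendsto_0 filterlim_inverse_at_top_right])
      then show ?thesis
        by (rule Lim_transform_eventually)
           (auto simp: eventually_at_right_less flat_def field_simps intro!: eventually_mono[OF eventually_at_right_less])
    qed
    moreover have "((\<lambda>h. flat p h / h) \<longlongrightarrow> 0) (at_left 0)"
      by (rule Lim_transform_eventually[OF tendsto_const])
         (auto simp: flat_def eventually_at_left_field intro!: exI[of _ "-1"])
    ultimately have "((\<lambda>h. flat p h / h) \<longlongrightarrow> 0) (at 0)" by (simp add: filterlim_split_at)
    then show ?thesis using 3 by (simp add: DERIV_def flat_def)
  qed
qed

lemma C_real_flat: "C_real k (flat p)"
proof (induction k arbitrary: p)
  case 0
  show ?case using DERIV_isCont[OF flat_has_derivative] by (simp add: continuous_at_imp_continuous_on)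
next
  case (Suc k)
  show ?case by (rule C_real_SucI[OF flat_has_derivative Suc])
qed

definition smooth_step :: "real \<Rightarrow> real" where
  "smooth_step x = flat 1 x * inverse (flat 1 x + flat 1 (1 - x))"

lemma smooth_step_denominator: "0 < flat 1 x + flat 1 (1 - x)"
  by (auto simp: flat_def add_pos_nonneg)

lemma C_real_smooth_step: "C_real k smooth_step"
proof -
  have "C_real k (\<lambda>x. flat 1 (1 - x))" using C_real_compose_affine[OF C_real_flat, of k 1 "-1" 1] by simp
  then have "C_real k (\<lambda>x. flat 1 x * inverse (flat 1 x + flat 1 (1 - x)))"
    using smooth_step_denominator
    by (intro C_real_mult C_real_inverse C_real_add C_real_flat) (auto simp: less_imp_neq[symmetric])
  then show ?thesis by (simp add: smooth_step_def[abs_def])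
qed

lemma smooth_step_bounds: "0 \<le> smooth_step x" "smooth_step x \<le> 1"
proof -
  have "0 \<le> flat 1 x" "0 \<le> flat 1 (1 - x)" by (auto simp: flat_def)
  then show "0 \<le> smooth_step x" "smooth_step x \<le> 1"
    using smooth_step_denominator[of x] by (auto simp: smooth_step_def field_simps)
qed

lemma smooth_step_eq: "x \<le> 0 \<Longrightarrow> smooth_step x = 0" "1 \<le> x \<Longrightarrow> smooth_step x = 1"
  using smooth_step_denominator[of x] by (auto simp: smooth_step_def flat_def)

lemma C_k_Suc_imp: "C_k (Suc k) U f \<Longrightarrow> C_k k U f"
proof (induction k arbitrary: f)
  case 0
  then show ?case by (simp add: continuous_at_imp_continuous_on differentiable_imp_continuous_within)
next
  case (Suc k)
  then show ?case using Suc.IH unfolding C_k.simps(2)[of k U f] C_k.simps(2)[of "Suc k" U f] by blast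
qed

lemma partial_eq:
  assumes "(f has_derivative f') (at x)" shows "partial i f x = f' (axis i 1)"
  using frechet_derivative_at[OF assms] by (simp add: partial_def)

lemma C_k_add: "C_k k UNIV f \<Longrightarrow> C_k k UNIV g \<Longrightarrow> C_k k UNIV (\<lambda>x. f x + g x)"
proof (induction k arbitrary: f g)
  case (Suc k)
  have d: "(f has_derivative frechet_derivative f (at x)) (at x)" "(g has_derivative frechet_derivative g (at x)) (at x)" for x
    using Suc.prems by (auto simp: frechet_derivative_works)
  have "partial i (\<lambda>x. f x + g x) = (\<lambda>x. partial i f x + partial i g x)" for i
    using partial_eq[OF has_derivative_add[OF d(1) d(2)]] by (auto simp: partial_def)
  then show ?case using Suc by auto
qed (auto intro: continuous_intros)

lemma C_k_mult: "C_k k UNIV f \<Longrightarrow> C_k k UNIV g \<Longrightarrow> C_k k UNIV (\<lambda>x. f x * g x)"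
proof (induction k arbitrary: f g)
  case (Suc k)
  have d: "(f has_derivative frechet_derivative f (at x)) (at x)" "(g has_derivative frechet_derivative g (at x)) (at x)" for x
    using Suc.prems by (auto simp: frechet_derivative_works)
  have p: "partial i (\<lambda>x. f x * g x) = (\<lambda>x. f x * partial i g x + partial i f x * g x)" for i
    using partial_eq[OF has_derivative_mult[OF d(1) d(2)]] by (auto simp: partial_def)
  have "C_k k UNIV (\<lambda>x. f x * partial i g x + partial i f x * g x)" for i
    using Suc.prems[THEN C_k_Suc_imp] Suc.prems by (intro C_k_add Suc.IH) auto
  then show ?case using Suc.prems p by auto
qed (auto intro: continuous_intros)

lemma C_k_const: "C_k k UNIV (\<lambda>x :: real^'n::finite. c)"
proof (induction k arbitrary: c)
  case (Suc k)
  have "partial i (\<lambda>x :: real^'n. c) = (\<lambda>x. 0)" for i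
    using partial_eq[OF has_derivative_const] by auto
  then show ?case using Suc[of 0] by auto
qed simp

lemma C_k_prod: "finite A \<Longrightarrow> (\<And>j. j \<in> A \<Longrightarrow> C_k k UNIV (f j)) \<Longrightarrow> C_k k UNIV (\<lambda>x. \<Prod>j\<in>A. f j x)"
  by (induction A rule: finite_induct) (auto intro: C_k_const C_k_mult)

lemma C_k_compose_inner: "C_real k f \<Longrightarrow> C_k k UNIV (\<lambda>x. f (x \<bullet> v))"
proof (induction k arbitrary: f)
  case 0
  then show ?case by (auto intro!: continuous_intros intro: continuous_on_compose2[of UNIV f])
next
  case (Suc k)
  then obtain f' where *: "\<forall>x. (f has_real_derivative f' x) (at x)" "C_real k f'" by auto
  have d: "((\<lambda>x. f (x \<bullet> v)) has_derivative (\<lambda>h. f' (x \<bullet> v) * (h \<bullet> v))) (at x)" for x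
    by (rule has_derivative_compose[OF bounded_linear_imp_has_derivative[OF bounded_linear_inner_left]
          *(1)[rule_format, unfolded has_field_derivative_def]])
  have "partial i (\<lambda>x. f (x \<bullet> v)) = (\<lambda>x. f' (x \<bullet> v) * (axis i 1 \<bullet> v))" for i
    using partial_eq[OF d] by auto
  moreover have "C_k k UNIV (\<lambda>x. f' (x \<bullet> v) * (axis i 1 \<bullet> v))" for i
    using * by (intro C_k_mult C_k_const Suc.IH)
  ultimately show ?case using d by (auto simp: differentiable_def)
qed

section \<open>Second-order geometry of a level set\<close>

lemma has_derivative_along_line:
  fixes f :: "real^'n::finite \<Rightarrow> real"
  assumes "f differentiable (at (x + t *\<^sub>R h))"
  shows "((\<lambda>t. f (x + t *\<^sub>R h)) has_real_derivative (\<Sum>i\<in>UNIV. partial i f (x + t *\<^sub>R h) * h $ i)) (at t)"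
proof -
  let ?L = "frechet_derivative f (at (x + t *\<^sub>R h))"
  have L: "(f has_derivative ?L) (at (x + t *\<^sub>R h))" using assms by (simp add: frechet_derivative_works)
  then have lin: "linear ?L" by (rule has_derivative_linear)
  have "h = (\<Sum>i\<in>UNIV. h $ i *\<^sub>R axis i 1)" by (simp add: vec_eq_iff axis_def if_distrib cong: if_cong)
  then have "?L h = ?L (\<Sum>i\<in>UNIV. h $ i *\<^sub>R axis i 1)" by (rule arg_cong)
  also have "\<dots> = (\<Sum>i\<in>UNIV. partial i f (x + t *\<^sub>R h) * h $ i)"
    using lin by (simp add: linear_sum linear_scale partial_def mult.commute)
  finally have Lh: "?L h = (\<Sum>i\<in>UNIV. partial i f (x + t *\<^sub>R h) * h $ i)" .
  have "((\<lambda>t. x + t *\<^sub>R h) has_derivative (\<lambda>s. s *\<^sub>R h)) (at t)"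
    by (auto intro!: derivative_eq_intros)
  from has_derivative_compose[OF this L]
  have "((\<lambda>t. f (x + t *\<^sub>R h)) has_derivative (\<lambda>s. ?L (s *\<^sub>R h))) (at t)" .
  then show ?thesis
    unfolding has_field_derivative_def linear_scale[OF lin] Lh by (simp add: mult.commute[of _ "sum _ _"])
qed

text \<open>Lagrange's form of the remainder on the segment from \<open>x\<close> to \<open>x + h\<close>.\<close>

lemma taylor_second_order:
  fixes \<phi> :: "real^'n::finite \<Rightarrow> real"
  assumes C: "C_k 2 U \<phi>" and seg: "\<And>t. 0 \<le> t \<Longrightarrow> t \<le> 1 \<Longrightarrow> x + t *\<^sub>R h \<in> U"
  obtains t where "0 < t" "t < 1"
    "\<phi> (x + h) = \<phi> x + grad \<phi> x \<bullet> h + (h \<bullet> (hessian \<phi> (x + t *\<^sub>R h) *v h)) / 2"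
proof -
  have C': "\<forall>y\<in>U. \<phi> differentiable (at y)" "\<And>i y. y \<in> U \<Longrightarrow> partial i \<phi> differentiable (at y)"
    using C by (simp_all add: numeral_2_eq_2)
  define d where "d = (\<lambda>(m::nat) t. if m = 0 then \<phi> (x + t *\<^sub>R h) else if m = 1 then (\<Sum>i\<in>UNIV. partial i \<phi> (x + t *\<^sub>R h) * h $ i)
     else h \<bullet> (hessian \<phi> (x + t *\<^sub>R h) *v h))"
  have "\<exists>t>0. t < 1 \<and> \<phi> (x + 1 *\<^sub>R h) = (\<Sum>m<2. d m 0 / fact m * 1 ^ m) + d 2 t / fact 2 * 1 ^ 2"
  proof (rule Maclaurin)
    show "d 0 = (\<lambda>t. \<phi> (x + t *\<^sub>R h))" by (simp add: d_def)
    show "\<forall>m t. m < 2 \<and> 0 \<le> t \<and> t \<le> 1 \<longrightarrow> ((d m) has_real_derivative d (Suc m) t) (at t)"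
    proof (intro allI impI)
      fix m :: nat and t :: real assume mt: "m < 2 \<and> 0 \<le> t \<and> t \<le> 1"
      then have U: "x + t *\<^sub>R h \<in> U" using seg by simp
      consider "m = 0" | "m = 1" using mt by linarith
      then show "((d m) has_real_derivative d (Suc m) t) (at t)"
      proof cases
        case 1
        then show ?thesis using has_derivative_along_line[of \<phi> x t h] C'(1) U by (simp add: d_def)
      next
        case 2
        have "((\<lambda>t. \<Sum>i\<in>UNIV. partial i \<phi> (x + t *\<^sub>R h) * h $ i) has_real_derivative
           (\<Sum>i\<in>UNIV. (\<Sum>j\<in>UNIV. partial j (partial i \<phi>) (x + t *\<^sub>R h) * h $ j) * h $ i)) (at t)"
          by (intro DERIV_sum DERIV_cmult_right has_derivative_along_line C'(2) U)
        also have "(\<Sum>i\<in>UNIV. (\<Sum>j\<in>UNIV. partial j (partial i \<phi>) (x + t *\<^sub>R h) * h $ j) * h $ i) =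
            h \<bullet> (hessian \<phi> (x + t *\<^sub>R h) *v h)"
        proof -
          have "h \<bullet> (hessian \<phi> (x + t *\<^sub>R h) *v h) =
             (\<Sum>j\<in>UNIV. \<Sum>i\<in>UNIV. h $ j * (partial j (partial i \<phi>) (x + t *\<^sub>R h) * h $ i))"
            by (simp add: inner_vec_def matrix_vector_mult_def hessian_def sum_distrib_left)
          also have "\<dots> = (\<Sum>i\<in>UNIV. \<Sum>j\<in>UNIV. h $ j * (partial j (partial i \<phi>) (x + t *\<^sub>R h) * h $ i))"
            by (rule sum.swap)
          finally show ?thesis by (simp add: sum_distrib_left mult_ac)
        qed
        finally show ?thesis using 2 by (simp add: d_def)
      qed
    qed
  qed auto
  moreover have "(\<Sum>m<2. d m 0 / fact m * 1 ^ m) = \<phi> x + grad \<phi> x \<bullet> h"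
    by (simp add: numeral_2_eq_2 d_def grad_def inner_vec_def)
  moreover have "d 2 t = h \<bullet> (hessian \<phi> (x + t *\<^sub>R h) *v h)" for t by (simp add: d_def)
  ultimately show ?thesis using that by auto
qed

lemma matrix_form_bound:
  fixes A :: "real^'n::finite^'n"
  assumes "\<And>i j. \<bar>A $ i $ j\<bar> \<le> B"
  shows "\<bar>u \<bullet> (A *v v)\<bar> \<le> (real CARD('n) * real CARD('n) * B) * (norm u * norm v)"
proof -
  have "\<bar>u \<bullet> (A *v v)\<bar> \<le> norm u * norm (A *v v)" by (rule Cauchy_Schwarz_ineq2)
  also have "\<dots> \<le> norm u * (onorm ((*v) A) * norm v)"
    by (intro mult_left_mono onorm matrix_vector_mul_bounded_linear) auto
  also have "\<dots> \<le> norm u * ((real CARD('n) * real CARD('n) * B) * norm v)"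
    by (intro mult_left_mono mult_right_mono onorm_le_matrix_component assms) auto
  finally show ?thesis by (simp add: mult_ac)
qed

text \<open>On the tangent space of the level set through \<open>x\<close> this is its second fundamental form, with the
  sign that makes it nonpositive if \<open>{\<phi> > 0}\<close> is convex.\<close>

definition normal_curvature_form :: "(real^'n::finite \<Rightarrow> real) \<Rightarrow> real^'n \<Rightarrow> real^'n \<Rightarrow> real^'n \<Rightarrow> real" where
  "normal_curvature_form \<phi> x u v = (u \<bullet> (hessian \<phi> x *v v)) / norm (grad \<phi> x)"

text \<open>By Taylor's formula \<open>\<phi> (x + h) / |grad \<phi> x|\<close> is \<open>- (h \<bullet> n - b(h, h) / 2)\<close> up to \<open>o(|h|\<^sup>2)\<close>, where \<open>b\<close> is the
  form above. Whenever the main term exceeds the error it decides the sign of \<open>\<phi>\<close>, and with it on which side of the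
  boundary \<open>x + h\<close> lies. On compact sets the error is uniform as \<open>hessian \<phi>\<close> is uniformly
  continuous nearby. Working with the sign directly avoids representing the boundary as a graph.\<close>

lemma second_order_geometry:
  fixes \<phi> :: "real^'n::finite \<Rightarrow> real"
  assumes X: "compact X" "X \<subseteq> U" and U: "open U" and C: "C_k 2 U \<phi>"
    and fr: "frontier E \<inter> U = {y\<in>U. \<phi> y = 0}" and int: "(E - frontier E) \<inter> U = {y\<in>U. \<phi> y > 0}"
    and X0: "\<And>x. x \<in> X \<Longrightarrow> \<phi> x = 0" and g0: "\<And>x. x \<in> X \<Longrightarrow> grad \<phi> x \<noteq> 0"
  obtains M where "0 < M"
    "\<And>x u v. x \<in> X \<Longrightarrow> \<bar>normal_curvature_form \<phi> x u v\<bar> \<le> M * (norm u * norm v)"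
    "\<And>\<eta>. 0 < \<eta> \<Longrightarrow> \<exists>\<delta>>0. \<forall>x\<in>X. \<forall>h. norm h < \<delta> \<longrightarrow>
       \<eta> * (norm h)\<^sup>2 < \<bar>h \<bullet> outer_normal_of \<phi> x - normal_curvature_form \<phi> x h h / 2\<bar> \<longrightarrow>
       x + h \<notin> frontier E \<and> (x + h \<in> interior E \<longleftrightarrow> h \<bullet> outer_normal_of \<phi> x < normal_curvature_form \<phi> x h h / 2)"
proof (cases "X = {}")
  case True
  then show ?thesis using that[of 1] by (auto intro: exI[of _ 1])
next
  case False
  have C': "\<And>i y. y \<in> U \<Longrightarrow> partial i \<phi> differentiable (at y)" "\<And>i j. continuous_on U (partial i (partial j \<phi>))"
    using C by (simp_all add: numeral_2_eq_2)
  have contg: "continuous_on U (grad \<phi>)"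
  proof -
    have "continuous_on U (partial i \<phi>)" for i
      using C'(1) by (simp add: continuous_at_imp_continuous_on differentiable_imp_continuous_within)
    then show ?thesis unfolding grad_def[abs_def] by (intro continuous_on_vec_lambda)
  qed
  have conth: "continuous_on U (hessian \<phi>)"
    unfolding hessian_def[abs_def] by (intro continuous_on_vec_lambda C')
  obtain x0 where x0: "x0 \<in> X" "\<And>x. x \<in> X \<Longrightarrow> norm (grad \<phi> x0) \<le> norm (grad \<phi> x)"
    using continuous_attains_inf[OF X(1) False, of "\<lambda>x. norm (grad \<phi> x)"] continuous_on_subset[OF contg X(2)]
    by (auto intro: continuous_on_norm)
  define c where "c = norm (grad \<phi> x0)"
  have c: "0 < c" "\<And>x. x \<in> X \<Longrightarrow> c \<le> norm (grad \<phi> x)" using x0 g0 by (auto simp: c_def)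
  have "bounded (hessian \<phi> ` X)"
    by (intro compact_imp_bounded compact_continuous_image continuous_on_subset[OF conth X(2)] X(1))
  then obtain B where B: "0 < B" "\<And>x. x \<in> X \<Longrightarrow> norm (hessian \<phi> x) \<le> B"
    unfolding bounded_pos by auto
  have comp: "\<bar>A $ i $ j\<bar> \<le> norm A" for A :: "real^'n^'n" and i j
    using component_le_norm_cart[of "A $ i" j] Finite_Cartesian_Product.norm_nth_le[of A i] by linarith
  let ?N = "real CARD('n) * real CARD('n)"
  have N: "0 < ?N" by simp
  obtain r where r: "0 < r" "{y. infdist y X \<le> r} \<subseteq> U"
    using compact_in_open_separated[OF False X(1) U X(2)] by blast
  define Y where "Y = {y. infdist y X \<le> r}"
  have Yc: "compact Y" unfolding Y_def using compact_infdist_le[OF False X(1) r(1)] by simp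
  have nearY: "x + k \<in> Y" if "x \<in> X" "norm k \<le> r" for x k
    using that infdist_le[OF that(1), of "x + k"] by (simp add: Y_def dist_norm)
  have unif: "uniformly_continuous_on Y (hessian \<phi>)"
    using r(2) by (intro compact_uniformly_continuous[OF _ Yc] continuous_on_subset[OF conth]) (simp add: Y_def)
  show ?thesis
  proof (rule that[of "?N * B / c"])
    show "0 < ?N * B / c" using B c N by simp
    fix x u v assume x: "x \<in> X"
    have "\<bar>u \<bullet> (hessian \<phi> x *v v)\<bar> \<le> (?N * B) * (norm u * norm v)"
      by (rule matrix_form_bound) (rule order.trans[OF comp B(2)[OF x]])
    then have "\<bar>u \<bullet> (hessian \<phi> x *v v)\<bar> / norm (grad \<phi> x) \<le> ((?N * B) * (norm u * norm v)) / c"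
      using c x by (intro frac_le) auto
    then show "\<bar>normal_curvature_form \<phi> x u v\<bar> \<le> ?N * B / c * (norm u * norm v)"
      by (simp add: normal_curvature_form_def)
  next
    fix \<eta> :: real assume \<eta>: "0 < \<eta>"
    define \<eta>' where "\<eta>' = 2 * \<eta> * c / ?N"
    have \<eta>': "0 < \<eta>'" using \<eta> c N by (simp add: \<eta>'_def)
    obtain \<delta> where \<delta>: "0 < \<delta>" "\<And>y z. y \<in> Y \<Longrightarrow> z \<in> Y \<Longrightarrow> dist z y < \<delta> \<Longrightarrow> dist (hessian \<phi> z) (hessian \<phi> y) < \<eta>'"
      using unif \<eta>' unfolding uniformly_continuous_on_def by metis
    show "\<exists>\<delta>>0. \<forall>x\<in>X. \<forall>h. norm h < \<delta> \<longrightarrow>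
       \<eta> * (norm h)\<^sup>2 < \<bar>h \<bullet> outer_normal_of \<phi> x - normal_curvature_form \<phi> x h h / 2\<bar> \<longrightarrow>
       x + h \<notin> frontier E \<and> (x + h \<in> interior E \<longleftrightarrow> h \<bullet> outer_normal_of \<phi> x < normal_curvature_form \<phi> x h h / 2)"
    proof (intro exI[of _ "min \<delta> r"] conjI ballI allI impI)
      show "0 < min \<delta> r" using \<delta> r by simp
      fix x h assume x: "x \<in> X" and h: "norm h < min \<delta> r"
        and big: "\<eta> * (norm h)\<^sup>2 < \<bar>h \<bullet> outer_normal_of \<phi> x - normal_curvature_form \<phi> x h h / 2\<bar>"
      have th: "norm (t *\<^sub>R h) \<le> norm h" if "0 \<le> t" "t \<le> 1" for t
        using that by (simp add: mult_left_le_one_le)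
      have inY: "x + t *\<^sub>R h \<in> Y" if "0 \<le> t" "t \<le> 1" for t
        using nearY[OF x, of "t *\<^sub>R h"] th[OF that] h by simp
      obtain t where t: "0 < t" "t < 1"
        "\<phi> (x + h) = \<phi> x + grad \<phi> x \<bullet> h + (h \<bullet> (hessian \<phi> (x + t *\<^sub>R h) *v h)) / 2"
        by (rule taylor_second_order[OF C, of x h]) (use inY r(2) in \<open>auto simp: Y_def\<close>)
      let ?g = "norm (grad \<phi> x)"
      have g: "0 < ?g" using g0[OF x] by simp
      let ?A = "hessian \<phi> (x + t *\<^sub>R h) - hessian \<phi> x"
      have "dist (hessian \<phi> (x + t *\<^sub>R h)) (hessian \<phi> x) < \<eta>'"
        using inY[of t] inY[of 0] t th[of t] h by (intro \<delta>(2)) (auto simp: dist_norm)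
      then have "\<bar>?A $ i $ j\<bar> \<le> \<eta>'" for i j using comp[of ?A i j] by (simp add: dist_norm)
      then have "\<bar>h \<bullet> (?A *v h)\<bar> \<le> (?N * \<eta>') * (norm h * norm h)" by (rule matrix_form_bound)
      also have "\<dots> = 2 * (\<eta> * (norm h)\<^sup>2) * c" using N by (simp add: \<eta>'_def power2_eq_square)
      also have "\<dots> \<le> 2 * (\<eta> * (norm h)\<^sup>2) * ?g" using \<eta> c(2)[OF x] by (intro mult_left_mono) auto
      finally have err: "\<bar>h \<bullet> (?A *v h)\<bar> / (2 * ?g) \<le> \<eta> * (norm h)\<^sup>2" using g by (simp add: field_simps)
      have hn: "h \<bullet> outer_normal_of \<phi> x = - (grad \<phi> x \<bullet> h) / ?g"
        by (simp add: outer_normal_of_def inner_commute divide_inverse mult.commute)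
      have "\<phi> (x + h) / ?g = - (h \<bullet> outer_normal_of \<phi> x - normal_curvature_form \<phi> x h h / 2) + (h \<bullet> (?A *v h)) / (2 * ?g)"
        unfolding hn t(3) normal_curvature_form_def using X0[OF x] g
        by (simp add: matrix_vector_mult_diff_rdistrib inner_diff_right field_simps)
      moreover have "\<bar>(h \<bullet> (?A *v h)) / (2 * ?g)\<bar> \<le> \<eta> * (norm h)\<^sup>2" using err g by simp
      ultimately have "\<phi> (x + h) / ?g \<noteq> 0 \<and> (0 < \<phi> (x + h) / ?g \<longleftrightarrow> h \<bullet> outer_normal_of \<phi> x < normal_curvature_form \<phi> x h h / 2)"
        using big by linarith
      then have *: "\<phi> (x + h) \<noteq> 0" "0 < \<phi> (x + h) \<longleftrightarrow> h \<bullet> outer_normal_of \<phi> x < normal_curvature_form \<phi> x h h / 2"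
        using g by (auto simp: zero_less_divide_iff)
      have inU: "x + h \<in> U" using inY[of 1] r(2) by (auto simp: Y_def)
      have "x + h \<in> interior E \<longleftrightarrow> x + h \<in> E - frontier E"
        using interior_subset closure_subset by (auto simp: frontier_def)
      then show "x + h \<notin> frontier E" "x + h \<in> interior E \<longleftrightarrow> h \<bullet> outer_normal_of \<phi> x < normal_curvature_form \<phi> x h h / 2"
        using * fr int inU by blast+
    qed
  qed
qed

section \<open>From weak derivatives to increments on the line\<close>

text \<open>Lebesgue's differentiation theorem on cubes.\<close>

lemma AE_zero_if_box_integrals_zero:
  fixes f :: "'a::euclidean_space \<Rightarrow> real"
  assumes f: "integrable lborel f" and z: "\<And>a b. (LINT x:cbox a b|lborel. f x) = 0"
  shows "AE x in lborel. f x = 0"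
proof -
  have s: "set_integrable lborel (cbox a b) f" for a b
    using integrable_mult_indicator[of "cbox a b" lborel f] f by (simp add: set_integrable_def)
  have i: "f integrable_on cbox a b" "integral (cbox a b) f = 0" for a b
    using set_borel_integral_eq_integral[OF s] z by auto
  obtain N where N: "negligible N"
    "\<And>x e. \<lbrakk>x \<notin> N; 0 < e\<rbrakk> \<Longrightarrow> \<exists>d>0. \<forall>h. 0 < h \<and> h < d \<longrightarrow>
       norm(integral (cbox x (x + h *\<^sub>R One)) f /\<^sub>R h ^ DIM('a) - f x) < e"
    using integrable_ccontinuous_explicit[OF i(1)] by blast
  have "f x = 0" if xN: "x \<notin> N" for x
  proof (rule ccontr)
    assume "f x \<noteq> 0"
    then obtain d where d: "d > 0" "\<forall>h. 0 < h \<and> h < d \<longrightarrow>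
        norm (integral (cbox x (x + h *\<^sub>R One)) f /\<^sub>R h ^ DIM('a) - f x) < \<bar>f x\<bar>"
      using N(2)[OF xN, of "\<bar>f x\<bar>"] by auto
    show False using d(2)[rule_format, of "d / 2"] d(1) by (simp add: i(2))
  qed
  then have "AE x in lebesgue. f x = 0"
    using N(1) unfolding negligible_iff_null_sets by (intro AE_I'[of N]) auto
  then show ?thesis by (simp add: AE_completion_iff)
qed

definition step_slope :: "real \<Rightarrow> real" where "step_slope = deriv smooth_step"

lemma smooth_step_has_derivative: "(smooth_step has_real_derivative step_slope x) (at x)"
  and C_real_step_slope: "C_real k step_slope"
proof -
  have *: "(smooth_step has_real_derivative step_slope x) (at x)" for x
  proof -
    obtain f' where "\<And>x. (smooth_step has_real_derivative f' x) (at x)"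
      using C_real_smooth_step[of "Suc 0"] by auto
    then show ?thesis unfolding step_slope_def by (metis DERIV_imp_deriv)
  qed
  then show "(smooth_step has_real_derivative step_slope x) (at x)" .
  obtain f' where f': "\<And>x. (smooth_step has_real_derivative f' x) (at x)" "C_real k f'"
    using C_real_smooth_step[of "Suc k"] by auto
  have "f' = step_slope" using f'(1) * DERIV_unique by blast
  then show "C_real k step_slope" using f'(2) by simp
qed

lemma continuous_step_slope: "continuous_on UNIV step_slope"
  using C_real_step_slope[of 0] by simp

lemma continuous_smooth_step: "continuous_on UNIV smooth_step"
  using C_real_smooth_step[of 0] by simp

lemma smooth_step_measurable [measurable]: "smooth_step \<in> borel_measurable borel" "step_slope \<in> borel_measurable borel"
  by (intro borel_measurable_continuous_onI continuous_smooth_step continuous_step_slope)+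

lemma step_slope_eq_0: "x \<le> 0 \<or> 1 \<le> x \<Longrightarrow> step_slope x = 0"
proof -
  have out: "step_slope x = 0" if "x < 0 \<or> 1 < x" for x
  proof -
    have "(smooth_step has_real_derivative 0) (at x)"
    proof (cases "x < 0")
      case True
      have "eventually (\<lambda>y. smooth_step y = 0) (nhds x)"
        using eventually_nhds_in_open[of "{..<0}" x] True by (auto elim!: eventually_mono simp: smooth_step_eq)
      then show ?thesis using True by (subst DERIV_cong_ev[OF refl _ refl, of _ "\<lambda>_. 0"]) auto
    next
      case False
      then have "1 < x" using that by simp
      have "eventually (\<lambda>y. smooth_step y = 1) (nhds x)"
        using eventually_nhds_in_open[of "{1<..}" x] \<open>1 < x\<close> by (auto elim!: eventually_mono simp: smooth_step_eq)
      then show ?thesis by (subst DERIV_cong_ev[OF refl _ refl, of _ "\<lambda>_. 1"]) auto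
    qed
    then show ?thesis using smooth_step_has_derivative DERIV_unique by blast
  qed
  have cl: "closed {x. step_slope x = 0}"
    by (intro closed_Collect_eq continuous_step_slope continuous_on_const)
  have "closure ({..<0} \<union> {1<..}) \<subseteq> {x. step_slope x = 0}"
    by (rule closure_minimal[OF _ cl]) (use out in auto)
  then show "x \<le> 0 \<or> 1 \<le> x \<Longrightarrow> step_slope x = 0" by (auto simp: closure_Un)
qed

lemma integral_step_slope: "integrable lborel step_slope" "(LINT x|lborel. step_slope x) = 1"
proof -
  have ind: "step_slope = (\<lambda>x. indicator {0..1} x *\<^sub>R step_slope x)"
  proof
    fix x show "step_slope x = indicator {0..1} x *\<^sub>R step_slope x"
      using step_slope_eq_0[of x] by (cases "0 \<le> x \<and> x \<le> 1") auto
  qed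
  have "has_bochner_integral lborel (\<lambda>x. indicator {0..1} x *\<^sub>R step_slope x) (smooth_step 1 - smooth_step 0)"
  proof (rule has_bochner_integral_FTC_Icc)
    fix x :: real
    show "(smooth_step has_vector_derivative step_slope x) (at x within {0..1})"
      using has_field_derivative_at_within[OF smooth_step_has_derivative]
      by (simp add: has_real_derivative_iff_has_vector_derivative)
    show "continuous_on {0..1} step_slope" by (rule continuous_on_subset[OF continuous_step_slope]) simp
  qed simp
  then have "has_bochner_integral lborel step_slope 1" unfolding ind[symmetric] by (simp add: smooth_step_eq)
  then show "integrable lborel step_slope" "(LINT x|lborel. step_slope x) = 1"
    by (auto simp: has_bochner_integral_iff)
qed

text \<open>For large \<open>N\<close> this is a smooth approximation of the indicator of \<open>{s<..t}\<close>, and its derivative approximates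
  a difference of point masses at \<open>s\<close> and \<open>t\<close>.\<close>

definition plateau :: "real \<Rightarrow> real \<Rightarrow> real \<Rightarrow> real \<Rightarrow> real" where
  "plateau N s t \<tau> = smooth_step (N * (\<tau> - s)) - smooth_step (N * (\<tau> - t))"

definition plateau_slope :: "real \<Rightarrow> real \<Rightarrow> real \<Rightarrow> real \<Rightarrow> real" where
  "plateau_slope N s t \<tau> = N * step_slope (N * (\<tau> - s)) - N * step_slope (N * (\<tau> - t))"

lemma plateau_measurable [measurable]: "plateau N s t \<in> borel_measurable borel" "plateau_slope N s t \<in> borel_measurable borel"
  unfolding plateau_def[abs_def] plateau_slope_def[abs_def] by measurable

lemma plateau_has_derivative: "(plateau N s t has_real_derivative plateau_slope N s t \<tau>) (at \<tau>)"
proof -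
  have "((\<lambda>\<tau>. smooth_step (N * (\<tau> - s))) has_real_derivative step_slope (N * (\<tau> - s)) * N) (at \<tau>)" for s
    by (rule DERIV_chain2[OF smooth_step_has_derivative]) (auto intro!: derivative_eq_intros)
  from DERIV_diff[OF this[of s] this[of t]] show ?thesis
    unfolding plateau_def[abs_def] plateau_slope_def by (simp add: mult.commute)
qed

lemma C_real_plateau: "C_real k (plateau N s t)"
proof -
  have a: "C_real k (\<lambda>\<tau>. smooth_step (N * (\<tau> - s)))" for s
    using C_real_compose_affine[OF C_real_smooth_step, of k N "- N * s"] by (simp add: algebra_simps)
  have "C_real k (\<lambda>\<tau>. smooth_step (N * (\<tau> - s)) + (- 1) * smooth_step (N * (\<tau> - t)))"
    by (intro C_real_add C_real_mult C_real_const a)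
  then show ?thesis by (simp add: plateau_def[abs_def])
qed

lemma plateau_outside:
  assumes "1 \<le> N" "s < t" "\<tau> < s \<or> t + 1 < \<tau>"
  shows "plateau N s t \<tau> = 0" "plateau_slope N s t \<tau> = 0"
proof -
  have "N * (\<tau> - s) \<le> 0 \<and> N * (\<tau> - t) \<le> 0 \<or> 1 \<le> N * (\<tau> - s) \<and> 1 \<le> N * (\<tau> - t)"
  proof (cases "\<tau> < s")
    case True then show ?thesis using assms by (auto simp: mult_le_0_iff)
  next
    case False
    then have "1 * 1 \<le> N * (\<tau> - s)" "1 * 1 \<le> N * (\<tau> - t)" using assms by (intro mult_mono; simp)+
    then show ?thesis by simp
  qed
  then show "plateau N s t \<tau> = 0" "plateau_slope N s t \<tau> = 0"
    by (auto simp: plateau_def plateau_slope_def smooth_step_eq step_slope_eq_0)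
qed

lemma plateau_bound: "\<bar>plateau N s t \<tau>\<bar> \<le> 1"
  using smooth_step_bounds[of "N * (\<tau> - s)"] smooth_step_bounds[of "N * (\<tau> - t)"] by (auto simp: plateau_def)

lemma plateau_slope_bounded: "\<exists>B. \<forall>\<tau>. \<bar>plateau_slope N s t \<tau>\<bar> \<le> B"
proof -
  have "bounded (step_slope ` {0..1})"
    by (intro compact_imp_bounded compact_continuous_image continuous_on_subset[OF continuous_step_slope]) auto
  then obtain B where "\<forall>y\<in>step_slope ` {0..1}. norm y \<le> B" unfolding bounded_iff by blast
  then have B: "\<bar>step_slope x\<bar> \<le> B" if "x \<in> {0..1}" for x using that by auto
  have B': "\<bar>step_slope x\<bar> \<le> \<bar>B\<bar>" for x
    using B[of x] step_slope_eq_0[of x] by (cases "x \<in> {0..1}") auto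
  have "\<bar>plateau_slope N s t \<tau>\<bar> \<le> \<bar>N\<bar> * \<bar>B\<bar> + \<bar>N\<bar> * \<bar>B\<bar>" for \<tau>
  proof -
    have "\<bar>plateau_slope N s t \<tau>\<bar> \<le> \<bar>N\<bar> * \<bar>step_slope (N * (\<tau> - s))\<bar> + \<bar>N\<bar> * \<bar>step_slope (N * (\<tau> - t))\<bar>"
      unfolding plateau_slope_def abs_mult[symmetric] by (rule abs_triangle_ineq4)
    also have "\<dots> \<le> \<bar>N\<bar> * \<bar>B\<bar> + \<bar>N\<bar> * \<bar>B\<bar>" by (intro add_mono mult_left_mono B') auto
    finally show ?thesis .
  qed
  then show ?thesis by blast
qed

lemma step_slope_average:
  fixes k :: "real \<Rightarrow> real"
  assumes k: "continuous_on UNIV k"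
  shows "integrable lborel (\<lambda>\<tau>. k \<tau> * (real (Suc n) * step_slope (real (Suc n) * (\<tau> - s))))"
    and "(\<lambda>n. LINT \<tau>|lborel. k \<tau> * (real (Suc n) * step_slope (real (Suc n) * (\<tau> - s)))) \<longlonglongrightarrow> k s"
proof -
  have [measurable]: "k \<in> borel_measurable borel" using k by (rule borel_measurable_continuous_onI)
  have "bounded (k ` {s..s + 1})"
    by (intro compact_imp_bounded compact_continuous_image continuous_on_subset[OF k]) auto
  then obtain B where "\<forall>y\<in>k ` {s..s + 1}. norm y \<le> B" unfolding bounded_iff by blast
  then have B: "\<bar>k x\<bar> \<le> B" if "x \<in> {s..s + 1}" for x using that by auto
  define g where "g n u = k (s + u / real (Suc n)) * step_slope u" for n u
  have [measurable]: "g n \<in> borel_measurable borel" for n unfolding g_def by measurable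
  have gb: "norm (g n u) \<le> norm (B * step_slope u)" for n u
  proof (cases "0 \<le> u \<and> u \<le> 1")
    case True
    have "u / real (Suc n) \<le> 1 / 1" using True by (intro frac_le) auto
    then have "\<bar>k (s + u / real (Suc n))\<bar> \<le> B" using True by (intro B) auto
    then show ?thesis by (auto simp: g_def abs_mult intro!: mult_right_mono)
  qed (use step_slope_eq_0[of u] in \<open>auto simp: g_def\<close>)
  have dom: "integrable lborel (\<lambda>u. B * step_slope u)" using integral_step_slope(1) by simp
  have gi: "integrable lborel (g n)" for n
    by (rule Bochner_Integration.integrable_bound[OF dom]) (use gb in auto)
  have lim: "(\<lambda>n. LINT u|lborel. g n u) \<longlonglongrightarrow> (LINT u|lborel. k s * step_slope u)"
  proof (rule integral_dominated_convergence[where w = "\<lambda>u. norm (B * step_slope u)"])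
    show "AE u in lborel. (\<lambda>n. g n u) \<longlonglongrightarrow> k s * step_slope u"
    proof (rule AE_I2)
      fix u :: real
      have lim: "(\<lambda>n. s + u / real (Suc n)) \<longlonglongrightarrow> s + 0"
        by (intro tendsto_add tendsto_const) (rule LIMSEQ_Suc[OF lim_const_over_n])
      have "isCont k (s + 0)" using k by (simp add: continuous_on_eq_continuous_at)
      from isCont_tendsto_compose[OF this lim]
      have "(\<lambda>n. k (s + u / real (Suc n))) \<longlonglongrightarrow> k s" by (simp only: add_0_right)
      then show "(\<lambda>n. g n u) \<longlonglongrightarrow> k s * step_slope u" unfolding g_def by (intro tendsto_mult tendsto_const)
    qed
    show "integrable lborel (\<lambda>u. norm (B * step_slope u))" using dom by (rule integrable_norm)
  qed (use gb in \<open>auto\<close>)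
  have sub: "(\<lambda>\<tau>. k \<tau> * (real (Suc n) * step_slope (real (Suc n) * (\<tau> - s)))) = (\<lambda>\<tau>. real (Suc n) * g n (- real (Suc n) * s + real (Suc n) * \<tau>))" for n
  proof
    fix \<tau>
    have "s + (- real (Suc n) * s + real (Suc n) * \<tau>) / real (Suc n) = \<tau>" by (simp add: field_simps)
    moreover have "- real (Suc n) * s + real (Suc n) * \<tau> = real (Suc n) * (\<tau> - s)" by (simp add: algebra_simps)
    ultimately show "k \<tau> * (real (Suc n) * step_slope (real (Suc n) * (\<tau> - s))) = real (Suc n) * g n (- real (Suc n) * s + real (Suc n) * \<tau>)"
      unfolding g_def by (simp add: mult_ac)
  qed
  show "integrable lborel (\<lambda>\<tau>. k \<tau> * (real (Suc n) * step_slope (real (Suc n) * (\<tau> - s))))"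
    unfolding sub by (intro integrable_mult_right lborel_integrable_real_affine gi) simp
  have eq: "(LINT \<tau>|lborel. k \<tau> * (real (Suc n) * step_slope (real (Suc n) * (\<tau> - s)))) = (LINT u|lborel. g n u)" for n
  proof -
    have "(LINT u|lborel. g n u) = \<bar>real (Suc n)\<bar> *\<^sub>R (LINT x|lborel. g n (- real (Suc n) * s + real (Suc n) * x))"
      by (rule lborel_integral_real_affine) simp
    then show ?thesis by (simp only: sub integral_mult_right_zero real_scaleR_def abs_of_nat)
  qed
  have "(LINT u|lborel. k s * step_slope u) = k s" by (simp add: integral_step_slope(2))
  then show "(\<lambda>n. LINT \<tau>|lborel. k \<tau> * (real (Suc n) * step_slope (real (Suc n) * (\<tau> - s)))) \<longlonglongrightarrow> k s"
    using lim by (simp only: eq)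
qed

text \<open>Test the weak derivative with the plateau and let its two edges become steep: the slopes concentrate
  at the end points, and the continuity of \<open>k\<close> turns them into \<open>k s - k t\<close>.\<close>

lemma increment_from_weak_derivative:
  fixes k d :: "real \<Rightarrow> real"
  assumes k: "continuous_on UNIV k" and d: "integrable lborel d" and st: "s < t"
    and weak: "\<And>n. (LINT \<tau>|lborel. k \<tau> * plateau_slope (real (Suc n)) s t \<tau> + d \<tau> * plateau (real (Suc n)) s t \<tau>) = 0"
  shows "k t - k s = (LINT \<tau>:{s<..t}|lborel. d \<tau>)"
proof -
  have [measurable]: "k \<in> borel_measurable borel" using k by (rule borel_measurable_continuous_onI)
  have dm [measurable]: "d \<in> borel_measurable borel" using d by simp
  let ?A = "\<lambda>n s. LINT \<tau>|lborel. k \<tau> * (real (Suc n) * step_slope (real (Suc n) * (\<tau> - s)))"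
  have i1: "integrable lborel (\<lambda>\<tau>. k \<tau> * plateau_slope (real (Suc n)) s t \<tau>)"
    "(LINT \<tau>|lborel. k \<tau> * plateau_slope (real (Suc n)) s t \<tau>) = ?A n s - ?A n t" for n
    unfolding plateau_slope_def right_diff_distrib[of "k _"]
    by (intro Bochner_Integration.integrable_diff Bochner_Integration.integral_diff step_slope_average(1)[OF k])+
  have db: "norm (d \<tau> * plateau (real (Suc n)) s t \<tau>) \<le> norm (d \<tau>)" for n \<tau>
    using plateau_bound[of "real (Suc n)" s t \<tau>] by (simp add: abs_mult mult_left_le)
  have i2: "integrable lborel (\<lambda>\<tau>. d \<tau> * plateau (real (Suc n)) s t \<tau>)" for n
    by (rule Bochner_Integration.integrable_bound[OF d]) (use db in auto)
  have lim2: "(\<lambda>n. LINT \<tau>|lborel. d \<tau> * plateau (real (Suc n)) s t \<tau>) \<longlonglongrightarrow> (LINT \<tau>|lborel. indicator {s<..t} \<tau> *\<^sub>R d \<tau>)"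
  proof (rule integral_dominated_convergence[where w = "\<lambda>\<tau>. norm (d \<tau>)"])
    show "AE \<tau> in lborel. (\<lambda>n. d \<tau> * plateau (real (Suc n)) s t \<tau>) \<longlonglongrightarrow> indicator {s<..t} \<tau> *\<^sub>R d \<tau>"
    proof (rule AE_I2)
      fix \<tau> :: real
      have pos: "(\<lambda>n. smooth_step (real (Suc n) * x)) \<longlonglongrightarrow> (if 0 < x then 1 else 0)" for x
      proof (cases "0 < x")
        case True
        obtain n0 where n0: "1 / x < real n0" using reals_Archimedean2 by blast
        have "eventually (\<lambda>n. smooth_step (real (Suc n) * x) = 1) sequentially"
          using eventually_ge_at_top[of n0]
        proof eventually_elim
          case (elim n)
          have "1 / x \<le> real (Suc n)" using n0 elim by linarith
          then show ?case using True by (intro smooth_step_eq) (simp add: field_simps)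
        qed
        then show ?thesis using True by (simp add: tendsto_eventually)
      next
        case False
        then have "smooth_step (real (Suc n) * x) = 0" for n by (intro smooth_step_eq) (simp add: mult_le_0_iff)
        then show ?thesis using False by simp
      qed
      have "(\<lambda>n. d \<tau> * plateau (real (Suc n)) s t \<tau>) \<longlonglongrightarrow> d \<tau> * ((if 0 < \<tau> - s then 1 else 0) - (if 0 < \<tau> - t then 1 else 0))"
        unfolding plateau_def by (intro tendsto_mult tendsto_diff tendsto_const pos)
      then show "(\<lambda>n. d \<tau> * plateau (real (Suc n)) s t \<tau>) \<longlonglongrightarrow> indicator {s<..t} \<tau> *\<^sub>R d \<tau>"
        using st by (auto simp: indicator_def split: if_splits)
    qed
  qed (use d db in \<open>auto intro: integrable_norm\<close>)
  have "?A n s - ?A n t + (LINT \<tau>|lborel. d \<tau> * plateau (real (Suc n)) s t \<tau>) = 0" for n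
    using weak[of n] by (simp only: Bochner_Integration.integral_add[OF i1(1) i2] i1(2))
  moreover have "(\<lambda>n. ?A n s - ?A n t + (LINT \<tau>|lborel. d \<tau> * plateau (real (Suc n)) s t \<tau>)) \<longlonglongrightarrow>
      k s - k t + (LINT \<tau>|lborel. indicator {s<..t} \<tau> *\<^sub>R d \<tau>)"
    by (intro tendsto_add tendsto_diff step_slope_average(2)[OF k] lim2)
  ultimately have "(\<lambda>n. 0) \<longlonglongrightarrow> k s - k t + (LINT \<tau>|lborel. indicator {s<..t} \<tau> *\<^sub>R d \<tau>)" by simp
  then have "k s - k t + (LINT \<tau>|lborel. indicator {s<..t} \<tau> *\<^sub>R d \<tau>) = 0"
    using LIMSEQ_unique tendsto_const by blast
  then show ?thesis by (simp add: set_lebesgue_integral_def)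
qed

section \<open>Borel versions of the kernel and its gradient\<close>

locale planar_kernel = curvature_kernel K DK
  for K :: "real^'n::finite \<Rightarrow> real" and DK :: "real^'n \<Rightarrow> real^'n" +
  assumes dim: "2 \<le> CARD('n)"
begin

lemma interior_complement_ball: "0 < r \<Longrightarrow> interior (- ball 0 r) = - cball (0::real^'n) r"
  by (simp add: interior_complement)

lemma K_lebesgue: "(\<lambda>x. if x \<in> - {0} then K x else 0) \<in> borel_measurable lebesgue"
  using measurable by (subst borel_measurable_if) auto

lemma DK_lebesgue: "(\<lambda>x. if x \<in> - {0} then DK x else 0) \<in> borel_measurable lebesgue"
proof (rule borel_measurable_LIMSEQ_metric)
  fix n :: nat
  have "set_integrable lebesgue (- cball 0 (1 / real (Suc n))) DK"
    using sobolev[of "1 / real (Suc n)"] by (simp add: sobolev_W11_def interior_complement_ball)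
  then show "(\<lambda>x. indicator (- cball 0 (1 / real (Suc n))) x *\<^sub>R DK x) \<in> borel_measurable lebesgue"
    by (simp add: set_integrable_def)
next
  fix x :: "real^'n"
  show "(\<lambda>n. indicator (- cball 0 (1 / real (Suc n))) x *\<^sub>R DK x) \<longlonglongrightarrow> (if x \<in> - {0} then DK x else 0)"
  proof (cases "x = 0")
    case False
    then obtain n0 where n0: "1 / real (Suc n0) < norm x" using nat_approx_posE[of "norm x"] by auto
    have "eventually (\<lambda>n. indicator (- cball 0 (1 / real (Suc n))) x *\<^sub>R DK x = DK x) sequentially"
      using eventually_ge_at_top[of n0]
    proof eventually_elim
      case (elim n)
      have "1 / real (Suc n) \<le> 1 / real (Suc n0)" using elim by (intro divide_left_mono) auto
      then have "x \<in> - cball 0 (1 / real (Suc n))" using n0 by simp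
      then show ?case by (simp only: indicator_simps scaleR_one)
    qed
    then show ?thesis using False by (simp add: tendsto_eventually)
  qed simp
qed

text \<open>The kernel is only Lebesgue measurable. Products and slices are formed with a nonnegative Borel
  function equal to \<open>K\<close> almost everywhere, and \<open>DKb\<close> serves \<open>DK\<close> in the same way; pointwise statements
  about \<open>K\<close> are recovered on almost every line.\<close>

definition Kb :: "real^'n \<Rightarrow> real" where
  "Kb = (SOME g. g \<in> borel_measurable borel \<and> (\<forall>x. 0 \<le> g x) \<and> (AE x in lborel. g x = K x))"

definition DKb :: "real^'n \<Rightarrow> real^'n" where
  "DKb = (SOME g. g \<in> borel_measurable borel \<and> (AE x in lborel. g x = DK x))"

lemma AE_not_0: "AE x in lborel. x \<noteq> (0 :: real^'n)"
  by (rule AE_lborel_singleton)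

lemma Kb: "Kb \<in> borel_measurable borel" "0 \<le> Kb x" "AE x in lborel. Kb x = K x"
proof -
  obtain g where g: "g \<in> borel_measurable lborel" "AE x in lborel. (if x \<in> - {0} then K x else 0) = g x"
    using completion_ex_borel_measurable_real[OF K_lebesgue] by blast
  have "\<exists>g. g \<in> borel_measurable borel \<and> (\<forall>x. 0 \<le> g x) \<and> (AE x in lborel. g x = K x)"
  proof (intro exI[of _ "\<lambda>x. max 0 (g x)"] conjI allI)
    show "(\<lambda>x. max 0 (g x)) \<in> borel_measurable borel" using g(1) by simp
    show "AE x in lborel. max 0 (g x) = K x"
      using g(2) AE_not_0
    proof eventually_elim
      case (elim x)
      then show ?case using nonneg[of x] by simp
    qed
  qed simp
  then have "Kb \<in> borel_measurable borel \<and> (\<forall>x. 0 \<le> Kb x) \<and> (AE x in lborel. Kb x = K x)"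
    unfolding Kb_def by (rule someI_ex)
  then show "Kb \<in> borel_measurable borel" "0 \<le> Kb x" "AE x in lborel. Kb x = K x" by auto
qed

lemma DKb: "DKb \<in> borel_measurable borel" "AE x in lborel. DKb x = DK x"
proof -
  have "\<exists>g. g \<in> borel_measurable borel \<and> (AE x in lborel. g x = DK x $ i)" for i
  proof -
    have "(\<lambda>x. (if x \<in> - {0} then DK x else 0) \<bullet> axis i 1) \<in> borel_measurable lebesgue"
      using DK_lebesgue by (rule borel_measurable_inner) simp
    then obtain g where g: "g \<in> borel_measurable lborel" "AE x in lborel. (if x \<in> - {0} then DK x else 0) \<bullet> axis i 1 = g x"
      using completion_ex_borel_measurable_real by blast
    have "AE x in lborel. g x = DK x $ i"
      using g(2) AE_not_0 by eventually_elim (auto simp: inner_axis)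
    then show ?thesis using g(1) by auto
  qed
  then obtain g where g: "\<And>i. g i \<in> borel_measurable borel" "\<And>i. AE x in lborel. g i x = DK x $ i" by metis
  have "\<exists>g. g \<in> borel_measurable borel \<and> (AE x in lborel. g x = DK x)"
  proof (intro exI[of _ "\<lambda>x. \<chi> i. g i x"] conjI)
    have "(\<lambda>x. \<Sum>i\<in>UNIV. g i x *\<^sub>R (axis i 1 :: real^'n)) \<in> borel_measurable borel"
      using g(1) by (intro borel_measurable_sum borel_measurable_scaleR) auto
    moreover have "(\<lambda>x. \<Sum>i\<in>UNIV. g i x *\<^sub>R (axis i 1 :: real^'n)) = (\<lambda>x. \<chi> i. g i x)"
      by (auto simp: vec_eq_iff axis_def if_distrib fun_eq_iff cong: if_cong)
    ultimately show "(\<lambda>x. \<chi> i. g i x) \<in> borel_measurable borel" by simp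
    have "AE x in lborel. \<forall>i\<in>UNIV. g i x = DK x $ i"
      using g(2) by (intro AE_finite_allI) auto
    then show "AE x in lborel. (\<chi> i. g i x) = DK x" by eventually_elim (simp add: vec_eq_iff)
  qed
  then have "DKb \<in> borel_measurable borel \<and> (AE x in lborel. DKb x = DK x)"
    unfolding DKb_def by (rule someI_ex)
  then show "DKb \<in> borel_measurable borel" "AE x in lborel. DKb x = DK x" by auto
qed

lemmas [measurable] = Kb(1) DKb(1)

lemma set_integrable_borel_version:
  fixes f g :: "real^'n \<Rightarrow> 'b::euclidean_space"
  assumes "set_integrable lebesgue A f" "A \<in> sets borel" "g \<in> borel_measurable borel" "AE x in lborel. g x = f x"
  shows "integrable lborel (\<lambda>x. indicator A x *\<^sub>R g x)"
    "(LINT x|lborel. indicator A x *\<^sub>R g x) = (LINT x:A|lebesgue. f x)"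
proof -
  have f: "integrable lebesgue (\<lambda>x. indicator A x *\<^sub>R f x)" using assms(1) by (simp add: set_integrable_def)
  have g [measurable]: "(\<lambda>x. indicator A x *\<^sub>R g x) \<in> borel_measurable lborel" using assms(2,3) by simp
  have gl: "(\<lambda>x. indicator A x *\<^sub>R g x) \<in> borel_measurable lebesgue" using g by (rule measurable_completion)
  have ae: "AE x in lebesgue. indicator A x *\<^sub>R f x = indicator A x *\<^sub>R g x"
    using AE_completion[OF assms(4)] by eventually_elim simp
  have "integrable lebesgue (\<lambda>x. indicator A x *\<^sub>R g x)"
    using integrable_cong_AE[OF borel_measurable_integrable[OF f] gl ae] f by simp
  then show "integrable lborel (\<lambda>x. indicator A x *\<^sub>R g x)" using integrable_completion[OF g] by simp
  have "(LINT x:A|lebesgue. f x) = (LINT x|lebesgue. indicator A x *\<^sub>R g x)"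
    unfolding set_lebesgue_integral_def by (rule integral_cong_AE[OF borel_measurable_integrable[OF f] gl ae])
  then show "(LINT x|lborel. indicator A x *\<^sub>R g x) = (LINT x:A|lebesgue. f x)"
    using integral_completion[OF g] by simp
qed

lemma Kb_outside: "0 < r \<Longrightarrow> integrable lborel (\<lambda>x. indicator (- cball 0 r) x *\<^sub>R Kb x)"
  by (rule set_integrable_borel_version(1)[of _ K])
     (use sobolev[of r] Kb in \<open>auto simp: sobolev_W11_def interior_complement_ball\<close>)

lemma DKb_outside: "0 < r \<Longrightarrow> integrable lborel (\<lambda>x. indicator (- cball 0 r) x *\<^sub>R DKb x)"
  by (rule set_integrable_borel_version(1)[of _ DK])
     (use sobolev[of r] DKb in \<open>auto simp: sobolev_W11_def interior_complement_ball\<close>)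

text \<open>The weak derivative of the Sobolev hypothesis in the constant direction \<open>e\<close>, where \<open>D\<close> is the derivative of
  the test function in this direction.\<close>

lemma weak_directional_derivative:
  assumes r: "0 < r" and \<phi>: "test_function (- cball 0 r) \<phi>" and e: "\<And>x. D x = (\<Sum>i\<in>UNIV. e $ i * partial i \<phi> x)"
  shows "(LINT x|lborel. indicator (- cball 0 r) x * (Kb x * D x + (DKb x \<bullet> e) * \<phi> x)) = 0"
proof -
  let ?U = "- cball (0::real^'n) r"
  define S where "S = closure {x. \<phi> x \<noteq> 0}"
  have S: "compact S" using \<phi> by (simp add: test_function_def S_def)
  have C1: "C_k 1 UNIV \<phi>" using \<phi> by (simp add: test_function_def)
  then have cont: "continuous_on UNIV \<phi>" "continuous_on UNIV (partial i \<phi>)" for i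
    by (auto simp: continuous_at_imp_continuous_on differentiable_imp_continuous_within)
  have [measurable]: "\<phi> \<in> borel_measurable borel" "partial i \<phi> \<in> borel_measurable borel" for i
    using cont by (auto intro: borel_measurable_continuous_onI)
  have out: "\<phi> x = 0" "partial i \<phi> x = 0" if "x \<notin> S" for x i
  proof -
    show "\<phi> x = 0" using that closure_subset[of "{x. \<phi> x \<noteq> 0}"] by (auto simp: S_def)
    have "eventually (\<lambda>y. y \<in> - S) (nhds x)"
      using S that by (intro eventually_nhds_in_open) (auto intro: compact_imp_closed)
    then have ev: "eventually (\<lambda>y. 0 = \<phi> y) (nhds x)"
      by eventually_elim (use closure_subset[of "{x. \<phi> x \<noteq> 0}"] in \<open>auto simp: S_def\<close>)
    have "(\<phi> has_derivative (\<lambda>h. 0)) (at x)"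
      by (rule has_derivative_transform_eventually[OF has_derivative_const[of 0]])
         (use ev in \<open>auto simp: eventually_at_filter elim: eventually_mono dest: eventually_nhds_x_imp_x\<close>)
    then show "partial i \<phi> x = 0" by (rule partial_eq[THEN trans]) simp
  qed
  have bnd: "\<exists>B. \<forall>x. \<bar>f x\<bar> \<le> B" if "continuous_on UNIV f" "\<And>x. x \<notin> S \<Longrightarrow> f x = 0" for f :: "real^'n \<Rightarrow> real"
  proof -
    have "bounded (f ` S)" by (intro compact_imp_bounded compact_continuous_image S continuous_on_subset[OF that(1)]) auto
    then obtain B where "\<forall>y\<in>f ` S. norm y \<le> B" unfolding bounded_iff by blast
    then have "\<bar>f x\<bar> \<le> \<bar>B\<bar>" for x using that(2)[of x] by (cases "x \<in> S") force+
    then show ?thesis by blast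
  qed
  obtain B0 where B0: "\<And>x. \<bar>\<phi> x\<bar> \<le> B0" using bnd[OF cont(1) out(1)] by blast
  have "\<exists>B. \<forall>x. \<bar>partial i \<phi> x\<bar> \<le> B" for i using bnd[OF cont(2) out(2)] by blast
  then obtain B1 where B1: "\<And>i x. \<bar>partial i \<phi> x\<bar> \<le> B1 i" by metis
  have iK: "integrable lborel (\<lambda>x. indicator ?U x *\<^sub>R (Kb x * partial i \<phi> x))" for i
    by (rule Bochner_Integration.integrable_bound[OF integrable_mult_left[OF Kb_outside[OF r], of "B1 i"]])
       (auto simp: abs_mult indicator_def intro!: mult_left_mono order.trans[OF B1] split: if_splits)
  have iD: "integrable lborel (\<lambda>x. indicator ?U x *\<^sub>R (DKb x $ i * \<phi> x))" for i
  proof (rule Bochner_Integration.integrable_bound[OF integrable_mult_left[OF integrable_norm[OF DKb_outside[OF r]], of B0]])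
    have "(\<lambda>x. (DKb x) \<bullet> axis i 1) \<in> borel_measurable borel" by measurable
    then have [measurable]: "(\<lambda>x. DKb x $ i) \<in> borel_measurable borel" by (simp add: inner_axis)
    show "(\<lambda>x. indicator ?U x *\<^sub>R (DKb x $ i * \<phi> x)) \<in> borel_measurable lborel" by measurable
    have "0 \<le> B0" using B0[of 0] by linarith
    have "\<bar>DKb x $ i\<bar> * \<bar>\<phi> x\<bar> \<le> norm (DKb x) * B0" for x
      by (intro mult_mono component_le_norm_cart B0) auto
    then show "AE x in lborel. norm (indicator ?U x *\<^sub>R (DKb x $ i * \<phi> x)) \<le> norm (norm (indicator ?U x *\<^sub>R DKb x) * B0)"
      using \<open>0 \<le> B0\<close> by (intro AE_I2) (auto simp: abs_mult indicator_def)
  qed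
  have weak: "(LINT x|lborel. indicator ?U x *\<^sub>R (Kb x * partial i \<phi> x)) = - (LINT x|lborel. indicator ?U x *\<^sub>R (DKb x $ i * \<phi> x))" for i
  proof -
    have sob: "(LINT x:?U|lebesgue. K x * partial i \<phi> x) = - (LINT x:?U|lebesgue. DK x $ i * \<phi> x)"
      using sobolev[OF r] \<phi> by (simp add: sobolev_W11_def interior_complement_ball[OF r])
    have conv: "(LINT x|lborel. indicator ?U x *\<^sub>R g x) = (LINT x:?U|lebesgue. f x)"
      if g: "integrable lborel (\<lambda>x. indicator ?U x *\<^sub>R g x)" and mf: "(\<lambda>x. indicator ?U x *\<^sub>R f x) \<in> borel_measurable lebesgue" and ae: "AE x in lborel. g x = f x" for f g :: "real^'n \<Rightarrow> real"
    proof -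
      have m: "(\<lambda>x. indicator ?U x *\<^sub>R g x) \<in> borel_measurable lborel" using g by (rule borel_measurable_integrable)
      have ae': "AE x in lebesgue. indicator ?U x *\<^sub>R g x = indicator ?U x *\<^sub>R f x"
        using AE_completion[OF ae] by eventually_elim simp
      have m': "(\<lambda>x. indicator ?U x *\<^sub>R g x) \<in> borel_measurable lebesgue" using m by (rule measurable_completion)
      show ?thesis
        unfolding set_lebesgue_integral_def integral_completion[OF m, symmetric]
        by (rule integral_cong_AE[OF m' mf ae'])
    qed
    have "AE x in lborel. Kb x * partial i \<phi> x = K x * partial i \<phi> x" using Kb(3) by eventually_elim simp
    moreover have "AE x in lborel. DKb x $ i * \<phi> x = DK x $ i * \<phi> x" using DKb(2) by eventually_elim simp
    moreover have "(\<lambda>x. indicator ?U x *\<^sub>R (K x * partial i \<phi> x)) \<in> borel_measurable lebesgue"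
    proof -
      have "(\<lambda>x. indicator ?U x * partial i \<phi> x) \<in> borel_measurable lebesgue" by (rule measurable_completion) simp
      then have "(\<lambda>x. (indicator ?U x * partial i \<phi> x) * (if x \<in> - {0} then K x else 0)) \<in> borel_measurable lebesgue"
        using K_lebesgue by (rule borel_measurable_times)
      moreover have "(\<lambda>x. (indicator ?U x * partial i \<phi> x) * (if x \<in> - {0} then K x else 0)) = (\<lambda>x. indicator ?U x *\<^sub>R (K x * partial i \<phi> x))"
        using r by (auto simp: fun_eq_iff indicator_def)
      ultimately show ?thesis by simp
    qed
    moreover have "(\<lambda>x. indicator ?U x *\<^sub>R (DK x $ i * \<phi> x)) \<in> borel_measurable lebesgue"
    proof -
      have "(\<lambda>x. indicator ?U x * \<phi> x) \<in> borel_measurable lebesgue" by (rule measurable_completion) simp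
      moreover have "(\<lambda>x. (if x \<in> - {0} then DK x else 0) \<bullet> axis i 1) \<in> borel_measurable lebesgue"
        using DK_lebesgue by (rule borel_measurable_inner) simp
      ultimately have "(\<lambda>x. (indicator ?U x * \<phi> x) * ((if x \<in> - {0} then DK x else 0) \<bullet> axis i 1)) \<in> borel_measurable lebesgue"
        by (rule borel_measurable_times)
      moreover have "(\<lambda>x. (indicator ?U x * \<phi> x) * ((if x \<in> - {0} then DK x else 0) \<bullet> axis i 1)) = (\<lambda>x. indicator ?U x *\<^sub>R (DK x $ i * \<phi> x))"
        using r by (auto simp: fun_eq_iff indicator_def inner_axis)
      ultimately show ?thesis by simp
    qed
    ultimately show ?thesis using sob conv[OF iK] conv[OF iD] by simp
  qed
  have "(\<lambda>x. indicator ?U x * (Kb x * D x + (DKb x \<bullet> e) * \<phi> x)) =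
     (\<lambda>x. \<Sum>i\<in>UNIV. e $ i * (indicator ?U x *\<^sub>R (Kb x * partial i \<phi> x)) + e $ i * (indicator ?U x *\<^sub>R (DKb x $ i * \<phi> x)))"
    by (auto simp: e inner_vec_def sum_distrib_left sum_distrib_right sum.distrib distrib_left mult_ac)
  then have "(LINT x|lborel. indicator ?U x * (Kb x * D x + (DKb x \<bullet> e) * \<phi> x)) =
     (\<Sum>i\<in>UNIV. e $ i * (LINT x|lborel. indicator ?U x *\<^sub>R (Kb x * partial i \<phi> x)) + e $ i * (LINT x|lborel. indicator ?U x *\<^sub>R (DKb x $ i * \<phi> x)))"
    using iK iD by (simp add: Bochner_Integration.integral_sum Bochner_Integration.integral_add)
  also have "\<dots> = 0" unfolding weak by simp
  finally show ?thesis .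
qed

end

section \<open>The weak gradient tested on cylinders\<close>

definition frame_proj :: "(real^'n::finite punctured \<Rightarrow> real^'n) \<Rightarrow> real^'n \<Rightarrow> real^'n punctured" where
  "frame_proj \<iota> x = (\<chi> j. x \<bullet> \<iota> (axis j 1))"

lemma frame_proj:
  assumes fr: "is_frame e \<iota>"
  shows "frame_proj \<iota> (\<iota> w + t *\<^sub>R e) = w"
    and "\<iota> (frame_proj \<iota> x) + (x \<bullet> e) *\<^sub>R e = x"
    and "(norm x)\<^sup>2 = (norm (frame_proj \<iota> x))\<^sup>2 + (x \<bullet> e)\<^sup>2"
    and "continuous_on UNIV (frame_proj \<iota>)"
proof -
  have ie: "\<iota> w \<bullet> e = 0" for w using fr by (simp add: is_frame_def)
  show 1: "frame_proj \<iota> (\<iota> w + t *\<^sub>R e) = w" for w t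
    using frame_inner[OF fr] ie by (simp add: frame_proj_def vec_eq_iff inner_add_left inner_commute[of e] inner_axis)
  show 2: "\<iota> (frame_proj \<iota> x) + (x \<bullet> e) *\<^sub>R e = x"
  proof -
    have "x - (x \<bullet> e) *\<^sub>R e \<in> range \<iota>"
      using fr by (simp add: is_frame_def hyperplane_def inner_diff_left norm_eq_1)
    then obtain w where "x - (x \<bullet> e) *\<^sub>R e = \<iota> w" by auto
    then have x: "x = \<iota> w + (x \<bullet> e) *\<^sub>R e" by (simp add: algebra_simps)
    then have "frame_proj \<iota> x = w" using 1[of w "x \<bullet> e"] by simp
    then show ?thesis using x by simp
  qed
  show "(norm x)\<^sup>2 = (norm (frame_proj \<iota> x))\<^sup>2 + (x \<bullet> e)\<^sup>2"
    using frame_norm[OF fr, of "frame_proj \<iota> x" "x \<bullet> e"] 2 by simp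
  show "continuous_on UNIV (frame_proj \<iota>)"
    unfolding frame_proj_def[abs_def] by (intro continuous_on_vec_lambda continuous_intros)
qed

text \<open>A smooth function that approximates from below the indicator of the cylinder over \<open>box a b\<close> in
  direction \<open>e\<close> and does not depend on the height.\<close>

definition box_bump :: "(real^'n::finite punctured \<Rightarrow> real^'n) \<Rightarrow> real^'n punctured \<Rightarrow> real^'n punctured \<Rightarrow> nat \<Rightarrow> real^'n \<Rightarrow> real" where
  "box_bump \<iota> a b k x = (\<Prod>j\<in>UNIV. smooth_step (real (Suc k) * (x \<bullet> \<iota> (axis j 1)) + - real (Suc k) * a $ j) *
      smooth_step (- real (Suc k) * (x \<bullet> \<iota> (axis j 1)) + real (Suc k) * b $ j))"

lemma C_k_box_bump: "C_k n UNIV (box_bump \<iota> a b k)"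
  unfolding box_bump_def[abs_def]
  by (intro C_k_prod C_k_mult C_k_compose_inner[of n "\<lambda>y. smooth_step (real (Suc k) * y + - real (Suc k) * a $ _)"]
      C_k_compose_inner[of n "\<lambda>y. smooth_step (- real (Suc k) * y + real (Suc k) * b $ _)"]
      C_real_compose_affine C_real_smooth_step) simp

lemma box_bump_bounds: "0 \<le> box_bump \<iota> a b k x" "box_bump \<iota> a b k x \<le> 1"
  unfolding box_bump_def
  by (auto intro!: prod_nonneg prod_le_1 mult_nonneg_nonneg mult_le_one smooth_step_bounds)

lemma box_bump_outside:
  assumes "frame_proj \<iota> x \<notin> box a b" shows "box_bump \<iota> a b k x = 0"
proof -
  obtain j where j: "x \<bullet> \<iota> (axis j 1) \<le> a $ j \<or> b $ j \<le> x \<bullet> \<iota> (axis j 1)"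
    using assms by (auto simp: mem_box_cart frame_proj_def not_less)
  have "smooth_step (real (Suc k) * (x \<bullet> \<iota> (axis j 1)) + - real (Suc k) * a $ j) *
      smooth_step (- real (Suc k) * (x \<bullet> \<iota> (axis j 1)) + real (Suc k) * b $ j) = 0"
  proof (cases "x \<bullet> \<iota> (axis j 1) \<le> a $ j")
    case True
    then have "real (Suc k) * (x \<bullet> \<iota> (axis j 1)) \<le> real (Suc k) * a $ j" by (intro mult_left_mono) auto
    then have "smooth_step (real (Suc k) * (x \<bullet> \<iota> (axis j 1)) + - real (Suc k) * a $ j) = 0"
      by (intro smooth_step_eq(1)) linarith
    then show ?thesis by (simp only: mult_zero_left)
  next
    case False
    then have "real (Suc k) * b $ j \<le> real (Suc k) * (x \<bullet> \<iota> (axis j 1))" using j by (intro mult_left_mono) auto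
    then have "smooth_step (- real (Suc k) * (x \<bullet> \<iota> (axis j 1)) + real (Suc k) * b $ j) = 0"
      by (intro smooth_step_eq(1)) linarith
    then show ?thesis by (simp only: mult_zero_right)
  qed
  then show ?thesis unfolding box_bump_def by (intro prod_zero) auto
qed

lemma box_bump_tendsto: "(\<lambda>k. box_bump \<iota> a b k x) \<longlonglongrightarrow> indicator (box a b) (frame_proj \<iota> x)"
proof (cases "frame_proj \<iota> x \<in> box a b")
  case True
  have one: "(\<lambda>k. smooth_step (real (Suc k) * p)) \<longlonglongrightarrow> 1" if "0 < p" for p
  proof (rule tendsto_eventually)
    obtain n0 where n0: "1 / p < real n0" using reals_Archimedean2 by blast
    show "eventually (\<lambda>k. smooth_step (real (Suc k) * p) = 1) sequentially"
      using eventually_ge_at_top[of n0]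
    proof eventually_elim
      case (elim k)
      then have "1 / p \<le> real (Suc k)" using n0 by linarith
      then show ?case using that by (intro smooth_step_eq) (simp add: field_simps)
    qed
  qed
  have "(\<lambda>k. box_bump \<iota> a b k x) \<longlonglongrightarrow> (\<Prod>j\<in>(UNIV :: 'a punctured set). 1 * 1)"
    unfolding box_bump_def
  proof (intro tendsto_prod tendsto_mult)
    fix j :: "'a punctured"
    have "0 < x \<bullet> \<iota> (axis j 1) - a $ j" "0 < b $ j - x \<bullet> \<iota> (axis j 1)"
      using True by (auto simp: mem_box_cart frame_proj_def)
    from this[THEN one]
    show "(\<lambda>k. smooth_step (real (Suc k) * (x \<bullet> \<iota> (axis j 1)) + - real (Suc k) * a $ j)) \<longlonglongrightarrow> 1"
      "(\<lambda>k. smooth_step (- real (Suc k) * (x \<bullet> \<iota> (axis j 1)) + real (Suc k) * b $ j)) \<longlonglongrightarrow> 1"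
      by (simp_all only: right_diff_distrib mult_minus_left add_uminus_conv_diff minus_add_distrib add.commute[of "- _"])
  qed
  then show ?thesis using True by simp
qed (simp add: box_bump_outside)

context planar_kernel begin

definition line_integrand :: "real^'n \<Rightarrow> real \<Rightarrow> real \<Rightarrow> real \<Rightarrow> real^'n \<Rightarrow> real" where
  "line_integrand e N s t x = Kb x * plateau_slope N s t (x \<bullet> e) + (DKb x \<bullet> e) * plateau N s t (x \<bullet> e)"

lemma line_integrand_measurable [measurable]: "line_integrand e N s t \<in> borel_measurable borel"
  unfolding line_integrand_def[abs_def] by measurable

lemma line_integrand_integrable:
  assumes r: "0 < r" and e: "norm e = 1"
  shows "integrable lborel (\<lambda>x. indicator (- cball 0 r) x *\<^sub>R line_integrand e N s t x)"
proof -
  obtain B where B: "\<And>\<tau>. \<bar>plateau_slope N s t \<tau>\<bar> \<le> B" using plateau_slope_bounded by blast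
  have B0: "0 \<le> B" using B[of 0] by linarith
  have dom: "integrable lborel (\<lambda>x. indicator (- cball 0 r) x *\<^sub>R Kb x * B + norm (indicator (- cball 0 r) x *\<^sub>R DKb x))"
    by (intro Bochner_Integration.integrable_add integrable_mult_left integrable_norm Kb_outside[OF r] DKb_outside[OF r])
  show ?thesis
  proof (rule Bochner_Integration.integrable_bound[OF dom])
    show "AE x in lborel. norm (indicator (- cball 0 r) x *\<^sub>R line_integrand e N s t x)
       \<le> norm (indicator (- cball 0 r) x *\<^sub>R Kb x * B + norm (indicator (- cball 0 r) x *\<^sub>R DKb x))"
    proof (rule AE_I2)
      fix x :: "real^'n"
      have "\<bar>Kb x * plateau_slope N s t (x \<bullet> e)\<bar> \<le> Kb x * B"
        using Kb(2)[of x] B by (simp add: abs_mult mult_left_mono)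
      moreover have "\<bar>(DKb x \<bullet> e) * plateau N s t (x \<bullet> e)\<bar> \<le> norm (DKb x) * 1"
        unfolding abs_mult using Cauchy_Schwarz_ineq2[of "DKb x" e] e by (intro mult_mono plateau_bound) auto
      ultimately have "\<bar>line_integrand e N s t x\<bar> \<le> Kb x * B + norm (DKb x)"
        unfolding line_integrand_def
        using abs_triangle_ineq[of "Kb x * plateau_slope N s t (x \<bullet> e)" "(DKb x \<bullet> e) * plateau N s t (x \<bullet> e)"] by linarith
      moreover have "0 \<le> Kb x * B" using Kb(2) B0 by simp
      ultimately show "norm (indicator (- cball 0 r) x *\<^sub>R line_integrand e N s t x)
         \<le> norm (indicator (- cball 0 r) x *\<^sub>R Kb x * B + norm (indicator (- cball 0 r) x *\<^sub>R DKb x))"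
        by (cases "x \<in> - cball 0 r") (simp_all only: indicator_simps, simp_all)
    qed
  qed simp
qed

text \<open>The function \<open>box_bump\<close> times the plateau in the height is a test function supported away from the
  origin: its support lies over \<open>cbox a b\<close>, whose points have norm greater than \<open>r\<close>. Its derivative in direction
  \<open>e\<close> falls on the plateau only. Let the bump tend to the indicator.\<close>

lemma box_integral_zero:
  assumes fr: "is_frame e \<iota>" and st: "s < t" and N: "1 \<le> N" and sub: "box a' b' \<subseteq> box a b"
    and r: "0 < r" "\<And>w. w \<in> cbox a b \<Longrightarrow> r < norm w"
  shows "(LINT x|lborel. indicator (- cball 0 r) x * (indicator (box a' b') (frame_proj \<iota> x) * line_integrand e N s t x)) = 0"
proof -
  let ?U = "- cball (0::real^'n) r"
  have e: "norm e = 1" using fr by (simp add: is_frame_def)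
  have [measurable]: "frame_proj \<iota> \<in> borel_measurable borel"
    by (rule borel_measurable_continuous_onI[OF frame_proj(4)[OF fr]])
  define \<phi> where "\<phi> k x = box_bump \<iota> a' b' k x * plateau N s t (x \<bullet> e)" for k x
  have zero: "(LINT x|lborel. indicator ?U x * (box_bump \<iota> a' b' k x * line_integrand e N s t x)) = 0" for k
  proof -
    have C: "C_k n UNIV (\<phi> k)" for n
      unfolding \<phi>_def by (intro C_k_mult C_k_box_bump C_k_compose_inner C_real_plateau)
    define S where "S = {x. frame_proj \<iota> x \<in> closure (box a' b') \<and> x \<bullet> e \<in> {s..t + 1}}"
    have cb: "closure (box a' b') \<subseteq> cbox a b"
      using closure_mono[OF sub] closure_minimal[of "box a b" "cbox a b"] box_subset_cbox by blast
    have "closed S"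
    proof -
      have "closed (frame_proj \<iota> -` closure (box a' b'))"
        by (intro closed_vimage continuous_on_closed_vimage[THEN iffD1, rule_format] closed_closure frame_proj(4)[OF fr])
      moreover have "closed ((\<lambda>x. x \<bullet> e) -` {s..t + 1})"
        by (intro closed_vimage closed_atLeastAtMost continuous_intros)
      moreover have "S = (frame_proj \<iota> -` closure (box a' b')) \<inter> ((\<lambda>x. x \<bullet> e) -` {s..t + 1})" by (auto simp: S_def)
      ultimately show ?thesis by (metis closed_Int)
    qed
    moreover have "bounded S"
    proof -
      obtain B where B: "\<And>w. w \<in> cbox a b \<Longrightarrow> norm w \<le> B" using bounded_cbox[of a b] by (auto simp: bounded_iff)
      have "norm x \<le> B + (\<bar>s\<bar> + \<bar>t + 1\<bar>)" if "x \<in> S" for x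
      proof -
        have "norm x \<le> norm (frame_proj \<iota> x) + \<bar>x \<bullet> e\<bar>"
        proof (rule power2_le_imp_le)
          have "(norm x)\<^sup>2 \<le> (norm (frame_proj \<iota> x))\<^sup>2 + (x \<bullet> e)\<^sup>2 + 2 * norm (frame_proj \<iota> x) * \<bar>x \<bullet> e\<bar>"
            unfolding frame_proj(3)[OF fr, of x] by simp
          then show "(norm x)\<^sup>2 \<le> (norm (frame_proj \<iota> x) + \<bar>x \<bullet> e\<bar>)\<^sup>2" by (simp only: power2_sum power2_abs)
        qed simp
        moreover have "norm (frame_proj \<iota> x) \<le> B" using that cb B by (auto simp: S_def)
        moreover have "\<bar>x \<bullet> e\<bar> \<le> \<bar>s\<bar> + \<bar>t + 1\<bar>" using that by (auto simp: S_def)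
        ultimately show ?thesis by linarith
      qed
      then show ?thesis unfolding bounded_iff by blast
    qed
    ultimately have cS: "compact S" by (simp add: compact_eq_bounded_closed)
    have "{x. \<phi> k x \<noteq> 0} \<subseteq> S"
    proof
      fix x assume "x \<in> {x. \<phi> k x \<noteq> 0}"
      then have "box_bump \<iota> a' b' k x \<noteq> 0" "plateau N s t (x \<bullet> e) \<noteq> 0" by (auto simp: \<phi>_def)
      then have "frame_proj \<iota> x \<in> box a' b'" "x \<bullet> e \<in> {s..t + 1}"
        using box_bump_outside plateau_outside(1)[OF N st] by (blast, force)
      then show "x \<in> S" using closure_subset by (auto simp: S_def)
    qed
    then have clS: "closure {x. \<phi> k x \<noteq> 0} \<subseteq> S" by (intro closure_minimal compact_imp_closed cS)
    have "S \<subseteq> ?U"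
    proof
      fix x assume "x \<in> S"
      then have "r < norm (frame_proj \<iota> x)" using cb r(2) by (auto simp: S_def)
      moreover have "(norm (frame_proj \<iota> x))\<^sup>2 \<le> (norm x)\<^sup>2" using frame_proj(3)[OF fr, of x] by simp
      then have "norm (frame_proj \<iota> x) \<le> norm x" by (rule power2_le_imp_le) simp
      ultimately show "x \<in> ?U" by simp
    qed
    then have test: "test_function ?U (\<phi> k)"
    proof -
      have "compact (S \<inter> closure {x. \<phi> k x \<noteq> 0})" by (intro compact_Int_closed cS closed_closure)
      then have "compact (closure {x. \<phi> k x \<noteq> 0})" using clS by (simp add: Int_absorb1)
      then show ?thesis unfolding test_function_def using C clS \<open>S \<subseteq> ?U\<close> by blast
    qed
    have D: "box_bump \<iota> a' b' k x * plateau_slope N s t (x \<bullet> e) = (\<Sum>i\<in>UNIV. e $ i * partial i (\<phi> k) x)" for x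
    proof -
      have "\<phi> k differentiable (at (x + 0 *\<^sub>R e))" using C[of 1] by simp
      from has_derivative_along_line[OF this]
      have 1: "((\<lambda>\<tau>. \<phi> k (x + \<tau> *\<^sub>R e)) has_real_derivative (\<Sum>i\<in>UNIV. partial i (\<phi> k) x * e $ i)) (at 0)" by simp
      have "e \<bullet> \<iota> (axis j 1) = 0" for j using fr by (simp add: is_frame_def inner_commute)
      then have "box_bump \<iota> a' b' k (x + \<tau> *\<^sub>R e) = box_bump \<iota> a' b' k x" for \<tau>
        by (simp add: box_bump_def inner_add_left)
      moreover have "(x + \<tau> *\<^sub>R e) \<bullet> e = x \<bullet> e + \<tau>" for \<tau> using e by (simp add: inner_add_left norm_eq_1)
      ultimately have "(\<lambda>\<tau>. \<phi> k (x + \<tau> *\<^sub>R e)) = (\<lambda>\<tau>. box_bump \<iota> a' b' k x * plateau N s t (x \<bullet> e + \<tau>))"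
        by (simp add: \<phi>_def)
      moreover have "((\<lambda>\<tau>. plateau N s t (x \<bullet> e + \<tau>)) has_real_derivative plateau_slope N s t (x \<bullet> e) * 1) (at 0)"
        by (rule DERIV_chain2[where f = "plateau N s t"]) (use plateau_has_derivative[of N s t "x \<bullet> e"] in \<open>auto intro!: derivative_eq_intros\<close>)
      ultimately have "((\<lambda>\<tau>. \<phi> k (x + \<tau> *\<^sub>R e)) has_real_derivative box_bump \<iota> a' b' k x * plateau_slope N s t (x \<bullet> e)) (at 0)"
        by (simp add: DERIV_cmult)
      from DERIV_unique[OF this 1] show ?thesis by (simp add: mult.commute)
    qed
    have "(LINT x|lborel. indicator ?U x * (Kb x * (box_bump \<iota> a' b' k x * plateau_slope N s t (x \<bullet> e)) + (DKb x \<bullet> e) * \<phi> k x)) = 0"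
      by (rule weak_directional_derivative[OF r(1) test D])
    moreover have "(\<lambda>x. indicator ?U x * (Kb x * (box_bump \<iota> a' b' k x * plateau_slope N s t (x \<bullet> e)) + (DKb x \<bullet> e) * \<phi> k x)) =
      (\<lambda>x. indicator ?U x * (box_bump \<iota> a' b' k x * line_integrand e N s t x))"
      by (simp add: fun_eq_iff \<phi>_def line_integrand_def distrib_left mult_ac)
    ultimately show ?thesis by simp
  qed
  have [measurable]: "box_bump \<iota> a' b' k \<in> borel_measurable borel" for k
    using C_k_box_bump[of 0] by (intro borel_measurable_continuous_onI) simp
  have "(\<lambda>k. LINT x|lborel. indicator ?U x * (box_bump \<iota> a' b' k x * line_integrand e N s t x)) \<longlonglongrightarrow>
     (LINT x|lborel. indicator ?U x * (indicator (box a' b') (frame_proj \<iota> x) * line_integrand e N s t x))"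
  proof (rule integral_dominated_convergence[OF _ _ integrable_norm[OF line_integrand_integrable[OF r(1) e, of N s t]]])
    show "AE x in lborel. (\<lambda>k. indicator ?U x * (box_bump \<iota> a' b' k x * line_integrand e N s t x)) \<longlonglongrightarrow>
       indicator ?U x * (indicator (box a' b') (frame_proj \<iota> x) * line_integrand e N s t x)"
      by (intro AE_I2 tendsto_mult tendsto_const box_bump_tendsto)
    show "AE x in lborel. norm (indicator ?U x * (box_bump \<iota> a' b' k x * line_integrand e N s t x)) \<le> norm (indicator ?U x *\<^sub>R line_integrand e N s t x)" for k
      using box_bump_bounds[of \<iota> a' b' k]
      by (intro AE_I2) (auto simp: abs_mult intro!: mult_left_mono mult_left_le_one_le)
  qed measurable
  then show ?thesis unfolding zero using LIMSEQ_unique tendsto_const by blast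
qed

end

section \<open>Increments of the kernel along almost every normal line\<close>

context planar_kernel begin

text \<open>By Fubini the previous lemma says that the line integrals, as a function of \<open>w\<close>, have integral 0 over
  every subbox.\<close>

lemma line_identity_AE:
  assumes fr: "is_frame e \<iota>" and st: "s < t" and N: "1 \<le> N" and nz: "0 \<notin> cbox a b"
  shows "AE w in lborel. w \<in> box a b \<longrightarrow> (LINT \<tau>|lborel. line_integrand e N s t (\<iota> w + \<tau> *\<^sub>R e)) = 0"
proof -
  have e: "norm e = 1" using fr by (simp add: is_frame_def)
  have P [measurable]: "frame_proj \<iota> \<in> borel_measurable borel"
    by (rule borel_measurable_continuous_onI[OF frame_proj(4)[OF fr]])
  obtain d where d: "0 < d" "ball 0 d \<subseteq> - cbox a b"
    using open_contains_ball[of "- cbox a b"] nz by (meson ComplI closed_cbox open_Compl)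
  define r where "r = d / 2"
  have r: "0 < r" "\<And>w. w \<in> cbox a b \<Longrightarrow> r < norm w"
  proof -
    show "0 < r" using d by (simp add: r_def)
    fix w assume "w \<in> cbox a b"
    then have "w \<notin> ball 0 d" using d(2) by blast
    then show "r < norm w" using d(1) by (simp add: r_def)
  qed
  let ?U = "- cball (0::real^'n) r"
  have out: "\<iota> w + \<tau> *\<^sub>R e \<in> ?U" if "w \<in> cbox a b" for w \<tau>
  proof -
    have "(norm w)\<^sup>2 \<le> (norm (\<iota> w + \<tau> *\<^sub>R e))\<^sup>2" using frame_norm[OF fr, of w \<tau>] by simp
    then have "norm w \<le> norm (\<iota> w + \<tau> *\<^sub>R e)" by (rule power2_le_imp_le) simp
    then show ?thesis using r(2)[OF that] by simp
  qed
  let ?f = "\<lambda>a' b' x. indicator ?U x * (indicator (box a' b') (frame_proj \<iota> x) * line_integrand e N s t x) :: real"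
  have int: "integrable lborel (?f a' b')" for a' b'
    by (rule Bochner_Integration.integrable_bound[OF line_integrand_integrable[OF r(1) e, of N s t]])
       (auto simp: abs_mult indicator_def)
  define G where "G w = (LINT \<tau>|lborel. ?f a b (\<iota> w + \<tau> *\<^sub>R e))" for w
  have Gi: "integrable lborel G" unfolding G_def by (rule integral_frame(2)[OF fr int])
  have G: "G w = indicator (box a b) w * (LINT \<tau>|lborel. line_integrand e N s t (\<iota> w + \<tau> *\<^sub>R e))" for w
  proof (cases "w \<in> box a b")
    case True
    then have "w \<in> cbox a b" using box_subset_cbox by blast
    then show ?thesis unfolding G_def using True out by (simp add: frame_proj(1)[OF fr] indicator_def)
  qed (simp add: G_def frame_proj(1)[OF fr])
  have "(LINT w:cbox p q|lborel. G w) = 0" for p q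
  proof -
    obtain a' b' where ab: "box a b \<inter> box p q = box a' b'" using box_Int_box by blast
    have "(LINT w:cbox p q|lborel. G w) = (LINT w|lborel. LINT \<tau>|lborel. ?f a' b' (\<iota> w + \<tau> *\<^sub>R e))"
      unfolding set_lebesgue_integral_def
    proof (rule integral_cong_AE)
      show "(\<lambda>w. indicator (cbox p q) w *\<^sub>R G w) \<in> borel_measurable lborel" using Gi by simp
      show "(\<lambda>w. LINT \<tau>|lborel. ?f a' b' (\<iota> w + \<tau> *\<^sub>R e)) \<in> borel_measurable lborel"
        using integral_frame(2)[OF fr int] by (rule borel_measurable_integrable)
      have "AE w in lebesgue. w \<notin> cbox p q - box p q"
        by (rule AE_not_in) (metis negligible_frontier_interval negligible_iff_null_sets)
      then have "AE w in lborel. w \<notin> cbox p q - box p q" by (simp add: AE_completion_iff)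
      then show "AE w in lborel. indicator (cbox p q) w *\<^sub>R G w = (LINT \<tau>|lborel. ?f a' b' (\<iota> w + \<tau> *\<^sub>R e))"
      proof eventually_elim
        case (elim w)
        have ind: "indicator (box a' b') w = (indicator (box p q) w * indicator (box a b) w :: real)"
          unfolding ab[symmetric] by (auto simp: indicator_def)
        have "indicator (cbox p q) w = (indicator (box p q) w :: real)"
          using elim box_subset_cbox[of p q] by (auto simp: indicator_def)
        then have "indicator (cbox p q) w *\<^sub>R G w = (LINT \<tau>|lborel. indicator (box p q) w * ?f a b (\<iota> w + \<tau> *\<^sub>R e))"
          by (simp only: G_def integral_mult_right_zero real_scaleR_def)
        also have "\<dots> = (LINT \<tau>|lborel. ?f a' b' (\<iota> w + \<tau> *\<^sub>R e))"
          by (simp only: frame_proj(1)[OF fr] ind mult_ac)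
        finally show ?case .
      qed
    qed
    also have "\<dots> = (LINT x|lborel. ?f a' b' x)" by (rule integral_frame(3)[OF fr int, symmetric])
    also have "\<dots> = 0"
    proof -
      have sub: "box a' b' \<subseteq> box a b" using ab by blast
      show ?thesis by (rule box_integral_zero[OF fr st N sub r])
    qed
    finally show ?thesis .
  qed
  then have "AE w in lborel. G w = 0" by (rule AE_zero_if_box_integrals_zero[OF Gi])
  then show ?thesis by eventually_elim (auto simp: G indicator_def split: if_splits)
qed

text \<open>The line \<open>\<iota> w + \<real> e\<close> is good enough for all later arguments.\<close>

definition line_regular :: "real^'n \<Rightarrow> (real^'n punctured \<Rightarrow> real^'n) \<Rightarrow> real^'n punctured \<Rightarrow> bool" where
  "line_regular e \<iota> w \<longleftrightarrow> continuous_on UNIV (\<lambda>\<tau>. K (\<iota> w + \<tau> *\<^sub>R e)) \<and>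
     (AE \<tau> in lborel. Kb (\<iota> w + \<tau> *\<^sub>R e) = K (\<iota> w + \<tau> *\<^sub>R e)) \<and>
     integrable lborel (\<lambda>\<tau>. norm (DKb (\<iota> w + \<tau> *\<^sub>R e))) \<and>
     (\<forall>t. \<bar>K (\<iota> w + t *\<^sub>R e) - K (\<iota> w)\<bar> \<le> (LINT \<tau>:{-\<bar>t\<bar>..\<bar>t\<bar>}|lborel. norm (DKb (\<iota> w + \<tau> *\<^sub>R e))))"

lemma abs_continuous_imp_continuous:
  assumes "\<And>a b. abs_continuous_on_Icc a b f" shows "continuous_on UNIV f"
  unfolding continuous_on_iff
proof (intro ballI allI impI)
  fix x \<epsilon> :: real assume "0 < \<epsilon>"
  have "\<exists>\<delta>>0. \<forall>\<D> S. \<D> division_of S \<and> S \<subseteq> {x - 1..x + 1} \<and> (\<Sum>I\<in>\<D>. Sup I - Inf I) < \<delta> \<longrightarrow>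
      (\<Sum>I\<in>\<D>. \<bar>f (Sup I) - f (Inf I)\<bar>) < \<epsilon>"
    by (rule assms[of "x - 1" "x + 1", unfolded abs_continuous_on_Icc_def, THEN spec, THEN mp, OF \<open>0 < \<epsilon>\<close>])
  then obtain \<delta> where \<delta>: "0 < \<delta>" "\<forall>\<D> S. \<D> division_of S \<and> S \<subseteq> {x - 1..x + 1} \<and> (\<Sum>I\<in>\<D>. Sup I - Inf I) < \<delta> \<longrightarrow>
      (\<Sum>I\<in>\<D>. \<bar>f (Sup I) - f (Inf I)\<bar>) < \<epsilon>" by (elim exE conjE)
  have key: "\<bar>f q - f p\<bar> < \<epsilon>" if "p \<le> q" "x - 1 \<le> p" "q \<le> x + 1" "q - p < \<delta>" for p q
  proof -
    have "{cbox p q} division_of (cbox p q)" using that by (intro division_of_self) auto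
    then show ?thesis using \<delta>(2)[rule_format, of "{cbox p q}" "cbox p q"] that by simp
  qed
  show "\<exists>d>0. \<forall>x'\<in>UNIV. dist x' x < d \<longrightarrow> dist (f x') (f x) < \<epsilon>"
  proof (intro exI[of _ "min \<delta> 1"] conjI ballI impI)
    show "0 < min \<delta> 1" using \<delta>(1) by simp
    fix y assume "dist y x < min \<delta> 1"
    then show "dist (f y) (f x) < \<epsilon>"
      using key[of x y] key[of y x] by (cases "x \<le> y") (auto simp: dist_real_def abs_minus_commute)
  qed
qed

text \<open>Only countably many pairs of end points can be treated outside a common null set of lines; continuity
  covers the others.\<close>

lemma increment_bound_from_rationals:
  fixes k d :: "real \<Rightarrow> real"
  assumes k: "continuous_on UNIV k" and d: "integrable lborel d" and n: "\<And>\<tau>. 0 \<le> d \<tau>"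
    and rat: "\<And>q r. q \<in> \<rat> \<Longrightarrow> r \<in> \<rat> \<Longrightarrow> q < r \<Longrightarrow> \<bar>k r - k q\<bar> \<le> (LINT \<tau>:{q<..r}|lborel. d \<tau>)"
  shows "\<bar>k t - k 0\<bar> \<le> (LINT \<tau>:{-\<bar>t\<bar>..\<bar>t\<bar>}|lborel. d \<tau>)" (is "_ \<le> ?I")
proof (rule ccontr)
  assume neg: "\<not> \<bar>k t - k 0\<bar> \<le> ?I"
  have sI: "set_integrable lborel A d" if "A \<in> sets borel" for A
    using integrable_mult_indicator[of A lborel d] d that by (simp add: set_integrable_def)
  have mono: "(LINT \<tau>:A|lborel. d \<tau>) \<le> ?I" if "A \<in> sets borel" "A \<subseteq> {-\<bar>t\<bar>..\<bar>t\<bar>}" for A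
    unfolding set_lebesgue_integral_def
    using sI[OF that(1)] sI[of "{-\<bar>t\<bar>..\<bar>t\<bar>}"] that(2) n
    by (intro integral_mono) (auto simp: set_integrable_def indicator_def)
  have "0 \<le> ?I" unfolding set_lebesgue_integral_def using n by (intro integral_nonneg_AE AE_I2) simp
  then have t0: "t \<noteq> 0" using neg by auto
  have rq: "\<bar>k q - k 0\<bar> \<le> ?I" if "q \<in> \<rat>" "\<bar>q\<bar> \<le> \<bar>t\<bar>" for q
  proof -
    consider "0 < q" | "q < 0" | "q = 0" by linarith
    then show ?thesis
    proof cases
      case 1
      then show ?thesis using rat[of 0 q] mono[of "{0<..q}"] that by fastforce
    next
      case 2
      then show ?thesis using rat[of q 0] mono[of "{q<..0}"] that by fastforce
    next
      case 3
      then show ?thesis using \<open>0 \<le> ?I\<close> by simp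
    qed
  qed
  define \<epsilon> where "\<epsilon> = \<bar>k t - k 0\<bar> - ?I"
  have "0 < \<epsilon>" using neg by (simp add: \<epsilon>_def)
  then obtain \<delta> where \<delta>: "0 < \<delta>" "\<And>y. dist y t < \<delta> \<Longrightarrow> dist (k y) (k t) < \<epsilon>"
    using k unfolding continuous_on_iff by blast
  have "\<exists>q\<in>\<rat>. \<bar>q\<bar> \<le> \<bar>t\<bar> \<and> dist q t < \<delta>"
  proof (cases "0 < t")
    case True
    obtain q where "q \<in> \<rat>" "max 0 (t - \<delta>) < q" "q < t"
      using Rats_dense_in_real[of "max 0 (t - \<delta>)" t] True \<delta>(1) by auto
    then show ?thesis by (intro bexI[of _ q]) (auto simp: dist_real_def)
  next
    case False
    obtain q where "q \<in> \<rat>" "t < q" "q < min 0 (t + \<delta>)"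
      using Rats_dense_in_real[of t "min 0 (t + \<delta>)"] False t0 \<delta>(1) by auto
    then show ?thesis by (intro bexI[of _ q]) (auto simp: dist_real_def)
  qed
  then obtain q where "q \<in> \<rat>" "\<bar>q\<bar> \<le> \<bar>t\<bar>" "dist q t < \<delta>" by blast
  then have "\<bar>k q - k 0\<bar> \<le> ?I" "\<bar>k q - k t\<bar> < \<epsilon>" using rq \<delta>(2) by (auto simp: dist_real_def)
  then show False unfolding \<epsilon>_def by linarith
qed

text \<open>The continuity of \<open>K\<close> on almost every line is the absolute continuity hypothesis, moved from
  Hausdorff to Lebesgue measure. The weak derivative identity is collected over rational end points and over
  countably many boxes that avoid the origin and cover all \<open>w \<noteq> 0\<close>.\<close>

lemma AE_line_regular:
  assumes fr: "is_frame e \<iota>"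
  shows "AE w in lborel. line_regular e \<iota> w"
proof -
  have e: "norm e = 1" using fr by (simp add: is_frame_def)
  have iso: "dist (\<iota> x) (\<iota> y) = dist x y" for x y
    using fr by (simp add: is_frame_def dist_norm linear_diff[symmetric])
  have D: "DIM(real^'n punctured) = CARD('n) - 1" using card_punctured[OF dim] by simp
  have "AE z in hausdorff_measure DIM(real^'n punctured). z \<in> range \<iota> \<longrightarrow> (\<forall>a b. abs_continuous_on_Icc a b (\<lambda>t. K (z + t *\<^sub>R e)))"
    using abs_continuous_on_lines[of e] e fr unfolding D by (simp add: is_frame_def)
  then have "AE w in lebesgue. \<forall>a b. abs_continuous_on_Icc a b (\<lambda>t. K (\<iota> w + t *\<^sub>R e))"
    by (rule AE_hausdorff_isometry[OF iso])
  then have a1: "AE w in lborel. continuous_on UNIV (\<lambda>\<tau>. K (\<iota> w + \<tau> *\<^sub>R e))"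
    unfolding AE_completion_iff by eventually_elim (blast intro: abs_continuous_imp_continuous)
  have a2: "AE w in lborel. AE \<tau> in lborel. Kb (\<iota> w + \<tau> *\<^sub>R e) = K (\<iota> w + \<tau> *\<^sub>R e)"
    by (rule AE_frame[OF fr Kb(3)])
  have nw: "norm w \<le> norm (\<iota> w + \<tau> *\<^sub>R e)" for w \<tau>
  proof -
    have "(norm w)\<^sup>2 \<le> (norm (\<iota> w + \<tau> *\<^sub>R e))\<^sup>2" using frame_norm[OF fr, of w \<tau>] by simp
    then show ?thesis by (rule power2_le_imp_le) simp
  qed
  have "AE w in lborel. \<forall>n. integrable lborel (\<lambda>\<tau>. norm (indicator (- cball 0 (1 / real (Suc n))) (\<iota> w + \<tau> *\<^sub>R e) *\<^sub>R DKb (\<iota> w + \<tau> *\<^sub>R e)))"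
    unfolding AE_all_countable
  proof
    fix n :: nat
    show "AE w in lborel. integrable lborel (\<lambda>\<tau>. norm (indicator (- cball 0 (1 / real (Suc n))) (\<iota> w + \<tau> *\<^sub>R e) *\<^sub>R DKb (\<iota> w + \<tau> *\<^sub>R e)))"
      by (rule integral_frame(1)[OF fr integrable_norm[OF DKb_outside]]) simp
  qed
  then have a3: "AE w in lborel. w \<noteq> 0 \<longrightarrow> integrable lborel (\<lambda>\<tau>. norm (DKb (\<iota> w + \<tau> *\<^sub>R e)))"
  proof eventually_elim
    case (elim w)
    show ?case
    proof
      assume "w \<noteq> 0"
      then obtain n where n: "1 / real (Suc n) < norm w" using nat_approx_posE[of "norm w"] by auto
      have "\<iota> w + \<tau> *\<^sub>R e \<in> - cball 0 (1 / real (Suc n))" for \<tau> using n nw[of w \<tau>] by simp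
      then have "indicator (- cball 0 (1 / real (Suc n))) (\<iota> w + \<tau> *\<^sub>R e) = (1::real)" for \<tau> by (simp only: indicator_simps)
      then show "integrable lborel (\<lambda>\<tau>. norm (DKb (\<iota> w + \<tau> *\<^sub>R e)))" using elim[rule_format, of n] by (simp only: scaleR_one)
    qed
  qed
  \<comment> \<open>boxes on which the coordinate \<open>j\<close> is bounded away from 0, with sign \<open>sg\<close>\<close>
  define A where "A j n sg = (\<chi> i. if i = j \<and> sg then 1 / real (Suc n) else - real (Suc n))" for j :: "'n punctured" and n :: nat and sg :: bool
  define B where "B j n sg = (\<chi> i. if i = j \<and> \<not> sg then - 1 / real (Suc n) else real (Suc n))" for j :: "'n punctured" and n :: nat and sg :: bool
  have nz: "0 \<notin> cbox (A j n sg) (B j n sg)" for j n sg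
  proof
    assume "0 \<in> cbox (A j n sg) (B j n sg)"
    then have "A j n sg $ j \<le> 0" "0 \<le> B j n sg $ j" by (auto simp: mem_box_cart)
    then show False by (cases sg) (auto simp: A_def B_def field_simps)
  qed
  have cover: "\<exists>j n sg. w \<in> box (A j n sg) (B j n sg)" if "w \<noteq> 0" for w
  proof -
    obtain j where j: "w $ j \<noteq> 0" using \<open>w \<noteq> 0\<close> by (auto simp: vec_eq_iff)
    obtain n1 where n1: "1 / real (Suc n1) < \<bar>w $ j\<bar>" using nat_approx_posE[of "\<bar>w $ j\<bar>"] j by auto
    obtain n2 where n2: "norm w < real n2" using reals_Archimedean2 by blast
    define n where "n = max n1 n2"
    have "1 / real (Suc n) \<le> 1 / real (Suc n1)" by (intro divide_left_mono) (auto simp: n_def)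
    then have 1: "1 / real (Suc n) < \<bar>w $ j\<bar>" using n1 by linarith
    have 2: "\<bar>w $ i\<bar> < real (Suc n)" for i using component_le_norm_cart[of w i] n2 by (simp add: n_def)
    have "w \<in> box (A j n (0 < w $ j)) (B j n (0 < w $ j))"
      unfolding mem_box_cart
    proof
      fix i
      show "A j n (0 < w $ j) $ i < w $ i \<and> w $ i < B j n (0 < w $ j) $ i"
        using 1 2[of i] by (auto simp: A_def B_def abs_less_iff abs_if split: if_splits)
    qed
    then show ?thesis by blast
  qed
  have a4: "AE w in lborel. \<forall>j\<in>UNIV. \<forall>n sg (s::rat) (t::rat) N. s < t \<longrightarrow> w \<in> box (A j n sg) (B j n sg) \<longrightarrow>
      (LINT \<tau>|lborel. line_integrand e (real (Suc N)) (of_rat s) (of_rat t) (\<iota> w + \<tau> *\<^sub>R e)) = 0"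
  proof (rule AE_finite_allI[OF finite], unfold AE_all_countable, intro allI)
    fix j n sg N and s t :: rat
    show "AE w in lborel. s < t \<longrightarrow> w \<in> box (A j n sg) (B j n sg) \<longrightarrow>
      (LINT \<tau>|lborel. line_integrand e (real (Suc N)) (of_rat s) (of_rat t) (\<iota> w + \<tau> *\<^sub>R e)) = 0"
    proof (cases "s < t")
      case True
      then have "(of_rat s :: real) < of_rat t" by (simp add: of_rat_less)
      from line_identity_AE[OF fr this _ nz, of "real (Suc N)" j n sg] show ?thesis by (rule eventually_mono) auto
    qed simp
  qed
  have a5: "AE w in lborel. w \<noteq> (0 :: real^'n punctured)" by (rule AE_lborel_singleton)
  from a1 a2 a3 a4 a5 show ?thesis
  proof eventually_elim
    case (elim w)
    define k where "k \<tau> = K (\<iota> w + \<tau> *\<^sub>R e)" for \<tau>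
    define d where "d \<tau> = DKb (\<iota> w + \<tau> *\<^sub>R e) \<bullet> e" for \<tau>
    have [measurable]: "(\<lambda>\<tau>. DKb (\<iota> w + \<tau> *\<^sub>R e)) \<in> borel_measurable borel" "(\<lambda>\<tau>. Kb (\<iota> w + \<tau> *\<^sub>R e)) \<in> borel_measurable borel" by measurable
    have kc: "continuous_on UNIV k" using elim(1) by (simp add: k_def[abs_def])
    then have [measurable]: "k \<in> borel_measurable borel" by (rule borel_measurable_continuous_onI)
    have dn: "integrable lborel (\<lambda>\<tau>. norm (DKb (\<iota> w + \<tau> *\<^sub>R e)))" using elim by simp
    have db: "\<bar>d \<tau>\<bar> \<le> norm (DKb (\<iota> w + \<tau> *\<^sub>R e))" for \<tau>
      using Cauchy_Schwarz_ineq2[of "DKb (\<iota> w + \<tau> *\<^sub>R e)" e] e by (simp add: d_def)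
    have dm [measurable]: "d \<in> borel_measurable borel" unfolding d_def by measurable
    have di: "integrable lborel d"
      by (rule Bochner_Integration.integrable_bound[OF dn]) (use db in auto)
    have rat: "\<bar>k t - k s\<bar> \<le> (LINT \<tau>:{s<..t}|lborel. norm (DKb (\<iota> w + \<tau> *\<^sub>R e)))"
      if st: "s \<in> \<rat>" "t \<in> \<rat>" "s < t" for s t
    proof -
      obtain j n sg where box: "w \<in> box (A j n sg) (B j n sg)" using cover elim by blast
      have "(LINT \<tau>|lborel. k \<tau> * plateau_slope (real (Suc N)) s t \<tau> + d \<tau> * plateau (real (Suc N)) s t \<tau>) = 0" for N
      proof -
        have "(LINT \<tau>|lborel. line_integrand e (real (Suc N)) s t (\<iota> w + \<tau> *\<^sub>R e)) = 0"
        proof -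
          obtain s' t' where "s = of_rat s'" "t = of_rat t'" using st by (auto elim!: Rats_cases)
          then show ?thesis using elim(4) st(3) box by (auto simp: of_rat_less)
        qed
        moreover have "(LINT \<tau>|lborel. line_integrand e (real (Suc N)) s t (\<iota> w + \<tau> *\<^sub>R e)) =
           (LINT \<tau>|lborel. k \<tau> * plateau_slope (real (Suc N)) s t \<tau> + d \<tau> * plateau (real (Suc N)) s t \<tau>)"
        proof (rule integral_cong_AE)
          show "AE \<tau> in lborel. line_integrand e (real (Suc N)) s t (\<iota> w + \<tau> *\<^sub>R e) = k \<tau> * plateau_slope (real (Suc N)) s t \<tau> + d \<tau> * plateau (real (Suc N)) s t \<tau>"
            using elim(2) by eventually_elim (simp add: line_integrand_def frame_height[OF fr] k_def d_def)
        qed measurable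
        ultimately show ?thesis by simp
      qed
      from increment_from_weak_derivative[OF kc di \<open>s < t\<close> this]
      have "\<bar>k t - k s\<bar> = \<bar>LINT \<tau>:{s<..t}|lborel. d \<tau>\<bar>" by simp
      also have "\<dots> \<le> (LINT \<tau>:{s<..t}|lborel. norm (DKb (\<iota> w + \<tau> *\<^sub>R e)))"
        unfolding set_lebesgue_integral_def real_norm_def[symmetric]
      proof (rule order.trans[OF integral_norm_bound], rule integral_mono)
        show "integrable lborel (\<lambda>x. norm (indicat_real {s<..t} x *\<^sub>R d x))"
          using integrable_mult_indicator[of "{s<..t}" lborel d] di by (intro integrable_norm) simp
        show "integrable lborel (\<lambda>\<tau>. indicat_real {s<..t} \<tau> *\<^sub>R norm (DKb (\<iota> w + \<tau> *\<^sub>R e)))"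
          using integrable_mult_indicator[of "{s<..t}" lborel, OF _ dn] by simp
        show "norm (indicat_real {s<..t} \<tau> *\<^sub>R d \<tau>) \<le> indicat_real {s<..t} \<tau> *\<^sub>R norm (DKb (\<iota> w + \<tau> *\<^sub>R e))" for \<tau>
          using db[of \<tau>] by (simp add: indicator_def)
      qed
      finally show ?thesis .
    qed
    have "\<bar>k t - k 0\<bar> \<le> (LINT \<tau>:{-\<bar>t\<bar>..\<bar>t\<bar>}|lborel. norm (DKb (\<iota> w + \<tau> *\<^sub>R e)))" for t
      by (rule increment_bound_from_rationals[OF kc dn _ rat]) auto
    then show ?case unfolding line_regular_def using elim dn by (simp add: k_def)
  qed
qed

end

section \<open>The second moment of the gradient is locally finite\<close>

lemma norm_proj_perp:
  fixes e y :: "real^'n::finite"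
  assumes "norm e = 1"
  shows "(norm (proj_perp e *v y))\<^sup>2 = (norm y)\<^sup>2 - (y \<bullet> e)\<^sup>2"
proof -
  have "tensor e e *v y = (y \<bullet> e) *\<^sub>R e"
    by (simp add: vec_eq_iff matrix_vector_mult_def tensor_def inner_vec_def sum_distrib_left mult_ac)
  then have "proj_perp e *v y = y - (y \<bullet> e) *\<^sub>R e"
    by (simp add: proj_perp_def matrix_vector_mult_diff_rdistrib)
  moreover have "e \<bullet> e = 1" using assms by (simp add: norm_eq_1)
  ultimately show ?thesis
    unfolding power2_norm_eq_inner
    by (simp add: inner_diff_left inner_diff_right inner_commute[of e y] power2_eq_square)
qed

lemma Q_iff:
  assumes "norm e = 1"
  shows "y \<in> Q l e \<longleftrightarrow> \<bar>y \<bullet> e\<bar> \<le> l / 2 * ((norm y)\<^sup>2 - (y \<bullet> e)\<^sup>2)"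
  by (simp add: Q_def norm_proj_perp[OF assms])

lemma Q_borel: "norm e = 1 \<Longrightarrow> Q l e \<in> sets borel"
proof -
  assume e: "norm e = 1"
  have "Q l e = {y. \<bar>y \<bullet> e\<bar> \<le> l / 2 * ((norm y)\<^sup>2 - (y \<bullet> e)\<^sup>2)}" using Q_iff[OF e] by auto
  then show ?thesis by simp
qed

context planar_kernel begin

text \<open>A lower bound of order \<open>l |x|\<close> for the measure of directions \<open>\<xi>\<close> (in an annulus instead of the
  sphere) that are nearly orthogonal to \<open>x\<close>; the numerical constants ensure that \<open>x\<close> lies in
  \<open>Q l (\<xi> / |\<xi>|)\<close> for all of them. In a frame for \<open>x / |x|\<close> the set contains a product \<open>V \<times> {-a..a}\<close> with a
  fixed ball \<open>V\<close> and \<open>a\<close> proportional to \<open>l |x|\<close>.\<close>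

lemma directions_volume:
  obtains \<kappa> where "0 < \<kappa>"
    "\<And>x l. x \<noteq> 0 \<Longrightarrow> 0 < l \<Longrightarrow> l * norm x \<le> 1 \<Longrightarrow>
       ennreal (l * norm x * \<kappa>) \<le> emeasure lborel {\<xi>::real^'n. 1/2 \<le> norm \<xi> \<and> norm \<xi> \<le> 1 \<and>
          \<bar>x \<bullet> \<xi>\<bar> * 2 \<le> norm x / 2 \<and> \<bar>x \<bullet> \<xi>\<bar> * 2 \<le> 3 / 16 * l * (norm x)\<^sup>2}"
proof -
  \<comment> \<open>the ball \<open>V\<close> lies in the annulus between the radii 1/2 and 3/4, which leaves room for the height\<close>
  define v0 :: "real^'n punctured" where "v0 = (5/8) *\<^sub>R axis undefined 1"
  define V where "V = ball v0 (1/8)"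
  define \<kappa> where "\<kappa> = 3 / 16 * measure lborel V"
  have Vb: "V \<in> sets borel" by (simp add: V_def)
  have mV: "0 < measure lborel V" unfolding V_def by (rule content_ball_pos) simp
  have eV: "emeasure lborel V = ennreal (measure lborel V)"
    unfolding V_def by (rule emeasure_eq_ennreal_measure) (simp add: emeasure_ball)
  have V: "1/2 \<le> norm v \<and> norm v \<le> 3/4" if "v \<in> V" for v
  proof -
    have "norm v0 = 5/8" by (simp add: v0_def norm_axis_1)
    moreover have "norm (v0 - v) < 1/8" using that by (simp add: V_def dist_norm)
    ultimately show ?thesis using norm_triangle_ineq2[of v0 v] norm_triangle_ineq2[of v v0] norm_minus_commute[of v v0] by linarith
  qed
  have "ennreal (l * norm x * \<kappa>) \<le> emeasure lborel {\<xi>::real^'n. 1/2 \<le> norm \<xi> \<and> norm \<xi> \<le> 1 \<and>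
          \<bar>x \<bullet> \<xi>\<bar> * 2 \<le> norm x / 2 \<and> \<bar>x \<bullet> \<xi>\<bar> * 2 \<le> 3 / 16 * l * (norm x)\<^sup>2}"
    (is "_ \<le> emeasure lborel ?T") if x: "x \<noteq> 0" and l: "0 < l" "l * norm x \<le> 1" for x l
  proof -
    define u where "u = x /\<^sub>R norm x"
    define a where "a = 3 / 32 * (l * norm x)"
    have u: "norm u = 1" "x = norm x *\<^sub>R u" using x by (simp_all add: u_def)
    have a: "0 \<le> a" "a \<le> 3/32" using l by (auto simp: a_def)
    obtain \<iota> where fr: "is_frame u \<iota>" using exists_frame[OF dim u(1)] by blast
    have T [measurable]: "?T \<in> sets borel" by measurable
    have sub: "\<iota> v + t *\<^sub>R u \<in> ?T" if v: "v \<in> V" and t: "\<bar>t\<bar> \<le> a" for v t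
    proof -
      have xi: "x \<bullet> (\<iota> v + t *\<^sub>R u) = norm x * t"
        using frame_height[OF fr, of v t] u(2) by (metis inner_commute inner_scaleR_left)
      have t2: "t\<^sup>2 \<le> (3/32)\<^sup>2" using t a by (intro abs_le_square_iff[THEN iffD1]) auto
      have n2: "(norm (\<iota> v + t *\<^sub>R u))\<^sup>2 = (norm v)\<^sup>2 + t\<^sup>2" by (rule frame_norm[OF fr])
      have "(1/2)\<^sup>2 \<le> (norm v)\<^sup>2" "(norm v)\<^sup>2 \<le> (3/4)\<^sup>2" using V[OF v] by (intro power_mono; simp)+
      then have "(1/2)\<^sup>2 \<le> (norm (\<iota> v + t *\<^sub>R u))\<^sup>2" "(norm (\<iota> v + t *\<^sub>R u))\<^sup>2 \<le> 1\<^sup>2"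
      proof -
        show "(1/2)\<^sup>2 \<le> (norm (\<iota> v + t *\<^sub>R u))\<^sup>2"
          using n2 \<open>(1/2)\<^sup>2 \<le> (norm v)\<^sup>2\<close> zero_le_power2[of t] by linarith
        have "(3/4)\<^sup>2 + (3/32)\<^sup>2 \<le> (1::real)\<^sup>2" by (simp add: power2_eq_square)
        then show "(norm (\<iota> v + t *\<^sub>R u))\<^sup>2 \<le> 1\<^sup>2"
          using n2 \<open>(norm v)\<^sup>2 \<le> (3/4)\<^sup>2\<close> t2 by linarith
      qed
      then have "1/2 \<le> norm (\<iota> v + t *\<^sub>R u)" "norm (\<iota> v + t *\<^sub>R u) \<le> 1"
        by (auto intro: power2_le_imp_le)
      moreover have "\<bar>norm x * t\<bar> * 2 \<le> norm x / 2"
        using mult_left_mono[of "\<bar>t\<bar>" "1/4" "norm x"] t a by (simp add: abs_mult)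
      moreover have "\<bar>norm x * t\<bar> * 2 \<le> 3 / 16 * l * (norm x)\<^sup>2"
        using mult_left_mono[OF t, of "norm x"] by (simp add: abs_mult a_def power2_eq_square mult_ac)
      ultimately show ?thesis by (simp add: xi)
    qed
    have "ennreal (l * norm x * \<kappa>) = emeasure lborel V * emeasure lborel {-a..a}"
      using a l mV unfolding eV by (simp add: \<kappa>_def a_def ennreal_mult[symmetric])
    also have "\<dots> = (\<integral>\<^sup>+v. (\<integral>\<^sup>+t. indicator V v * indicator {-a..a} t \<partial>lborel) \<partial>lborel)"
      using Vb by (simp add: nn_integral_cmult nn_integral_multc)
    also have "\<dots> \<le> (\<integral>\<^sup>+v. (\<integral>\<^sup>+t. indicator ?T (\<iota> v + t *\<^sub>R u) \<partial>lborel) \<partial>lborel)"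
    proof (intro nn_integral_mono)
      fix v :: "real^'n punctured" and t :: real
      show "indicator V v * indicator {-a..a} t \<le> (indicator ?T (\<iota> v + t *\<^sub>R u) :: ennreal)"
        using sub[of v t] by (cases "v \<in> V \<and> t \<in> {-a..a}") (auto simp: abs_le_iff)
    qed
    also have "\<dots> = (\<integral>\<^sup>+\<xi>. indicator ?T \<xi> \<partial>lborel)" by (rule nn_integral_frame[OF fr, symmetric]) simp
    also have "\<dots> = emeasure lborel ?T" by simp
    finally show ?thesis .
  qed
  moreover have "0 < \<kappa>" using mV by (simp add: \<kappa>_def)
  ultimately show ?thesis using that by blast
qed

lemma weighted_gradient_Q:
  assumes e: "norm e = 1" and l: "0 < l"
  shows "(\<integral>\<^sup>+x. ennreal (norm x * norm (DKb x)) * indicator (Q l e) x \<partial>lborel) = ennreal (LINT y:Q l e|lebesgue. norm (DK y) * norm y)"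
proof -
  have s: "set_integrable lebesgue (Q l e) (\<lambda>y. norm (DK y) * norm y)"
    using integrable_Q[of e l] e l by (simp add: mult.commute)
  have ae: "AE x in lborel. norm (DKb x) * norm x = norm (DK x) * norm x"
    using DKb(2) by eventually_elim simp
  note * = set_integrable_borel_version[OF s Q_borel[OF e] _ ae]
  have "(\<integral>\<^sup>+x. ennreal (norm x * norm (DKb x)) * indicator (Q l e) x \<partial>lborel) =
     (\<integral>\<^sup>+x. ennreal (indicator (Q l e) x *\<^sub>R (norm (DKb x) * norm x)) \<partial>lborel)"
    by (intro nn_integral_cong) (simp add: indicator_def mult.commute)
  also have "\<dots> = ennreal (LINT x|lborel. indicator (Q l e) x *\<^sub>R (norm (DKb x) * norm x))"
    by (rule nn_integral_eq_integral[OF *(1)]) auto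
  finally show ?thesis using *(2) by simp
qed

lemma eventually_gradient_bound:
  obtains b where "0 < b" "\<And>e. norm e = 1 \<Longrightarrow>
    eventually (\<lambda>n. ennreal (real (Suc n)) * (\<integral>\<^sup>+x. ennreal (norm x * norm (DKb x)) * indicator (Q (1 / real (Suc n)) e) x \<partial>lborel) \<le> ennreal b) sequentially"
proof -
  obtain b where b: "0 < b" "\<And>e. e \<in> sphere 0 1 \<Longrightarrow>
      Limsup (at_right 0) (\<lambda>l. ereal (1 / l * (LINT y:Q l e|lebesgue. norm (DK y) * norm y))) \<le> ereal b"
    using small_Q_gradient by blast
  have "eventually (\<lambda>n. ennreal (real (Suc n)) * (\<integral>\<^sup>+x. ennreal (norm x * norm (DKb x)) * indicator (Q (1 / real (Suc n)) e) x \<partial>lborel) \<le> ennreal (b + 1)) sequentially"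
    if e: "norm e = 1" for e
  proof -
    have "Limsup (at_right 0) (\<lambda>l. ereal (1 / l * (LINT y:Q l e|lebesgue. norm (DK y) * norm y))) < ereal (b + 1)"
      using b(2)[of e] e by (simp add: le_less_trans)
    then have "eventually (\<lambda>l. ereal (1 / l * (LINT y:Q l e|lebesgue. norm (DK y) * norm y)) < ereal (b + 1)) (at_right 0)"
      by (rule Limsup_lessD)
    moreover have "filterlim (\<lambda>n. 1 / real (Suc n)) (at_right 0) sequentially"
      unfolding filterlim_at using LIMSEQ_Suc[OF lim_const_over_n[of "1::real"]] by simp
    ultimately have "eventually (\<lambda>n. ereal (1 / (1 / real (Suc n)) * (LINT y:Q (1 / real (Suc n)) e|lebesgue. norm (DK y) * norm y)) < ereal (b + 1)) sequentially"
      by (rule eventually_compose_filterlim)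
    then show ?thesis
    proof eventually_elim
      case (elim n)
      have "ennreal (real (Suc n)) * (\<integral>\<^sup>+x. ennreal (norm x * norm (DKb x)) * indicator (Q (1 / real (Suc n)) e) x \<partial>lborel)
        = ennreal (real (Suc n) * (LINT y:Q (1 / real (Suc n)) e|lebesgue. norm (DK y) * norm y))"
      proof -
        have pos: "0 < 1 / real (Suc n)" by simp
        show ?thesis unfolding weighted_gradient_Q[OF e pos] by (rule ennreal_mult'[symmetric]) simp
      qed
      also have "\<dots> \<le> ennreal (b + 1)" using elim by (intro ennreal_leI) simp
      finally show ?case .
    qed
  qed
  then show ?thesis using that[of "b + 1"] b(1) by simp
qed

text \<open>A truncation of \<open>|x| |DK x|\<close> that is bounded and vanishes near the origin. The truncation provides the
  majorant for the reverse Fatou lemma below.\<close>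

definition kernel_weight :: "nat \<Rightarrow> real^'n \<Rightarrow> real" where
  "kernel_weight k x = (if 1 / real (Suc k) \<le> norm x then min (norm x * norm (DKb x)) (real k) else 0)"

lemma kernel_weight: "kernel_weight k \<in> borel_measurable borel" "0 \<le> kernel_weight k x"
  "kernel_weight k x \<le> norm x * norm (DKb x)" "kernel_weight k x \<le> real k"
proof -
  have "kernel_weight k = (\<lambda>x. indicator {x. 1 / real (Suc k) \<le> norm x} x * min (norm x * norm (DKb x)) (real k))"
    by (auto simp: kernel_weight_def fun_eq_iff indicator_def)
  then show "kernel_weight k \<in> borel_measurable borel" by simp
qed (auto simp: kernel_weight_def)

text \<open>Integrate \<open>n \<integral>\<^sub>Q w\<close> over directions, where \<open>Q\<close> has parameter \<open>1 / n\<close> and \<open>w\<close> is the truncated weight. For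
  fixed direction the limes superior is bounded by hypothesis, and truncation gives a bound
  uniform in \<open>n\<close>, so that the reverse Fatou lemma bounds the limes superior of the averages. By Fubini and
  \<open>directions_volume\<close> the averages are at least \<open>\<kappa>\<close> times the first moment of \<open>w\<close>. The bound does not depend on
  the level of truncation.\<close>

lemma truncated_moment_bound:
  assumes R: "0 < R"
  obtains C where "0 \<le> C" "\<And>k. (\<integral>\<^sup>+x. ennreal (kernel_weight k x * norm x) * indicator (cball 0 R) x \<partial>lborel) \<le> ennreal C"
proof -
  obtain b where b: "0 < b" "\<And>e. norm e = 1 \<Longrightarrow>
    eventually (\<lambda>n. ennreal (real (Suc n)) * (\<integral>\<^sup>+x. ennreal (norm x * norm (DKb x)) * indicator (Q (1 / real (Suc n)) e) x \<partial>lborel) \<le> ennreal b) sequentially"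
    using eventually_gradient_bound by blast
  obtain \<kappa> where \<kappa>: "0 < \<kappa>"
    "\<And>x l. x \<noteq> 0 \<Longrightarrow> 0 < l \<Longrightarrow> l * norm x \<le> 1 \<Longrightarrow>
       ennreal (l * norm x * \<kappa>) \<le> emeasure lborel {\<xi>::real^'n. 1/2 \<le> norm \<xi> \<and> norm \<xi> \<le> 1 \<and>
          \<bar>x \<bullet> \<xi>\<bar> * 2 \<le> norm x / 2 \<and> \<bar>x \<bullet> \<xi>\<bar> * 2 \<le> 3 / 16 * l * (norm x)\<^sup>2}"
    using directions_volume by blast
  define S where "S = {\<xi>::real^'n. 1/2 \<le> norm \<xi> \<and> norm \<xi> \<le> 1}"
  have Sb [measurable]: "S \<in> sets borel" unfolding S_def by measurable
  define vS where "vS = measure lborel (cball (0::real^'n) 1)"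
  have vS: "emeasure lborel S \<le> ennreal vS"
  proof -
    have "emeasure lborel S \<le> emeasure lborel (cball (0::real^'n) 1)" by (rule emeasure_mono) (auto simp: S_def)
    also have "\<dots> = ennreal vS" unfolding vS_def by (rule emeasure_eq_ennreal_measure) (simp add: emeasure_cball)
    finally show ?thesis .
  qed
  define C where "C = b * vS / \<kappa>"
  have "(\<integral>\<^sup>+x. ennreal (kernel_weight k x * norm x) * indicator (cball 0 R) x \<partial>lborel) \<le> ennreal C" for k
  proof -
    note [measurable] = kernel_weight(1)
    have [measurable]: "cball (0::real^'n) R \<in> sets borel" by simp
    define w where "w x = ennreal (kernel_weight k x) * indicator (cball 0 R) x" for x
    have wm [measurable]: "w \<in> borel_measurable borel" unfolding w_def by measurable
    \<comment> \<open>the condition \<open>x \<in> Q (1 / Suc n) (\<xi> / |\<xi>|)\<close> without division, so that it is visibly measurable in both variables\<close>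
    define c where "c n x \<xi> = (if \<bar>x \<bullet> \<xi>\<bar> * norm \<xi> \<le> 1 / real (Suc n) / 2 * ((norm x)\<^sup>2 * (norm \<xi>)\<^sup>2 - (x \<bullet> \<xi>)\<^sup>2) \<and> 1/2 \<le> norm \<xi> \<and> norm \<xi> \<le> 1 then 1 else 0 :: ennreal)"
      for n :: nat and x \<xi> :: "real^'n"
    have cm [measurable]: "(\<lambda>(x, \<xi>). c n x \<xi>) \<in> borel_measurable (borel \<Otimes>\<^sub>M borel)" for n
      unfolding c_def by measurable
    have cQ: "c n x \<xi> = indicator (Q (1 / real (Suc n)) (\<xi> /\<^sub>R norm \<xi>)) x * indicator S \<xi>" for n x \<xi>
    proof (cases "\<xi> \<in> S")
      case True
      then have n0: "0 < norm \<xi>" by (auto simp: S_def intro: less_le_trans[of 0 "1/2"])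
      then have u: "norm (\<xi> /\<^sub>R norm \<xi>) = 1" by simp
      have i: "x \<bullet> (\<xi> /\<^sub>R norm \<xi>) = (x \<bullet> \<xi>) / norm \<xi>" by (simp add: divide_inverse mult.commute)
      have "x \<in> Q (1 / real (Suc n)) (\<xi> /\<^sub>R norm \<xi>) \<longleftrightarrow>
         \<bar>x \<bullet> \<xi>\<bar> / norm \<xi> \<le> 1 / real (Suc n) / 2 * ((norm x)\<^sup>2 - ((x \<bullet> \<xi>) / norm \<xi>)\<^sup>2)"
        unfolding Q_iff[OF u] i using n0 by (simp add: abs_divide)
      also have "\<dots> \<longleftrightarrow> \<bar>x \<bullet> \<xi>\<bar> / norm \<xi> * (norm \<xi>)\<^sup>2 \<le> 1 / real (Suc n) / 2 * ((norm x)\<^sup>2 - ((x \<bullet> \<xi>) / norm \<xi>)\<^sup>2) * (norm \<xi>)\<^sup>2"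
        using n0 by (intro mult_le_cancel_right_pos[symmetric]) simp
      also have "\<bar>x \<bullet> \<xi>\<bar> / norm \<xi> * (norm \<xi>)\<^sup>2 = \<bar>x \<bullet> \<xi>\<bar> * norm \<xi>" using n0 by (simp add: power2_eq_square)
      also have "1 / real (Suc n) / 2 * ((norm x)\<^sup>2 - ((x \<bullet> \<xi>) / norm \<xi>)\<^sup>2) * (norm \<xi>)\<^sup>2 =
         1 / real (Suc n) / 2 * ((norm x)\<^sup>2 * (norm \<xi>)\<^sup>2 - (x \<bullet> \<xi>)\<^sup>2)"
        using n0 by (simp add: power_divide left_diff_distrib mult.assoc)
      finally show ?thesis using True by (auto simp: c_def S_def indicator_def)
    qed (auto simp: c_def S_def)
    define u where "u n \<xi> = ennreal (real (Suc n)) * (\<integral>\<^sup>+x. w x * c n x \<xi> \<partial>lborel)" for n \<xi>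
    have um [measurable]: "u n \<in> borel_measurable borel" for n
      unfolding u_def by measurable
    \<comment> \<open>the weight is at most \<open>k\<close> and the slab containing \<open>Q\<close> has volume of order \<open>1 / n\<close>, whence a majorant independent of \<open>n\<close>\<close>
    define D where "D = real k * R\<^sup>2 * (2 * R) ^ (CARD('n) - 1)"
    have D0: "0 \<le> D" using R by (simp add: D_def)
    have udom: "u n \<xi> \<le> ennreal D * indicator S \<xi>" for n \<xi>
    proof (cases "\<xi> \<in> S")
      case True
      then have n0: "0 < norm \<xi>" by (auto simp: S_def intro: less_le_trans[of 0 "1/2"])
      define e where "e = \<xi> /\<^sub>R norm \<xi>"
      have e: "norm e = 1" using n0 by (simp add: e_def)
      let ?A = "{z. \<bar>z \<bullet> e\<bar> \<le> 1 / real (Suc n) / 2 * R\<^sup>2 \<and> norm z \<le> R}"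
      have "(\<integral>\<^sup>+x. w x * c n x \<xi> \<partial>lborel) \<le> (\<integral>\<^sup>+x. ennreal (real k) * indicator ?A x \<partial>lborel)"
      proof (rule nn_integral_mono)
        fix x
        show "w x * c n x \<xi> \<le> ennreal (real k) * indicator ?A x"
        proof (cases "x \<in> Q (1 / real (Suc n)) e \<and> norm x \<le> R")
          case True
          have "\<bar>x \<bullet> e\<bar> \<le> 1 / real (Suc n) / 2 * ((norm x)\<^sup>2 - (x \<bullet> e)\<^sup>2)" using True Q_iff[OF e] by blast
          also have "\<dots> \<le> 1 / real (Suc n) / 2 * R\<^sup>2"
            using True power_mono[of "norm x" R 2] by (intro mult_left_mono) (auto intro: order.trans[of _ "(norm x)\<^sup>2"])
          finally have "x \<in> ?A" using True by simp
          moreover have "w x * c n x \<xi> \<le> ennreal (real k) * 1"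
            unfolding w_def using kernel_weight(4)[of k x] by (intro mult_mono) (auto simp: indicator_def c_def ennreal_leI)
          ultimately show ?thesis by simp
        next
          case False
          then show ?thesis by (auto simp: w_def cQ e_def[symmetric])
        qed
      qed
      also have "\<dots> = ennreal (real k) * emeasure lborel ?A" by (rule nn_integral_cmult_indicator) simp
      also have "\<dots> \<le> ennreal (real k) * ennreal (2 * (1 / real (Suc n) / 2 * R\<^sup>2) * (2 * R) ^ (CARD('n) - 1))"
        using R by (intro mult_left_mono slab_volume[OF dim e]) auto
      finally have "u n \<xi> \<le> ennreal (real (Suc n)) * (ennreal (real k) * ennreal (2 * (1 / real (Suc n) / 2 * R\<^sup>2) * (2 * R) ^ (CARD('n) - 1)))"
        unfolding u_def by (intro mult_left_mono) auto
      also have "\<dots> = ennreal D"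
        using R by (simp add: D_def ennreal_mult[symmetric] del: of_nat_Suc)
      finally show ?thesis using True by simp
    qed (simp add: u_def cQ)
    have ulim: "limsup (\<lambda>n. u n \<xi>) \<le> ennreal b * indicator S \<xi>" for \<xi>
    proof (cases "\<xi> \<in> S")
      case True
      then have n0: "0 < norm \<xi>" by (auto simp: S_def intro: less_le_trans[of 0 "1/2"])
      then have e: "norm (\<xi> /\<^sub>R norm \<xi>) = 1" by simp
      have "eventually (\<lambda>n. u n \<xi> \<le> ennreal b) sequentially"
        using b(2)[OF e]
      proof eventually_elim
        case (elim n)
        have "(\<integral>\<^sup>+x. w x * c n x \<xi> \<partial>lborel) \<le> (\<integral>\<^sup>+x. ennreal (norm x * norm (DKb x)) * indicator (Q (1 / real (Suc n)) (\<xi> /\<^sub>R norm \<xi>)) x \<partial>lborel)"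
        proof (rule nn_integral_mono)
          fix x
          have "w x \<le> ennreal (norm x * norm (DKb x)) * 1"
            unfolding w_def using kernel_weight(3)[of k x] by (intro mult_mono) (auto simp: indicator_def ennreal_leI)
          then show "w x * c n x \<xi> \<le> ennreal (norm x * norm (DKb x)) * indicator (Q (1 / real (Suc n)) (\<xi> /\<^sub>R norm \<xi>)) x"
            unfolding cQ using True by (intro mult_mono) (auto simp: indicator_def)
        qed
        then have "u n \<xi> \<le> ennreal (real (Suc n)) * (\<integral>\<^sup>+x. ennreal (norm x * norm (DKb x)) * indicator (Q (1 / real (Suc n)) (\<xi> /\<^sub>R norm \<xi>)) x \<partial>lborel)"
          unfolding u_def by (intro mult_left_mono) auto
        also have "\<dots> \<le> ennreal b" by (rule elim)
        finally show ?case .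
      qed
      then have "limsup (\<lambda>n. u n \<xi>) \<le> ennreal b" by (rule Limsup_bounded)
      then show ?thesis using True by simp
    next
      case False
      have "limsup (\<lambda>n. u n \<xi>) \<le> 0" by (rule Limsup_bounded) (use False in \<open>simp add: u_def cQ\<close>)
      then show ?thesis using False by simp
    qed
    have "limsup (\<lambda>n. \<integral>\<^sup>+\<xi>. u n \<xi> \<partial>lborel) \<le> (\<integral>\<^sup>+\<xi>. limsup (\<lambda>n. u n \<xi>) \<partial>lborel)"
    proof (rule nn_integral_limsup[where w = "\<lambda>\<xi>. ennreal D * indicator S \<xi>"])
      have "(\<integral>\<^sup>+\<xi>. ennreal D * indicator S \<xi> \<partial>lborel) = ennreal D * emeasure lborel S"
        by (rule nn_integral_cmult_indicator) simp
      also have "\<dots> \<le> ennreal D * ennreal vS" using vS by (intro mult_left_mono) auto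
      also have "\<dots> < \<infinity>" by (simp add: ennreal_mult_less_top)
      finally show "(\<integral>\<^sup>+\<xi>. ennreal D * indicator S \<xi> \<partial>lborel) < \<infinity>" .
    qed (use udom in auto)
    also have "\<dots> \<le> (\<integral>\<^sup>+\<xi>. ennreal b * indicator S \<xi> \<partial>lborel)" by (intro nn_integral_mono ulim)
    also have "\<dots> = ennreal b * emeasure lborel S" by (rule nn_integral_cmult_indicator) simp
    also have "\<dots> \<le> ennreal b * ennreal vS" using vS by (intro mult_left_mono) auto
    finally have up: "limsup (\<lambda>n. \<integral>\<^sup>+\<xi>. u n \<xi> \<partial>lborel) \<le> ennreal (b * vS)"
      using b(1) by (simp add: ennreal_mult vS_def)
    have low: "ennreal \<kappa> * (\<integral>\<^sup>+x. w x * ennreal (norm x) \<partial>lborel) \<le> (\<integral>\<^sup>+\<xi>. u n \<xi> \<partial>lborel)" if n: "R \<le> real (Suc n)" for n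
    proof -
      have "ennreal \<kappa> * (\<integral>\<^sup>+x. w x * ennreal (norm x) \<partial>lborel) = (\<integral>\<^sup>+x. ennreal \<kappa> * (w x * ennreal (norm x)) \<partial>lborel)"
        by (rule nn_integral_cmult[symmetric]) simp
      also have "\<dots> \<le> (\<integral>\<^sup>+x. (\<integral>\<^sup>+\<xi>. ennreal (real (Suc n)) * (w x * c n x \<xi>) \<partial>lborel) \<partial>lborel)"
      proof (rule nn_integral_mono)
        fix x :: "real^'n"
        show "ennreal \<kappa> * (w x * ennreal (norm x)) \<le> (\<integral>\<^sup>+\<xi>. ennreal (real (Suc n)) * (w x * c n x \<xi>) \<partial>lborel)"
        proof (cases "x \<noteq> 0 \<and> norm x \<le> R")
          case True
          define l where "l = 1 / real (Suc n)"
          have l: "0 < l" "l * norm x \<le> 1" using True n by (auto simp: l_def field_simps)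
          let ?T = "{\<xi>::real^'n. 1/2 \<le> norm \<xi> \<and> norm \<xi> \<le> 1 \<and>
            \<bar>x \<bullet> \<xi>\<bar> * 2 \<le> norm x / 2 \<and> \<bar>x \<bullet> \<xi>\<bar> * 2 \<le> 3 / 16 * l * (norm x)\<^sup>2}"
          have Tc: "indicator ?T \<xi> \<le> c n x \<xi>" for \<xi>
          proof (cases "\<xi> \<in> ?T")
            case xi: True
            have "\<bar>x \<bullet> \<xi>\<bar> * norm \<xi> \<le> \<bar>x \<bullet> \<xi>\<bar> * 1" using xi by (intro mult_left_mono) auto
            also have "\<dots> \<le> l / 2 * (3 / 16 * (norm x)\<^sup>2)" using xi by simp
            also have "\<dots> \<le> l / 2 * ((norm x)\<^sup>2 * (norm \<xi>)\<^sup>2 - (x \<bullet> \<xi>)\<^sup>2) "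
            proof -
              have "(1/2)\<^sup>2 \<le> (norm \<xi>)\<^sup>2" using xi by (intro power_mono) auto
              then have 1: "(norm x)\<^sup>2 * (1/2)\<^sup>2 \<le> (norm x)\<^sup>2 * (norm \<xi>)\<^sup>2" by (intro mult_left_mono) auto
              have "\<bar>x \<bullet> \<xi>\<bar>\<^sup>2 \<le> (norm x / 4)\<^sup>2" using xi by (intro power_mono) auto
              then have 2: "(x \<bullet> \<xi>)\<^sup>2 \<le> (norm x)\<^sup>2 / 16" by (simp add: power_divide)
              have "3 / 16 * (norm x)\<^sup>2 \<le> (norm x)\<^sup>2 * (norm \<xi>)\<^sup>2 - (x \<bullet> \<xi>)\<^sup>2"
                using 1 2 by (simp add: power_divide)
              then show ?thesis using l(1) by (intro mult_left_mono) auto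
            qed
            finally show ?thesis using xi by (simp add: c_def l_def)
          qed simp
          have "ennreal \<kappa> * (w x * ennreal (norm x)) = ennreal (real (Suc n)) * (w x * ennreal (l * norm x * \<kappa>))"
          proof -
            have "ennreal (real (Suc n)) * ennreal (l * norm x * \<kappa>) = ennreal (norm x) * ennreal \<kappa>"
              using \<kappa>(1) by (simp add: ennreal_mult[symmetric] l_def del: of_nat_Suc)
            then show ?thesis by (metis mult.assoc mult.commute)
          qed
          also have "\<dots> \<le> ennreal (real (Suc n)) * (w x * emeasure lborel ?T)"
            using True l by (intro mult_left_mono \<kappa>(2)) auto
          also have "emeasure lborel ?T = (\<integral>\<^sup>+\<xi>. indicator ?T \<xi> \<partial>lborel)" by (rule nn_integral_indicator[symmetric]) measurable
          also have "\<dots> \<le> (\<integral>\<^sup>+\<xi>. c n x \<xi> \<partial>lborel)" by (intro nn_integral_mono Tc)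
          finally have "ennreal \<kappa> * (w x * ennreal (norm x)) \<le> ennreal (real (Suc n)) * (w x * (\<integral>\<^sup>+\<xi>. c n x \<xi> \<partial>lborel))"
            by (simp add: mult_left_mono)
          also have "\<dots> = (\<integral>\<^sup>+\<xi>. ennreal (real (Suc n)) * (w x * c n x \<xi>) \<partial>lborel)"
            by (simp add: nn_integral_cmult)
          finally show ?thesis .
        qed (auto simp: w_def)
      qed
      also have "\<dots> = (\<integral>\<^sup>+\<xi>. (\<integral>\<^sup>+x. ennreal (real (Suc n)) * (w x * c n x \<xi>) \<partial>lborel) \<partial>lborel)"
        by (rule lborel_pair.Fubini') measurable
      also have "\<dots> = (\<integral>\<^sup>+\<xi>. u n \<xi> \<partial>lborel)" unfolding u_def by (intro nn_integral_cong nn_integral_cmult) simp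
      finally show ?thesis .
    qed
    have "eventually (\<lambda>n. ennreal \<kappa> * (\<integral>\<^sup>+x. w x * ennreal (norm x) \<partial>lborel) \<le> (\<integral>\<^sup>+\<xi>. u n \<xi> \<partial>lborel)) sequentially"
    proof -
      obtain n0 where "R \<le> real n0" using real_arch_simple by blast
      then show ?thesis unfolding eventually_sequentially by (intro exI[of _ n0] allI impI low) auto
    qed
    then have "ennreal \<kappa> * (\<integral>\<^sup>+x. w x * ennreal (norm x) \<partial>lborel) \<le> limsup (\<lambda>n. \<integral>\<^sup>+\<xi>. u n \<xi> \<partial>lborel)"
      by (rule le_Limsup[OF sequentially_bot])
    also note up
    finally have "ennreal (1 / \<kappa>) * (ennreal \<kappa> * (\<integral>\<^sup>+x. w x * ennreal (norm x) \<partial>lborel)) \<le> ennreal (1 / \<kappa>) * ennreal (b * vS)"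
      by (rule mult_left_mono) simp
    moreover have "ennreal (1 / \<kappa>) * (ennreal \<kappa> * X) = X" for X
      using \<kappa>(1) by (simp add: mult.assoc[symmetric] ennreal_mult[symmetric])
    moreover have "ennreal (1 / \<kappa>) * ennreal (b * vS) = ennreal C"
      using \<kappa>(1) b(1) by (simp add: C_def ennreal_mult[symmetric] vS_def)
    moreover have "(\<integral>\<^sup>+x. w x * ennreal (norm x) \<partial>lborel) = (\<integral>\<^sup>+x. ennreal (kernel_weight k x * norm x) * indicator (cball 0 R) x \<partial>lborel)"
      unfolding w_def using kernel_weight(2) by (intro nn_integral_cong) (simp add: ennreal_mult mult_ac)
    ultimately show ?thesis by simp
  qed
  moreover have "0 \<le> C" using b(1) \<kappa>(1) by (simp add: C_def vS_def)
  ultimately show ?thesis using that by blast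
qed

text \<open>Remove the truncation by Fatou's lemma.\<close>

lemma gradient_second_moment:
  assumes R: "0 < R"
  shows "(\<integral>\<^sup>+x. ennreal ((norm x)\<^sup>2 * norm (DKb x)) * indicator (cball 0 R) x \<partial>lborel) < \<infinity>"
proof -
  obtain C where C: "0 \<le> C" "\<And>k. (\<integral>\<^sup>+x. ennreal (kernel_weight k x * norm x) * indicator (cball 0 R) x \<partial>lborel) \<le> ennreal C"
    using truncated_moment_bound[OF R] by blast
  note [measurable] = kernel_weight(1)
  have [measurable]: "cball (0::real^'n) R \<in> sets borel" by simp
  have "ennreal ((norm x)\<^sup>2 * norm (DKb x)) * indicator (cball 0 R) x \<le>
     liminf (\<lambda>k. ennreal (kernel_weight k x * norm x) * indicator (cball 0 R) x)" for x
  proof (cases "x = 0")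
    case False
    obtain k1 where k1: "1 / real (Suc k1) < norm x" using nat_approx_posE[of "norm x"] False by auto
    obtain k2 where k2: "norm x * norm (DKb x) \<le> real k2" using real_arch_simple by blast
    have "eventually (\<lambda>k. ennreal ((norm x)\<^sup>2 * norm (DKb x)) * indicator (cball 0 R) x \<le>
        ennreal (kernel_weight k x * norm x) * indicator (cball 0 R) x) sequentially"
      using eventually_ge_at_top[of "max k1 k2"]
    proof eventually_elim
      case (elim k)
      have "1 / real (Suc k) \<le> 1 / real (Suc k1)" using elim by (intro divide_left_mono) auto
      then have "kernel_weight k x = norm x * norm (DKb x)" using k1 k2 elim by (simp add: kernel_weight_def)
      then show ?case by (simp add: power2_eq_square mult_ac)
    qed
    then show ?thesis by (rule Liminf_bounded)
  qed simp
  then have "(\<integral>\<^sup>+x. ennreal ((norm x)\<^sup>2 * norm (DKb x)) * indicator (cball 0 R) x \<partial>lborel) \<le>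
     (\<integral>\<^sup>+x. liminf (\<lambda>k. ennreal (kernel_weight k x * norm x) * indicator (cball 0 R) x) \<partial>lborel)"
    by (intro nn_integral_mono)
  also have "\<dots> \<le> liminf (\<lambda>k. \<integral>\<^sup>+x. ennreal (kernel_weight k x * norm x) * indicator (cball 0 R) x \<partial>lborel)"
    by (rule nn_integral_liminf) measurable
  also have "\<dots> \<le> liminf (\<lambda>k. ennreal C)" by (intro Liminf_mono always_eventually allI C(2))
  also have "\<dots> = ennreal C" by (simp add: Liminf_const)
  finally show ?thesis by (simp add: le_less_trans)
qed

end

section \<open>Smallness of tails and of thin regions\<close>

text \<open>Absolute continuity of the integral.\<close>

lemma small_integral_on_small_sets:
  fixes f :: "'a \<Rightarrow> real"
  assumes f: "integrable M f" and n: "\<And>x. 0 \<le> f x" and \<eta>: "0 < \<eta>"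
  obtains \<delta> where "0 < \<delta>" "\<And>A. A \<in> sets M \<Longrightarrow> emeasure M A \<le> ennreal \<delta> \<Longrightarrow> (\<integral>\<^sup>+x. ennreal (f x) * indicator A x \<partial>M) \<le> ennreal \<eta>"
proof -
  have [measurable]: "f \<in> borel_measurable M" using f by simp
  have "(\<lambda>k. LINT x|M. f x - min (f x) (real k)) \<longlonglongrightarrow> (LINT x|M. 0)"
  proof (rule integral_dominated_convergence[where w = f])
    show "AE x in M. (\<lambda>k. f x - min (f x) (real k)) \<longlonglongrightarrow> 0"
    proof (rule AE_I2)
      fix x
      obtain k0 where "f x \<le> real k0" using real_arch_simple by blast
      then have "eventually (\<lambda>k. f x - min (f x) (real k) = 0) sequentially"
        unfolding eventually_sequentially by (intro exI[of _ k0]) auto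
      then show "(\<lambda>k. f x - min (f x) (real k)) \<longlonglongrightarrow> 0" by (rule tendsto_eventually)
    qed
    show "AE x in M. norm (f x - min (f x) (real k)) \<le> f x" for k
      using n by (intro AE_I2) (auto simp: min_def)
  qed (use f in auto)
  then have "eventually (\<lambda>k. (LINT x|M. f x - min (f x) (real k)) < \<eta> / 2) sequentially"
    using \<eta> by (intro order_tendstoD(2)) auto
  then obtain k where k: "(LINT x|M. f x - min (f x) (real k)) < \<eta> / 2" by (auto simp: eventually_sequentially)
  define \<delta> where "\<delta> = \<eta> / (2 * real (Suc k))"
  have i: "integrable M (\<lambda>x. f x - min (f x) (real k))"
    by (rule Bochner_Integration.integrable_bound[OF f]) (use n in \<open>auto simp: min_def\<close>)
  show ?thesis
  proof (rule that[of \<delta>])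
    show "0 < \<delta>" using \<eta> by (simp add: \<delta>_def)
    fix A assume A [measurable]: "A \<in> sets M" and small: "emeasure M A \<le> ennreal \<delta>"
    have "(\<integral>\<^sup>+x. ennreal (f x) * indicator A x \<partial>M) \<le> (\<integral>\<^sup>+x. ennreal (real k) * indicator A x + ennreal (f x - min (f x) (real k)) \<partial>M)"
    proof (rule nn_integral_mono)
      fix x
      have "f x \<le> real k + (f x - min (f x) (real k))" by (auto simp: min_def)
      then have "ennreal (f x) \<le> ennreal (real k) + ennreal (f x - min (f x) (real k))"
        using ennreal_leI[of "f x" "real k + (f x - min (f x) (real k))"] by (subst ennreal_plus[symmetric]) auto
      then show "ennreal (f x) * indicator A x \<le> ennreal (real k) * indicator A x + ennreal (f x - min (f x) (real k))"
        by (cases "x \<in> A") auto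
    qed
    also have "\<dots> = ennreal (real k) * emeasure M A + ennreal (LINT x|M. f x - min (f x) (real k))"
      by (subst nn_integral_add) (auto simp: nn_integral_cmult_indicator nn_integral_eq_integral[OF i])
    also have "\<dots> \<le> ennreal (real k) * ennreal \<delta> + ennreal (\<eta> / 2)"
      using small k by (intro add_mono mult_left_mono ennreal_leI) auto
    also have "\<dots> = ennreal (real k * \<delta> + \<eta> / 2)" using \<eta> by (simp add: ennreal_mult[symmetric] \<delta>_def)
    also have "\<dots> \<le> ennreal \<eta>"
    proof (rule ennreal_leI)
      have "real k * \<delta> \<le> real (Suc k) * \<delta>" using \<open>0 < \<delta>\<close> by (intro mult_right_mono) auto
      also have "\<dots> = \<eta> / 2" by (simp add: \<delta>_def del: of_nat_Suc)
      finally show "real k * \<delta> + \<eta> / 2 \<le> \<eta>" by simp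
    qed
    finally show "(\<integral>\<^sup>+x. ennreal (f x) * indicator A x \<partial>M) \<le> ennreal \<eta>" .
  qed
qed

lemma tail_integral_small:
  fixes f :: "'a::euclidean_space \<Rightarrow> ennreal"
  assumes f [measurable]: "f \<in> borel_measurable borel" and fin: "(\<integral>\<^sup>+x. f x * indicator {x. 1 \<le> norm x} x \<partial>lborel) < \<infinity>"
    and \<eta>: "0 < (\<eta>::real)"
  obtains r where "1 \<le> r" "\<And>r'. r \<le> r' \<Longrightarrow> (\<integral>\<^sup>+x. f x * indicator {x. r' \<le> norm x} x \<partial>lborel) \<le> ennreal \<eta>"
proof -
  have "(\<lambda>n. \<integral>\<^sup>+x. f x * indicator {x. real (Suc n) \<le> norm x} x \<partial>lborel) \<longlonglongrightarrow> (\<integral>\<^sup>+(x::'a). 0 \<partial>lborel)"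
  proof (rule nn_integral_dominated_convergence[where w = "\<lambda>x. f x * indicator {x. 1 \<le> norm x} x"])
    show "AE x in lborel. f x * indicator {x. real (Suc n) \<le> norm x} x \<le> f x * indicator {x. 1 \<le> norm x} x" for n
      by (intro AE_I2 mult_left_mono) (auto simp: indicator_def)
    show "AE x in lborel. (\<lambda>n. f x * indicator {x. real (Suc n) \<le> norm x} x) \<longlonglongrightarrow> 0"
    proof (rule AE_I2)
      fix x :: 'a
      obtain n0 where "norm x \<le> real n0" using real_arch_simple by blast
      then have "eventually (\<lambda>n. f x * indicator {x. real (Suc n) \<le> norm x} x = 0) sequentially"
        unfolding eventually_sequentially by (intro exI[of _ n0]) (auto simp: indicator_def)
      then show "(\<lambda>n. f x * indicator {x. real (Suc n) \<le> norm x} x) \<longlonglongrightarrow> 0" by (rule tendsto_eventually)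
    qed
  qed (use fin in auto)
  then have "eventually (\<lambda>n. (\<integral>\<^sup>+x. f x * indicator {x. real (Suc n) \<le> norm x} x \<partial>lborel) < ennreal \<eta>) sequentially"
    using \<eta> by (intro order_tendstoD(2)) auto
  then obtain n where n: "(\<integral>\<^sup>+x. f x * indicator {x. real (Suc n) \<le> norm x} x \<partial>lborel) < ennreal \<eta>"
    by (auto simp: eventually_sequentially)
  show ?thesis
  proof (rule that[of "real (Suc n)"])
    fix r' assume "real (Suc n) \<le> r'"
    then have "(\<integral>\<^sup>+x. f x * indicator {x. r' \<le> norm x} x \<partial>lborel) \<le> (\<integral>\<^sup>+x. f x * indicator {x. real (Suc n) \<le> norm x} x \<partial>lborel)"
      by (intro nn_integral_mono mult_left_mono) (auto simp: indicator_def)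
    then show "(\<integral>\<^sup>+x. f x * indicator {x. r' \<le> norm x} x \<partial>lborel) \<le> ennreal \<eta>" using n by simp
  qed simp
qed

lemma integral_diff_le_nn_integral:
  fixes f g :: "'a \<Rightarrow> real"
  assumes "integrable M f" "integrable M g" "(\<integral>\<^sup>+x. ennreal \<bar>f x - g x\<bar> \<partial>M) \<le> ennreal c" "0 \<le> c"
  shows "\<bar>(LINT x|M. f x) - (LINT x|M. g x)\<bar> \<le> c"
proof -
  have "\<bar>(LINT x|M. f x) - (LINT x|M. g x)\<bar> = norm (LINT x|M. f x - g x)" using assms by simp
  also have "\<dots> \<le> (LINT x|M. norm (f x - g x))" by (rule integral_norm_bound)
  finally have "ennreal \<bar>(LINT x|M. f x) - (LINT x|M. g x)\<bar> \<le> ennreal (LINT x|M. norm (f x - g x))" by (rule ennreal_leI)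
  also have "\<dots> = (\<integral>\<^sup>+x. ennreal (norm (f x - g x)) \<partial>M)"
    using assms by (intro nn_integral_eq_integral[symmetric]) auto
  also have "\<dots> \<le> ennreal c" using assms by simp
  finally show ?thesis using assms(4) by (simp add: ennreal_le_iff)
qed

context planar_kernel begin

text \<open>A bounded piece of \<open>Q l e\<close> lies in a slab of width of order \<open>l\<close>, whatever \<open>e\<close> is.\<close>

lemma gradient_thin:
  assumes R: "0 < R" and \<eta>: "0 < \<eta>"
  obtains l0 where "0 < l0" "\<And>l e. 0 < l \<Longrightarrow> l \<le> l0 \<Longrightarrow> norm e = 1 \<Longrightarrow>
    (\<integral>\<^sup>+x. ennreal ((norm x)\<^sup>2 * norm (DKb x)) * indicator (Q l e \<inter> cball 0 R) x \<partial>lborel) \<le> ennreal \<eta>"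
proof -
  have [measurable]: "cball (0::real^'n) R \<in> sets borel" by simp
  define f where "f x = (norm x)\<^sup>2 * norm (DKb x) * indicator (cball 0 R) x" for x
  have fe: "ennreal (f x) = ennreal ((norm x)\<^sup>2 * norm (DKb x)) * indicator (cball 0 R) x" for x
    by (simp add: f_def indicator_def)
  have "integrable lborel f"
  proof (rule integrableI_nonneg)
    show "f \<in> borel_measurable lborel" unfolding f_def by measurable
    show "(\<integral>\<^sup>+x. ennreal (f x) \<partial>lborel) < \<infinity>" unfolding fe by (rule gradient_second_moment[OF R])
  qed (simp add: f_def)
  note fi = this
  have fn: "0 \<le> f x" for x by (simp add: f_def)
  obtain \<delta> where \<delta>: "0 < \<delta>" "\<And>A. A \<in> sets lborel \<Longrightarrow> emeasure lborel A \<le> ennreal \<delta> \<Longrightarrow> (\<integral>\<^sup>+x. ennreal (f x) * indicator A x \<partial>lborel) \<le> ennreal \<eta>"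
    by (rule small_integral_on_small_sets[OF fi fn \<eta>]) (rule that, assumption+)
  define c where "c = R\<^sup>2 * (2 * R) ^ (CARD('n) - 1)"
  have c: "0 < c" using R by (simp add: c_def)
  show ?thesis
  proof (rule that[of "\<delta> / c"])
    show "0 < \<delta> / c" using \<delta>(1) c by simp
    fix l and e :: "real^'n" assume l: "0 < l" "l \<le> \<delta> / c" and e: "norm e = 1"
    let ?A = "Q l e \<inter> cball 0 R"
    have "?A \<subseteq> {z. \<bar>z \<bullet> e\<bar> \<le> l / 2 * R\<^sup>2 \<and> norm z \<le> R}"
    proof
      fix z assume z: "z \<in> ?A"
      have "\<bar>z \<bullet> e\<bar> \<le> l / 2 * ((norm z)\<^sup>2 - (z \<bullet> e)\<^sup>2)" using z Q_iff[OF e] by blast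
      also have "\<dots> \<le> l / 2 * R\<^sup>2"
        using z l power_mono[of "norm z" R 2] by (intro mult_left_mono) (auto intro: order.trans[of _ "(norm z)\<^sup>2"])
      finally show "z \<in> {z. \<bar>z \<bullet> e\<bar> \<le> l / 2 * R\<^sup>2 \<and> norm z \<le> R}" using z by simp
    qed
    then have "emeasure lborel ?A \<le> emeasure lborel {z. \<bar>z \<bullet> e\<bar> \<le> l / 2 * R\<^sup>2 \<and> norm z \<le> R}"
      by (rule emeasure_mono) simp
    also have "\<dots> \<le> ennreal (2 * (l / 2 * R\<^sup>2) * (2 * R) ^ (CARD('n) - 1))"
      using l R by (intro slab_volume[OF dim e]) auto
    also have "2 * (l / 2 * R\<^sup>2) * (2 * R) ^ (CARD('n) - 1) = l * c" by (simp add: c_def)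
    also have "ennreal (l * c) \<le> ennreal \<delta>" using l c by (intro ennreal_leI) (simp add: field_simps)
    finally have "(\<integral>\<^sup>+x. ennreal (f x) * indicator ?A x \<partial>lborel) \<le> ennreal \<eta>"
      using Q_borel[OF e] by (intro \<delta>(2)) auto
    moreover have "(\<integral>\<^sup>+x. ennreal (f x) * indicator ?A x \<partial>lborel) = (\<integral>\<^sup>+x. ennreal ((norm x)\<^sup>2 * norm (DKb x)) * indicator ?A x \<partial>lborel)"
      by (intro nn_integral_cong) (auto simp: f_def indicator_def)
    ultimately show "(\<integral>\<^sup>+x. ennreal ((norm x)\<^sup>2 * norm (DKb x)) * indicator ?A x \<partial>lborel) \<le> ennreal \<eta>" by simp
  qed
qed

lemma Kb_Q: "norm e = 1 \<Longrightarrow> 0 < l \<Longrightarrow> (\<integral>\<^sup>+x. ennreal (Kb x) * indicator (Q l e) x \<partial>lborel) = ennreal (LINT y:Q l e|lebesgue. K y)"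
proof -
  assume e: "norm e = 1" and l: "0 < l"
  have s: "set_integrable lebesgue (Q l e) K" using integrable_Q[of e l] e l by simp
  note * = set_integrable_borel_version[OF s Q_borel[OF e] Kb(1) Kb(3)]
  have "(\<integral>\<^sup>+x. ennreal (Kb x) * indicator (Q l e) x \<partial>lborel) = (\<integral>\<^sup>+x. ennreal (indicator (Q l e) x *\<^sub>R Kb x) \<partial>lborel)"
    by (intro nn_integral_cong) (simp add: indicator_def)
  also have "\<dots> = ennreal (LINT x|lborel. indicator (Q l e) x *\<^sub>R Kb x)"
    by (rule nn_integral_eq_integral[OF *(1)]) (use Kb(2) in auto)
  finally show ?thesis using *(2) by simp
qed

lemma eventually_Kb_Q_bound:
  obtains a where "0 < a" "\<And>e. norm e = 1 \<Longrightarrow>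
    eventually (\<lambda>l. (\<integral>\<^sup>+x. ennreal (Kb x) * indicator (Q l e) x \<partial>lborel) \<le> ennreal (a * l)) (at_right 0)"
proof -
  obtain a where a: "0 < a" "\<And>e. e \<in> sphere 0 1 \<Longrightarrow>
      Limsup (at_right 0) (\<lambda>l. ereal (1 / l * (LINT y:Q l e|lebesgue. K y))) \<le> ereal a"
    using small_Q by blast
  have "eventually (\<lambda>l. (\<integral>\<^sup>+x. ennreal (Kb x) * indicator (Q l e) x \<partial>lborel) \<le> ennreal ((a + 1) * l)) (at_right 0)" if e: "norm e = 1" for e
  proof -
    have "Limsup (at_right 0) (\<lambda>l. ereal (1 / l * (LINT y:Q l e|lebesgue. K y))) < ereal (a + 1)"
      using a(2)[of e] e by (simp add: le_less_trans)
    then have "eventually (\<lambda>l. ereal (1 / l * (LINT y:Q l e|lebesgue. K y)) < ereal (a + 1)) (at_right 0)"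
      by (rule Limsup_lessD)
    then show ?thesis using eventually_at_right_less[of "0::real"]
    proof eventually_elim
      case (elim l)
      then show ?case using Kb_Q[OF e, of l] by (simp add: field_simps ennreal_leI)
    qed
  qed
  then show ?thesis using that[of "a + 1"] a(1) by simp
qed

text \<open>The exponent exceeds \<open>d + 1\<close>. This makes \<open>|x| K x\<close> integrable at infinity in \<open>d\<close> dimensions and
  \<open>|w|\<^sup>2 K w\<close> in \<open>d - 1\<close> dimensions.\<close>

lemma decay_rate:
  obtains m p where "0 < m" "real CARD('n) + 1 < p" "\<And>y. 1 \<le> norm y \<Longrightarrow> K y \<le> m * norm y powr - p"
proof -
  obtain m s where ms: "0 < m" "s \<in> {0<..<1}" "\<And>y. y \<in> - ball 0 1 \<Longrightarrow> K y \<le> m / norm y powr (real CARD('n) + 1 + s)"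
    using decay by blast
  show ?thesis
  proof (rule that[of m "real CARD('n) + 1 + s"])
    fix y :: "real^'n" assume "1 \<le> norm y"
    then show "K y \<le> m * norm y powr - (real CARD('n) + 1 + s)"
      using ms(3)[of y] by (simp only: powr_minus divide_inverse) simp
  qed (use ms in auto)
qed

lemma kernel_tail:
  assumes \<eta>: "0 < \<eta>"
  obtains r where "1 \<le> r" "\<And>r'. r \<le> r' \<Longrightarrow> (\<integral>\<^sup>+x. ennreal (norm x * Kb x) * indicator {x. r' \<le> norm x} x \<partial>lborel) \<le> ennreal \<eta>"
proof -
  obtain m p where mp: "0 < m" "real CARD('n) + 1 < p" "\<And>y. 1 \<le> norm y \<Longrightarrow> K y \<le> m * norm y powr - p"
    using decay_rate by blast
  have "(\<integral>\<^sup>+x. ennreal (norm x * Kb x) * indicator {x. 1 \<le> norm x} x \<partial>lborel) \<le>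
      (\<integral>\<^sup>+(x::real^'n). ennreal m * (ennreal (norm x powr - (p - 1)) * indicator {x. 1 \<le> norm x} x) \<partial>lborel)"
  proof (rule nn_integral_mono_AE)
    show "AE x in lborel. ennreal (norm x * Kb x) * indicator {x. 1 \<le> norm x} x \<le> ennreal m * (ennreal (norm x powr - (p - 1)) * indicator {x. 1 \<le> norm x} x)"
      using Kb(3)
    proof eventually_elim
      case (elim x)
      show ?case
      proof (cases "1 \<le> norm x")
        case True
        have "norm x * Kb x \<le> norm x * (m * norm x powr - p)" using True mp(3)[OF True] elim by (intro mult_left_mono) auto
        also have "\<dots> = m * norm x powr - (p - 1)"
        proof -
          have "norm x * norm x powr - p = norm x powr 1 * norm x powr - p" using True by simp
          also have "\<dots> = norm x powr - (p - 1)" unfolding powr_add[symmetric] by (simp add: algebra_simps)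
          finally show ?thesis by (simp only: mult.left_commute)
        qed
        finally show ?thesis using True mp(1) by (simp add: ennreal_mult[symmetric] ennreal_leI)
      qed simp
    qed
  qed
  also have "\<dots> = ennreal m * (\<integral>\<^sup>+(x::real^'n). ennreal (norm x powr - (p - 1)) * indicator {x. 1 \<le> norm x} x \<partial>lborel)"
    by (rule nn_integral_cmult) measurable
  also have "\<dots> < \<infinity>"
    using nn_integral_powr_tail_finite[where 'a = "real^'n" and p = "p - 1"] mp(2) by (simp add: ennreal_mult_less_top)
  finally have fin: "(\<integral>\<^sup>+x. ennreal (norm x * Kb x) * indicator {x. 1 \<le> norm x} x \<partial>lborel) < \<infinity>" .
  have fm: "(\<lambda>x. ennreal (norm x * Kb x)) \<in> borel_measurable borel" by measurable
  show ?thesis by (rule tail_integral_small[OF fm fin \<eta>]) (rule that, assumption+)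
qed

lemma slice_tail:
  fixes m p \<eta> :: real
  assumes p: "real CARD('n) + 1 < p" and m: "0 < m" and \<eta>: "0 < \<eta>"
  obtains R where "1 \<le> R" "\<And>R'. R \<le> R' \<Longrightarrow> (\<integral>\<^sup>+(w::real^'n punctured). ennreal ((norm w)\<^sup>2 * (m * norm w powr - p)) * indicator {w. R' \<le> norm w} w \<partial>lborel) \<le> ennreal \<eta>"
proof -
  have eq: "ennreal ((norm w)\<^sup>2 * (m * norm w powr - p)) * indicator {w. 1 \<le> norm w} w = ennreal m * (ennreal (norm w powr - (p - 2)) * indicator {w. 1 \<le> norm w} w)"
    for w :: "real^'n punctured"
  proof (cases "1 \<le> norm w")
    case True
    have "(norm w)\<^sup>2 * norm w powr - p = norm w powr 2 * norm w powr - p" using True by simp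
    also have "\<dots> = norm w powr - (p - 2)" unfolding powr_add[symmetric] by (simp add: algebra_simps)
    finally have "(norm w)\<^sup>2 * (m * norm w powr - p) = m * norm w powr - (p - 2)" by (simp only: mult.left_commute)
    then show ?thesis using True m by (simp add: ennreal_mult[symmetric])
  qed simp
  have "real DIM(real^'n punctured) < p - 2" using p card_punctured[OF dim] dim by (simp add: of_nat_diff)
  then have fin: "(\<integral>\<^sup>+(w::real^'n punctured). ennreal ((norm w)\<^sup>2 * (m * norm w powr - p)) * indicator {w. 1 \<le> norm w} w \<partial>lborel) < \<infinity>"
    unfolding eq using nn_integral_powr_tail_finite[where 'a = "real^'n punctured" and p = "p - 2"]
    by (subst nn_integral_cmult) (auto simp: ennreal_mult_less_top)
  have fm: "(\<lambda>w::real^'n punctured. ennreal ((norm w)\<^sup>2 * (m * norm w powr - p))) \<in> borel_measurable borel" by measurable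
  show ?thesis by (rule tail_integral_small[OF fm fin \<eta>]) (rule that, assumption+)
qed

end

section \<open>The trace of the kernel on a hyperplane\<close>

text \<open>The signed length between the levels 0 and \<open>c\<close>.\<close>

lemma integral_step_difference:
  fixes c h :: real
  assumes "\<bar>c\<bar> \<le> h"
  defines "J \<equiv> \<lambda>\<tau>. (if \<tau> < c then 1 else 0) - (if \<tau> < 0 then 1 else (0::real))"
  shows "integrable lborel (\<lambda>\<tau>. J \<tau> * indicator {-h..h} \<tau>)" "(LINT \<tau>|lborel. J \<tau> * indicator {-h..h} \<tau>) = c"
proof -
  have "has_bochner_integral lborel (\<lambda>\<tau>. J \<tau> * indicator {-h..h} \<tau>) c"
  proof (cases "0 \<le> c")
    case True
    have "(\<lambda>\<tau>. J \<tau> * indicator {-h..h} \<tau>) = indicator {0..<c}"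
      using True assms by (auto simp: J_def fun_eq_iff indicator_def)
    moreover have "has_bochner_integral lborel (indicator {0..<c} :: real \<Rightarrow> real) (measure lborel {0..<c})"
      by (rule has_bochner_integral_real_indicator) (use True in auto)
    ultimately show ?thesis using True by simp
  next
    case False
    have "(\<lambda>\<tau>. J \<tau> * indicator {-h..h} \<tau>) = (\<lambda>\<tau>. - indicator {c..<0} \<tau>)"
      using False assms by (auto simp: J_def fun_eq_iff indicator_def)
    moreover have "has_bochner_integral lborel (\<lambda>\<tau>. - indicator {c..<0} \<tau> :: real) (- measure lborel {c..<0})"
      by (intro has_bochner_integral_minus has_bochner_integral_real_indicator) (use False in auto)
    ultimately show ?thesis using False by simp
  qed
  then show "integrable lborel (\<lambda>\<tau>. J \<tau> * indicator {-h..h} \<tau>)" "(LINT \<tau>|lborel. J \<tau> * indicator {-h..h} \<tau>) = c"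
    by (auto simp: has_bochner_integral_iff)
qed

lemma integrable_interval: "integrable lborel (indicator {a..b::real} :: real \<Rightarrow> real)"
  by (rule integrable_real_indicator) (auto intro!: emeasure_bounded_finite[unfolded infinity_ennreal_def])

lemma integrable_bounded_on_interval:
  fixes g :: "real \<Rightarrow> real"
  assumes [measurable]: "g \<in> borel_measurable borel" and g: "\<And>t. \<bar>g t\<bar> \<le> 1"
  shows "integrable lborel (\<lambda>t. g t * indicator {a..b} t)"
proof (rule Bochner_Integration.integrable_bound)
  show "integrable lborel (indicator {a..b} :: real \<Rightarrow> real)" by (rule integrable_interval)
  show "AE t in lborel. norm (g t * indicator {a..b} t) \<le> norm (indicator {a..b} t :: real)"
    using g by (intro AE_I2) (simp add: indicator_def)
qed measurable

context planar_kernel begin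

text \<open>The averages over \<open>0 < \<tau> < 1 / (j + 1)\<close> converge to the trace on almost every line by continuity. As limits
  of integrals they depend measurably on \<open>w\<close>, which is not clear for \<open>K\<close> restricted to a null set.\<close>

definition trace_average :: "real^'n \<Rightarrow> (real^'n punctured \<Rightarrow> real^'n) \<Rightarrow> nat \<Rightarrow> real^'n punctured \<Rightarrow> real" where
  "trace_average e \<iota> j w = (LINT \<tau>|lborel. Kb (\<iota> w + \<tau> *\<^sub>R e) * (real (Suc j) * step_slope (real (Suc j) * (\<tau> - 0))))"

definition Ks :: "real^'n \<Rightarrow> (real^'n punctured \<Rightarrow> real^'n) \<Rightarrow> real^'n punctured \<Rightarrow> real" where
  "Ks e \<iota> w = lim (\<lambda>j. trace_average e \<iota> j w)"

lemma Ks_measurable: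
  assumes fr: "is_frame e \<iota>" shows "Ks e \<iota> \<in> borel_measurable borel"
proof -
  have [measurable]: "\<iota> \<in> borel_measurable borel" by (rule frame_measurable(1)[OF fr])
  have "trace_average e \<iota> j \<in> borel_measurable borel" for j
    unfolding trace_average_def by (rule lborel.borel_measurable_lebesgue_integral) measurable
  then show ?thesis unfolding Ks_def[abs_def] by (rule borel_measurable_lim_metric)
qed

lemma Ks_eq:
  assumes reg: "line_regular e \<iota> w" shows "Ks e \<iota> w = K (\<iota> w)"
proof -
  define k where "k \<tau> = K (\<iota> w + \<tau> *\<^sub>R e)" for \<tau>
  have kc: "continuous_on UNIV k" using reg by (simp add: line_regular_def k_def[abs_def])
  then have [measurable]: "k \<in> borel_measurable borel" by (rule borel_measurable_continuous_onI)
  have ae: "AE \<tau> in lborel. Kb (\<iota> w + \<tau> *\<^sub>R e) = k \<tau>" using reg by (simp add: line_regular_def k_def)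
  have "trace_average e \<iota> j w = (LINT \<tau>|lborel. k \<tau> * (real (Suc j) * step_slope (real (Suc j) * (\<tau> - 0))))" for j
    unfolding trace_average_def
  proof (rule integral_cong_AE)
    show "AE \<tau> in lborel. Kb (\<iota> w + \<tau> *\<^sub>R e) * (real (Suc j) * step_slope (real (Suc j) * (\<tau> - 0))) = k \<tau> * (real (Suc j) * step_slope (real (Suc j) * (\<tau> - 0)))"
      using ae by eventually_elim (simp only:)
  qed measurable
  then have "(\<lambda>j. trace_average e \<iota> j w) \<longlonglongrightarrow> k 0" using step_slope_average(2)[OF kc, of 0] by (simp only:)
  then show ?thesis unfolding Ks_def by (simp add: limI k_def)
qed

lemma Ks_AE:
  assumes fr: "is_frame e \<iota>"
  shows "AE w in lborel. Ks e \<iota> w = K (\<iota> w)" "AE w in lborel. 0 \<le> Ks e \<iota> w"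
proof -
  show 1: "AE w in lborel. Ks e \<iota> w = K (\<iota> w)"
    using AE_line_regular[OF fr] by eventually_elim (rule Ks_eq)
  have "AE w in lborel. w \<noteq> (0 :: real^'n punctured)" by (rule AE_lborel_singleton)
  with 1 show "AE w in lborel. 0 \<le> Ks e \<iota> w"
  proof eventually_elim
    case (elim w)
    have "norm (\<iota> w) = norm w" using fr by (simp add: is_frame_def)
    then have "\<iota> w \<noteq> 0" using elim by force
    then show ?case using nonneg elim by simp
  qed
qed

lemma frame_in_Q:
  assumes fr: "is_frame e \<iota>" shows "\<iota> w + \<tau> *\<^sub>R e \<in> Q l e \<longleftrightarrow> \<bar>\<tau>\<bar> \<le> l / 2 * (norm w)\<^sup>2"
proof -
  have e: "norm e = 1" using fr by (simp add: is_frame_def)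
  show ?thesis unfolding Q_iff[OF e] frame_height[OF fr] frame_norm[OF fr] by simp
qed

lemma slice_gradient_bound:
  assumes fr: "is_frame e \<iota>" and reg: "line_regular e \<iota> w" and w: "norm w < R" and l: "0 < l" "l \<le> 1"
  defines "h \<equiv> l / 2 * (norm w)\<^sup>2"
  shows "ennreal (2 * h * (LINT \<tau>:{-h..h}|lborel. norm (DKb (\<iota> w + \<tau> *\<^sub>R e)))) \<le>
     (\<integral>\<^sup>+\<tau>. ennreal l * (ennreal ((norm (\<iota> w + \<tau> *\<^sub>R e))\<^sup>2 * norm (DKb (\<iota> w + \<tau> *\<^sub>R e))) * indicator (Q l e \<inter> cball 0 (R + R\<^sup>2)) (\<iota> w + \<tau> *\<^sub>R e)) \<partial>lborel)"
proof -
  have h: "0 \<le> h" using l by (simp add: h_def)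
  have hR: "h \<le> R\<^sup>2"
  proof -
    have "h \<le> 1 * (norm w)\<^sup>2" unfolding h_def using l by (intro mult_right_mono) auto
    also have "\<dots> \<le> R\<^sup>2" using w by (simp add: power_mono)
    finally show ?thesis .
  qed
  have dn: "integrable lborel (\<lambda>\<tau>. norm (DKb (\<iota> w + \<tau> *\<^sub>R e)))" using reg by (simp add: line_regular_def)
  have [measurable]: "(\<lambda>\<tau>. DKb (\<iota> w + \<tau> *\<^sub>R e)) \<in> borel_measurable borel" by measurable
  have si: "integrable lborel (\<lambda>\<tau>. indicator {-h..h} \<tau> *\<^sub>R norm (DKb (\<iota> w + \<tau> *\<^sub>R e)))"
    using integrable_mult_indicator[of "{-h..h}" lborel, OF _ dn] by simp
  have "ennreal (2 * h * (LINT \<tau>:{-h..h}|lborel. norm (DKb (\<iota> w + \<tau> *\<^sub>R e)))) =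
     ennreal (LINT \<tau>|lborel. 2 * h * (indicator {-h..h} \<tau> *\<^sub>R norm (DKb (\<iota> w + \<tau> *\<^sub>R e))))"
    by (simp add: set_lebesgue_integral_def)
  also have "\<dots> = (\<integral>\<^sup>+\<tau>. ennreal (2 * h * (indicator {-h..h} \<tau> *\<^sub>R norm (DKb (\<iota> w + \<tau> *\<^sub>R e)))) \<partial>lborel)"
    using si h by (intro nn_integral_eq_integral[symmetric]) auto
  also have "\<dots> \<le> (\<integral>\<^sup>+\<tau>. ennreal l * (ennreal ((norm (\<iota> w + \<tau> *\<^sub>R e))\<^sup>2 * norm (DKb (\<iota> w + \<tau> *\<^sub>R e))) * indicator (Q l e \<inter> cball 0 (R + R\<^sup>2)) (\<iota> w + \<tau> *\<^sub>R e)) \<partial>lborel)"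
  proof (rule nn_integral_mono)
    fix \<tau> :: real
    let ?x = "\<iota> w + \<tau> *\<^sub>R e"
    show "ennreal (2 * h * (indicator {-h..h} \<tau> *\<^sub>R norm (DKb ?x))) \<le>
      ennreal l * (ennreal ((norm ?x)\<^sup>2 * norm (DKb ?x)) * indicator (Q l e \<inter> cball 0 (R + R\<^sup>2)) ?x)"
    proof (cases "\<tau> \<in> {-h..h}")
      case True
      then have \<tau>: "\<bar>\<tau>\<bar> \<le> h" by auto
      then have q: "?x \<in> Q l e" using frame_in_Q[OF fr] by (simp add: h_def)
      have "norm ?x \<le> norm (\<iota> w) + norm (\<tau> *\<^sub>R e)" by (rule norm_triangle_ineq)
      then have c: "norm ?x \<le> R + R\<^sup>2" using fr w \<tau> hR by (simp add: is_frame_def)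
      have "2 * h * norm (DKb ?x) = l * ((norm w)\<^sup>2 * norm (DKb ?x))" by (simp add: h_def)
      also have "\<dots> \<le> l * ((norm ?x)\<^sup>2 * norm (DKb ?x))"
        using l frame_norm[OF fr, of w \<tau>] by (intro mult_left_mono mult_right_mono) auto
      finally have "ennreal (2 * h * norm (DKb ?x)) \<le> ennreal l * ennreal ((norm ?x)\<^sup>2 * norm (DKb ?x))"
        using l by (simp add: ennreal_mult[symmetric] ennreal_leI)
      then show ?thesis using True q c by simp
    qed simp
  qed
  finally show ?thesis .
qed

lemma line_increment_in_slab:
  assumes reg: "line_regular e \<iota> w" and \<tau>: "\<bar>\<tau>\<bar> \<le> h"
  shows "\<bar>K (\<iota> w + \<tau> *\<^sub>R e) - K (\<iota> w)\<bar> \<le> (LINT \<tau>:{-h..h}|lborel. norm (DKb (\<iota> w + \<tau> *\<^sub>R e)))"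
proof -
  have dn: "integrable lborel (\<lambda>\<tau>. norm (DKb (\<iota> w + \<tau> *\<^sub>R e)))" using reg by (simp add: line_regular_def)
  have si: "integrable lborel (\<lambda>\<tau>. indicator {-h..h} \<tau> *\<^sub>R norm (DKb (\<iota> w + \<tau> *\<^sub>R e)))" for h
    using integrable_mult_indicator[of "{-h..h}" lborel, OF _ dn] by simp
  have "\<bar>K (\<iota> w + \<tau> *\<^sub>R e) - K (\<iota> w)\<bar> \<le> (LINT \<tau>:{-\<bar>\<tau>\<bar>..\<bar>\<tau>\<bar>}|lborel. norm (DKb (\<iota> w + \<tau> *\<^sub>R e)))"
    using reg by (simp add: line_regular_def)
  also have "\<dots> \<le> (LINT \<tau>:{-h..h}|lborel. norm (DKb (\<iota> w + \<tau> *\<^sub>R e)))"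
    unfolding set_lebesgue_integral_def
  proof (rule integral_mono[OF si si])
    fix t show "indicator {-\<bar>\<tau>\<bar>..\<bar>\<tau>\<bar>} t *\<^sub>R norm (DKb (\<iota> w + t *\<^sub>R e)) \<le> indicator {-h..h} t *\<^sub>R norm (DKb (\<iota> w + t *\<^sub>R e))"
      using \<tau> by (auto simp: indicator_def)
  qed
  finally show ?thesis .
qed

text \<open>With \<open>h = l / 2 |w|\<^sup>2\<close>, the quantity \<open>l |w|\<^sup>2 K w\<close> is the integral of the constant \<open>K w\<close> over the part \<open>{- h..h}\<close> of the
  normal line inside \<open>Q l e\<close>. Comparing with \<open>K (w + \<tau> e)\<close> costs the gradient term, so that the moment is at
  most \<open>(1 / l) \<integral>\<^sub>Q K\<close> plus the second moment of the gradient. For suitable small \<open>l\<close>, depending on \<open>e\<close>,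
  the first term is at most the constant of the hypothesis on \<open>K\<close>.\<close>

lemma slice_moment:
  assumes R: "0 < R"
  obtains A where "0 \<le> A" "\<And>e \<iota>. is_frame e \<iota> \<Longrightarrow>
    (\<integral>\<^sup>+w. ennreal ((norm w)\<^sup>2 * Ks e \<iota> w) * indicator {w. norm w < R} w \<partial>lborel) \<le> ennreal A"
proof -
  obtain a where a: "0 < a" "\<And>e. norm e = 1 \<Longrightarrow>
    eventually (\<lambda>l. (\<integral>\<^sup>+x. ennreal (Kb x) * indicator (Q l e) x \<partial>lborel) \<le> ennreal (a * l)) (at_right 0)"
    by (rule eventually_Kb_Q_bound) (rule that, assumption+)
  have R': "0 < R + R\<^sup>2" using R by (simp add: add_pos_nonneg)
  have [measurable]: "cball (0::real^'n) (R + R\<^sup>2) \<in> sets borel" by simp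
  define F where "F = enn2real (\<integral>\<^sup>+x. ennreal ((norm x)\<^sup>2 * norm (DKb x)) * indicator (cball 0 (R + R\<^sup>2)) x \<partial>lborel)"
  have F: "(\<integral>\<^sup>+x. ennreal ((norm x)\<^sup>2 * norm (DKb x)) * indicator (cball 0 (R + R\<^sup>2)) x \<partial>lborel) = ennreal F"
    unfolding F_def using gradient_second_moment[OF R'] by (simp add: less_top)
  have F0: "0 \<le> F" by (simp add: F_def)
  have "(\<integral>\<^sup>+w. ennreal ((norm w)\<^sup>2 * Ks e \<iota> w) * indicator {w. norm w < R} w \<partial>lborel) \<le> ennreal (a + F)"
    if fr: "is_frame e \<iota>" for e \<iota>
  proof -
    have e: "norm e = 1" using fr by (simp add: is_frame_def)
    have [measurable]: "\<iota> \<in> borel_measurable borel" "Ks e \<iota> \<in> borel_measurable borel"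
      by (rule frame_measurable(1)[OF fr] Ks_measurable[OF fr])+
    have "eventually (\<lambda>l. (\<integral>\<^sup>+x. ennreal (Kb x) * indicator (Q l e) x \<partial>lborel) \<le> ennreal (a * l) \<and> 0 < l \<and> l \<le> 1) (at_right (0::real))"
      using a(2)[OF e] eventually_at_right_less[of "0::real"] eventually_at_right_field[of "\<lambda>l. l \<le> 1" "0::real"]
      by (intro eventually_conj) (auto intro: exI[of _ 1])
    then obtain l where l: "(\<integral>\<^sup>+x. ennreal (Kb x) * indicator (Q l e) x \<partial>lborel) \<le> ennreal (a * l)" "0 < l" "l \<le> 1"
      using eventually_happens[of _ "at_right (0::real)"] by (metis (mono_tags, lifting) trivial_limit_at_right_real)
    have Qm [measurable]: "Q l e \<in> sets borel" by (rule Q_borel[OF e])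
    define g1 where "g1 x = ennreal (Kb x) * indicator (Q l e) x" for x
    define g2 where "g2 x = ennreal l * (ennreal ((norm x)\<^sup>2 * norm (DKb x)) * indicator (Q l e \<inter> cball 0 (R + R\<^sup>2)) x)" for x
    have [measurable]: "g1 \<in> borel_measurable borel" "g2 \<in> borel_measurable borel" unfolding g1_def g2_def by measurable
    have pw: "AE w in lborel. ennreal l * (ennreal ((norm w)\<^sup>2 * Ks e \<iota> w) * indicator {w. norm w < R} w) \<le>
        (\<integral>\<^sup>+\<tau>. g1 (\<iota> w + \<tau> *\<^sub>R e) + g2 (\<iota> w + \<tau> *\<^sub>R e) \<partial>lborel)"
      using AE_line_regular[OF fr] Ks_AE(2)[OF fr]
    proof eventually_elim
      case (elim w)
      show ?case
      proof (cases "norm w < R")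
        case True
        define h where "h = l / 2 * (norm w)\<^sup>2"
        define N where "N = (LINT \<tau>:{-h..h}|lborel. norm (DKb (\<iota> w + \<tau> *\<^sub>R e)))"
        have h: "0 \<le> h" using l by (simp add: h_def)
        have N: "0 \<le> N" unfolding N_def set_lebesgue_integral_def by (intro integral_nonneg_AE AE_I2) simp
        have k0: "Ks e \<iota> w = K (\<iota> w)" by (rule Ks_eq[OF elim(1)])
        have ae: "AE \<tau> in lborel. Kb (\<iota> w + \<tau> *\<^sub>R e) = K (\<iota> w + \<tau> *\<^sub>R e)" using elim(1) by (simp add: line_regular_def)
        have "ennreal l * (ennreal ((norm w)\<^sup>2 * Ks e \<iota> w) * indicator {w. norm w < R} w) = ennreal (Ks e \<iota> w) * ennreal (2 * h)"
          using True l elim(2) by (simp add: ennreal_mult[symmetric] h_def mult_ac)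
        also have "\<dots> = (\<integral>\<^sup>+\<tau>. ennreal (Ks e \<iota> w) * indicator {-h..h} \<tau> \<partial>lborel)"
          using h by (subst nn_integral_cmult_indicator) auto
        also have "\<dots> \<le> (\<integral>\<^sup>+\<tau>. g1 (\<iota> w + \<tau> *\<^sub>R e) + ennreal N * indicator {-h..h} \<tau> \<partial>lborel)"
        proof (rule nn_integral_mono_AE)
          show "AE \<tau> in lborel. ennreal (Ks e \<iota> w) * indicator {-h..h} \<tau> \<le> g1 (\<iota> w + \<tau> *\<^sub>R e) + ennreal N * indicator {-h..h} \<tau>"
            using ae
          proof eventually_elim
            case (elim \<tau>)
            show ?case
            proof (cases "\<tau> \<in> {-h..h}")
              case True
              then have \<tau>: "\<bar>\<tau>\<bar> \<le> h" by auto
              then have q: "\<iota> w + \<tau> *\<^sub>R e \<in> Q l e" using frame_in_Q[OF fr] by (simp add: h_def)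
              have "K (\<iota> w) \<le> Kb (\<iota> w + \<tau> *\<^sub>R e) + N"
                using line_increment_in_slab[OF \<open>line_regular e \<iota> w\<close> \<tau>] elim unfolding N_def by linarith
              then have "ennreal (K (\<iota> w)) \<le> ennreal (Kb (\<iota> w + \<tau> *\<^sub>R e)) + ennreal N"
                using Kb(2) N by (simp add: ennreal_plus[symmetric] ennreal_leI del: ennreal_plus)
              then show ?thesis using True q by (simp add: g1_def k0)
            qed simp
          qed
        qed
        also have "\<dots> = (\<integral>\<^sup>+\<tau>. g1 (\<iota> w + \<tau> *\<^sub>R e) \<partial>lborel) + ennreal N * ennreal (2 * h)"
          using h by (subst nn_integral_add) (auto simp: nn_integral_cmult_indicator)
        also have "ennreal N * ennreal (2 * h) = ennreal (2 * h * N)" using h N by (simp add: ennreal_mult[symmetric] mult_ac)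
        also have "\<dots> \<le> (\<integral>\<^sup>+\<tau>. g2 (\<iota> w + \<tau> *\<^sub>R e) \<partial>lborel)"
          unfolding N_def g2_def h_def by (rule slice_gradient_bound[OF fr elim(1) True l(2,3)])
        finally show ?thesis by (subst nn_integral_add) (auto simp: add_left_mono)
      qed simp
    qed
    have "ennreal l * (\<integral>\<^sup>+w. ennreal ((norm w)\<^sup>2 * Ks e \<iota> w) * indicator {w. norm w < R} w \<partial>lborel) =
       (\<integral>\<^sup>+w. ennreal l * (ennreal ((norm w)\<^sup>2 * Ks e \<iota> w) * indicator {w. norm w < R} w) \<partial>lborel)"
      by (rule nn_integral_cmult[symmetric]) measurable
    also have "\<dots> \<le> (\<integral>\<^sup>+w. (\<integral>\<^sup>+\<tau>. g1 (\<iota> w + \<tau> *\<^sub>R e) + g2 (\<iota> w + \<tau> *\<^sub>R e) \<partial>lborel) \<partial>lborel)"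
      by (rule nn_integral_mono_AE[OF pw])
    also have "\<dots> = (\<integral>\<^sup>+x. g1 x + g2 x \<partial>lborel)"
      by (rule nn_integral_frame[OF fr, symmetric]) measurable
    also have "\<dots> = (\<integral>\<^sup>+x. g1 x \<partial>lborel) + (\<integral>\<^sup>+x. g2 x \<partial>lborel)" by (rule nn_integral_add) auto
    also have "\<dots> \<le> ennreal (a * l) + ennreal l * ennreal F"
    proof (rule add_mono)
      show "(\<integral>\<^sup>+x. g1 x \<partial>lborel) \<le> ennreal (a * l)" using l(1) by (simp add: g1_def)
      have "(\<integral>\<^sup>+x. g2 x \<partial>lborel) = ennreal l * (\<integral>\<^sup>+x. ennreal ((norm x)\<^sup>2 * norm (DKb x)) * indicator (Q l e \<inter> cball 0 (R + R\<^sup>2)) x \<partial>lborel)"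
        unfolding g2_def by (rule nn_integral_cmult) measurable
      also have "\<dots> \<le> ennreal l * ennreal F"
        unfolding F[symmetric] by (intro mult_left_mono nn_integral_mono) (auto simp: indicator_def)
      finally show "(\<integral>\<^sup>+x. g2 x \<partial>lborel) \<le> ennreal l * ennreal F" .
    qed
    also have "\<dots> = ennreal (l * (a + F))" using l a(1) F0 by (simp add: ennreal_mult[symmetric] ennreal_plus[symmetric] algebra_simps del: ennreal_plus)
    finally have "ennreal (1 / l) * (ennreal l * (\<integral>\<^sup>+w. ennreal ((norm w)\<^sup>2 * Ks e \<iota> w) * indicator {w. norm w < R} w \<partial>lborel)) \<le> ennreal (1 / l) * ennreal (l * (a + F))"
      by (rule mult_left_mono) simp
    moreover have "ennreal (1 / l) * (ennreal l * X) = X" for X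
      using l by (simp add: mult.assoc[symmetric] ennreal_mult[symmetric])
    moreover have "ennreal (1 / l) * ennreal (l * (a + F)) = ennreal (a + F)"
      using l a(1) F0 by (simp add: ennreal_mult[symmetric])
    ultimately show ?thesis by simp
  qed
  then show ?thesis using a(1) F0 by (intro that[of "a + F"]) auto
qed

text \<open>Replacing the kernel by its trace in the thin region: along each normal line the error is the length
  \<open>l |w|\<^sup>2\<close> times the integral of \<open>|DK|\<close>, hence at most \<open>l\<close> times the integral of \<open>|x|\<^sup>2 |DK|\<close>.\<close>

lemma slice_replacement:
  assumes fr: "is_frame e \<iota>" and R: "0 < R" and l: "0 < l" "l \<le> 1"
    and \<sigma> [measurable]: "\<sigma> \<in> borel_measurable borel" and \<sigma>1: "\<And>x. \<bar>\<sigma> x\<bar> \<le> 1"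
    and thin: "(\<integral>\<^sup>+x. ennreal ((norm x)\<^sup>2 * norm (DKb x)) * indicator (Q l e \<inter> cball 0 (R + R\<^sup>2)) x \<partial>lborel) \<le> ennreal \<eta>"
    and \<eta>: "0 \<le> \<eta>"
  defines "D \<equiv> \<lambda>w. LINT \<tau>|lborel. \<sigma> (\<iota> w + \<tau> *\<^sub>R e) * indicator {- (l / 2 * (norm w)\<^sup>2)..l / 2 * (norm w)\<^sup>2} \<tau>"
  shows "integrable lborel (\<lambda>w. Ks e \<iota> w * D w * indicator {w. norm w < R} w)"
    and "integrable lborel (\<lambda>x. Kb x * \<sigma> x * indicator {x. norm (frame_proj \<iota> x) < R \<and> \<bar>x \<bullet> e\<bar> \<le> l / 2 * (norm (frame_proj \<iota> x))\<^sup>2} x)"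
    and "\<bar>(LINT x|lborel. Kb x * \<sigma> x * indicator {x. norm (frame_proj \<iota> x) < R \<and> \<bar>x \<bullet> e\<bar> \<le> l / 2 * (norm (frame_proj \<iota> x))\<^sup>2} x)
       - (LINT w|lborel. Ks e \<iota> w * D w * indicator {w. norm w < R} w)\<bar> \<le> l * \<eta>"
proof -
  have e: "norm e = 1" using fr by (simp add: is_frame_def)
  have [measurable]: "\<iota> \<in> borel_measurable borel" "Ks e \<iota> \<in> borel_measurable borel" "Q l e \<in> sets borel"
    "cball (0::real^'n) (R + R\<^sup>2) \<in> sets borel"
    using frame_measurable(1)[OF fr] Ks_measurable[OF fr] Q_borel[OF e] by simp_all
  have [measurable]: "frame_proj \<iota> \<in> borel_measurable borel"
    by (rule borel_measurable_continuous_onI[OF frame_proj(4)[OF fr]])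
  define h where "h w = l / 2 * (norm w)\<^sup>2" for w :: "real^'n punctured"
  have h: "0 \<le> h w" for w using l by (simp add: h_def)
  have hm [measurable]: "h \<in> borel_measurable borel" unfolding h_def by measurable
  define Z where "Z = {x. norm (frame_proj \<iota> x) < R \<and> \<bar>x \<bullet> e\<bar> \<le> l / 2 * (norm (frame_proj \<iota> x))\<^sup>2}"
  have Zm [measurable]: "Z \<in> sets borel" unfolding Z_def by measurable
  have ZT: "\<iota> w + \<tau> *\<^sub>R e \<in> Z \<longleftrightarrow> norm w < R \<and> \<tau> \<in> {- h w..h w}" for w \<tau>
    by (auto simp: Z_def frame_proj(1)[OF fr] frame_height[OF fr] h_def abs_le_iff)
  have ZQ: "x \<in> Z \<Longrightarrow> x \<in> Q l e" for x
    unfolding Q_iff[OF e] using frame_proj(3)[OF fr, of x] by (simp add: Z_def)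
  let ?f = "\<lambda>x. Kb x * \<sigma> x * indicator Z x"
  have fi: "integrable lborel ?f"
  proof (rule integrableI_bounded)
    have "(\<integral>\<^sup>+x. ennreal (norm (?f x)) \<partial>lborel) \<le> (\<integral>\<^sup>+x. ennreal (Kb x) * indicator (Q l e) x \<partial>lborel)"
    proof (rule nn_integral_mono)
      fix x
      have "\<bar>Kb x * \<sigma> x\<bar> \<le> Kb x * 1" unfolding abs_mult using \<sigma>1[of x] Kb(2)[of x] by (intro mult_mono) auto
      then show "ennreal (norm (?f x)) \<le> ennreal (Kb x) * indicator (Q l e) x"
        using ZQ[of x] by (cases "x \<in> Z") (auto intro: ennreal_leI)
    qed
    also have "\<dots> < \<infinity>" unfolding Kb_Q[OF e l(1)] by simp
    finally show "(\<integral>\<^sup>+x. ennreal (norm (?f x)) \<partial>lborel) < \<infinity>" .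
  qed simp
  then show "integrable lborel (\<lambda>x. Kb x * \<sigma> x * indicator {x. norm (frame_proj \<iota> x) < R \<and> \<bar>x \<bullet> e\<bar> \<le> l / 2 * (norm (frame_proj \<iota> x))\<^sup>2} x)"
    by (simp only: Z_def)
  have Dm [measurable]: "D \<in> borel_measurable borel"
  proof -
    have "D = (\<lambda>w. LINT \<tau>|lborel. \<sigma> (\<iota> w + \<tau> *\<^sub>R e) * (if - h w \<le> \<tau> \<and> \<tau> \<le> h w then 1 else 0))"
      by (intro ext) (simp only: D_def h_def indicator_def of_bool_def atLeastAtMost_iff)
    also have "\<dots> \<in> borel_measurable borel" by (rule lborel.borel_measurable_lebesgue_integral) measurable
    finally show ?thesis .
  qed
  have \<sigma>i: "integrable lborel (\<lambda>\<tau>. \<sigma> (\<iota> w + \<tau> *\<^sub>R e) * indicator {- h w..h w} \<tau>)" for w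
    by (rule integrable_bounded_on_interval) (measurable, rule \<sigma>1)
  have Db: "\<bar>D w\<bar> \<le> l * (norm w)\<^sup>2" for w
  proof -
    have "\<bar>D w\<bar> \<le> (LINT \<tau>|lborel. norm (\<sigma> (\<iota> w + \<tau> *\<^sub>R e) * indicator {- h w..h w} \<tau>))"
      unfolding D_def h_def[symmetric] real_norm_def[symmetric] by (rule integral_norm_bound)
    also have "\<dots> \<le> (LINT \<tau>|lborel. indicator {- h w..h w} \<tau>)"
      by (rule integral_mono[OF integrable_norm[OF \<sigma>i] integrable_interval]) (use \<sigma>1 in \<open>auto simp: indicator_def\<close>)
    also have "\<dots> = l * (norm w)\<^sup>2" using h[of w] by (simp add: h_def)
    finally show ?thesis .
  qed
  let ?g = "\<lambda>w. Ks e \<iota> w * D w * indicator {w. norm w < R} w"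
  obtain A where A: "0 \<le> A" "\<And>e \<iota>. is_frame e \<iota> \<Longrightarrow>
    (\<integral>\<^sup>+w. ennreal ((norm w)\<^sup>2 * Ks e \<iota> w) * indicator {w. norm w < R} w \<partial>lborel) \<le> ennreal A"
    by (rule slice_moment[OF R]) (rule that, assumption+)
  show gi: "integrable lborel ?g"
  proof (rule integrableI_bounded)
    have "(\<integral>\<^sup>+w. ennreal (norm (?g w)) \<partial>lborel) \<le> (\<integral>\<^sup>+w. ennreal l * (ennreal ((norm w)\<^sup>2 * Ks e \<iota> w) * indicator {w. norm w < R} w) \<partial>lborel)"
    proof (rule nn_integral_mono_AE)
      show "AE w in lborel. ennreal (norm (?g w)) \<le> ennreal l * (ennreal ((norm w)\<^sup>2 * Ks e \<iota> w) * indicator {w. norm w < R} w)"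
        using Ks_AE(2)[OF fr]
      proof eventually_elim
        case (elim w)
        have "\<bar>Ks e \<iota> w * D w\<bar> \<le> Ks e \<iota> w * (l * (norm w)\<^sup>2)"
          unfolding abs_mult using elim Db[of w] by (intro mult_mono) auto
        then show ?case using l elim by (auto simp: indicator_def ennreal_mult[symmetric] mult_ac intro!: ennreal_leI)
      qed
    qed
    also have "\<dots> = ennreal l * (\<integral>\<^sup>+w. ennreal ((norm w)\<^sup>2 * Ks e \<iota> w) * indicator {w. norm w < R} w \<partial>lborel)"
      by (rule nn_integral_cmult) measurable
    also have "\<dots> \<le> ennreal l * ennreal A" by (intro mult_left_mono A(2)[OF fr]) simp
    also have "\<dots> < \<infinity>" by (simp add: ennreal_mult_less_top)
    finally show "(\<integral>\<^sup>+w. ennreal (norm (?g w)) \<partial>lborel) < \<infinity>" .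
  qed measurable
  define F where "F w = (LINT \<tau>|lborel. ?f (\<iota> w + \<tau> *\<^sub>R e))" for w
  have Fi: "integrable lborel F" "(LINT x|lborel. ?f x) = (LINT w|lborel. F w)"
    unfolding F_def by (rule integral_frame(2)[OF fr fi] integral_frame(3)[OF fr fi])+
  let ?G = "\<lambda>x. ennreal l * (ennreal ((norm x)\<^sup>2 * norm (DKb x)) * indicator (Q l e \<inter> cball 0 (R + R\<^sup>2)) x)"
  have pw: "AE w in lborel. ennreal \<bar>F w - ?g w\<bar> \<le> (\<integral>\<^sup>+\<tau>. ?G (\<iota> w + \<tau> *\<^sub>R e) \<partial>lborel)"
    using AE_line_regular[OF fr]
  proof eventually_elim
    case (elim w)
    show ?case
    proof (cases "norm w < R")
      case True
      define N where "N = (LINT \<tau>:{-h w..h w}|lborel. norm (DKb (\<iota> w + \<tau> *\<^sub>R e)))"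
      have N0: "0 \<le> N" unfolding N_def set_lebesgue_integral_def by (intro integral_nonneg_AE AE_I2) simp
      define k where "k \<tau> = K (\<iota> w + \<tau> *\<^sub>R e)" for \<tau>
      have kc: "continuous_on UNIV k" using elim by (simp add: line_regular_def k_def[abs_def])
      then have km [measurable]: "k \<in> borel_measurable borel" by (rule borel_measurable_continuous_onI)
      have ae: "AE \<tau> in lborel. Kb (\<iota> w + \<tau> *\<^sub>R e) = k \<tau>" using elim by (simp add: line_regular_def k_def)
      let ?s = "\<lambda>\<tau>. \<sigma> (\<iota> w + \<tau> *\<^sub>R e) * indicator {- h w..h w} \<tau>"
      have inc: "\<bar>k \<tau> - k 0\<bar> \<le> N" if "\<tau> \<in> {-h w..h w}" for \<tau>
        unfolding k_def N_def using line_increment_in_slab[OF elim, of \<tau> "h w"] that by (simp add: abs_le_iff)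
      have sb: "\<bar>?s \<tau>\<bar> \<le> indicator {- h w..h w} \<tau>" for \<tau> using \<sigma>1 by (simp add: indicator_def)
      have db: "norm ((k \<tau> - k 0) * ?s \<tau>) \<le> N * indicator {- h w..h w} \<tau>" for \<tau>
        using inc[of \<tau>] \<sigma>1[of "\<iota> w + \<tau> *\<^sub>R e"] N0
        by (cases "\<tau> \<in> {-h w..h w}") (auto simp: abs_mult intro: order.trans[OF mult_left_le])
      have Ni: "integrable lborel (\<lambda>\<tau>. N * indicator {- h w..h w} \<tau>)" by (intro integrable_mult_right integrable_interval)
      have di: "integrable lborel (\<lambda>\<tau>. (k \<tau> - k 0) * ?s \<tau>)"
        by (rule Bochner_Integration.integrable_bound[OF Ni]) (use db N0 in auto)
      have "F w = (LINT \<tau>|lborel. (k \<tau> - k 0) * ?s \<tau> + k 0 * ?s \<tau>)"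
        unfolding F_def
      proof (rule integral_cong_AE)
        show "AE \<tau> in lborel. Kb (\<iota> w + \<tau> *\<^sub>R e) * \<sigma> (\<iota> w + \<tau> *\<^sub>R e) * indicator Z (\<iota> w + \<tau> *\<^sub>R e) = (k \<tau> - k 0) * ?s \<tau> + k 0 * ?s \<tau>"
          using ae
        proof eventually_elim
          case (elim \<tau>)
          have "indicator Z (\<iota> w + \<tau> *\<^sub>R e) = (indicator {- h w..h w} \<tau> :: real)" using ZT[of w \<tau>] True by (simp add: indicator_def)
          then show ?case using elim by (simp add: algebra_simps)
        qed
      qed measurable
      also have "\<dots> = (LINT \<tau>|lborel. (k \<tau> - k 0) * ?s \<tau>) + k 0 * D w"
        unfolding D_def h_def[symmetric] using di \<sigma>i by (subst Bochner_Integration.integral_add) auto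
      finally have "F w - ?g w = (LINT \<tau>|lborel. (k \<tau> - k 0) * ?s \<tau>)"
        using True by (simp add: Ks_eq[OF elim] k_def)
      then have "\<bar>F w - ?g w\<bar> \<le> (LINT \<tau>|lborel. norm ((k \<tau> - k 0) * ?s \<tau>))"
        using integral_norm_bound[of lborel "\<lambda>\<tau>. (k \<tau> - k 0) * ?s \<tau>"] by simp
      also have "\<dots> \<le> (LINT \<tau>|lborel. N * indicator {- h w..h w} \<tau>)"
        by (rule integral_mono[OF integrable_norm[OF di] Ni db])
      also have "\<dots> = 2 * h w * N" using h[of w] by simp
      finally have "ennreal \<bar>F w - ?g w\<bar> \<le> ennreal (2 * h w * N)" by (rule ennreal_leI)
      also have "\<dots> \<le> (\<integral>\<^sup>+\<tau>. ?G (\<iota> w + \<tau> *\<^sub>R e) \<partial>lborel)"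
        unfolding N_def h_def by (rule slice_gradient_bound[OF fr elim True l])
      finally show ?thesis .
    next
      case False
      then have "F w = 0" unfolding F_def using ZT[of w] by simp
      then show ?thesis using False by simp
    qed
  qed
  have "(\<integral>\<^sup>+w. ennreal \<bar>F w - ?g w\<bar> \<partial>lborel) \<le> (\<integral>\<^sup>+w. (\<integral>\<^sup>+\<tau>. ?G (\<iota> w + \<tau> *\<^sub>R e) \<partial>lborel) \<partial>lborel)"
    by (rule nn_integral_mono_AE[OF pw])
  also have "\<dots> = (\<integral>\<^sup>+x. ?G x \<partial>lborel)" by (rule nn_integral_frame[OF fr, symmetric]) measurable
  also have "\<dots> = ennreal l * (\<integral>\<^sup>+x. ennreal ((norm x)\<^sup>2 * norm (DKb x)) * indicator (Q l e \<inter> cball 0 (R + R\<^sup>2)) x \<partial>lborel)"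
    by (rule nn_integral_cmult) measurable
  also have "\<dots> \<le> ennreal l * ennreal \<eta>" by (intro mult_left_mono thin) simp
  also have "\<dots> = ennreal (l * \<eta>)" using l \<eta> by (intro ennreal_mult[symmetric]) auto
  finally have "\<bar>(LINT w|lborel. F w) - (LINT w|lborel. ?g w)\<bar> \<le> l * \<eta>"
    using l \<eta> by (intro integral_diff_le_nn_integral Fi(1) gi) auto
  then show "\<bar>(LINT x|lborel. Kb x * \<sigma> x * indicator {x. norm (frame_proj \<iota> x) < R \<and> \<bar>x \<bullet> e\<bar> \<le> l / 2 * (norm (frame_proj \<iota> x))\<^sup>2} x)
       - (LINT w|lborel. ?g w)\<bar> \<le> l * \<eta>"
    by (simp only: Fi(2)[symmetric] Z_def)
qed

end

section \<open>Integrals over thin neighbourhoods of a hyperplane\<close>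

context planar_kernel begin

lemma slice_weight_integrable:
  assumes fr: "is_frame e \<iota>" and R: "0 < R" and b [measurable]: "b \<in> borel_measurable borel"
    and bC: "\<And>w. \<bar>b w\<bar> \<le> C * (norm w)\<^sup>2"
  shows "integrable lborel (\<lambda>w. Ks e \<iota> w * b w * indicator {w. norm w < R} w)"
proof (rule integrableI_bounded)
  have [measurable]: "Ks e \<iota> \<in> borel_measurable borel" by (rule Ks_measurable[OF fr])
  show "(\<lambda>w. Ks e \<iota> w * b w * indicator {w. norm w < R} w) \<in> borel_measurable lborel" by measurable
  obtain A where A: "0 \<le> A" "\<And>e \<iota>. is_frame e \<iota> \<Longrightarrow>
    (\<integral>\<^sup>+w. ennreal ((norm w)\<^sup>2 * Ks e \<iota> w) * indicator {w. norm w < R} w \<partial>lborel) \<le> ennreal A"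
    by (rule slice_moment[OF R]) (rule that, assumption+)
  have "(\<integral>\<^sup>+w. ennreal (norm (Ks e \<iota> w * b w * indicator {w. norm w < R} w)) \<partial>lborel)
      \<le> (\<integral>\<^sup>+w. ennreal \<bar>C\<bar> * (ennreal ((norm w)\<^sup>2 * Ks e \<iota> w) * indicator {w. norm w < R} w) \<partial>lborel)"
  proof (rule nn_integral_mono_AE)
    show "AE w in lborel. ennreal (norm (Ks e \<iota> w * b w * indicator {w. norm w < R} w))
        \<le> ennreal \<bar>C\<bar> * (ennreal ((norm w)\<^sup>2 * Ks e \<iota> w) * indicator {w. norm w < R} w)"
      using Ks_AE(2)[OF fr]
    proof eventually_elim
      case (elim w)
      have "\<bar>b w\<bar> \<le> \<bar>C\<bar> * (norm w)\<^sup>2" by (rule order.trans[OF bC]) (simp add: mult_right_mono)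
      then have "\<bar>Ks e \<iota> w * b w\<bar> \<le> Ks e \<iota> w * (\<bar>C\<bar> * (norm w)\<^sup>2)"
        unfolding abs_mult using elim by (intro mult_mono) auto
      then show ?case using elim by (auto simp: indicator_def ennreal_mult[symmetric] mult_ac intro!: ennreal_leI)
    qed
  qed
  also have "\<dots> = ennreal \<bar>C\<bar> * (\<integral>\<^sup>+w. ennreal ((norm w)\<^sup>2 * Ks e \<iota> w) * indicator {w. norm w < R} w \<partial>lborel)"
    by (rule nn_integral_cmult) measurable
  also have "\<dots> \<le> ennreal \<bar>C\<bar> * ennreal A" by (intro mult_left_mono A(2)[OF fr]) simp
  also have "\<dots> < \<infinity>" by (simp add: ennreal_mult_less_top)
  finally show "(\<integral>\<^sup>+w. ennreal (norm (Ks e \<iota> w * b w * indicator {w. norm w < R} w)) \<partial>lborel) < \<infinity>" .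
qed

text \<open>The function \<open>\<sigma>\<close> vanishes outside the thin region and, up to relative error \<open>\<eta>\<close>, is the defect between the
  subgraph of \<open>\<epsilon> / 2 b\<close> and the half space. After \<open>slice_replacement\<close> only its integral in the height
  matters, which differs from \<open>\<epsilon> / 2 b w\<close> by at most \<open>4 \<eta> \<epsilon> |w|\<^sup>2\<close>; the moment bound is uniform in the
  frame, and so is the choice of \<open>\<eta>\<close> and \<open>\<epsilon>0\<close>.\<close>

lemma thin_region_expansion:
  assumes C1: "0 < C1" and R: "0 < R" and \<tau>: "0 < \<tau>"
  obtains \<eta> \<epsilon>0 where "0 < \<eta>" "0 < \<epsilon>0"
    "\<And>e \<iota> \<sigma> b \<epsilon>. is_frame e \<iota> \<Longrightarrow> \<sigma> \<in> borel_measurable borel \<Longrightarrow> \<forall>x. \<bar>\<sigma> x\<bar> \<le> 1 \<Longrightarrow>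
       b \<in> borel_measurable borel \<Longrightarrow> \<forall>w. \<bar>b w\<bar> \<le> 2 * C1 * (norm w)\<^sup>2 \<Longrightarrow> 0 < \<epsilon> \<Longrightarrow> \<epsilon> \<le> \<epsilon>0 \<Longrightarrow>
       \<forall>w t. norm w < R \<longrightarrow> C1 * \<epsilon> * (norm w)\<^sup>2 < \<bar>t\<bar> \<longrightarrow> \<sigma> (\<iota> w + t *\<^sub>R e) = 0 \<Longrightarrow>
       \<forall>w t. norm w < R \<longrightarrow> \<bar>t\<bar> \<le> C1 * \<epsilon> * (norm w)\<^sup>2 \<longrightarrow> \<eta> * \<epsilon> * (norm w)\<^sup>2 < \<bar>t - \<epsilon> / 2 * b w\<bar> \<longrightarrow>
          \<sigma> (\<iota> w + t *\<^sub>R e) = (if t < \<epsilon> / 2 * b w then 1 else 0) - (if t < 0 then 1 else 0) \<Longrightarrow>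
       \<bar>(LINT x|lborel. Kb x * \<sigma> x * indicator {x. norm (frame_proj \<iota> x) < R} x)
         - \<epsilon> / 2 * (LINT w|lborel. Ks e \<iota> w * b w * indicator {w. norm w < R} w)\<bar> \<le> \<epsilon> * \<tau>"
proof -
  obtain A where A: "0 \<le> A" "\<And>e \<iota>. is_frame e \<iota> \<Longrightarrow>
    (\<integral>\<^sup>+w. ennreal ((norm w)\<^sup>2 * Ks e \<iota> w) * indicator {w. norm w < R} w \<partial>lborel) \<le> ennreal A"
    by (rule slice_moment[OF R]) (rule that, assumption+)
  \<comment> \<open>half of the tolerance each for the gradient error \<open>2 C1 \<epsilon> \<eta>2\<close> and for the height error \<open>4 \<eta> \<epsilon> A\<close>\<close>
  define \<eta>2 where "\<eta>2 = \<tau> / (4 * C1)"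
  define \<eta> where "\<eta> = \<tau> / (8 * (A + 1))"
  have \<eta>2: "0 < \<eta>2" and \<eta>: "0 < \<eta>" using \<tau> C1 A(1) by (simp_all add: \<eta>2_def \<eta>_def)
  have R': "0 < R + R\<^sup>2" using R by (simp add: add_pos_nonneg)
  obtain l0 where l0: "0 < l0" "\<And>l e. 0 < l \<Longrightarrow> l \<le> l0 \<Longrightarrow> norm e = 1 \<Longrightarrow>
    (\<integral>\<^sup>+x. ennreal ((norm x)\<^sup>2 * norm (DKb x)) * indicator (Q l e \<inter> cball 0 (R + R\<^sup>2)) x \<partial>lborel) \<le> ennreal \<eta>2"
    by (rule gradient_thin[OF R' \<eta>2]) (rule that, assumption+)
  define \<epsilon>0 where "\<epsilon>0 = min l0 1 / (2 * C1)"
  have main: "\<bar>(LINT x|lborel. Kb x * \<sigma> x * indicator {x. norm (frame_proj \<iota> x) < R} x)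
         - \<epsilon> / 2 * (LINT w|lborel. Ks e \<iota> w * b w * indicator {w. norm w < R} w)\<bar> \<le> \<epsilon> * \<tau>"
    if fr: "is_frame e \<iota>" and \<sigma> [measurable]: "\<sigma> \<in> borel_measurable borel" and \<sigma>1': "\<forall>x. \<bar>\<sigma> x\<bar> \<le> 1"
      and b [measurable]: "b \<in> borel_measurable borel" and bC': "\<forall>w. \<bar>b w\<bar> \<le> 2 * C1 * (norm w)\<^sup>2"
      and \<epsilon>: "0 < \<epsilon>" "\<epsilon> \<le> \<epsilon>0"
      and H1': "\<forall>w t. norm w < R \<longrightarrow> C1 * \<epsilon> * (norm w)\<^sup>2 < \<bar>t\<bar> \<longrightarrow> \<sigma> (\<iota> w + t *\<^sub>R e) = 0"
      and H2': "\<forall>w t. norm w < R \<longrightarrow> \<bar>t\<bar> \<le> C1 * \<epsilon> * (norm w)\<^sup>2 \<longrightarrow> \<eta> * \<epsilon> * (norm w)\<^sup>2 < \<bar>t - \<epsilon> / 2 * b w\<bar> \<longrightarrow>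
          \<sigma> (\<iota> w + t *\<^sub>R e) = (if t < \<epsilon> / 2 * b w then 1 else 0) - (if t < 0 then 1 else 0)"
    for e \<iota> \<sigma> b \<epsilon>
  proof -
    note \<sigma>1 = \<sigma>1'[rule_format] and bC = bC'[rule_format] and H1 = H1'[rule_format] and H2 = H2'[rule_format]
    have e: "norm e = 1" using fr by (simp add: is_frame_def)
    have [measurable]: "\<iota> \<in> borel_measurable borel" "Ks e \<iota> \<in> borel_measurable borel"
      using frame_measurable(1)[OF fr] Ks_measurable[OF fr] by simp_all
    define l where "l = 2 * C1 * \<epsilon>"
    have "l \<le> min l0 1" using \<epsilon>(2) C1 by (simp add: l_def \<epsilon>0_def field_simps)
    then have l: "0 < l" "l \<le> 1" "l \<le> l0" using \<epsilon> C1 by (simp_all add: l_def)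
    define h where "h w = l / 2 * (norm w)\<^sup>2" for w :: "real^'n punctured"
    have h: "0 \<le> h w" "h w = C1 * \<epsilon> * (norm w)\<^sup>2" for w using l by (simp_all add: h_def l_def)
    define D where "D w = (LINT \<tau>|lborel. \<sigma> (\<iota> w + \<tau> *\<^sub>R e) * indicator {- h w..h w} \<tau>)" for w
    note rep = slice_replacement[OF fr R l(1,2) \<sigma> \<sigma>1 l0(2)[OF l(1,3) e] less_imp_le[OF \<eta>2],
        folded h_def, folded D_def]
    have cut: "Kb x * \<sigma> x * indicator {x. norm (frame_proj \<iota> x) < R \<and> \<bar>x \<bullet> e\<bar> \<le> h (frame_proj \<iota> x)} x
        = Kb x * \<sigma> x * indicator {x. norm (frame_proj \<iota> x) < R} x" for x
      using H1[of "frame_proj \<iota> x" "x \<bullet> e"] frame_proj(2)[OF fr, of x] h(2)[of "frame_proj \<iota> x"]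
      by (auto simp: indicator_def not_le)
    have r: "\<bar>(LINT x|lborel. Kb x * \<sigma> x * indicator {x. norm (frame_proj \<iota> x) < R} x)
        - (LINT w|lborel. Ks e \<iota> w * D w * indicator {w. norm w < R} w)\<bar> \<le> l * \<eta>2"
      using rep(3) by (simp only: cut)
    have Dd: "\<bar>D w - \<epsilon> / 2 * b w\<bar> \<le> 4 * \<eta> * \<epsilon> * (norm w)\<^sup>2" if w: "norm w < R" for w
    proof -
      define c where "c = \<epsilon> / 2 * b w"
      define \<kappa> where "\<kappa> = \<eta> * \<epsilon> * (norm w)\<^sup>2"
      have \<kappa>: "0 \<le> \<kappa>" using \<eta> \<epsilon> by (simp add: \<kappa>_def)
      have "\<bar>c\<bar> = \<epsilon> / 2 * \<bar>b w\<bar>" using \<epsilon> by (simp add: c_def abs_mult)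
      also have "\<dots> \<le> \<epsilon> / 2 * (2 * C1 * (norm w)\<^sup>2)" using bC[of w] \<epsilon> by (intro mult_left_mono) auto
      finally have ch: "\<bar>c\<bar> \<le> h w" by (simp add: h(2) mult_ac)
      let ?J = "\<lambda>\<tau>. ((if \<tau> < c then 1 else 0) - (if \<tau> < 0 then 1 else (0::real))) * indicator {- h w..h w} \<tau>"
      let ?s = "\<lambda>\<tau>. \<sigma> (\<iota> w + \<tau> *\<^sub>R e) * indicator {- h w..h w} \<tau>"
      have si: "integrable lborel ?s"
        by (rule integrable_bounded_on_interval) (measurable, rule \<sigma>1)
      have Ji: "integrable lborel ?J" "(LINT \<tau>|lborel. ?J \<tau>) = c" by (rule integral_step_difference[OF ch])+
      have "D w - c = (LINT \<tau>|lborel. ?s \<tau> - ?J \<tau>)" unfolding D_def using si Ji by simp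
      then have "\<bar>D w - c\<bar> \<le> (LINT \<tau>|lborel. norm (?s \<tau> - ?J \<tau>))"
        using integral_norm_bound[of lborel "\<lambda>\<tau>. ?s \<tau> - ?J \<tau>"] by simp
      also have "\<dots> \<le> (LINT \<tau>|lborel. 2 * indicator {c - \<kappa>..c + \<kappa>} \<tau>)"
      proof (rule integral_mono)
        show "integrable lborel (\<lambda>\<tau>. norm (?s \<tau> - ?J \<tau>))" using si Ji by (intro integrable_norm Bochner_Integration.integrable_diff)
        show "integrable lborel (\<lambda>\<tau>. 2 * indicator {c - \<kappa>..c + \<kappa>} \<tau> :: real)" by (intro integrable_mult_right integrable_interval)
        fix \<tau> :: real
        show "norm (?s \<tau> - ?J \<tau>) \<le> 2 * indicator {c - \<kappa>..c + \<kappa>} \<tau>"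
        proof (cases "\<tau> \<in> {c - \<kappa>..c + \<kappa>}")
          case True
          have "\<bar>?s \<tau> - ?J \<tau>\<bar> \<le> 2" using \<sigma>1[of "\<iota> w + \<tau> *\<^sub>R e"] by (auto simp: indicator_def)
          then show ?thesis using True by simp
        next
          case False
          then have f: "\<eta> * \<epsilon> * (norm w)\<^sup>2 < \<bar>\<tau> - \<epsilon> / 2 * b w\<bar>" by (auto simp: c_def \<kappa>_def)
          have "?s \<tau> = ?J \<tau>"
          proof (cases "\<tau> \<in> {- h w..h w}")
            case True
            then have "\<bar>\<tau>\<bar> \<le> C1 * \<epsilon> * (norm w)\<^sup>2" unfolding h(2) by (auto simp: abs_le_iff)
            from H2[OF w this f] show ?thesis by (simp only: c_def)
          qed simp
          then show ?thesis using False by simp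
        qed
      qed
      also have "\<dots> = 4 * \<kappa>" using \<kappa> by simp
      finally show ?thesis by (simp add: c_def \<kappa>_def mult.assoc)
    qed
    have bi: "integrable lborel (\<lambda>w. \<epsilon> / 2 * (Ks e \<iota> w * b w * indicator {w. norm w < R} w))"
      by (intro integrable_mult_right slice_weight_integrable[OF fr R b bC])
    have "\<bar>(LINT w|lborel. Ks e \<iota> w * D w * indicator {w. norm w < R} w)
        - (LINT w|lborel. \<epsilon> / 2 * (Ks e \<iota> w * b w * indicator {w. norm w < R} w))\<bar> \<le> 4 * \<eta> * \<epsilon> * A"
    proof (rule integral_diff_le_nn_integral[OF rep(1) bi])
      have "(\<integral>\<^sup>+w. ennreal \<bar>Ks e \<iota> w * D w * indicator {w. norm w < R} w - \<epsilon> / 2 * (Ks e \<iota> w * b w * indicator {w. norm w < R} w)\<bar> \<partial>lborel)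
         \<le> (\<integral>\<^sup>+w. ennreal (4 * \<eta> * \<epsilon>) * (ennreal ((norm w)\<^sup>2 * Ks e \<iota> w) * indicator {w. norm w < R} w) \<partial>lborel)"
      proof (rule nn_integral_mono_AE)
        show "AE w in lborel. ennreal \<bar>Ks e \<iota> w * D w * indicator {w. norm w < R} w - \<epsilon> / 2 * (Ks e \<iota> w * b w * indicator {w. norm w < R} w)\<bar>
          \<le> ennreal (4 * \<eta> * \<epsilon>) * (ennreal ((norm w)\<^sup>2 * Ks e \<iota> w) * indicator {w. norm w < R} w)"
          using Ks_AE(2)[OF fr]
        proof eventually_elim
          case (elim w)
          show ?case
          proof (cases "norm w < R")
            case True
            have "\<bar>Ks e \<iota> w * D w - \<epsilon> / 2 * (Ks e \<iota> w * b w)\<bar> = Ks e \<iota> w * \<bar>D w - \<epsilon> / 2 * b w\<bar>"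
              using elim by (simp add: abs_mult[of "Ks e \<iota> w", simplified abs_of_nonneg[OF elim], symmetric] algebra_simps)
            also have "\<dots> \<le> Ks e \<iota> w * (4 * \<eta> * \<epsilon> * (norm w)\<^sup>2)" by (rule mult_left_mono[OF Dd[OF True] elim])
            also have "\<dots> = 4 * \<eta> * \<epsilon> * ((norm w)\<^sup>2 * Ks e \<iota> w)" by simp
            finally have "ennreal \<bar>Ks e \<iota> w * D w - \<epsilon> / 2 * (Ks e \<iota> w * b w)\<bar> \<le> ennreal (4 * \<eta> * \<epsilon> * ((norm w)\<^sup>2 * Ks e \<iota> w))" by (rule ennreal_leI)
            also have "\<dots> = ennreal (4 * \<eta> * \<epsilon>) * ennreal ((norm w)\<^sup>2 * Ks e \<iota> w)" using \<eta> \<epsilon> by (intro ennreal_mult) (use elim in auto)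
            finally show ?thesis using True by simp
          qed simp
        qed
      qed
      also have "\<dots> = ennreal (4 * \<eta> * \<epsilon>) * (\<integral>\<^sup>+w. ennreal ((norm w)\<^sup>2 * Ks e \<iota> w) * indicator {w. norm w < R} w \<partial>lborel)"
        by (rule nn_integral_cmult) measurable
      also have "\<dots> \<le> ennreal (4 * \<eta> * \<epsilon>) * ennreal A" by (intro mult_left_mono A(2)[OF fr]) simp
      also have "\<dots> = ennreal (4 * \<eta> * \<epsilon> * A)" using \<eta> \<epsilon> A by (intro ennreal_mult[symmetric]) auto
      finally show "(\<integral>\<^sup>+w. ennreal \<bar>Ks e \<iota> w * D w * indicator {w. norm w < R} w - \<epsilon> / 2 * (Ks e \<iota> w * b w * indicator {w. norm w < R} w)\<bar> \<partial>lborel) \<le> ennreal (4 * \<eta> * \<epsilon> * A)" .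
      show "0 \<le> 4 * \<eta> * \<epsilon> * A" using \<eta> \<epsilon> A by simp
    qed
    moreover have "l * \<eta>2 = \<epsilon> * (\<tau> / 2)" using C1 by (simp add: l_def \<eta>2_def)
    moreover have "4 * \<eta> * \<epsilon> * A \<le> \<epsilon> * (\<tau> / 2)"
    proof -
      have "4 * \<eta> * \<epsilon> * A \<le> 4 * \<eta> * \<epsilon> * (A + 1)" using \<eta> \<epsilon> by (intro mult_left_mono) auto
      also have "\<dots> = \<epsilon> * (\<tau> / 2)" using A(1) by (simp add: \<eta>_def add_eq_0_iff_both_eq_0 field_simps)
      finally show ?thesis .
    qed
    ultimately show ?thesis using r by simp
  qed
  show ?thesis
  proof (rule that[OF \<eta>])
    show "0 < \<epsilon>0" using l0(1) C1 by (simp add: \<epsilon>0_def)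
  qed (rule main, assumption+)
qed

end

section \<open>The curvature as an integral against the defect of a half space\<close>

lemma nn_integral_lborel_affine:
  fixes f :: "'a::euclidean_space \<Rightarrow> ennreal"
  assumes [measurable]: "f \<in> borel_measurable borel" and c: "c \<noteq> 0"
  shows "(\<integral>\<^sup>+y. f y \<partial>lborel) = ennreal (\<bar>c\<bar> ^ DIM('a)) * (\<integral>\<^sup>+z. f (x + c *\<^sub>R z) \<partial>lborel)"
  by (subst lborel_affine[OF c, of x]) (simp add: nn_integral_density nn_integral_distr nn_integral_cmult)

lemma AE_lborel_affine:
  fixes x :: "'a::euclidean_space"
  assumes P: "AE y in lborel. P y" and c: "c \<noteq> 0"
  shows "AE z in lborel. P (x + c *\<^sub>R z)"
proof -
  obtain N where N: "{y. \<not> P y} \<subseteq> N" "emeasure lborel N = 0" "N \<in> sets borel"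
    using P by (auto elim!: AE_E)
  have [measurable]: "N \<in> sets borel" by (rule N(3))
  have "ennreal (\<bar>c\<bar> ^ DIM('a)) * (\<integral>\<^sup>+z. indicator N (x + c *\<^sub>R z) \<partial>lborel) = 0"
    using N(2) by (subst nn_integral_lborel_affine[symmetric, OF _ c]) simp_all
  then have "(\<integral>\<^sup>+z. indicator N (x + c *\<^sub>R z) \<partial>lborel) = 0" using c by simp
  then have "AE z in lborel. (indicator N (x + c *\<^sub>R z) :: ennreal) = 0"
    by (subst (asm) nn_integral_0_iff_AE) auto
  then show ?thesis by eventually_elim (use N(1) in \<open>auto simp: indicator_def split: if_splits\<close>)
qed

lemma integral_lborel_affine:
  fixes f :: "'a::euclidean_space \<Rightarrow> real"
  assumes [measurable]: "f \<in> borel_measurable borel" and c: "c \<noteq> 0"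
  shows "(LINT y|lborel. f y) = \<bar>c\<bar> ^ DIM('a) * (LINT z|lborel. f (x + c *\<^sub>R z))"
  by (subst lborel_affine[OF c, of x]) (simp add: integral_density integral_distr)

lemma borel_measurable_lebesgue_AE:
  fixes f g :: "'a::euclidean_space \<Rightarrow> 'b::topological_space"
  assumes g: "g \<in> borel_measurable borel" and ae: "AE x in lborel. f x = g x"
  shows "f \<in> borel_measurable lebesgue"
proof (rule measurableI)
  fix S :: "'b set" assume S: "S \<in> sets borel"
  have ae': "AE x in lebesgue. x \<in> g -` S \<longleftrightarrow> x \<in> f -` S"
    using AE_completion[OF ae] by eventually_elim simp
  have "g -` S \<in> sets lebesgue" using measurable_sets[OF g S] by simp
  then have "f -` S \<in> sets lebesgue" using completion.in_sets_AE[OF ae'] by simp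
  then show "f -` S \<inter> space lebesgue \<in> sets lebesgue" by simp
qed simp

lemma integral_lebesgue_AE:
  fixes f g :: "'a::euclidean_space \<Rightarrow> 'b::euclidean_space"
  assumes g: "g \<in> borel_measurable borel" and ae: "AE x in lborel. f x = g x"
  shows "(LINT x|lebesgue. f x) = (LINT x|lborel. g x)"
proof -
  have gl: "g \<in> borel_measurable lborel" using g by simp
  have "(LINT x|lebesgue. f x) = (LINT x|lebesgue. g x)"
    by (rule integral_cong_AE[OF borel_measurable_lebesgue_AE[OF g ae] measurable_completion[OF gl] AE_completion[OF ae]])
  then show ?thesis using integral_completion[OF gl] by simp
qed

text \<open>The interior of \<open>E\<close> replaces \<open>E\<close> because it is Borel; the frontier will turn out to be a null set.\<close>

definition halfspace_defect :: "(real^'n::finite) set \<Rightarrow> real^'n \<Rightarrow> real^'n \<Rightarrow> real \<Rightarrow> real^'n \<Rightarrow> real" where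
  "halfspace_defect E n x \<epsilon> z = (if x + \<epsilon> *\<^sub>R z \<in> interior E then 1 else 0) - (if z \<bullet> n < 0 then 1 else 0)"

lemma halfspace_defect_measurable [measurable]: "halfspace_defect E n x \<epsilon> \<in> borel_measurable borel"
proof -
  have [measurable]: "interior E \<in> sets borel" by simp
  show ?thesis unfolding halfspace_defect_def by measurable
qed

lemma halfspace_defect_bound: "\<bar>halfspace_defect E n x \<epsilon> z\<bar> \<le> 1"
  by (simp add: halfspace_defect_def)

context planar_kernel begin

text \<open>The reflection \<open>z \<mapsto> - z\<close> changes the sign of the integrand, as \<open>K\<close> is even and the hyperplane is null.\<close>

lemma halfspace_balanced:
  assumes n: "norm n = 1" and r: "0 < r"
  shows "(LINT z|lborel. indicator (- ball 0 r) z * Kb z * (2 * (if z \<bullet> n < 0 then 1 else 0) - 1)) = 0"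
proof -
  let ?h = "\<lambda>z. indicator (- ball 0 r) z * Kb z * (2 * (if z \<bullet> n < 0 then 1 else 0) - 1)"
  have [measurable]: "ball (0::real^'n) r \<in> sets borel" by simp
  have n0: "n \<noteq> 0" using n by auto
  have "negligible {z. n \<bullet> z = 0}" using n0 by (rule negligible_hyperplane[OF disjI1])
  then have "AE z in lebesgue. z \<notin> {z. n \<bullet> z = 0}"
    unfolding negligible_iff_null_sets by (rule AE_not_in)
  then have a0: "AE z in lborel. z \<bullet> n \<noteq> 0" by (simp add: AE_completion_iff inner_commute)
  have a1: "AE z in lborel. Kb (0 + (- 1) *\<^sub>R z) = K (0 + (- 1) *\<^sub>R z)"
    by (rule AE_lborel_affine[OF Kb(3)]) simp
  have "(LINT z|lborel. ?h z) = (LINT z|lborel. ?h (0 + (- 1) *\<^sub>R z))"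
    by (subst integral_lborel_affine[where c = "-1" and x = 0]) simp_all
  also have "\<dots> = (LINT z|lborel. - ?h z)"
  proof (rule integral_cong_AE)
    show "AE z in lborel. ?h (0 + (- 1) *\<^sub>R z) = - ?h z"
      using a0 a1 Kb(3) AE_not_0
    proof eventually_elim
      case (elim z)
      have "Kb (- z) = Kb z" using elim even[of z] by simp
      moreover have "indicator (- ball 0 r) (- z) = (indicator (- ball 0 r) z :: real)" by (simp add: indicator_def)
      ultimately show ?case using elim(1) by simp
    qed
  qed measurable
  finally show ?thesis by simp
qed

text \<open>Substitute \<open>y = x + \<epsilon> z\<close> and subtract the half space, which contributes 0.\<close>

lemma truncated_curvature_rescaled:
  assumes n: "norm n = 1" and \<epsilon>: "0 < \<epsilon>" and r: "0 < r" and neg: "negligible (frontier E)"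
  shows "truncated_curvature (rescaled_kernel \<epsilon> K) E x r =
     - 2 * (LINT z|lborel. indicator (- ball 0 (r / \<epsilon>)) z * (Kb z * halfspace_defect E n x \<epsilon> z))"
proof -
  have [measurable]: "interior E \<in> sets borel" "ball x r \<in> sets borel" "ball (0::real^'n) (r / \<epsilon>) \<in> sets borel" by simp_all
  define s :: "real^'n \<Rightarrow> real" where "s y = (if y \<in> interior E then 1 else - 1)" for y
  define g where "g y = indicator (- ball x r) y * (Kb ((1 / \<epsilon>) *\<^sub>R (y - x)) / \<epsilon> ^ CARD('n) * s y)" for y
  have gm [measurable]: "g \<in> borel_measurable borel" unfolding g_def s_def by measurable
  have "AE y in lebesgue. y \<notin> frontier E"
    using neg unfolding negligible_iff_null_sets by (rule AE_not_in)
  then have a1: "AE y in lborel. y \<notin> frontier E" by (simp add: AE_completion_iff)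
  have a2: "AE y in lborel. Kb (- (1 / \<epsilon>) *\<^sub>R x + (1 / \<epsilon>) *\<^sub>R y) = K (- (1 / \<epsilon>) *\<^sub>R x + (1 / \<epsilon>) *\<^sub>R y)"
    by (rule AE_lborel_affine[OF Kb(3)]) (use \<epsilon> in simp)
  have eq: "- (1 / \<epsilon>) *\<^sub>R x + (1 / \<epsilon>) *\<^sub>R y = (1 / \<epsilon>) *\<^sub>R (y - x)" for y by (simp add: scaleR_diff_right)
  have ae: "AE y in lborel. indicator (- ball x r) y *\<^sub>R (rescaled_kernel \<epsilon> K (y - x) * signed_chi E y) = g y"
    using a1 a2
  proof eventually_elim
    case (elim y)
    have "y \<in> E \<longleftrightarrow> y \<in> interior E"
      using elim(1) interior_subset[of E] closure_subset[of E] by (auto simp: frontier_def)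
    then have "signed_chi E y = s y" by (simp add: signed_chi_def s_def)
    moreover have "K ((y - x) /\<^sub>R \<epsilon>) = Kb ((1 / \<epsilon>) *\<^sub>R (y - x))"
      using elim(2) unfolding eq by (simp only: inverse_eq_divide)
    ultimately show ?case by (simp only: g_def rescaled_kernel_def real_scaleR_def)
  qed
  have "truncated_curvature (rescaled_kernel \<epsilon> K) E x r = - (LINT y|lborel. g y)"
    unfolding truncated_curvature_def set_lebesgue_integral_def using integral_lebesgue_AE[OF gm ae] by simp
  also have "(LINT y|lborel. g y) = \<epsilon> ^ CARD('n) * (LINT z|lborel. g (x + \<epsilon> *\<^sub>R z))"
    using integral_lborel_affine[OF gm, of \<epsilon> x] \<epsilon> by simp
  also have "\<dots> = (LINT z|lborel. indicator (- ball 0 (r / \<epsilon>)) z * Kb z * s (x + \<epsilon> *\<^sub>R z))"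
  proof -
    have ind: "indicator (- ball x r) (x + \<epsilon> *\<^sub>R z) = (indicator (- ball 0 (r / \<epsilon>)) z :: real)" for z
      using \<epsilon> by (simp add: indicator_def dist_norm pos_divide_le_eq mult.commute not_less)
    have "g (x + \<epsilon> *\<^sub>R z) = (indicator (- ball 0 (r / \<epsilon>)) z * Kb z * s (x + \<epsilon> *\<^sub>R z)) / \<epsilon> ^ CARD('n)" for z
      using \<epsilon> unfolding g_def ind by simp
    then show ?thesis using \<epsilon> by simp
  qed
  also have "\<dots> = (LINT z|lborel. 2 * (indicator (- ball 0 (r / \<epsilon>)) z * (Kb z * halfspace_defect E n x \<epsilon> z))
      + indicator (- ball 0 (r / \<epsilon>)) z * Kb z * (2 * (if z \<bullet> n < 0 then 1 else 0) - 1))"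
    by (intro Bochner_Integration.integral_cong refl) (simp add: halfspace_defect_def s_def algebra_simps)
  also have "\<dots> = 2 * (LINT z|lborel. indicator (- ball 0 (r / \<epsilon>)) z * (Kb z * halfspace_defect E n x \<epsilon> z)) + 0"
  proof -
    have r2: "0 < r / (2 * \<epsilon>)" using r \<epsilon> by simp
    have out: "z \<in> - cball 0 (r / (2 * \<epsilon>))" if "z \<in> - ball (0::real^'n) (r / \<epsilon>)" for z
    proof -
      have "r / (2 * \<epsilon>) < r / \<epsilon>" using r \<epsilon> by (simp add: field_simps)
      then show ?thesis using that by simp
    qed
    have dom: "integrable lborel (\<lambda>z. indicator (- ball 0 (r / \<epsilon>)) z * (Kb z * k z))"
      if [measurable]: "k \<in> borel_measurable borel" and k: "\<And>z. \<bar>k z\<bar> \<le> 1" for k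
    proof (rule Bochner_Integration.integrable_bound[OF Kb_outside[OF r2]])
      show "AE z in lborel. norm (indicator (- ball 0 (r / \<epsilon>)) z * (Kb z * k z)) \<le> norm (indicator (- cball 0 (r / (2 * \<epsilon>))) z *\<^sub>R Kb z)"
      proof (rule AE_I2)
        fix z
        have "\<bar>Kb z * k z\<bar> \<le> Kb z * 1" unfolding abs_mult using k[of z] Kb(2)[of z] by (intro mult_mono) auto
        then show "norm (indicator (- ball 0 (r / \<epsilon>)) z * (Kb z * k z)) \<le> norm (indicator (- cball 0 (r / (2 * \<epsilon>))) z *\<^sub>R Kb z)"
          using out[of z] Kb(2)[of z] by (cases "z \<in> - ball 0 (r / \<epsilon>)") (auto simp del: ComplD)
      qed
    qed measurable
    have i1: "integrable lborel (\<lambda>z. indicator (- ball 0 (r / \<epsilon>)) z * (Kb z * halfspace_defect E n x \<epsilon> z))"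
      by (rule dom) (simp_all add: halfspace_defect_bound)
    have "integrable lborel (\<lambda>z. indicator (- ball 0 (r / \<epsilon>)) z * (Kb z * (2 * (if z \<bullet> n < 0 then 1 else 0) - 1)))"
      by (rule dom) simp_all
    then have i2: "integrable lborel (\<lambda>z. indicator (- ball 0 (r / \<epsilon>)) z * Kb z * (2 * (if z \<bullet> n < 0 then 1 else 0) - 1))"
      by (simp only: mult.assoc)
    have "0 < r / \<epsilon>" using r \<epsilon> by simp
    note hb = halfspace_balanced[OF n this]
    show ?thesis
      by (subst Bochner_Integration.integral_add[OF integrable_mult_right[OF i1] i2]) (simp only: hb integral_mult_right_zero)
  qed
  finally show ?thesis by simp
qed

lemma truncated_curvature_tendsto:
  assumes n: "norm n = 1" and \<epsilon>: "0 < \<epsilon>" and neg: "negligible (frontier E)"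
    and int: "integrable lborel (\<lambda>z. Kb z * halfspace_defect E n x \<epsilon> z)"
  shows "(truncated_curvature (rescaled_kernel \<epsilon> K) E x \<longlongrightarrow> - 2 * (LINT z|lborel. Kb z * halfspace_defect E n x \<epsilon> z)) (at_right 0)"
    and "rescaled_curvature K \<epsilon> E x = - (2 / \<epsilon>) * (LINT z|lborel. Kb z * halfspace_defect E n x \<epsilon> z)"
proof -
  let ?f = "\<lambda>z. Kb z * halfspace_defect E n x \<epsilon> z"
  show lim: "(truncated_curvature (rescaled_kernel \<epsilon> K) E x \<longlongrightarrow> - 2 * (LINT z|lborel. ?f z)) (at_right 0)"
    unfolding tendsto_at_iff_sequentially
  proof (intro allI impI)
    fix X :: "nat \<Rightarrow> real" assume X: "\<forall>i. X i \<in> {0<..} - {0}" "X \<longlonglongrightarrow> 0"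
    have [measurable]: "ball (0::real^'n) (X i / \<epsilon>) \<in> sets borel" for i by simp
    have "(\<lambda>i. LINT z|lborel. indicator (- ball 0 (X i / \<epsilon>)) z * ?f z) \<longlonglongrightarrow> (LINT z|lborel. ?f z)"
    proof (rule integral_dominated_convergence[where w = "\<lambda>z. norm (?f z)"])
      show "AE z in lborel. (\<lambda>i. indicator (- ball 0 (X i / \<epsilon>)) z * ?f z) \<longlonglongrightarrow> ?f z"
        using AE_not_0
      proof eventually_elim
        case (elim z)
        have "(\<lambda>i. X i / \<epsilon>) \<longlonglongrightarrow> 0 / \<epsilon>" using X(2) \<epsilon> by (intro tendsto_divide tendsto_const) auto
        then have "eventually (\<lambda>i. X i / \<epsilon> < norm z) sequentially"
          using elim by (intro order_tendstoD(2)) auto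
        then have "eventually (\<lambda>i. indicator (- ball 0 (X i / \<epsilon>)) z * ?f z = ?f z) sequentially"
          by eventually_elim (simp add: indicator_def)
        then show ?case by (rule tendsto_eventually)
      qed
      show "AE z in lborel. norm (indicator (- ball 0 (X i / \<epsilon>)) z * ?f z) \<le> norm (?f z)" for i
        by (intro AE_I2) (auto simp: indicator_def)
      show "integrable lborel (\<lambda>z. norm (?f z))" using int by (rule integrable_norm)
    qed measurable
    then have "(\<lambda>i. - 2 * (LINT z|lborel. indicator (- ball 0 (X i / \<epsilon>)) z * ?f z)) \<longlonglongrightarrow> - 2 * (LINT z|lborel. ?f z)"
      by (intro tendsto_mult tendsto_const)
    then show "(truncated_curvature (rescaled_kernel \<epsilon> K) E x \<circ> X) \<longlonglongrightarrow> - 2 * (LINT z|lborel. ?f z)"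
      using X(1) by (simp add: o_def truncated_curvature_rescaled[OF n \<epsilon> _ neg])
  qed
  have "nonlocal_curvature (rescaled_kernel \<epsilon> K) E x = - 2 * (LINT z|lborel. ?f z)"
    unfolding nonlocal_curvature_def by (rule tendsto_Lim[OF _ lim]) simp
  then show "rescaled_curvature K \<epsilon> E x = - (2 / \<epsilon>) * (LINT z|lborel. ?f z)"
    by (simp add: rescaled_curvature_def)
qed

end

section \<open>Shape of the defect and decay away from the origin\<close>

lemma normal_curvature_form_add:
  "normal_curvature_form \<phi> x (u + u') v = normal_curvature_form \<phi> x u v + normal_curvature_form \<phi> x u' v"
  "normal_curvature_form \<phi> x u (v + v') = normal_curvature_form \<phi> x u v + normal_curvature_form \<phi> x u v'"
  by (simp_all add: normal_curvature_form_def inner_add_left inner_add_right matrix_vector_right_distrib add_divide_distrib)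

lemma normal_curvature_form_scale:
  "normal_curvature_form \<phi> x (c *\<^sub>R u) v = c * normal_curvature_form \<phi> x u v"
  "normal_curvature_form \<phi> x u (c *\<^sub>R v) = c * normal_curvature_form \<phi> x u v"
  by (simp_all add: normal_curvature_form_def matrix_vector_mult_scaleR)

text \<open>Close to \<open>x\<close> the defect vanishes outside the thin region: with \<open>h = \<epsilon> z\<close> the expansion shows that the defect can
  be nonzero only if \<open>|h \<bullet> n| \<le> (M / 2 + 1) |h|\<^sup>2\<close>. The bound on \<open>\<delta>\<close> allows the height to be absorbed, so that \<open>|z|\<^sup>2\<close> on
  the right becomes the square \<open>|z|\<^sup>2 - (z \<bullet> n)\<^sup>2\<close> of the tangential part.\<close>

lemma halfspace_defect_near:
  assumes \<epsilon>: "0 < \<epsilon>" and M: "0 \<le> M" "\<And>h. \<bar>b h\<bar> \<le> M * (norm h)\<^sup>2"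
    and near: "\<And>h. norm h < \<delta> \<Longrightarrow> (norm h)\<^sup>2 < \<bar>h \<bullet> n - b h / 2\<bar> \<Longrightarrow> x + h \<in> interior E \<longleftrightarrow> h \<bullet> n < b h / 2"
    and \<delta>: "\<delta> * (M / 2 + 1) \<le> 1 / 2" and n: "norm n = 1"
    and z: "\<epsilon> * norm z < \<delta>" "halfspace_defect E n x \<epsilon> z \<noteq> 0"
  shows "\<bar>z \<bullet> n\<bar> \<le> 2 * (M / 2 + 1) * \<epsilon> * ((norm z)\<^sup>2 - (z \<bullet> n)\<^sup>2)"
proof -
  let ?C = "M / 2 + 1" and ?h = "\<epsilon> *\<^sub>R z"
  have hn: "?h \<bullet> n = \<epsilon> * (z \<bullet> n)" and nh: "norm ?h = \<epsilon> * norm z" using \<epsilon> by simp_all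
  have "\<bar>?h \<bullet> n\<bar> \<le> ?C * (norm ?h)\<^sup>2"
  proof (rule ccontr)
    assume "\<not> ?thesis"
    then have big: "M / 2 * (norm ?h)\<^sup>2 + (norm ?h)\<^sup>2 < \<bar>?h \<bullet> n\<bar>" by (simp add: algebra_simps)
    have b2: "\<bar>b ?h / 2\<bar> \<le> M / 2 * (norm ?h)\<^sup>2" using M(2)[of ?h] by simp
    have "(norm ?h)\<^sup>2 < \<bar>?h \<bullet> n - b ?h / 2\<bar>" using big b2 by linarith
    then have "x + ?h \<in> interior E \<longleftrightarrow> ?h \<bullet> n < b ?h / 2"
      by (rule near[rotated]) (use z(1) \<epsilon> in simp)
    also have "\<dots> \<longleftrightarrow> ?h \<bullet> n < 0"
    proof -
      have "\<bar>b ?h / 2\<bar> < \<bar>?h \<bullet> n\<bar>" using big b2 zero_le_power2[of "norm ?h"] by linarith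
      then show ?thesis by linarith
    qed
    also have "\<dots> \<longleftrightarrow> z \<bullet> n < 0" using \<epsilon> unfolding hn by (simp add: mult_less_0_iff)
    finally show False using z(2) by (simp add: halfspace_defect_def)
  qed
  then have "\<epsilon> * \<bar>z \<bullet> n\<bar> \<le> \<epsilon> * (?C * \<epsilon> * (norm z)\<^sup>2)"
    unfolding hn nh using \<epsilon> by (simp add: abs_mult power2_eq_square mult_ac)
  then have t: "\<bar>z \<bullet> n\<bar> \<le> ?C * \<epsilon> * (norm z)\<^sup>2" using \<epsilon> by simp
  have tz: "\<bar>z \<bullet> n\<bar> \<le> norm z" using Cauchy_Schwarz_ineq2[of z n] n by simp
  have "?C * \<epsilon> * (z \<bullet> n)\<^sup>2 = (?C * (\<epsilon> * \<bar>z \<bullet> n\<bar>)) * \<bar>z \<bullet> n\<bar>" by (simp add: power2_eq_square[of "z \<bullet> n"] abs_mult_self_eq mult.assoc)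
  also have "\<dots> \<le> (?C * \<delta>) * \<bar>z \<bullet> n\<bar>"
  proof (intro mult_right_mono mult_left_mono)
    have "\<epsilon> * \<bar>z \<bullet> n\<bar> \<le> \<epsilon> * norm z" using tz \<epsilon> by (intro mult_left_mono) auto
    then show "\<epsilon> * \<bar>z \<bullet> n\<bar> \<le> \<delta>" using z(1) by linarith
  qed (use M(1) in auto)
  also have "\<dots> \<le> 1 / 2 * \<bar>z \<bullet> n\<bar>" using \<delta> by (intro mult_right_mono) (simp_all add: mult.commute)
  finally have "?C * \<epsilon> * (z \<bullet> n)\<^sup>2 \<le> \<bar>z \<bullet> n\<bar> / 2" by simp
  then have "\<bar>z \<bullet> n\<bar> / 2 \<le> ?C * \<epsilon> * (norm z)\<^sup>2 - ?C * \<epsilon> * (z \<bullet> n)\<^sup>2" using t by linarith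
  then show ?thesis by (simp only: right_diff_distrib)
qed

text \<open>For small \<open>\<epsilon>\<close> the form at \<open>z = \<iota> w + t n\<close> differs little from the form at the tangential part \<open>\<iota> w\<close>, because
  \<open>|t|\<close> is of order \<open>\<epsilon> |w|\<^sup>2\<close>. A point whose distance from the graph exceeds \<open>\<eta> \<epsilon> |w|\<^sup>2\<close> is therefore on the side
  predicted by the quadratic form.\<close>

lemma halfspace_defect_graph:
  assumes fr: "is_frame n \<iota>" and \<epsilon>: "0 < \<epsilon>" and R: "0 < R" and \<eta>: "0 < \<eta>" and M: "0 < M"
    and form: "\<And>u v. \<bar>normal_curvature_form \<phi> x u v\<bar> \<le> M * (norm u * norm v)"
    and near: "\<And>h. norm h < \<delta> \<Longrightarrow> \<eta> / 4 * (norm h)\<^sup>2 < \<bar>h \<bullet> n - normal_curvature_form \<phi> x h h / 2\<bar> \<Longrightarrow>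
        x + h \<in> interior E \<longleftrightarrow> h \<bullet> n < normal_curvature_form \<phi> x h h / 2"
    and C: "0 < C" and small: "C * \<epsilon> * R \<le> 1" "\<epsilon> * (2 * R) < \<delta>" "6 * C * M * R * \<epsilon> \<le> \<eta>"
    and w: "norm w < R" and t: "\<bar>t\<bar> \<le> C * \<epsilon> * (norm w)\<^sup>2"
    and far: "\<eta> * \<epsilon> * (norm w)\<^sup>2 < \<bar>t - \<epsilon> / 2 * normal_curvature_form \<phi> x (\<iota> w) (\<iota> w)\<bar>"
  shows "halfspace_defect E n x \<epsilon> (\<iota> w + t *\<^sub>R n) =
      (if t < \<epsilon> / 2 * normal_curvature_form \<phi> x (\<iota> w) (\<iota> w) then 1 else 0) - (if t < 0 then 1 else 0)"
    and "\<epsilon> * norm (\<iota> w + t *\<^sub>R n) < \<delta>"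
proof -
  let ?z = "\<iota> w + t *\<^sub>R n" and ?B = "normal_curvature_form \<phi> x"
  have nn: "norm n = 1" and nw: "norm (\<iota> w) = norm w" using fr by (simp_all add: is_frame_def)
  have "\<bar>t\<bar> \<le> (C * \<epsilon> * norm w) * norm w" using t by (simp add: power2_eq_square mult.assoc)
  also have "\<dots> \<le> (C * \<epsilon> * R) * norm w" using w C \<epsilon> by (intro mult_right_mono mult_left_mono) auto
  also have "\<dots> \<le> 1 * norm w" using small(1) by (intro mult_right_mono) auto
  finally have tw: "\<bar>t\<bar> \<le> norm w" by simp
  have "norm ?z \<le> norm (\<iota> w) + norm (t *\<^sub>R n)" by (rule norm_triangle_ineq)
  then have zw: "norm ?z \<le> 2 * norm w" using tw nn nw by simp
  have "\<epsilon> * norm ?z \<le> \<epsilon> * (2 * R)" using zw w \<epsilon> by (intro mult_left_mono) auto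
  then show nd: "\<epsilon> * norm ?z < \<delta>" using small(2) by linarith
  have z2: "(norm ?z)\<^sup>2 \<le> 2 * (norm w)\<^sup>2"
    unfolding frame_norm[OF fr] using power_mono[OF tw, of 2] by simp
  have diff: "\<epsilon> / 2 * \<bar>?B ?z ?z - ?B (\<iota> w) (\<iota> w)\<bar> \<le> \<eta> / 4 * \<epsilon> * (norm w)\<^sup>2"
  proof -
    have "?B ?z ?z - ?B (\<iota> w) (\<iota> w) = t * (?B n ?z + ?B (\<iota> w) n)"
      by (simp add: normal_curvature_form_add normal_curvature_form_scale algebra_simps)
    then have "\<bar>?B ?z ?z - ?B (\<iota> w) (\<iota> w)\<bar> \<le> \<bar>t\<bar> * (\<bar>?B n ?z\<bar> + \<bar>?B (\<iota> w) n\<bar>)"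
      by (simp add: abs_mult abs_triangle_ineq mult_left_mono)
    also have "\<dots> \<le> (C * \<epsilon> * (norm w)\<^sup>2) * (M * (3 * R))"
    proof (rule mult_mono[OF t])
      have "\<bar>?B n ?z\<bar> \<le> M * (1 * (2 * R))" using zw w M by (intro order.trans[OF form] mult_left_mono mult_mono) (use R in \<open>auto simp: nn\<close>)
      moreover have "\<bar>?B (\<iota> w) n\<bar> \<le> M * (R * 1)" using w M by (intro order.trans[OF form] mult_left_mono mult_mono) (use R in \<open>auto simp: nn nw\<close>)
      ultimately show "\<bar>?B n ?z\<bar> + \<bar>?B (\<iota> w) n\<bar> \<le> M * (3 * R)" by (simp add: algebra_simps)
    qed (use C \<epsilon> in auto)
    finally have "\<epsilon> / 2 * \<bar>?B ?z ?z - ?B (\<iota> w) (\<iota> w)\<bar> \<le> \<epsilon> / 2 * ((C * \<epsilon> * (norm w)\<^sup>2) * (M * (3 * R)))"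
      using \<epsilon> by (intro mult_left_mono) auto
    also have "\<dots> = (6 * C * M * R * \<epsilon>) * (\<epsilon> * (norm w)\<^sup>2) / 4" by simp
    also have "\<dots> \<le> \<eta> * (\<epsilon> * (norm w)\<^sup>2) / 4" using small(3) \<epsilon> by (intro divide_right_mono mult_right_mono) auto
    finally show ?thesis by simp
  qed
  define a where "a = \<epsilon> / 2 * ?B (\<iota> w) (\<iota> w)"
  define a' where "a' = \<epsilon> / 2 * ?B ?z ?z"
  define k where "k = \<epsilon> * (norm w)\<^sup>2"
  have k: "0 \<le> k" using \<epsilon> by (simp add: k_def)
  have "\<bar>a' - a\<bar> = \<epsilon> / 2 * \<bar>?B ?z ?z - ?B (\<iota> w) (\<iota> w)\<bar>"
    using \<epsilon> abs_mult[of "\<epsilon> / 2" "?B ?z ?z - ?B (\<iota> w) (\<iota> w)"] by (simp add: a_def a'_def right_diff_distrib)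
  then have da: "\<bar>a' - a\<bar> \<le> \<eta> * k / 4" using diff by (simp add: k_def mult.assoc)
  have f: "\<eta> * k < \<bar>t - a\<bar>" using far by (simp add: a_def k_def mult.assoc)
  have hk: "0 \<le> \<eta> * k" using \<eta> k by simp
  let ?h = "\<epsilon> *\<^sub>R ?z"
  have hn: "?h \<bullet> n = \<epsilon> * t" using frame_height[OF fr, of w t] by simp
  have hB: "?B ?h ?h / 2 = \<epsilon> * a'" by (simp add: normal_curvature_form_scale a'_def)
  have "\<eta> / 4 * (norm ?h)\<^sup>2 = \<epsilon> * (\<eta> / 4 * \<epsilon> * (norm ?z)\<^sup>2)" using \<epsilon> by (simp add: power2_eq_square)
  also have "\<dots> \<le> \<epsilon> * (\<eta> / 4 * \<epsilon> * (2 * (norm w)\<^sup>2))" using z2 \<epsilon> \<eta> by (intro mult_left_mono) auto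
  also have "\<dots> = \<epsilon> * (\<eta> * k / 2)" by (simp add: k_def)
  also have "\<dots> < \<epsilon> * \<bar>t - a'\<bar>" using f da hk \<epsilon> by (intro mult_strict_left_mono) linarith+
  also have "\<dots> = \<bar>?h \<bullet> n - ?B ?h ?h / 2\<bar>" unfolding hn hB right_diff_distrib[symmetric] using \<epsilon> by (simp add: abs_mult)
  finally have "x + ?h \<in> interior E \<longleftrightarrow> ?h \<bullet> n < ?B ?h ?h / 2" using nd \<epsilon> by (intro near) simp_all
  also have "\<dots> \<longleftrightarrow> t < a'" unfolding hn hB using \<epsilon> by simp
  also have "\<dots> \<longleftrightarrow> t < a" using f da hk by linarith
  finally show "halfspace_defect E n x \<epsilon> ?z = (if t < \<epsilon> / 2 * ?B (\<iota> w) (\<iota> w) then 1 else 0) - (if t < 0 then 1 else 0)"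
    unfolding halfspace_defect_def frame_height[OF fr] a_def by simp
qed

context planar_kernel begin

text \<open>Near the origin the defect is supported in some \<open>Q l n\<close>, where \<open>K\<close> is integrable.\<close>

lemma defect_integrable:
  assumes \<epsilon>: "0 < \<epsilon>" and \<delta>: "0 < \<delta>" and C: "0 < C" and n: "norm n = 1"
    and supp: "\<And>z. \<epsilon> * norm z < \<delta> \<Longrightarrow> halfspace_defect E n x \<epsilon> z \<noteq> 0 \<Longrightarrow> \<bar>z \<bullet> n\<bar> \<le> C * \<epsilon> * ((norm z)\<^sup>2 - (z \<bullet> n)\<^sup>2)"
  shows "integrable lborel (\<lambda>z. Kb z * halfspace_defect E n x \<epsilon> z)"
proof (rule integrableI_bounded)
  have [measurable]: "Q (2 * C * \<epsilon>) n \<in> sets borel" by (rule Q_borel[OF n])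
  have [measurable]: "cball (0::real^'n) (\<delta> / (2 * \<epsilon>)) \<in> sets borel" by simp
  have l: "0 < 2 * C * \<epsilon>" using C \<epsilon> by simp
  have r: "0 < \<delta> / (2 * \<epsilon>)" using \<delta> \<epsilon> by simp
  let ?s = "halfspace_defect E n x \<epsilon>"
  have "(\<integral>\<^sup>+z. ennreal (norm (Kb z * ?s z)) \<partial>lborel) \<le>
     (\<integral>\<^sup>+z. ennreal (Kb z) * indicator (Q (2 * C * \<epsilon>) n) z + ennreal (indicator (- cball 0 (\<delta> / (2 * \<epsilon>))) z *\<^sub>R Kb z) \<partial>lborel)"
  proof (rule nn_integral_mono)
    fix z
    have "\<bar>Kb z * ?s z\<bar> \<le> Kb z * 1"
      unfolding abs_mult using Kb(2)[of z] halfspace_defect_bound[of E n x \<epsilon> z] by (intro mult_mono) auto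
    then have le: "ennreal (norm (Kb z * ?s z)) \<le> ennreal (Kb z)" by (simp add: ennreal_leI)
    consider "?s z = 0" | "?s z \<noteq> 0" "\<epsilon> * norm z < \<delta>" | "\<delta> \<le> \<epsilon> * norm z" by linarith
    then show "ennreal (norm (Kb z * ?s z)) \<le> ennreal (Kb z) * indicator (Q (2 * C * \<epsilon>) n) z + ennreal (indicator (- cball 0 (\<delta> / (2 * \<epsilon>))) z *\<^sub>R Kb z)"
    proof cases
      case 2
      then have "z \<in> Q (2 * C * \<epsilon>) n" unfolding Q_iff[OF n] using supp[of z] by simp
      then show ?thesis using le by (simp add: add_increasing2)
    next
      case 3
      have "\<delta> / (2 * \<epsilon>) < \<delta> / \<epsilon>" using \<delta> \<epsilon> by (simp add: field_simps)
      also have "\<dots> \<le> norm z" using 3 \<epsilon> by (simp add: field_simps)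
      finally show ?thesis using le by (simp add: add_increasing)
    qed simp
  qed
  also have "\<dots> = (\<integral>\<^sup>+z. ennreal (Kb z) * indicator (Q (2 * C * \<epsilon>) n) z \<partial>lborel) + (\<integral>\<^sup>+z. ennreal (indicator (- cball 0 (\<delta> / (2 * \<epsilon>))) z *\<^sub>R Kb z) \<partial>lborel)"
    by (rule nn_integral_add) measurable
  also have "\<dots> < \<infinity>"
    unfolding Kb_Q[OF n l] using nn_integral_eq_integral[OF Kb_outside[OF r]] Kb(2) by (simp add: indicator_def)
  finally show "(\<integral>\<^sup>+z. ennreal (norm (Kb z * ?s z)) \<partial>lborel) < \<infinity>" .
qed measurable

text \<open>In this region \<open>K z \<le> \<epsilon> / \<delta> |z| K z\<close>, and \<open>|z| K z\<close> is integrable at infinity.\<close>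

lemma far_region_small:
  assumes \<delta>: "0 < \<delta>" and \<tau>: "0 < \<tau>"
  obtains \<epsilon>0 where "0 < \<epsilon>0" "\<And>\<epsilon>. 0 < \<epsilon> \<Longrightarrow> \<epsilon> \<le> \<epsilon>0 \<Longrightarrow>
     (\<integral>\<^sup>+z. ennreal (Kb z) * indicator {z. \<delta> \<le> \<epsilon> * norm z} z \<partial>lborel) \<le> ennreal (\<epsilon> * \<tau>)"
proof -
  have "0 < \<delta> * \<tau>" using \<delta> \<tau> by simp
  then obtain r where r: "1 \<le> r" "\<And>r'. r \<le> r' \<Longrightarrow> (\<integral>\<^sup>+x. ennreal (norm x * Kb x) * indicator {x. r' \<le> norm x} x \<partial>lborel) \<le> ennreal (\<delta> * \<tau>)"
    by (rule kernel_tail) (rule that, assumption+)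
  show ?thesis
  proof (rule that[of "\<delta> / r"])
    show "0 < \<delta> / r" using \<delta> r by simp
    fix \<epsilon> assume \<epsilon>: "0 < \<epsilon>" "\<epsilon> \<le> \<delta> / r"
    have r': "r \<le> \<delta> / \<epsilon>" using \<epsilon> r by (simp add: field_simps)
    have "(\<integral>\<^sup>+z. ennreal (Kb z) * indicator {z. \<delta> \<le> \<epsilon> * norm z} z \<partial>lborel) \<le>
        (\<integral>\<^sup>+z. ennreal (\<epsilon> / \<delta>) * (ennreal (norm z * Kb z) * indicator {z. \<delta> / \<epsilon> \<le> norm z} z) \<partial>lborel)"
    proof (rule nn_integral_mono)
      fix z
      show "ennreal (Kb z) * indicator {z. \<delta> \<le> \<epsilon> * norm z} z \<le> ennreal (\<epsilon> / \<delta>) * (ennreal (norm z * Kb z) * indicator {z. \<delta> / \<epsilon> \<le> norm z} z)"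
      proof (cases "\<delta> \<le> \<epsilon> * norm z")
        case True
        then have "1 * Kb z \<le> (\<epsilon> / \<delta> * norm z) * Kb z"
          using \<delta> \<epsilon> Kb(2)[of z] by (intro mult_right_mono) (simp_all add: field_simps)
        then have "ennreal (Kb z) \<le> ennreal (\<epsilon> / \<delta> * (norm z * Kb z))" by (simp add: ennreal_leI mult.assoc)
        also have "\<dots> = ennreal (\<epsilon> / \<delta>) * ennreal (norm z * Kb z)" using \<epsilon> \<delta> Kb(2)[of z] by (intro ennreal_mult) auto
        finally show ?thesis using True \<epsilon> by (simp add: pos_divide_le_eq mult.commute)
      qed simp
    qed
    also have "\<dots> = ennreal (\<epsilon> / \<delta>) * (\<integral>\<^sup>+z. ennreal (norm z * Kb z) * indicator {z. \<delta> / \<epsilon> \<le> norm z} z \<partial>lborel)"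
      by (rule nn_integral_cmult) measurable
    also have "\<dots> \<le> ennreal (\<epsilon> / \<delta>) * ennreal (\<delta> * \<tau>)" by (intro mult_left_mono r(2)[OF r']) simp
    also have "\<dots> = ennreal (\<epsilon> * \<tau>)" using \<epsilon> \<delta> \<tau> by (subst ennreal_mult[symmetric]) auto
    finally show "(\<integral>\<^sup>+z. ennreal (Kb z) * indicator {z. \<delta> \<le> \<epsilon> * norm z} z \<partial>lborel) \<le> ennreal (\<epsilon> * \<tau>)" .
  qed
qed

lemma kernel_decay_in_slice:
  assumes fr: "is_frame e \<iota>" and K: "\<And>y. 1 \<le> norm y \<Longrightarrow> K y \<le> m * norm y powr - p" and mp: "0 < m" "0 < p"
    and w: "1 \<le> norm w"
  shows "K (\<iota> w + t *\<^sub>R e) \<le> m * norm w powr - p"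
proof -
  have "(norm w)\<^sup>2 \<le> (norm (\<iota> w + t *\<^sub>R e))\<^sup>2" unfolding frame_norm[OF fr] by simp
  then have le: "norm w \<le> norm (\<iota> w + t *\<^sub>R e)" by (rule power2_le_imp_le) simp
  have "K (\<iota> w + t *\<^sub>R e) \<le> m * norm (\<iota> w + t *\<^sub>R e) powr - p" using le w by (intro K) simp
  also have "\<dots> \<le> m * norm w powr - p" using mp w le by (intro mult_left_mono powr_mono2') auto
  finally show ?thesis .
qed

text \<open>The thin region has height of order \<open>\<epsilon> |w|\<^sup>2\<close> over \<open>w\<close>, so both integrals reduce to the second moment of
  \<open>|w|\<^sup>-\<^sup>p\<close> at infinity.\<close>

lemma slice_outside_small:
  assumes C: "0 < C" and \<tau>: "0 < \<tau>"
  obtains R where "1 \<le> R"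
    "\<And>e \<iota> \<epsilon>. is_frame e \<iota> \<Longrightarrow> 0 < \<epsilon> \<Longrightarrow>
      (\<integral>\<^sup>+z. ennreal (Kb z) * indicator {z. R \<le> norm (frame_proj \<iota> z) \<and> \<bar>z \<bullet> e\<bar> \<le> C * \<epsilon> * (norm (frame_proj \<iota> z))\<^sup>2} z \<partial>lborel) \<le> ennreal (\<epsilon> * \<tau>)"
    "\<And>e \<iota>. is_frame e \<iota> \<Longrightarrow> (\<integral>\<^sup>+w. ennreal ((norm w)\<^sup>2 * Ks e \<iota> w) * indicator {w. R \<le> norm w} w \<partial>lborel) \<le> ennreal \<tau>"
proof -
  obtain m p where mp: "0 < m" "real CARD('n) + 1 < p" "\<And>y. 1 \<le> norm y \<Longrightarrow> K y \<le> m * norm y powr - p"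
    using decay_rate by blast
  have p0: "0 < p" using mp(2) by linarith
  define \<tau>' where "\<tau>' = min \<tau> (\<tau> / (2 * C))"
  have \<tau>': "0 < \<tau>'" using \<tau> C by (simp add: \<tau>'_def)
  obtain R where R: "1 \<le> R" "\<And>R'. R \<le> R' \<Longrightarrow> (\<integral>\<^sup>+(w::real^'n punctured). ennreal ((norm w)\<^sup>2 * (m * norm w powr - p)) * indicator {w. R' \<le> norm w} w \<partial>lborel) \<le> ennreal \<tau>'"
    by (rule slice_tail[OF mp(2,1) \<tau>']) (rule that, assumption+)
  have tail: "(\<integral>\<^sup>+(w::real^'n punctured). ennreal ((norm w)\<^sup>2 * (m * norm w powr - p)) * indicator {w. R \<le> norm w} w \<partial>lborel) \<le> ennreal \<tau>'"
    by (rule R(2)) simp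
  show ?thesis
  proof (rule that[OF R(1)])
    fix e :: "real^'n" and \<iota> assume fr: "is_frame e \<iota>"
    have "(\<integral>\<^sup>+w. ennreal ((norm w)\<^sup>2 * Ks e \<iota> w) * indicator {w. R \<le> norm w} w \<partial>lborel) \<le>
       (\<integral>\<^sup>+(w::real^'n punctured). ennreal ((norm w)\<^sup>2 * (m * norm w powr - p)) * indicator {w. R \<le> norm w} w \<partial>lborel)"
    proof (rule nn_integral_mono_AE)
      show "AE w in lborel. ennreal ((norm w)\<^sup>2 * Ks e \<iota> w) * indicator {w. R \<le> norm w} w \<le> ennreal ((norm w)\<^sup>2 * (m * norm w powr - p)) * indicator {w. R \<le> norm w} w"
        using Ks_AE(1)[OF fr]
      proof eventually_elim
        case (elim w)
        show ?case
        proof (cases "R \<le> norm w")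
          case True
          then have "Ks e \<iota> w \<le> m * norm w powr - p"
            using kernel_decay_in_slice[OF fr mp(3) mp(1) p0, of w 0] R(1) elim by simp
          then show ?thesis using True by (auto intro!: ennreal_leI mult_left_mono)
        qed simp
      qed
    qed
    also have "\<dots> \<le> ennreal \<tau>'" by (rule tail)
    also have "\<dots> \<le> ennreal \<tau>" by (rule ennreal_leI) (simp add: \<tau>'_def)
    finally show "(\<integral>\<^sup>+w. ennreal ((norm w)\<^sup>2 * Ks e \<iota> w) * indicator {w. R \<le> norm w} w \<partial>lborel) \<le> ennreal \<tau>" .
  next
    fix e :: "real^'n" and \<iota> and \<epsilon> :: real assume fr: "is_frame e \<iota>" and \<epsilon>: "0 < \<epsilon>"
    have [measurable]: "frame_proj \<iota> \<in> borel_measurable borel"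
      by (rule borel_measurable_continuous_onI[OF frame_proj(4)[OF fr]])
    let ?Z = "{z. R \<le> norm (frame_proj \<iota> z) \<and> \<bar>z \<bullet> e\<bar> \<le> C * \<epsilon> * (norm (frame_proj \<iota> z))\<^sup>2}"
    have ZT: "\<iota> w + t *\<^sub>R e \<in> ?Z \<longleftrightarrow> R \<le> norm w \<and> t \<in> {- (C * \<epsilon> * (norm w)\<^sup>2)..C * \<epsilon> * (norm w)\<^sup>2}" for w t
      by (auto simp: frame_proj(1)[OF fr] frame_height[OF fr] abs_le_iff)
    have "(\<integral>\<^sup>+z. ennreal (Kb z) * indicator ?Z z \<partial>lborel) = (\<integral>\<^sup>+w. (\<integral>\<^sup>+t. ennreal (Kb (\<iota> w + t *\<^sub>R e)) * indicator ?Z (\<iota> w + t *\<^sub>R e) \<partial>lborel) \<partial>lborel)"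
      by (rule nn_integral_frame[OF fr]) measurable
    also have "\<dots> \<le> (\<integral>\<^sup>+(w::real^'n punctured). ennreal (2 * C * \<epsilon>) * (ennreal ((norm w)\<^sup>2 * (m * norm w powr - p)) * indicator {w. R \<le> norm w} w) \<partial>lborel)"
    proof (rule nn_integral_mono_AE)
      show "AE w in lborel. (\<integral>\<^sup>+t. ennreal (Kb (\<iota> w + t *\<^sub>R e)) * indicator ?Z (\<iota> w + t *\<^sub>R e) \<partial>lborel) \<le>
          ennreal (2 * C * \<epsilon>) * (ennreal ((norm w)\<^sup>2 * (m * norm w powr - p)) * indicator {w. R \<le> norm w} w)"
        using AE_frame[OF fr Kb(3)]
      proof eventually_elim
        case (elim w)
        show ?case
        proof (cases "R \<le> norm w")
          case True
          let ?h = "C * \<epsilon> * (norm w)\<^sup>2"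
          have h0: "0 \<le> ?h" using C \<epsilon> by simp
          have "(\<integral>\<^sup>+t. ennreal (Kb (\<iota> w + t *\<^sub>R e)) * indicator ?Z (\<iota> w + t *\<^sub>R e) \<partial>lborel) \<le> (\<integral>\<^sup>+t. ennreal (m * norm w powr - p) * indicator {- ?h..?h} t \<partial>lborel)"
          proof (rule nn_integral_mono_AE)
            show "AE t in lborel. ennreal (Kb (\<iota> w + t *\<^sub>R e)) * indicator ?Z (\<iota> w + t *\<^sub>R e) \<le> ennreal (m * norm w powr - p) * indicator {- ?h..?h} t"
              using elim
            proof eventually_elim
              case (elim t)
              have "Kb (\<iota> w + t *\<^sub>R e) \<le> m * norm w powr - p"
                using kernel_decay_in_slice[OF fr mp(3) mp(1) p0, of w t] R(1) True elim by simp
              then show ?case using ZT[of w t] True by (simp add: indicator_def ennreal_leI)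
            qed
          qed
          also have "\<dots> = ennreal (m * norm w powr - p) * ennreal (2 * ?h)"
            using h0 by (subst nn_integral_cmult_indicator) (auto simp: mult.assoc)
          also have "\<dots> = ennreal (m * norm w powr - p * (2 * ?h))" using mp(1) h0 by (intro ennreal_mult[symmetric]) auto
          also have "m * norm w powr - p * (2 * ?h) = (2 * C * \<epsilon>) * ((norm w)\<^sup>2 * (m * norm w powr - p))" by simp
          also have "ennreal \<dots> = ennreal (2 * C * \<epsilon>) * ennreal ((norm w)\<^sup>2 * (m * norm w powr - p))"
            using C \<epsilon> mp(1) by (intro ennreal_mult) auto
          finally show ?thesis using True by simp
        next
          case False
          then show ?thesis using ZT[of w] by simp
        qed
      qed
    qed
    also have "\<dots> = ennreal (2 * C * \<epsilon>) * (\<integral>\<^sup>+(w::real^'n punctured). ennreal ((norm w)\<^sup>2 * (m * norm w powr - p)) * indicator {w. R \<le> norm w} w \<partial>lborel)"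
      by (rule nn_integral_cmult) measurable
    also have "\<dots> \<le> ennreal (2 * C * \<epsilon>) * ennreal (\<tau> / (2 * C))"
      using tail by (intro mult_left_mono order.trans[OF tail] ennreal_leI) (simp_all add: \<tau>'_def)
    also have "\<dots> = ennreal (\<epsilon> * \<tau>)" using C \<epsilon> \<tau> by (subst ennreal_mult[symmetric]) auto
    finally show "(\<integral>\<^sup>+z. ennreal (Kb z) * indicator ?Z z \<partial>lborel) \<le> ennreal (\<epsilon> * \<tau>)" .
  qed
qed

lemma slice_second_moment:
  assumes fr: "is_frame e \<iota>" shows "(\<integral>\<^sup>+w. ennreal ((norm w)\<^sup>2 * Ks e \<iota> w) \<partial>lborel) < \<infinity>"
proof -
  have [measurable]: "Ks e \<iota> \<in> borel_measurable borel" by (rule Ks_measurable[OF fr])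
  obtain R where R: "1 \<le> R"
    "\<And>e \<iota> \<epsilon>. is_frame e \<iota> \<Longrightarrow> 0 < \<epsilon> \<Longrightarrow>
      (\<integral>\<^sup>+z. ennreal (Kb z) * indicator {z. R \<le> norm (frame_proj \<iota> z) \<and> \<bar>z \<bullet> e\<bar> \<le> 1 * \<epsilon> * (norm (frame_proj \<iota> z))\<^sup>2} z \<partial>lborel) \<le> ennreal (\<epsilon> * 1)"
    "\<And>e \<iota>. is_frame e \<iota> \<Longrightarrow> (\<integral>\<^sup>+w. ennreal ((norm w)\<^sup>2 * Ks e \<iota> w) * indicator {w. R \<le> norm w} w \<partial>lborel) \<le> ennreal 1"
    by (rule slice_outside_small[of 1 1]) (simp, simp, rule that, assumption+)
  have R0: "0 < R" using R(1) by simp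
  obtain A where A: "0 \<le> A" "\<And>e \<iota>. is_frame e \<iota> \<Longrightarrow>
    (\<integral>\<^sup>+w. ennreal ((norm w)\<^sup>2 * Ks e \<iota> w) * indicator {w. norm w < R} w \<partial>lborel) \<le> ennreal A"
    by (rule slice_moment[OF R0]) (rule that, assumption+)
  have "(\<integral>\<^sup>+w. ennreal ((norm w)\<^sup>2 * Ks e \<iota> w) \<partial>lborel) =
     (\<integral>\<^sup>+w. ennreal ((norm w)\<^sup>2 * Ks e \<iota> w) * indicator {w. norm w < R} w + ennreal ((norm w)\<^sup>2 * Ks e \<iota> w) * indicator {w. R \<le> norm w} w \<partial>lborel)"
    by (intro nn_integral_cong) (auto simp: indicator_def)
  also have "\<dots> = (\<integral>\<^sup>+w. ennreal ((norm w)\<^sup>2 * Ks e \<iota> w) * indicator {w. norm w < R} w \<partial>lborel) + (\<integral>\<^sup>+w. ennreal ((norm w)\<^sup>2 * Ks e \<iota> w) * indicator {w. R \<le> norm w} w \<partial>lborel)"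
    by (rule nn_integral_add) measurable
  also have "\<dots> \<le> ennreal A + ennreal 1" by (intro add_mono A(2)[OF fr] R(3)[OF fr])
  also have "\<dots> < \<infinity>" by simp
  finally show ?thesis .
qed

lemma slice_integrable:
  fixes b :: "real^'n punctured \<Rightarrow> 'b::euclidean_space"
  assumes fr: "is_frame e \<iota>" and b [measurable]: "b \<in> borel_measurable borel" and bC: "\<And>w. norm (b w) \<le> C * (norm w)\<^sup>2"
  shows "integrable lborel (\<lambda>w. Ks e \<iota> w *\<^sub>R b w)"
proof (rule integrableI_bounded)
  have [measurable]: "Ks e \<iota> \<in> borel_measurable borel" by (rule Ks_measurable[OF fr])
  show "(\<lambda>w. Ks e \<iota> w *\<^sub>R b w) \<in> borel_measurable lborel" by measurable
  have "(\<integral>\<^sup>+w. ennreal (norm (Ks e \<iota> w *\<^sub>R b w)) \<partial>lborel) \<le> (\<integral>\<^sup>+w. ennreal \<bar>C\<bar> * ennreal ((norm w)\<^sup>2 * Ks e \<iota> w) \<partial>lborel)"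
  proof (rule nn_integral_mono_AE)
    show "AE w in lborel. ennreal (norm (Ks e \<iota> w *\<^sub>R b w)) \<le> ennreal \<bar>C\<bar> * ennreal ((norm w)\<^sup>2 * Ks e \<iota> w)"
      using Ks_AE(2)[OF fr]
    proof eventually_elim
      case (elim w)
      have "norm (b w) \<le> \<bar>C\<bar> * (norm w)\<^sup>2" by (rule order.trans[OF bC]) (simp add: mult_right_mono)
      then have "norm (Ks e \<iota> w *\<^sub>R b w) \<le> Ks e \<iota> w * (\<bar>C\<bar> * (norm w)\<^sup>2)"
        using elim by (simp add: mult_left_mono)
      then show ?case using elim by (auto simp: ennreal_mult[symmetric] mult_ac intro!: ennreal_leI)
    qed
  qed
  also have "\<dots> = ennreal \<bar>C\<bar> * (\<integral>\<^sup>+w. ennreal ((norm w)\<^sup>2 * Ks e \<iota> w) \<partial>lborel)"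
    by (rule nn_integral_cmult) measurable
  also have "\<dots> < \<infinity>" using slice_second_moment[OF fr] by (simp add: ennreal_mult_less_top)
  finally show "(\<integral>\<^sup>+w. ennreal (norm (Ks e \<iota> w *\<^sub>R b w)) \<partial>lborel) < \<infinity>" .
qed

end

section \<open>First-order expansion of the defect integral\<close>

lemma norm_outer_normal: "grad \<phi> x \<noteq> 0 \<Longrightarrow> norm (outer_normal_of \<phi> x) = 1"
  by (simp add: outer_normal_of_def)

text \<open>Near each of its points the frontier lies in a slab of width of order \<open>d\<^sup>2\<close> inside the ball of radius \<open>d\<close>, so its
  density is 0 at each of its points.\<close>

lemma negligible_C2_frontier:
  fixes E :: "(real^'n::finite) set"
  assumes c: "2 \<le> CARD('n)" and E: "has_C2_boundary E"
  shows "negligible (frontier E)"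
  unfolding negligible_eq_zero_density
proof (intro ballI allI impI)
  fix x and r e :: real assume x: "x \<in> frontier E" and r: "0 < r" and e: "0 < e"
  obtain \<phi> U where \<phi>: "open U" "x \<in> U" "C_k 2 U \<phi>" "frontier E \<inter> U = {y\<in>U. \<phi> y = 0}"
      "(E - frontier E) \<inter> U = {y\<in>U. \<phi> y > 0}" "grad \<phi> x \<noteq> 0"
    using E x unfolding has_C2_boundary_def C2_defining_function_def by blast
  have X: "compact {x}" "{x} \<subseteq> U" "\<And>y. y \<in> {x} \<Longrightarrow> \<phi> y = 0" "\<And>y. y \<in> {x} \<Longrightarrow> grad \<phi> y \<noteq> 0"
    using \<phi> x by auto
  obtain M where M: "0 < M"
    "\<And>x' u v. x' \<in> {x} \<Longrightarrow> \<bar>normal_curvature_form \<phi> x' u v\<bar> \<le> M * (norm u * norm v)"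
    "\<And>\<eta>. 0 < \<eta> \<Longrightarrow> \<exists>\<delta>>0. \<forall>x'\<in>{x}. \<forall>h. norm h < \<delta> \<longrightarrow>
       \<eta> * (norm h)\<^sup>2 < \<bar>h \<bullet> outer_normal_of \<phi> x' - normal_curvature_form \<phi> x' h h / 2\<bar> \<longrightarrow>
       x' + h \<notin> frontier E \<and> (x' + h \<in> interior E \<longleftrightarrow> h \<bullet> outer_normal_of \<phi> x' < normal_curvature_form \<phi> x' h h / 2)"
    by (rule second_order_geometry[OF X(1,2) \<phi>(1,3,4,5) X(3,4)]) (assumption+, rule that, assumption+)
  obtain \<delta> where \<delta>: "0 < \<delta>" "\<And>h. norm h < \<delta> \<Longrightarrow> (norm h)\<^sup>2 < \<bar>h \<bullet> outer_normal_of \<phi> x - normal_curvature_form \<phi> x h h / 2\<bar> \<Longrightarrow> x + h \<notin> frontier E"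
    using M(3)[of 1] by auto
  let ?n = "outer_normal_of \<phi> x" and ?C = "M / 2 + 1" and ?V = "unit_ball_vol (real CARD('n))"
  have n: "norm ?n = 1" using \<phi>(6) by (rule norm_outer_normal)
  have V: "0 < ?V" by simp
  then have V0: "?V \<noteq> 0" by (metis less_irrefl)
  \<comment> \<open>\<open>d * q\<close> bounds the proportion of the slab in the ball of radius \<open>d\<close>\<close>
  define q where "q = ?C * 2 ^ CARD('n) / ?V"
  have q: "0 < q" using M(1) V by (simp add: q_def)
  define d where "d = min (min r (\<delta> / 2)) (e / (2 * q))"
  have d: "0 < d" "d \<le> r" "d < \<delta>" "d * q < e"
  proof -
    show "0 < d" "d \<le> r" "d < \<delta>" using r \<delta>(1) e q by (auto simp: d_def min_def)
    have "d * q \<le> e / (2 * q) * q" using q by (intro mult_right_mono) (auto simp: d_def)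
    also have "\<dots> < e" using q e by simp
    finally show "d * q < e" .
  qed
  define S where "S = {z. \<bar>z \<bullet> ?n\<bar> \<le> ?C * d\<^sup>2 \<and> norm z \<le> d}"
  have Sc: "closed S" unfolding S_def
    by (intro closed_Collect_conj closed_Collect_le continuous_intros)
  have Sb: "bounded S" unfolding S_def bounded_iff by blast
  have "emeasure lborel S \<le> ennreal (2 * (?C * d\<^sup>2) * (2 * d) ^ (CARD('n) - 1))"
    unfolding S_def using M(1) d by (intro slab_volume[OF c n]) auto
  also have "2 * (?C * d\<^sup>2) * (2 * d) ^ (CARD('n) - 1) = ?C * d * (2 * d) ^ CARD('n)"
    using c by (subst (2) power_eq_if) (simp add: power2_eq_square)
  finally have "measure lborel S \<le> ?C * d * (2 * d) ^ CARD('n)"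
    unfolding measure_def using M(1) d by (intro enn2real_leI) auto
  then have mS: "measure lebesgue S \<le> ?C * d * (2 * d) ^ CARD('n)" using Sc by simp
  have Sl: "S \<in> lmeasurable" using Sc Sb by (simp add: lmeasurable_compact compact_eq_bounded_closed)
  show "\<exists>d. 0 < d \<and> d \<le> r \<and> (\<exists>U. frontier E \<inter> ball x d \<subseteq> U \<and> U \<in> lmeasurable \<and> measure lebesgue U < e * measure lebesgue (ball x d))"
  proof (intro exI[of _ d] conjI exI[of _ "(+) x ` S"])
    show "0 < d" "d \<le> r" by (rule d)+
    show "frontier E \<inter> ball x d \<subseteq> (+) x ` S"
    proof
      fix y assume y: "y \<in> frontier E \<inter> ball x d"
      define h where "h = y - x"
      have hd: "norm h < d" using y by (simp add: h_def dist_norm norm_minus_commute)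
      have "\<not> (norm h)\<^sup>2 < \<bar>h \<bullet> ?n - normal_curvature_form \<phi> x h h / 2\<bar>"
        using \<delta>(2)[of h] y hd d(3) by (auto simp: h_def)
      moreover have "\<bar>normal_curvature_form \<phi> x h h\<bar> \<le> M * (norm h)\<^sup>2" using M(2)[of x h h] by (simp add: power2_eq_square)
      ultimately have "\<bar>h \<bullet> ?n\<bar> \<le> ?C * (norm h)\<^sup>2" unfolding distrib_right by linarith
      also have "\<dots> \<le> ?C * d\<^sup>2" using hd M(1) by (intro mult_left_mono power_mono) auto
      finally have "h \<in> S" using hd by (simp add: S_def)
      then show "y \<in> (+) x ` S" by (rule image_eqI[rotated]) (simp add: h_def)
    qed
    show "(+) x ` S \<in> lmeasurable" using Sl by (rule measurable_translation)
    have "measure lebesgue ((+) x ` S) = measure lebesgue S" by (rule measure_translation)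
    also have "\<dots> \<le> ?C * d * (2 * d) ^ CARD('n)" by (rule mS)
    also have "\<dots> = d * q * (?V * d ^ CARD('n))" by (simp add: q_def power_mult_distrib V0)
    also have "\<dots> < e * (?V * d ^ CARD('n))" using d(1,4) V by (intro mult_strict_right_mono) auto
    also have "?V * d ^ CARD('n) = measure lebesgue (ball x d)" using content_ball[of d x] d(1) by simp
    finally show "measure lebesgue ((+) x ` S) < e * measure lebesgue (ball x d)" .
  qed
qed

lemma normal_curvature_form_measurable:
  assumes fr: "is_frame e \<iota>"
  shows "(\<lambda>w. normal_curvature_form \<phi> x (\<iota> w) (\<iota> w)) \<in> borel_measurable borel"
proof -
  have i: "continuous_on UNIV \<iota>"
    using fr by (intro linear_continuous_on) (simp add: is_frame_def linear_conv_bounded_linear)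
  have "continuous_on UNIV (\<lambda>w. hessian \<phi> x *v \<iota> w)"
    by (rule continuous_on_compose2[OF matrix_vector_mult_linear_continuous_on[of UNIV] i]) simp
  then have "continuous_on UNIV (\<lambda>w. normal_curvature_form \<phi> x (\<iota> w) (\<iota> w))"
    unfolding normal_curvature_form_def divide_inverse by (intro continuous_intros i)
  then show ?thesis by (rule borel_measurable_continuous_onI)
qed

context planar_kernel begin

text \<open>Split the integral into \<open>|\<epsilon> z| \<ge> \<delta>\<close>, the part of the thin region over \<open>|w| \<ge> R\<close>, and the part over \<open>|w| < R\<close>.
  The radius \<open>R\<close> is chosen first, then \<open>\<eta>\<close> for this \<open>R\<close>, then the scale on which the quadratic expansion
  has error \<open>\<eta> / 4\<close>; \<open>\<epsilon>0\<close> comes last. None of them depends on the point of \<open>X\<close> or on the frame.\<close>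

lemma defect_expansion:
  assumes X: "compact X" "X \<subseteq> U" and U: "open U" and C2: "C_k 2 U \<phi>"
    and fr: "frontier E \<inter> U = {y\<in>U. \<phi> y = 0}" and int: "(E - frontier E) \<inter> U = {y\<in>U. \<phi> y > 0}"
    and X0: "\<And>x. x \<in> X \<Longrightarrow> \<phi> x = 0" and g0: "\<And>x. x \<in> X \<Longrightarrow> grad \<phi> x \<noteq> 0"
  shows "\<And>x \<epsilon>. x \<in> X \<Longrightarrow> 0 < \<epsilon> \<Longrightarrow> integrable lborel (\<lambda>z. Kb z * halfspace_defect E (outer_normal_of \<phi> x) x \<epsilon> z)"
    and "\<And>\<tau>. 0 < \<tau> \<Longrightarrow> \<exists>\<epsilon>0>0. \<forall>\<epsilon> x \<iota>. 0 < \<epsilon> \<longrightarrow> \<epsilon> \<le> \<epsilon>0 \<longrightarrow> x \<in> X \<longrightarrow> is_frame (outer_normal_of \<phi> x) \<iota> \<longrightarrow>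
       \<bar>(LINT z|lborel. Kb z * halfspace_defect E (outer_normal_of \<phi> x) x \<epsilon> z)
         - \<epsilon> / 2 * (LINT w|lborel. Ks (outer_normal_of \<phi> x) \<iota> w * normal_curvature_form \<phi> x (\<iota> w) (\<iota> w))\<bar> \<le> \<epsilon> * \<tau>"
proof -
  obtain M where M: "0 < M"
    "\<And>x u v. x \<in> X \<Longrightarrow> \<bar>normal_curvature_form \<phi> x u v\<bar> \<le> M * (norm u * norm v)"
    "\<And>\<eta>. 0 < \<eta> \<Longrightarrow> \<exists>\<delta>>0. \<forall>x\<in>X. \<forall>h. norm h < \<delta> \<longrightarrow>
       \<eta> * (norm h)\<^sup>2 < \<bar>h \<bullet> outer_normal_of \<phi> x - normal_curvature_form \<phi> x h h / 2\<bar> \<longrightarrow>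
       x + h \<notin> frontier E \<and> (x + h \<in> interior E \<longleftrightarrow> h \<bullet> outer_normal_of \<phi> x < normal_curvature_form \<phi> x h h / 2)"
    by (rule second_order_geometry[OF X U C2 fr int X0 g0]) (assumption+, rule that, assumption+)
  define C where "C = 2 * (M / 2 + 1)"
  have C: "0 < C" using M(1) by (simp add: C_def)
  obtain \<delta>1 where \<delta>1: "0 < \<delta>1" "\<And>x h. x \<in> X \<Longrightarrow> norm h < \<delta>1 \<Longrightarrow>
      (norm h)\<^sup>2 < \<bar>h \<bullet> outer_normal_of \<phi> x - normal_curvature_form \<phi> x h h / 2\<bar> \<Longrightarrow>
      x + h \<in> interior E \<longleftrightarrow> h \<bullet> outer_normal_of \<phi> x < normal_curvature_form \<phi> x h h / 2"
    using M(3)[of 1] by auto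
  \<comment> \<open>\<open>1 / C\<close> is what the absorption of the height requires\<close>
  define \<delta> where "\<delta> = min \<delta>1 (1 / C)"
  have \<delta>: "0 < \<delta>" using \<delta>1(1) C by (simp add: \<delta>_def)
  have \<delta>C: "\<delta> * (M / 2 + 1) \<le> 1 / 2"
  proof -
    have "\<delta> * C \<le> 1 / C * C" using C by (intro mult_right_mono) (auto simp: \<delta>_def)
    then show ?thesis using C by (simp add: C_def field_simps)
  qed
  have n1: "norm (outer_normal_of \<phi> x) = 1" if "x \<in> X" for x by (rule norm_outer_normal[OF g0[OF that]])
  have supp: "\<bar>z \<bullet> outer_normal_of \<phi> x\<bar> \<le> C * \<epsilon> * ((norm z)\<^sup>2 - (z \<bullet> outer_normal_of \<phi> x)\<^sup>2)"
    if x: "x \<in> X" and \<epsilon>: "0 < \<epsilon>" and z: "\<epsilon> * norm z < \<delta>" "halfspace_defect E (outer_normal_of \<phi> x) x \<epsilon> z \<noteq> 0" for x \<epsilon> z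
    unfolding C_def
  proof (rule halfspace_defect_near[OF \<epsilon> _ _ _ \<delta>C n1[OF x] z, where b = "\<lambda>h. normal_curvature_form \<phi> x h h"])
    show "\<bar>normal_curvature_form \<phi> x h h\<bar> \<le> M * (norm h)\<^sup>2" for h using M(2)[OF x, of h h] by (simp add: power2_eq_square)
    show "x + h \<in> interior E \<longleftrightarrow> h \<bullet> outer_normal_of \<phi> x < normal_curvature_form \<phi> x h h / 2"
      if "norm h < \<delta>" "(norm h)\<^sup>2 < \<bar>h \<bullet> outer_normal_of \<phi> x - normal_curvature_form \<phi> x h h / 2\<bar>" for h
      using that \<delta>1(2)[OF x, of h] by (simp add: \<delta>_def)
  qed (use M(1) in simp)
  show integ: "integrable lborel (\<lambda>z. Kb z * halfspace_defect E (outer_normal_of \<phi> x) x \<epsilon> z)" if x: "x \<in> X" and \<epsilon>: "0 < \<epsilon>" for x \<epsilon>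
    by (rule defect_integrable[OF \<epsilon> \<delta> C n1[OF x] supp[OF x \<epsilon>]])
  fix \<tau> :: real assume \<tau>: "0 < \<tau>"
  \<comment> \<open>small enough both for the integral of the kernel and for that of the form, which carries a factor \<open>M\<close>\<close>
  define \<tau>2 where "\<tau>2 = \<tau> / (4 * (M + 1))"
  have \<tau>2: "0 < \<tau>2" "\<tau>2 \<le> \<tau> / 4" "M * \<tau>2 \<le> \<tau> / 4"
    using \<tau> M(1) by (simp_all add: \<tau>2_def field_simps)
  have \<tau>4: "0 < \<tau> / 4" using \<tau> by simp
  obtain R where R: "1 \<le> R"
    "\<And>e \<iota> \<epsilon>. is_frame e \<iota> \<Longrightarrow> 0 < \<epsilon> \<Longrightarrow>
      (\<integral>\<^sup>+z. ennreal (Kb z) * indicator {z. R \<le> norm (frame_proj \<iota> z) \<and> \<bar>z \<bullet> e\<bar> \<le> C * \<epsilon> * (norm (frame_proj \<iota> z))\<^sup>2} z \<partial>lborel) \<le> ennreal (\<epsilon> * \<tau>2)"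
    "\<And>e \<iota>. is_frame e \<iota> \<Longrightarrow> (\<integral>\<^sup>+w. ennreal ((norm w)\<^sup>2 * Ks e \<iota> w) * indicator {w. R \<le> norm w} w \<partial>lborel) \<le> ennreal \<tau>2"
    by (rule slice_outside_small[OF C \<tau>2(1)]) (rule that, assumption+)
  have R0: "0 < R" using R(1) by simp
  obtain \<eta> \<epsilon>1 where main: "0 < \<eta>" "0 < \<epsilon>1"
    "\<And>e \<iota> \<sigma> b \<epsilon>. is_frame e \<iota> \<Longrightarrow> \<sigma> \<in> borel_measurable borel \<Longrightarrow> \<forall>x. \<bar>\<sigma> x\<bar> \<le> 1 \<Longrightarrow>
       b \<in> borel_measurable borel \<Longrightarrow> \<forall>w. \<bar>b w\<bar> \<le> 2 * C * (norm w)\<^sup>2 \<Longrightarrow> 0 < \<epsilon> \<Longrightarrow> \<epsilon> \<le> \<epsilon>1 \<Longrightarrow>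
       \<forall>w t. norm w < R \<longrightarrow> C * \<epsilon> * (norm w)\<^sup>2 < \<bar>t\<bar> \<longrightarrow> \<sigma> (\<iota> w + t *\<^sub>R e) = 0 \<Longrightarrow>
       \<forall>w t. norm w < R \<longrightarrow> \<bar>t\<bar> \<le> C * \<epsilon> * (norm w)\<^sup>2 \<longrightarrow> \<eta> * \<epsilon> * (norm w)\<^sup>2 < \<bar>t - \<epsilon> / 2 * b w\<bar> \<longrightarrow>
          \<sigma> (\<iota> w + t *\<^sub>R e) = (if t < \<epsilon> / 2 * b w then 1 else 0) - (if t < 0 then 1 else 0) \<Longrightarrow>
       \<bar>(LINT x|lborel. Kb x * \<sigma> x * indicator {x. norm (frame_proj \<iota> x) < R} x)
         - \<epsilon> / 2 * (LINT w|lborel. Ks e \<iota> w * b w * indicator {w. norm w < R} w)\<bar> \<le> \<epsilon> * (\<tau> / 4)"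
    by (rule thin_region_expansion[OF C R0 \<tau>4]) (rule that, assumption+)
  obtain \<epsilon>2 where far: "0 < \<epsilon>2" "\<And>\<epsilon>. 0 < \<epsilon> \<Longrightarrow> \<epsilon> \<le> \<epsilon>2 \<Longrightarrow>
     (\<integral>\<^sup>+z. ennreal (Kb z) * indicator {z. \<delta> \<le> \<epsilon> * norm z} z \<partial>lborel) \<le> ennreal (\<epsilon> * (\<tau> / 4))"
    by (rule far_region_small[OF \<delta> \<tau>4]) (rule that, assumption+)
  have "0 < \<eta> / 4" using main(1) by simp
  then obtain \<delta>2 where \<delta>2: "0 < \<delta>2" "\<And>x h. x \<in> X \<Longrightarrow> norm h < \<delta>2 \<Longrightarrow>
      \<eta> / 4 * (norm h)\<^sup>2 < \<bar>h \<bullet> outer_normal_of \<phi> x - normal_curvature_form \<phi> x h h / 2\<bar> \<Longrightarrow>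
      x + h \<in> interior E \<longleftrightarrow> h \<bullet> outer_normal_of \<phi> x < normal_curvature_form \<phi> x h h / 2"
    using M(3)[of "\<eta> / 4"] by blast
  define \<delta>3 where "\<delta>3 = min \<delta> \<delta>2"
  have \<delta>3: "0 < \<delta>3" "\<delta>3 \<le> \<delta>" "\<delta>3 \<le> \<delta>2" using \<delta> \<delta>2(1) by (auto simp: \<delta>3_def)
  define \<epsilon>0 where "\<epsilon>0 = Min {\<epsilon>1, \<epsilon>2, 1 / (C * R), \<delta>3 / (4 * R), \<eta> / (6 * C * M * R)}"
  have \<epsilon>0: "0 < \<epsilon>0" using main far C R0 \<delta>3 M(1) by (simp add: \<epsilon>0_def)
  show "\<exists>\<epsilon>0>0. \<forall>\<epsilon> x \<iota>. 0 < \<epsilon> \<longrightarrow> \<epsilon> \<le> \<epsilon>0 \<longrightarrow> x \<in> X \<longrightarrow> is_frame (outer_normal_of \<phi> x) \<iota> \<longrightarrow>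
       \<bar>(LINT z|lborel. Kb z * halfspace_defect E (outer_normal_of \<phi> x) x \<epsilon> z)
         - \<epsilon> / 2 * (LINT w|lborel. Ks (outer_normal_of \<phi> x) \<iota> w * normal_curvature_form \<phi> x (\<iota> w) (\<iota> w))\<bar> \<le> \<epsilon> * \<tau>"
  proof (rule exI[of _ \<epsilon>0], intro conjI allI impI)
    fix \<epsilon> x \<iota> assume \<epsilon>: "0 < \<epsilon>" "\<epsilon> \<le> \<epsilon>0" and x: "x \<in> X" and frame: "is_frame (outer_normal_of \<phi> x) \<iota>"
    define n where "n = outer_normal_of \<phi> x"
    define b where "b w = normal_curvature_form \<phi> x (\<iota> w) (\<iota> w)" for w
    define \<sigma> where "\<sigma> = halfspace_defect E n x \<epsilon>"
    \<comment> \<open>the part of the defect that is known to live in the thin region\<close>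
    define \<sigma>' where "\<sigma>' z = \<sigma> z * (if \<epsilon> * norm z < \<delta> then 1 else 0)" for z
    have nf: "is_frame n \<iota>" using frame by (simp add: n_def)
    have [measurable]: "frame_proj \<iota> \<in> borel_measurable borel"
      by (rule borel_measurable_continuous_onI[OF frame_proj(4)[OF nf]])
    have [measurable]: "Ks n \<iota> \<in> borel_measurable borel" by (rule Ks_measurable[OF nf])
    have bm [measurable]: "b \<in> borel_measurable borel" unfolding b_def by (rule normal_curvature_form_measurable[OF nf])
    have \<sigma>m [measurable]: "\<sigma> \<in> borel_measurable borel" by (simp add: \<sigma>_def)
    have \<sigma>'m [measurable]: "\<sigma>' \<in> borel_measurable borel" unfolding \<sigma>'_def by measurable
    have \<sigma>'1: "\<bar>\<sigma>' z\<bar> \<le> 1" for z using halfspace_defect_bound[of E n x \<epsilon> z] by (simp add: \<sigma>'_def \<sigma>_def)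
    have bM: "\<bar>b w\<bar> \<le> M * (norm w)\<^sup>2" for w
      using M(2)[OF x, of "\<iota> w" "\<iota> w"] nf by (simp add: b_def is_frame_def power2_eq_square)
    have bC: "\<bar>b w\<bar> \<le> 2 * C * (norm w)\<^sup>2" for w
      by (rule order.trans[OF bM]) (use M(1) in \<open>auto simp: C_def intro!: mult_right_mono\<close>)
    have es: "\<epsilon> \<le> \<epsilon>1" "\<epsilon> \<le> \<epsilon>2" "C * \<epsilon> * R \<le> 1" "\<epsilon> * (2 * R) < \<delta>3" "6 * C * M * R * \<epsilon> \<le> \<eta>"
    proof -
      have "\<epsilon> \<le> \<epsilon>1 \<and> \<epsilon> \<le> \<epsilon>2 \<and> \<epsilon> \<le> 1 / (C * R) \<and> \<epsilon> \<le> \<delta>3 / (4 * R) \<and> \<epsilon> \<le> \<eta> / (6 * C * M * R)"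
        using \<epsilon>(2) by (simp add: \<epsilon>0_def)
      then show "\<epsilon> \<le> \<epsilon>1" "\<epsilon> \<le> \<epsilon>2" "C * \<epsilon> * R \<le> 1" "\<epsilon> * (2 * R) < \<delta>3" "6 * C * M * R * \<epsilon> \<le> \<eta>"
        using C R0 M(1) \<delta>3(1) by (auto simp: field_simps)
    qed
    have H1: "\<sigma>' (\<iota> w + t *\<^sub>R n) = 0" if big: "C * \<epsilon> * (norm w)\<^sup>2 < \<bar>t\<bar>" for w t
    proof (rule ccontr)
      assume "\<sigma>' (\<iota> w + t *\<^sub>R n) \<noteq> 0"
      then have "\<epsilon> * norm (\<iota> w + t *\<^sub>R n) < \<delta>" "halfspace_defect E n x \<epsilon> (\<iota> w + t *\<^sub>R n) \<noteq> 0"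
        by (auto simp: \<sigma>'_def \<sigma>_def split: if_splits)
      from supp[OF x \<epsilon>(1) this[unfolded n_def], folded n_def] show False
        using big by (simp add: frame_height[OF nf] frame_norm[OF nf])
    qed
    have H2: "\<sigma>' (\<iota> w + t *\<^sub>R n) = (if t < \<epsilon> / 2 * b w then 1 else 0) - (if t < 0 then 1 else 0)"
      if w: "norm w < R" and t: "\<bar>t\<bar> \<le> C * \<epsilon> * (norm w)\<^sup>2" and f: "\<eta> * \<epsilon> * (norm w)\<^sup>2 < \<bar>t - \<epsilon> / 2 * b w\<bar>" for w t
    proof -
      have near: "x + h \<in> interior E \<longleftrightarrow> h \<bullet> n < normal_curvature_form \<phi> x h h / 2"
        if "norm h < \<delta>3" "\<eta> / 4 * (norm h)\<^sup>2 < \<bar>h \<bullet> n - normal_curvature_form \<phi> x h h / 2\<bar>" for h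
        unfolding n_def by (rule \<delta>2(2)[OF x]) (use that \<delta>3(3) in \<open>simp_all add: n_def\<close>)
      note g = halfspace_defect_graph[OF nf \<epsilon>(1) R0 main(1) M(1) M(2)[OF x] near C es(3,4,5) w t f[unfolded b_def]]
      show ?thesis using g \<delta>3(2) by (simp add: \<sigma>'_def \<sigma>_def b_def)
    qed
    have s1: "\<bar>(LINT z|lborel. Kb z * \<sigma>' z * indicator {z. norm (frame_proj \<iota> z) < R} z)
         - \<epsilon> / 2 * (LINT w|lborel. Ks n \<iota> w * b w * indicator {w. norm w < R} w)\<bar> \<le> \<epsilon> * (\<tau> / 4)"
      by (rule main(3)[OF nf \<sigma>'m _ bm _ \<epsilon>(1) es(1)]) (intro allI impI \<sigma>'1 bC H1 H2; assumption)+
    let ?Z = "{z. R \<le> norm (frame_proj \<iota> z) \<and> \<bar>z \<bullet> n\<bar> \<le> C * \<epsilon> * (norm (frame_proj \<iota> z))\<^sup>2}"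
    let ?f = "\<lambda>z. Kb z * \<sigma> z" and ?g = "\<lambda>z. Kb z * \<sigma>' z * indicator {z. norm (frame_proj \<iota> z) < R} z"
    have fi: "integrable lborel ?f" unfolding \<sigma>_def n_def by (rule integ[OF x \<epsilon>(1)])
    have gi: "integrable lborel ?g"
    proof (rule Bochner_Integration.integrable_bound[OF fi])
      show "AE z in lborel. norm (?g z) \<le> norm (?f z)" by (intro AE_I2) (auto simp: \<sigma>'_def indicator_def)
    qed measurable
    have s2: "\<bar>(LINT z|lborel. ?f z) - (LINT z|lborel. ?g z)\<bar> \<le> \<epsilon> * (\<tau> / 2)"
    proof (rule integral_diff_le_nn_integral[OF fi gi])
      have "(\<integral>\<^sup>+z. ennreal \<bar>?f z - ?g z\<bar> \<partial>lborel) \<le>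
         (\<integral>\<^sup>+z. ennreal (Kb z) * indicator ?Z z + ennreal (Kb z) * indicator {z. \<delta> \<le> \<epsilon> * norm z} z \<partial>lborel)"
      proof (rule nn_integral_mono)
        fix z
        have k: "\<bar>?f z\<bar> \<le> Kb z"
          unfolding \<sigma>_def abs_mult using Kb(2)[of z] halfspace_defect_bound[of E n x \<epsilon> z]
          by (simp add: mult_left_le)
        consider "\<delta> \<le> \<epsilon> * norm z" | "\<epsilon> * norm z < \<delta>" "norm (frame_proj \<iota> z) < R"
          | "\<epsilon> * norm z < \<delta>" "R \<le> norm (frame_proj \<iota> z)" by linarith
        then show "ennreal \<bar>?f z - ?g z\<bar> \<le> ennreal (Kb z) * indicator ?Z z + ennreal (Kb z) * indicator {z. \<delta> \<le> \<epsilon> * norm z} z"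
        proof cases
          case 1
          then have "ennreal \<bar>?f z - ?g z\<bar> \<le> ennreal (Kb z)" using k by (simp add: \<sigma>'_def ennreal_leI)
          then show ?thesis using 1 by (simp add: add_increasing)
        next
          case 2
          then show ?thesis by (simp add: \<sigma>'_def)
        next
          case 3
          show ?thesis
          proof (cases "\<sigma> z = 0")
            case False
            then have "\<bar>z \<bullet> n\<bar> \<le> C * \<epsilon> * ((norm z)\<^sup>2 - (z \<bullet> n)\<^sup>2)"
              using supp[OF x \<epsilon>(1) 3(1)] by (simp add: \<sigma>_def n_def)
            then have "z \<in> ?Z" using 3 frame_proj(3)[OF nf, of z] by simp
            moreover have "ennreal \<bar>?f z - ?g z\<bar> \<le> ennreal (Kb z)" using k 3 by (simp add: ennreal_leI)
            ultimately show ?thesis by (simp add: add_increasing2)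
          qed (simp add: \<sigma>'_def)
        qed
      qed
      also have "\<dots> = (\<integral>\<^sup>+z. ennreal (Kb z) * indicator ?Z z \<partial>lborel) + (\<integral>\<^sup>+z. ennreal (Kb z) * indicator {z. \<delta> \<le> \<epsilon> * norm z} z \<partial>lborel)"
        by (rule nn_integral_add) measurable
      also have "\<dots> \<le> ennreal (\<epsilon> * \<tau>2) + ennreal (\<epsilon> * (\<tau> / 4))"
        by (intro add_mono R(2)[OF nf \<epsilon>(1)] far(2)[OF \<epsilon>(1) es(2)])
      also have "\<dots> = ennreal (\<epsilon> * \<tau>2 + \<epsilon> * (\<tau> / 4))" using \<epsilon>(1) \<tau>2(1) \<tau> by (intro ennreal_plus[symmetric]) auto
      also have "\<dots> \<le> ennreal (\<epsilon> * (\<tau> / 2))"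
      proof (rule ennreal_leI)
        have "\<epsilon> * \<tau>2 \<le> \<epsilon> * (\<tau> / 4)" using \<tau>2(2) \<epsilon>(1) by (intro mult_left_mono) auto
        then show "\<epsilon> * \<tau>2 + \<epsilon> * (\<tau> / 4) \<le> \<epsilon> * (\<tau> / 2)" by linarith
      qed
      finally show "(\<integral>\<^sup>+z. ennreal \<bar>?f z - ?g z\<bar> \<partial>lborel) \<le> ennreal (\<epsilon> * (\<tau> / 2))" .
      show "0 \<le> \<epsilon> * (\<tau> / 2)" using \<epsilon>(1) \<tau> by simp
    qed
    have bi: "integrable lborel (\<lambda>w. Ks n \<iota> w * b w)"
      using slice_integrable[OF nf bm, of M] bM by simp
    have s3: "\<bar>(LINT w|lborel. Ks n \<iota> w * b w) - (LINT w|lborel. Ks n \<iota> w * b w * indicator {w. norm w < R} w)\<bar> \<le> M * \<tau>2"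
    proof (rule integral_diff_le_nn_integral[OF bi slice_weight_integrable[OF nf R0 bm bM]])
      have "(\<integral>\<^sup>+w. ennreal \<bar>Ks n \<iota> w * b w - Ks n \<iota> w * b w * indicator {w. norm w < R} w\<bar> \<partial>lborel) \<le>
         (\<integral>\<^sup>+w. ennreal M * (ennreal ((norm w)\<^sup>2 * Ks n \<iota> w) * indicator {w. R \<le> norm w} w) \<partial>lborel)"
      proof (rule nn_integral_mono_AE)
        show "AE w in lborel. ennreal \<bar>Ks n \<iota> w * b w - Ks n \<iota> w * b w * indicator {w. norm w < R} w\<bar> \<le>
           ennreal M * (ennreal ((norm w)\<^sup>2 * Ks n \<iota> w) * indicator {w. R \<le> norm w} w)"
          using Ks_AE(2)[OF nf]
        proof eventually_elim
          case (elim w)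
          have "\<bar>Ks n \<iota> w * b w\<bar> \<le> Ks n \<iota> w * (M * (norm w)\<^sup>2)" unfolding abs_mult using elim bM[of w] by (intro mult_mono) auto
          then show ?case using elim M(1) by (auto simp: indicator_def ennreal_mult[symmetric] mult_ac intro!: ennreal_leI)
        qed
      qed
      also have "\<dots> = ennreal M * (\<integral>\<^sup>+w. ennreal ((norm w)\<^sup>2 * Ks n \<iota> w) * indicator {w. R \<le> norm w} w \<partial>lborel)"
        by (rule nn_integral_cmult) measurable
      also have "\<dots> \<le> ennreal M * ennreal \<tau>2" by (intro mult_left_mono R(3)[OF nf]) simp
      also have "\<dots> = ennreal (M * \<tau>2)" using M(1) \<tau>2(1) by (intro ennreal_mult[symmetric]) auto
      finally show "(\<integral>\<^sup>+w. ennreal \<bar>Ks n \<iota> w * b w - Ks n \<iota> w * b w * indicator {w. norm w < R} w\<bar> \<partial>lborel) \<le> ennreal (M * \<tau>2)" .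
      show "0 \<le> M * \<tau>2" using M(1) \<tau>2(1) by simp
    qed
    have "\<bar>\<epsilon> / 2 * (LINT w|lborel. Ks n \<iota> w * b w) - \<epsilon> / 2 * (LINT w|lborel. Ks n \<iota> w * b w * indicator {w. norm w < R} w)\<bar> \<le> \<epsilon> / 2 * (\<tau> / 4)"
      unfolding right_diff_distrib[symmetric] abs_mult using s3 \<tau>2(3) \<epsilon>(1) by (intro mult_mono) auto
    then have "\<bar>(LINT z|lborel. ?f z) - \<epsilon> / 2 * (LINT w|lborel. Ks n \<iota> w * b w)\<bar> \<le> \<epsilon> * (\<tau> / 4) + \<epsilon> * (\<tau> / 2) + \<epsilon> / 2 * (\<tau> / 4)"
      using s1 s2 by linarith
    also have "\<dots> \<le> \<epsilon> * \<tau>" using \<epsilon>(1) \<tau> by (simp add: field_simps)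
    finally show "\<bar>(LINT z|lborel. Kb z * halfspace_defect E (outer_normal_of \<phi> x) x \<epsilon> z)
         - \<epsilon> / 2 * (LINT w|lborel. Ks (outer_normal_of \<phi> x) \<iota> w * normal_curvature_form \<phi> x (\<iota> w) (\<iota> w))\<bar> \<le> \<epsilon> * \<tau>"
      by (simp only: n_def \<sigma>_def b_def)
  qed (rule \<epsilon>0)
qed

end

section \<open>Convergence to the anisotropic mean curvature\<close>

lemma trace_tensor_mult: "trace (tensor u v ** A) = v \<bullet> (A *v u)"
proof -
  have "trace (tensor u v ** A) = (\<Sum>i\<in>UNIV. \<Sum>k\<in>UNIV. u $ i * v $ k * A $ k $ i)"
    by (simp add: trace_def matrix_matrix_mult_def tensor_def)
  also have "\<dots> = (\<Sum>k\<in>UNIV. \<Sum>i\<in>UNIV. u $ i * v $ k * A $ k $ i)" by (rule sum.swap)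
  also have "\<dots> = v \<bullet> (A *v u)"
    by (simp add: inner_vec_def matrix_vector_mult_def sum_distrib_left mult_ac)
  finally show ?thesis .
qed

lemma norm_tensor: "norm (tensor u v) = norm u * norm v"
proof -
  have "tensor u v $ i = u $ i *\<^sub>R v" for i by (simp add: tensor_def vec_eq_iff)
  then have "norm (tensor u v) = L2_set (\<lambda>i. norm (u $ i) * norm v) UNIV" by (simp add: norm_vec_def[of "tensor u v"])
  also have "\<dots> = norm u * norm v" by (simp add: L2_set_left_distrib[symmetric] norm_vec_def[of u])
  finally show ?thesis .
qed

lemma proj_perp_mult: "proj_perp e *v y = y - (y \<bullet> e) *\<^sub>R e"
proof -
  have "(tensor e e *v y) $ i = ((y \<bullet> e) *\<^sub>R e) $ i" for i
    by (simp add: tensor_def matrix_vector_mult_def inner_vec_def sum_distrib_left mult_ac)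
  then have "tensor e e *v y = (y \<bullet> e) *\<^sub>R e" by (simp add: vec_eq_iff)
  then show ?thesis by (simp add: proj_perp_def matrix_vector_mult_diff_rdistrib)
qed

lemma bounded_linear_trace_mult: "bounded_linear (\<lambda>A::real^'n^'n::finite. trace (A ** X))"
proof -
  have "linear (\<lambda>A::real^'n^'n. trace (A ** X))"
    by (rule linearI) (simp_all add: trace_def matrix_matrix_mult_def sum.distrib distrib_right sum_distrib_left mult.assoc)
  then show ?thesis by (simp add: linear_conv_bounded_linear)
qed

context planar_kernel begin

text \<open>The value that the expansion yields for the defining function \<open>\<phi>\<close>, expressed by an integral over a
  parametrised hyperplane.\<close>

definition limit_curvature :: "(real^'n \<Rightarrow> real) \<Rightarrow> real^'n \<Rightarrow> real" where
  "limit_curvature \<phi> x = (let n = outer_normal_of \<phi> x; \<iota> = (SOME \<iota>. is_frame n \<iota>) in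
     - (LINT w|lborel. Ks n \<iota> w * normal_curvature_form \<phi> x (\<iota> w) (\<iota> w)))"

lemma curvature_matrix_frame:
  assumes fr: "is_frame e \<iota>"
  shows "integrable lborel (\<lambda>w. Ks e \<iota> w *\<^sub>R tensor (\<iota> w) (\<iota> w))"
    and "curvature_matrix K e = (LINT w|lborel. Ks e \<iota> w *\<^sub>R tensor (\<iota> w) (\<iota> w))"
proof -
  have [measurable]: "Ks e \<iota> \<in> borel_measurable borel" by (rule Ks_measurable[OF fr])
  have i: "continuous_on UNIV \<iota>"
    using fr by (intro linear_continuous_on) (simp add: is_frame_def linear_conv_bounded_linear)
  have "continuous_on UNIV (\<lambda>w. tensor (\<iota> w) (\<iota> w))"
    unfolding tensor_def by (intro continuous_on_vec_lambda continuous_intros i)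
  then have tm [measurable]: "(\<lambda>w. tensor (\<iota> w) (\<iota> w)) \<in> borel_measurable borel" by (rule borel_measurable_continuous_onI)
  have nw: "norm (\<iota> w) = norm w" for w using fr by (simp add: is_frame_def)
  show "integrable lborel (\<lambda>w. Ks e \<iota> w *\<^sub>R tensor (\<iota> w) (\<iota> w))"
    by (rule slice_integrable[OF fr tm, of 1]) (simp add: norm_tensor nw power2_eq_square)
  have iso: "dist (\<iota> x) (\<iota> y) = dist x y" for x y
    using fr by (simp add: is_frame_def dist_norm linear_diff[symmetric])
  have D: "DIM(real^'n punctured) = CARD('n) - 1" using card_punctured[OF dim] by simp
  have rng: "range \<iota> = hyperplane e" using fr by (simp add: is_frame_def)
  have gm: "(\<lambda>w. Ks e \<iota> w *\<^sub>R tensor (\<iota> w) (\<iota> w)) \<in> borel_measurable borel" by measurable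
  have ae: "AE w in lborel. K (\<iota> w) *\<^sub>R tensor (\<iota> w) (\<iota> w) = Ks e \<iota> w *\<^sub>R tensor (\<iota> w) (\<iota> w)"
    using Ks_AE(1)[OF fr] by eventually_elim simp
  have "curvature_matrix K e = (LINT z:range \<iota>|hausdorff_measure DIM(real^'n punctured). K z *\<^sub>R tensor z z)"
    unfolding curvature_matrix_def D rng ..
  also have "\<dots> = (LINT w|lebesgue. K (\<iota> w) *\<^sub>R tensor (\<iota> w) (\<iota> w))"
    by (rule set_integral_hausdorff_isometry[OF iso borel_measurable_lebesgue_AE[OF gm ae]])
  also have "\<dots> = (LINT w|lborel. Ks e \<iota> w *\<^sub>R tensor (\<iota> w) (\<iota> w))"
    by (rule integral_lebesgue_AE[OF gm ae])
  finally show "curvature_matrix K e = (LINT w|lborel. Ks e \<iota> w *\<^sub>R tensor (\<iota> w) (\<iota> w))" .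
qed

text \<open>For \<open>u\<close> in the hyperplane the trace of \<open>(u \<otimes> u) P H P\<close> is \<open>u \<bullet> H u\<close>, and the trace commutes with the integral
  defining the curvature matrix.\<close>

lemma anisotropic_curvature_slice:
  assumes g: "grad \<phi> x \<noteq> 0"
  defines "n \<equiv> outer_normal_of \<phi> x"
  shows "- (1 / norm (grad \<phi> x)) * trace (curvature_matrix K n ** proj_perp n ** hessian \<phi> x ** proj_perp n) = limit_curvature \<phi> x"
proof -
  have "norm n = 1" unfolding n_def by (rule norm_outer_normal[OF g])
  then have ex: "\<exists>\<iota>. is_frame n \<iota>" by (rule exists_frame[OF dim])
  define \<iota> where "\<iota> = (SOME \<iota>. is_frame n \<iota>)"
  have fr: "is_frame n \<iota>" unfolding \<iota>_def by (rule someI_ex[OF ex])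
  let ?X = "proj_perp n ** hessian \<phi> x ** proj_perp n"
  have slice: "trace ((Ks n \<iota> w *\<^sub>R tensor (\<iota> w) (\<iota> w)) ** ?X) = norm (grad \<phi> x) * (Ks n \<iota> w * normal_curvature_form \<phi> x (\<iota> w) (\<iota> w))" for w
  proof -
    have w0: "\<iota> w \<bullet> n = 0" using fr by (simp add: is_frame_def)
    have "trace ((Ks n \<iota> w *\<^sub>R tensor (\<iota> w) (\<iota> w)) ** ?X) = Ks n \<iota> w * trace (tensor (\<iota> w) (\<iota> w) ** ?X)"
      using linear_scale[OF bounded_linear.linear[OF bounded_linear_trace_mult[of ?X]]] by simp
    also have "trace (tensor (\<iota> w) (\<iota> w) ** ?X) = \<iota> w \<bullet> (?X *v \<iota> w)" by (rule trace_tensor_mult)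
    also have "?X *v \<iota> w = proj_perp n *v (hessian \<phi> x *v (proj_perp n *v \<iota> w))"
      by (simp add: matrix_vector_mul_assoc matrix_mul_assoc)
    also have "\<iota> w \<bullet> \<dots> = \<iota> w \<bullet> (hessian \<phi> x *v \<iota> w)"
      by (simp add: proj_perp_mult w0 inner_diff_right)
    also have "\<dots> = norm (grad \<phi> x) * normal_curvature_form \<phi> x (\<iota> w) (\<iota> w)" using g by (simp add: normal_curvature_form_def)
    finally show ?thesis by simp
  qed
  have "trace (curvature_matrix K n ** proj_perp n ** hessian \<phi> x ** proj_perp n) = trace (curvature_matrix K n ** ?X)"
    by (simp only: matrix_mul_assoc)
  also have "\<dots> = (LINT w|lborel. trace ((Ks n \<iota> w *\<^sub>R tensor (\<iota> w) (\<iota> w)) ** ?X))"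
    unfolding curvature_matrix_frame(2)[OF fr]
    by (rule integral_bounded_linear[OF bounded_linear_trace_mult curvature_matrix_frame(1)[OF fr], symmetric])
  also have "\<dots> = norm (grad \<phi> x) * (LINT w|lborel. Ks n \<iota> w * normal_curvature_form \<phi> x (\<iota> w) (\<iota> w))"
    unfolding slice by simp
  finally have "trace (curvature_matrix K n ** proj_perp n ** hessian \<phi> x ** proj_perp n) =
      norm (grad \<phi> x) * (LINT w|lborel. Ks n \<iota> w * normal_curvature_form \<phi> x (\<iota> w) (\<iota> w))" .
  then show ?thesis using g by (simp add: limit_curvature_def Let_def n_def[symmetric] \<iota>_def[symmetric])
qed

lemma rescaled_curvature_uniform_limit:
  assumes X: "compact X" "X \<subseteq> U" and U: "open U" and C2: "C_k 2 U \<phi>"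
    and fr: "frontier E \<inter> U = {y\<in>U. \<phi> y = 0}" and int: "(E - frontier E) \<inter> U = {y\<in>U. \<phi> y > 0}"
    and X0: "\<And>x. x \<in> X \<Longrightarrow> \<phi> x = 0" and g0: "\<And>x. x \<in> X \<Longrightarrow> grad \<phi> x \<noteq> 0"
    and neg: "negligible (frontier E)"
  shows "uniform_limit X (\<lambda>\<epsilon>. rescaled_curvature K \<epsilon> E) (limit_curvature \<phi>) (at_right 0)"
    and "\<And>x \<epsilon>. x \<in> X \<Longrightarrow> 0 < \<epsilon> \<Longrightarrow> \<exists>h. (truncated_curvature (rescaled_kernel \<epsilon> K) E x \<longlongrightarrow> h) (at_right 0)"
proof -
  note exp = defect_expansion[OF X U C2 fr int X0 g0, simplified]
  have n1: "norm (outer_normal_of \<phi> x) = 1" if "x \<in> X" for x by (rule norm_outer_normal[OF g0[OF that]])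
  show "\<exists>h. (truncated_curvature (rescaled_kernel \<epsilon> K) E x \<longlongrightarrow> h) (at_right 0)" if x: "x \<in> X" and \<epsilon>: "0 < \<epsilon>" for x \<epsilon>
    using truncated_curvature_tendsto(1)[OF n1[OF x] \<epsilon> neg exp(1)[OF x \<epsilon>]] by blast
  show "uniform_limit X (\<lambda>\<epsilon>. rescaled_curvature K \<epsilon> E) (limit_curvature \<phi>) (at_right 0)"
  proof (rule uniform_limitI)
    fix \<tau> :: real assume \<tau>: "0 < \<tau>"
    then have "0 < \<tau> / 4" by simp
    from exp(2)[OF this] obtain \<epsilon>0 where \<epsilon>0: "0 < \<epsilon>0" "\<And>\<epsilon> x \<iota>. 0 < \<epsilon> \<Longrightarrow> \<epsilon> \<le> \<epsilon>0 \<Longrightarrow> x \<in> X \<Longrightarrow> is_frame (outer_normal_of \<phi> x) \<iota> \<Longrightarrow>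
       \<bar>(LINT z|lborel. Kb z * halfspace_defect E (outer_normal_of \<phi> x) x \<epsilon> z)
         - \<epsilon> / 2 * (LINT w|lborel. Ks (outer_normal_of \<phi> x) \<iota> w * normal_curvature_form \<phi> x (\<iota> w) (\<iota> w))\<bar> \<le> \<epsilon> * (\<tau> / 4)"
      by (auto simp del: times_divide_eq_right)
    have "eventually (\<lambda>\<epsilon>. \<epsilon> \<le> \<epsilon>0) (at_right (0::real))"
      unfolding eventually_at_right_field using \<epsilon>0(1) by (intro exI[of _ \<epsilon>0]) auto
    then show "\<forall>\<^sub>F \<epsilon> in at_right 0. \<forall>x\<in>X. dist (rescaled_curvature K \<epsilon> E x) (limit_curvature \<phi> x) < \<tau>"
      using eventually_at_right_less[of "0::real"]
    proof eventually_elim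
      case (elim \<epsilon>)
      show ?case
      proof
        fix x assume x: "x \<in> X"
        define n where "n = outer_normal_of \<phi> x"
        define \<iota> where "\<iota> = (SOME \<iota>. is_frame n \<iota>)"
        have "\<exists>\<iota>. is_frame n \<iota>" unfolding n_def by (rule exists_frame[OF dim n1[OF x]])
        then have frm: "is_frame n \<iota>" unfolding \<iota>_def by (rule someI_ex)
        define I where "I = (LINT z|lborel. Kb z * halfspace_defect E n x \<epsilon> z)"
        define J where "J = (LINT w|lborel. Ks n \<iota> w * normal_curvature_form \<phi> x (\<iota> w) (\<iota> w))"
        have "\<bar>I - \<epsilon> / 2 * J\<bar> \<le> \<epsilon> * (\<tau> / 4)"
          unfolding I_def J_def n_def by (rule \<epsilon>0(2)[OF elim(2,1) x frm[unfolded n_def]])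
        then have "2 / \<epsilon> * \<bar>I - \<epsilon> / 2 * J\<bar> \<le> 2 / \<epsilon> * (\<epsilon> * (\<tau> / 4))" using elim by (intro mult_left_mono) auto
        also have "2 / \<epsilon> * \<bar>I - \<epsilon> / 2 * J\<bar> = \<bar>2 / \<epsilon> * (I - \<epsilon> / 2 * J)\<bar>" by (subst abs_mult) (use elim in simp)
        also have "2 / \<epsilon> * (I - \<epsilon> / 2 * J) = 2 / \<epsilon> * I - J" using elim by (simp add: field_simps)
        finally have "\<bar>2 / \<epsilon> * I - J\<bar> < \<tau>" using elim \<tau> by simp
        moreover have "rescaled_curvature K \<epsilon> E x = - (2 / \<epsilon>) * I"
          unfolding I_def n_def by (rule truncated_curvature_tendsto(2)[OF n1[OF x] elim(2) neg exp(1)[OF x elim(2)]])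
        moreover have "limit_curvature \<phi> x = - J"
          by (simp add: limit_curvature_def Let_def J_def \<iota>_def n_def)
        ultimately show "dist (rescaled_curvature K \<epsilon> E x) (limit_curvature \<phi> x) < \<tau>" by (simp add: dist_real_def)
      qed
    qed
  qed
qed

lemma rescaled_curvature_limit_at:
  assumes x: "x \<in> frontier E" and \<phi>: "C2_defining_function E x \<phi>" and neg: "negligible (frontier E)"
  shows "((\<lambda>\<epsilon>. rescaled_curvature K \<epsilon> E x) \<longlongrightarrow> limit_curvature \<phi> x) (at_right 0)"
    and "\<And>\<epsilon>. 0 < \<epsilon> \<Longrightarrow> \<exists>h. (truncated_curvature (rescaled_kernel \<epsilon> K) E x \<longlongrightarrow> h) (at_right 0)"
proof -
  obtain U where U: "open U" "x \<in> U" "C_k 2 U \<phi>" "frontier E \<inter> U = {y\<in>U. \<phi> y = 0}"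
      "(E - frontier E) \<inter> U = {y\<in>U. \<phi> y > 0}" "grad \<phi> x \<noteq> 0"
    using \<phi> unfolding C2_defining_function_def by blast
  have X: "compact {x}" "{x} \<subseteq> U" "\<And>y. y \<in> {x} \<Longrightarrow> \<phi> y = 0" "\<And>y. y \<in> {x} \<Longrightarrow> grad \<phi> y \<noteq> 0"
    using U x by auto
  note lim = rescaled_curvature_uniform_limit[OF X(1,2) U(1,3,4,5) X(3,4) neg, simplified]
  show "((\<lambda>\<epsilon>. rescaled_curvature K \<epsilon> E x) \<longlongrightarrow> limit_curvature \<phi> x) (at_right 0)"
    using lim(1) by (simp add: uniform_limit_singleton)
  show "\<exists>h. (truncated_curvature (rescaled_kernel \<epsilon> K) E x \<longlongrightarrow> h) (at_right 0)" if "0 < \<epsilon>" for \<epsilon>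
    using lim(2) that by blast
qed

text \<open>The limits for two defining functions are limits of the same curvatures.\<close>

lemma anisotropic_curvature_eq:
  assumes x: "x \<in> frontier E" and \<phi>: "C2_defining_function E x \<phi>" and neg: "negligible (frontier E)"
  shows "anisotropic_curvature K E x = limit_curvature \<phi> x"
proof -
  define \<psi> where "\<psi> = (SOME \<phi>. C2_defining_function E x \<phi>)"
  have \<psi>: "C2_defining_function E x \<psi>" unfolding \<psi>_def by (rule someI[of "C2_defining_function E x", OF \<phi>])
  then have "grad \<psi> x \<noteq> 0" by (auto simp: C2_defining_function_def)
  then have "anisotropic_curvature K E x = limit_curvature \<psi> x"
    using anisotropic_curvature_slice[of \<psi> x] by (simp add: anisotropic_curvature_def Let_def \<psi>_def[symmetric])
  also have "\<dots> = limit_curvature \<phi> x"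
    by (rule tendsto_unique[OF _ rescaled_curvature_limit_at(1)[OF x \<psi> neg] rescaled_curvature_limit_at(1)[OF x \<phi> neg]]) simp
  finally show ?thesis .
qed

end

theorem theorem1p1:
  fixes K :: "real^'n::finite \<Rightarrow> real"
    and DK :: "real^'n \<Rightarrow> real^'n"
    and E :: "(real^'n) set"
  assumes "CARD('n) \<ge> 2"
    and "curvature_kernel K DK"
    and "compact (frontier E)"
    and "has_C2_boundary E"
  shows "(\<forall>\<epsilon>>0. \<forall>x\<in>frontier E. \<exists>h.
            (truncated_curvature (rescaled_kernel \<epsilon> K) E x \<longlongrightarrow> h) (at_right 0)) \<and>
         uniform_limit (frontier E) (\<lambda>\<epsilon>. rescaled_curvature K \<epsilon> E)
           (anisotropic_curvature K E) (at_right 0)"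
proof -
  interpret planar_kernel K DK
    using assms(1,2) by (simp add: planar_kernel_def planar_kernel_axioms_def)
  have neg: "negligible (frontier E)" by (rule negligible_C2_frontier[OF assms(1,4)])
  have C2: "\<exists>\<phi>. C2_defining_function E x \<phi>" if "x \<in> frontier E" for x
    using assms(4) that by (simp add: has_C2_boundary_def)
  have "\<exists>r>0. uniform_limit (frontier E \<inter> cball x r) (\<lambda>\<epsilon>. rescaled_curvature K \<epsilon> E) (anisotropic_curvature K E) (at_right 0)"
    if x: "x \<in> frontier E" for x
  proof -
    obtain \<phi> where "C2_defining_function E x \<phi>" using C2[OF x] by blast
    then obtain U where U: "open U" "x \<in> U" "C_k 2 U \<phi>" "frontier E \<inter> U = {y\<in>U. \<phi> y = 0}"
        "(E - frontier E) \<inter> U = {y\<in>U. \<phi> y > 0}" "grad \<phi> x \<noteq> 0"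
      unfolding C2_defining_function_def by blast
    have "continuous_on U (partial i \<phi>)" for i
      using U(3) by (auto simp: numeral_2_eq_2 intro!: continuous_at_imp_continuous_on differentiable_imp_continuous_within)
    then have "continuous_on U (grad \<phi>)" unfolding grad_def[abs_def] by (intro continuous_on_vec_lambda)
    then have "open (U \<inter> grad \<phi> -` (- {0}))" using U(1) by (intro continuous_open_preimage) auto
    moreover have "x \<in> U \<inter> grad \<phi> -` (- {0})" using U(2,6) by simp
    ultimately obtain r where r: "0 < r" "cball x r \<subseteq> U \<inter> grad \<phi> -` (- {0})" by (metis open_contains_cball)
    let ?X = "frontier E \<inter> cball x r"
    have X: "compact ?X" "?X \<subseteq> U" "\<And>y. y \<in> ?X \<Longrightarrow> \<phi> y = 0" "\<And>y. y \<in> ?X \<Longrightarrow> grad \<phi> y \<noteq> 0"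
      using r(2) U(4) assms(3) by (auto intro: compact_Int_closed)
    have "limit_curvature \<phi> y = anisotropic_curvature K E y" if y: "y \<in> ?X" for y
    proof (rule anisotropic_curvature_eq[symmetric, OF _ _ neg])
      show "C2_defining_function E y \<phi>"
        unfolding C2_defining_function_def using U(1,3,4,5) X(2,4) y by blast
    qed (use y in simp)
    then have "uniform_limit ?X (\<lambda>\<epsilon>. rescaled_curvature K \<epsilon> E) (anisotropic_curvature K E) (at_right 0) \<longleftrightarrow>
        uniform_limit ?X (\<lambda>\<epsilon>. rescaled_curvature K \<epsilon> E) (limit_curvature \<phi>) (at_right 0)"
      by (intro uniform_limit_cong') auto
    then show ?thesis
      using rescaled_curvature_uniform_limit(1)[OF X(1,2) U(1,3,4,5) X(3,4) neg] r(1) by blast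
  qed
  then obtain r where r: "\<And>x. x \<in> frontier E \<Longrightarrow> 0 < r x"
    "\<And>x. x \<in> frontier E \<Longrightarrow> uniform_limit (frontier E \<inter> cball x (r x)) (\<lambda>\<epsilon>. rescaled_curvature K \<epsilon> E) (anisotropic_curvature K E) (at_right 0)"
    by metis
  have "frontier E \<subseteq> (\<Union>x\<in>frontier E. ball x (r x))" using r(1) by force
  then obtain T where T: "T \<subseteq> frontier E" "finite T" "frontier E \<subseteq> (\<Union>x\<in>T. ball x (r x))"
    by (rule compactE_image[OF assms(3), rotated]) (auto intro: that)
  have "uniform_limit (\<Union>x\<in>T. frontier E \<inter> cball x (r x)) (\<lambda>\<epsilon>. rescaled_curvature K \<epsilon> E) (anisotropic_curvature K E) (at_right 0)"
    by (rule uniform_limit_on_UNION[OF T(2) r(2)]) (use T(1) in blast)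
  then have "uniform_limit (frontier E) (\<lambda>\<epsilon>. rescaled_curvature K \<epsilon> E) (anisotropic_curvature K E) (at_right 0)"
    by (rule uniform_limit_on_subset) (use T(3) in force)
  moreover have "\<exists>h. (truncated_curvature (rescaled_kernel \<epsilon> K) E x \<longlongrightarrow> h) (at_right 0)"
    if "0 < \<epsilon>" "x \<in> frontier E" for \<epsilon> x
    using C2[OF that(2)] rescaled_curvature_limit_at(2)[OF that(2) _ neg that(1)] by blast
  ultimately show ?thesis by blast
qed

end
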